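(* Let $\ell\geq 1$ and let $\lambda,\mu,\nu$ be regular irreducible representations of $\mathrm G(\mathfrak o_\ell)$, and let $g_{\lambda\mu}^{\nu}$ denote the multiplicity of $\nu$ in $\lambda\otimes\mu$. (1) If $\mathbf{cus}\in\{\mathrm{tt}(\lambda),\mathrm{tt}(\mu),\mathrm{tt}(\nu)\}$, then $g_{\lambda\mu}^{\nu}\leq 1$. (2) If the set $\{\mathrm{tt}(\lambda),\mathrm{tt}(\mu),\mathrm{tt}(\nu)\}$ consists of exactly two types, then $g_{\lambda\mu}^{\nu}\leq 2$, with equality occurring only when the triple $(\mathrm{tt}(\lambda),\mathrm{tt}(\mu),\mathrm{tt}(\nu))$ is a permutation of $(\mathbf{ss},\mathbf{sns},\mathbf{ss})$. (3) If $\{\mathrm{tt}(\lambda),\mathrm{tt}(\mu),\mathrm{tt}(\nu)\}=\{\mathbf{ss}\}$, then $g_{\lambda\mu}^{\nu}\leq \ell+1$.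
   Context: Let $\mathcal O$ be a complete discrete valuation ring with maximal ideal $\mathfrak p=\pi\mathcal O$ and finite residue field of odd characteristic and cardinality $q$. Let $\mathfrak O=\mathcal O[\vartheta]$ be the unramified quadratic extension, with $\vartheta^2\in\mathcal O^\times$ a non-square, and Galois involution $x\mapsto x^\circ$, $\vartheta^\circ=-\vartheta$. For $\ell\geq1$ let $\mathfrak o_\ell=\mathcal O/\mathfrak p^\ell$ and $\mathfrak O_\ell=\mathfrak O/\pi^\ell\mathfrak O$. $\mathrm G$ denotes either $\mathrm{GL}_2$ (so $\mathrm G(\mathfrak o_\ell)=\mathrm{GL}_2(\mathfrak o_\ell)$, $R_\ell=\mathfrak o_\ell$, $\epsilon=1$, $\mathfrak g(\mathfrak o_\ell)=M_2(\mathfrak o_\ell)$) or $\mathrm{GU}_2$ (so $\mathrm G(\mathfrak o_\ell)=\{A\in \mathrm{GL}_2(\mathfrak O_\ell): A^\star A=I\}$ where $(a_{ij})^\star=W(a_{ji}^\circ)W^{-1}$, $W=\begin{pmatrix}0&1\\1&0\end{pmatrix}$, $R_\ell=\mathfrak O_\ell$, $\epsilon=\vartheta$, $\mathfrak g(\mathfrak o_\ell)=\{A\in M_2(\mathfrak O_\ell):A+A^\star=0\}$). Fix an additive character $\psi$ of $R_\ell$ nontrivial on $\pi^{\ell-1}\mathfrak o_\ell$ (for $\mathrm{GU}_2$ with $\psi(x+\vartheta y)=\psi'(x)\psi'(y)$ for such a character $\psi'$ of $\mathfrak o_\ell$). For $\ell\ge2$ let $K^{\ell-1}=\{I+\pi^{\ell-1}B\}\cap\mathrm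 G(\mathfrak o_\ell)$ and for $A\in\mathfrak g(\mathfrak o_1)$ let $\psi_A(I+\pi^{\ell-1}B)=\psi(\pi^{\ell-1}\mathrm{tr}(\tilde AB))$ with $\tilde A$ a lift of $A$. For $\ell\geq 2$, an irreducible representation $\rho$ of $\mathrm G(\mathfrak o_\ell)$ is regular if every character $\psi_A$ occurring in $\rho|_{K^{\ell-1}}$ has $A$ non-scalar; its type $\mathrm{tt}(\rho)$ is $\mathbf{cus}$, $\mathbf{ss}$, $\mathbf{sns}$ according as $\dim\rho=(q-1)q^{\ell-1}$, $(q+1)q^{\ell-1}$, $(q^2-1)q^{\ell-2}$. For $\ell=1$, the regular representations are all non-linear irreducible representations of $\mathrm G(\mathfrak o_1)$, of type $\mathbf{cus}$, $\mathbf{ss}$, $\mathbf{sns}$ according as the dimension is $q-1$, $q+1$, $q$. *)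

theory Defs
  imports "HOL-Library.FuncSet" "Jordan_Normal_Form.Matrix"
begin

type_synonym 'r qe = "'r \<times> 'r"

definition qadd :: "'r::comm_ring_1 qe \<Rightarrow> 'r qe \<Rightarrow> 'r qe" where
  "qadd u v = (fst u + fst v, snd u + snd v)"

definition qneg :: "'r::comm_ring_1 qe \<Rightarrow> 'r qe" where
  "qneg u = (- fst u, - snd u)"

definition qsub :: "'r::comm_ring_1 qe \<Rightarrow> 'r qe \<Rightarrow> 'r qe" where
  "qsub u v = qadd u (qneg v)"

definition qmul :: "'r::comm_ring_1 \<Rightarrow> 'r qe \<Rightarrow> 'r qe \<Rightarrow> 'r qe" where
  "qmul d u v = (fst u * fst v + d * snd u * snd v, fst u * snd v + snd u * fst v)"

definition qconj :: "'r::comm_ring_1 qe \<Rightarrow> 'r qe" where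
  "qconj u = (fst u, - snd u)"

definition qzero :: "'r::comm_ring_1 qe" where "qzero = (0, 0)"
definition qone :: "'r::comm_ring_1 qe" where "qone = (1, 0)"

definition qdvd :: "'r::comm_ring_1 \<Rightarrow> 'r qe \<Rightarrow> bool" where
  "qdvd a u \<longleftrightarrow> a dvd fst u \<and> a dvd snd u"

definition qreal :: "'r::comm_ring_1 qe \<Rightarrow> bool" where
  "qreal u \<longleftrightarrow> snd u = 0"

definition residue_card :: "'r::comm_ring_1 \<Rightarrow> nat" where
  "residue_card \<pi> = card ((UNIV :: 'r set) // {(x, y). \<pi> dvd (x - y)})"

datatype 'e m2 = M2 (m11: 'e) (m12: 'e) (m21: 'e) (m22: 'e)

definition m2add :: "'r::comm_ring_1 qe m2 \<Rightarrow> 'r qe m2 \<Rightarrow> 'r qe m2" where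
  "m2add A B = M2 (qadd (m11 A) (m11 B)) (qadd (m12 A) (m12 B))
                  (qadd (m21 A) (m21 B)) (qadd (m22 A) (m22 B))"

definition m2sub :: "'r::comm_ring_1 qe m2 \<Rightarrow> 'r qe m2 \<Rightarrow> 'r qe m2" where
  "m2sub A B = M2 (qsub (m11 A) (m11 B)) (qsub (m12 A) (m12 B))
                  (qsub (m21 A) (m21 B)) (qsub (m22 A) (m22 B))"

definition m2mul :: "'r::comm_ring_1 \<Rightarrow> 'r qe m2 \<Rightarrow> 'r qe m2 \<Rightarrow> 'r qe m2" where
  "m2mul d A B = M2
     (qadd (qmul d (m11 A) (m11 B)) (qmul d (m12 A) (m21 B)))
     (qadd (qmul d (m11 A) (m12 B)) (qmul d (m12 A) (m22 B)))
     (qadd (qmul d (m21 A) (m11 B)) (qmul d (m22 A) (m21 B)))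
     (qadd (qmul d (m21 A) (m12 B)) (qmul d (m22 A) (m22 B)))"

definition m2one :: "'r::comm_ring_1 qe m2" where
  "m2one = M2 qone qzero qzero qone"

definition m2zero :: "'r::comm_ring_1 qe m2" where
  "m2zero = M2 qzero qzero qzero qzero"

definition m2scalar :: "'r::comm_ring_1 qe \<Rightarrow> 'r qe m2" where
  "m2scalar c = M2 c qzero qzero c"

definition m2tr :: "'r::comm_ring_1 qe m2 \<Rightarrow> 'r qe" where
  "m2tr A = qadd (m11 A) (m22 A)"

text \<open>A^star = W (a_ji^o) W^{-1} with W = antidiagonal(1,1).\<close>
definition m2star :: "'r::comm_ring_1 qe m2 \<Rightarrow> 'r qe m2" where
  "m2star A = M2 (qconj (m22 A)) (qconj (m12 A)) (qconj (m21 A)) (qconj (m11 A))"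

definition m2dvd :: "'r::comm_ring_1 \<Rightarrow> 'r qe m2 \<Rightarrow> bool" where
  "m2dvd a A \<longleftrightarrow> qdvd a (m11 A) \<and> qdvd a (m12 A) \<and> qdvd a (m21 A) \<and> qdvd a (m22 A)"

definition m2real :: "'r::comm_ring_1 qe m2 \<Rightarrow> bool" where
  "m2real A \<longleftrightarrow> qreal (m11 A) \<and> qreal (m12 A) \<and> qreal (m21 A) \<and> qreal (m22 A)"

definition Gset :: "bool \<Rightarrow> 'r::comm_ring_1 \<Rightarrow> 'r qe m2 set" where
  "Gset unitary d =
    (if unitary then {A. m2mul d (m2star A) A = m2one}
     else {A. m2real A \<and>
              (fst (m11 A) * fst (m22 A) - fst (m12 A) * fst (m21 A)) dvd 1})"

definition gset :: "bool \<Rightarrow> 'r::comm_ring_1 qe m2 set" where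
  "gset unitary =
    (if unitary then {A. m2add A (m2star A) = m2zero} else {A. m2real A})"

definition Kset :: "bool \<Rightarrow> 'r::comm_ring_1 \<Rightarrow> 'r \<Rightarrow> nat \<Rightarrow> 'r qe m2 set" where
  "Kset unitary d \<pi> l = {k \<in> Gset unitary d. m2dvd (\<pi> ^ (l - 1)) (m2sub k m2one)}"

text \<open>The additive character psi of R_l: psi(x + theta y) = psi'(x) psi'(y)
  (on o_l, i.e. y = 0, this is psi' itself).\<close>
definition Psi :: "('r::comm_ring_1 \<Rightarrow> complex) \<Rightarrow> 'r qe \<Rightarrow> complex" where
  "Psi psi' u = psi' (fst u) * psi' (snd u)"

text \<open>psi_A (I + \<pi>^{l-1} B) = psi(\<pi>^{l-1} tr(A B)) = psi(tr(A (k - I))) for k = I + \<pi>^{l-1} B.\<close>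
definition psiA :: "('r::comm_ring_1 \<Rightarrow> complex) \<Rightarrow> 'r \<Rightarrow> 'r qe m2 \<Rightarrow> 'r qe m2 \<Rightarrow> complex" where
  "psiA psi' d A k = Psi psi' (m2tr (m2mul d A (m2sub k m2one)))"

text \<open>A (a lift of an element of g(o_1)) is scalar modulo \<pi>.\<close>
definition scalar_mod :: "'r::comm_ring_1 \<Rightarrow> 'r qe m2 \<Rightarrow> bool" where
  "scalar_mod \<pi> A \<longleftrightarrow> (\<exists>c. m2dvd \<pi> (m2sub A (m2scalar c)))"

definition is_rep :: "'g set \<Rightarrow> ('g \<Rightarrow> 'g \<Rightarrow> 'g) \<Rightarrow> 'g \<Rightarrow> nat \<Rightarrow> ('g \<Rightarrow> complex mat) \<Rightarrow> bool" where
  "is_rep G mul e n \<rho> \<longleftrightarrow>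
     (\<forall>g\<in>G. \<rho> g \<in> carrier_mat n n) \<and>
     (\<forall>g\<in>G. \<forall>h\<in>G. \<rho> (mul g h) = \<rho> g * \<rho> h) \<and>
     \<rho> e = 1\<^sub>m n"

definition invariant_subspace :: "'g set \<Rightarrow> nat \<Rightarrow> ('g \<Rightarrow> complex mat) \<Rightarrow> complex vec set \<Rightarrow> bool" where
  "invariant_subspace G n \<rho> W \<longleftrightarrow>
     W \<subseteq> carrier_vec n \<and> 0\<^sub>v n \<in> W \<and>
     (\<forall>v\<in>W. \<forall>w\<in>W. v + w \<in> W) \<and>
     (\<forall>c. \<forall>v\<in>W. c \<cdot>\<^sub>v v \<in> W) \<and>
     (\<forall>g\<in>G. \<forall>v\<in>W. \<rho> g *\<^sub>v v \<in> W)"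

definition irred_rep :: "'g set \<Rightarrow> ('g \<Rightarrow> 'g \<Rightarrow> 'g) \<Rightarrow> 'g \<Rightarrow> nat \<Rightarrow> ('g \<Rightarrow> complex mat) \<Rightarrow> bool" where
  "irred_rep G mul e n \<rho> \<longleftrightarrow> is_rep G mul e n \<rho> \<and> n > 0 \<and>
     (\<forall>W. invariant_subspace G n \<rho> W \<longrightarrow> W = {0\<^sub>v n} \<or> W = carrier_vec n)"

definition char_occurs :: "'g set \<Rightarrow> nat \<Rightarrow> ('g \<Rightarrow> complex mat) \<Rightarrow> ('g \<Rightarrow> complex) \<Rightarrow> bool" where
  "char_occurs K n \<rho> \<chi> \<longleftrightarrow>
     (\<exists>v\<in>carrier_vec n. v \<noteq> 0\<^sub>v n \<and> (\<forall>k\<in>K. \<rho> k *\<^sub>v v = \<chi> k \<cdot>\<^sub>v v))"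

definition kron :: "complex mat \<Rightarrow> complex mat \<Rightarrow> complex mat" where
  "kron A B = mat (dim_row A * dim_row B) (dim_col A * dim_col B)
     (\<lambda>(i, j). A $$ (i div dim_row B, j div dim_col B) * B $$ (i mod dim_row B, j mod dim_col B))"

definition intertwiner :: "'g set \<Rightarrow> nat \<Rightarrow> ('g \<Rightarrow> complex mat) \<Rightarrow> nat \<Rightarrow> ('g \<Rightarrow> complex mat)
     \<Rightarrow> nat \<Rightarrow> ('g \<Rightarrow> complex mat) \<Rightarrow> complex mat \<Rightarrow> bool" where
  "intertwiner G nl rl nm rm nn rn T \<longleftrightarrow>
     T \<in> carrier_mat (nl * nm) nn \<and> (\<forall>g\<in>G. T * rn g = kron (rl g) (rm g) * T)"

text \<open>Multiplicity of nu in lambda (x) mu, i.e. dim Hom_G(nu, lambda (x) mu).\<close>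
definition tensor_mult :: "'g set \<Rightarrow> nat \<Rightarrow> ('g \<Rightarrow> complex mat) \<Rightarrow> nat \<Rightarrow> ('g \<Rightarrow> complex mat)
     \<Rightarrow> nat \<Rightarrow> ('g \<Rightarrow> complex mat) \<Rightarrow> nat" where
  "tensor_mult G nl rl nm rm nn rn =
     (GREATEST k. \<exists>Ts :: nat \<Rightarrow> complex mat.
        (\<forall>i<k. intertwiner G nl rl nm rm nn rn (Ts i)) \<and>
        (\<forall>c :: nat \<Rightarrow> complex.
           (\<forall>r<nl * nm. \<forall>s<nn. (\<Sum>i<k. c i * Ts i $$ (r, s)) = 0) \<longrightarrow> (\<forall>i<k. c i = 0)))"

definition regular_rep :: "bool \<Rightarrow> 'r::comm_ring_1 \<Rightarrow> 'r \<Rightarrow> ('r \<Rightarrow> complex) \<Rightarrow> nat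
     \<Rightarrow> nat \<Rightarrow> ('r qe m2 \<Rightarrow> complex mat) \<Rightarrow> bool" where
  "regular_rep unitary d \<pi> psi' l n \<rho> \<longleftrightarrow>
     irred_rep (Gset unitary d) (m2mul d) m2one n \<rho> \<and>
     (if l = 1 then n > 1
      else (\<forall>A\<in>gset unitary.
              char_occurs (Kset unitary d \<pi> l) n \<rho> (psiA psi' d A) \<longrightarrow> \<not> scalar_mod \<pi> A))"

datatype rtype = Cus | SS | SNS

definition has_type :: "nat \<Rightarrow> nat \<Rightarrow> nat \<Rightarrow> rtype \<Rightarrow> bool" where
  "has_type l q n t \<longleftrightarrow>
     (case t of
        Cus \<Rightarrow> n = (q - 1) * q ^ (l - 1)
      | SS \<Rightarrow> n = (q + 1) * q ^ (l - 1)
      | SNS \<Rightarrow> (if l = 1 then n = q else n = (q ^ 2 - 1) * q ^ (l - 2)))"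

end

theory Submission
  imports Defs "Jordan_Normal_Form.Spectral_Radius"
begin

text \<open>Both groups are quotients of a group \<open>\<Gamma>\<close> of pairs \<open>(c, X)\<close> with \<open>X\<close> in \<open>GL\<^sub>2\<close> of the chain ring, so
  that the upper unipotent group \<open>U\<close>, the torus \<open>T\<close> and the Weyl element are available in both cases.
  For \<open>l \<ge> 2\<close>, an irreducible representation that is
  trivial on the kernel of \<open>SL\<^sub>2\<close> modulo \<open>p\<^bsup>l-1\<^esup>\<close> has dimension at most \<open>(q + 1) q\<^bsup>l-2\<^esup>\<close>; hence the three types have exact level
  \<open>l\<close>, and each primitive character of \<open>U\<close> occurs in them exactly once. The complement \<open>N\<close> of the primitive part,
  the vectors fixed by the unipotents congruent to \<open>1\<close> modulo \<open>p\<^bsup>l-1\<^esup>\<close>, then has dimension \<open>0\<close>, \<open>2 q\<^bsup>l-1\<^esup>\<close> and \<open>(q - 1) q\<^bsup>l-2\<^esup>\<close>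
  (or \<open>1\<close> for \<open>l = 1\<close>) for the types cus, ss and sns. For ss it provides eigenvectors of the Borel subgroup with
  two conjugate characters that differ on the subgroup \<open>T'\<close> of \<open>T\<close> of elements that are scalar modulo \<open>p\<^bsup>l-1\<^esup>\<close>;
  for sns, \<open>T'\<close> acts on \<open>N\<close> by a Weyl invariant character.

  The multiplicity is the dimension of the space of invariant trilinear forms. If one factor is cuspidal, Gelfand's trick
  for the diagonal in \<open>\<Gamma>\<^sup>3\<close> and the anti-involution given by the adjugate bounds it by one: a function of
  two matrices that is invariant under simultaneous conjugation, and cuspidal in the first variable, is invariant
  under the simultaneous adjugate. Otherwise the forms are evaluated on Borel eigenvectors, Whittaker vectors and
  generators of \<open>N\<close>; the Bruhat cells reduce everything to few values, and the cells at which the characters of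
  \<open>T'\<close> do not cancel contribute nothing.\<close>

section \<open>Linear algebra of kernels on finite index sets\<close>

text \<open>A type is given only as a dimension, so level, Whittaker multiplicity and the torus
  action on \<open>N\<close> all have to be recovered by counting; the gap between the dimension of
  each type and the largest dimension possible below level \<open>l\<close> is what starts this. The
  cell arguments need a Borel eigenvector in one factor. A cuspidal factor has none, which is why it
  is treated through commuting compressed operators instead. The constants count torus orbits on the
  open cell. With three principal series this cell is parametrised by the ring, on which units act
  by scaling; the orbits are the valuations 0, ..., \<open>l\<close>, whence \<open>l + 1\<close>.
  If one factor is sns, its Whittaker line and the generator of \<open>N\<close> contribute one
  value each, whence 2. With two sns factors only a pair of opposite Whittaker lines survives,
  whence 1. The remaining cells can be silenced because the two conjugate Borel characters of an ss
  factor differ on \<open>T'\<close>, so that at least one of them violates any given triviality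
  relation.\<close>

lemma idempotent_kernel_decomposition:
  fixes K :: "'i \<Rightarrow> 'i \<Rightarrow> complex"
  assumes "finite I"
    and "\<And>i j. i \<in> I \<Longrightarrow> j \<in> I \<Longrightarrow> (\<Sum>k\<in>I. K i k * K k j) = K i j"
  shows "\<exists>(r::nat) a b. (\<forall>i\<in>I. \<forall>j\<in>I. K i j = (\<Sum>m<r. a m i * b m j)) \<and>
     (\<forall>m<r. \<forall>m'<r. (\<Sum>i\<in>I. b m i * a m' i) = (if m = m' then 1 else 0))"
  using assms(2)
proof (induction "card {i\<in>I. \<exists>j\<in>I. K i j \<noteq> 0}" arbitrary: K rule: less_induct)
  case less
  note idem = less.prems
  show ?case
  proof (cases "\<exists>i\<in>I. \<exists>j\<in>I. K i j \<noteq> 0")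
    case False
    then show ?thesis by (intro exI[of _ 0]) auto
  next
    case True
    then obtain i0 j0 where ij: "i0 \<in> I" "j0 \<in> I" "K i0 j0 \<noteq> 0" by auto
    \<comment> \<open>Peel off a rank-one piece: a nonzero column \<open>v\<close> and the row
      \<open>b0\<close> through the same entry, scaled so that \<open>b0\<close> pairs with
      \<open>v\<close> to 1. The difference \<open>L\<close> is again idempotent and its row
      \<open>i0\<close> vanishes, so the number of nonzero rows drops.\<close>
    define v where "v = (\<lambda>i. K i j0)"
    define b0 where "b0 = (\<lambda>j. K i0 j / v i0)"
    have v0: "v i0 \<noteq> 0" using ij by (simp add: v_def)
    have Kv: "(\<Sum>k\<in>I. K i k * v k) = v i" if "i \<in> I" for i
      using idem[OF that ij(2)] by (simp add: v_def)
    have bK: "(\<Sum>k\<in>I. b0 k * K k j) = b0 j" if "j \<in> I" for j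
      using idem[OF ij(1) that] by (simp add: b0_def sum_divide_distrib[symmetric])
    have bv: "(\<Sum>k\<in>I. b0 k * v k) = 1"
      using Kv[OF ij(1)] v0 by (simp add: b0_def sum_divide_distrib[symmetric])
    define L where "L = (\<lambda>i j. K i j - v i * b0 j)"
    have Lidem: "(\<Sum>k\<in>I. L i k * L k j) = L i j" if "i \<in> I" "j \<in> I" for i j
    proof -
      have "(\<Sum>k\<in>I. L i k * L k j) = (\<Sum>k\<in>I. K i k * K k j) - (\<Sum>k\<in>I. K i k * v k) * b0 j
         - v i * (\<Sum>k\<in>I. b0 k * K k j) + v i * (\<Sum>k\<in>I. b0 k * v k) * b0 j"
        by (simp add: L_def algebra_simps sum.distrib sum_subtractf sum_distrib_left sum_distrib_right)
      then show ?thesis using that by (simp add: idem Kv bK bv L_def)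
    qed
    have sub: "{i\<in>I. \<exists>j\<in>I. L i j \<noteq> 0} \<subset> {i\<in>I. \<exists>j\<in>I. K i j \<noteq> 0}"
    proof -
      have "L i0 j = 0" for j using v0 by (simp add: L_def b0_def)
      moreover have "\<exists>j\<in>I. K i j \<noteq> 0" if "i \<in> I" "j \<in> I" "L i j \<noteq> 0" for i j
        using that ij(2) by (cases "K i j = 0") (auto simp: L_def v_def)
      ultimately show ?thesis using ij by blast
    qed
    have "card {i\<in>I. \<exists>j\<in>I. L i j \<noteq> 0} < card {i\<in>I. \<exists>j\<in>I. K i j \<noteq> 0}"
      by (rule psubset_card_mono[OF _ sub]) (simp add: assms(1))
    from less.hyps[OF this Lidem] obtain r :: nat and a b where
      L: "\<And>i j. i \<in> I \<Longrightarrow> j \<in> I \<Longrightarrow> L i j = (\<Sum>m<r. a m i * b m j)" and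
      orth: "\<And>m m'. m < r \<Longrightarrow> m' < r \<Longrightarrow> (\<Sum>i\<in>I. b m i * a m' i) = (if m = m' then 1 else 0)"
      by blast
    have La: "(\<Sum>j\<in>I. L i j * a m j) = a m i" if "i \<in> I" "m < r" for i m
    proof -
      have "(\<Sum>j\<in>I. L i j * a m j) = (\<Sum>j\<in>I. \<Sum>m'<r. a m' i * (b m' j * a m j))"
        using that by (simp add: L sum_distrib_right mult.assoc)
      also have "\<dots> = (\<Sum>m'<r. a m' i * (\<Sum>j\<in>I. b m' j * a m j))"
        by (subst sum.swap) (simp add: sum_distrib_left)
      also have "\<dots> = (\<Sum>m'<r. if m' = m then a m' i else 0)"
        using that by (intro sum.cong) (auto simp: orth)
      finally show ?thesis using that by simp
    qed
    have bL: "(\<Sum>i\<in>I. b m i * L i j) = b m j" if "j \<in> I" "m < r" for j m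
    proof -
      have "(\<Sum>i\<in>I. b m i * L i j) = (\<Sum>i\<in>I. \<Sum>m'<r. (b m i * a m' i) * b m' j)"
        using that by (simp add: L sum_distrib_left mult.assoc)
      also have "\<dots> = (\<Sum>m'<r. (\<Sum>i\<in>I. b m i * a m' i) * b m' j)"
        by (subst sum.swap) (simp add: sum_distrib_right)
      also have "\<dots> = (\<Sum>m'<r. if m' = m then b m' j else 0)"
        using that by (intro sum.cong) (auto simp: orth)
      finally show ?thesis using that by simp
    qed
    have b0L: "(\<Sum>i\<in>I. b0 i * L i j) = 0" if "j \<in> I" for j
    proof -
      have "(\<Sum>i\<in>I. b0 i * L i j) = (\<Sum>i\<in>I. b0 i * K i j) - (\<Sum>i\<in>I. b0 i * v i) * b0 j"
        by (simp add: L_def algebra_simps sum_subtractf sum_distrib_left)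
      then show ?thesis using that by (simp add: bK bv)
    qed
    have Lv: "(\<Sum>j\<in>I. L i j * v j) = 0" if "i \<in> I" for i
    proof -
      have "(\<Sum>j\<in>I. L i j * v j) = (\<Sum>j\<in>I. K i j * v j) - v i * (\<Sum>j\<in>I. b0 j * v j)"
        by (simp add: L_def algebra_simps sum_subtractf sum_distrib_left)
      then show ?thesis using that by (simp add: Kv bv)
    qed
    have b0a: "(\<Sum>i\<in>I. b0 i * a m i) = 0" if "m < r" for m
    proof -
      have "(\<Sum>i\<in>I. b0 i * a m i) = (\<Sum>i\<in>I. b0 i * (\<Sum>j\<in>I. L i j * a m j))"
        using that by (simp add: La)
      also have "\<dots> = (\<Sum>j\<in>I. (\<Sum>i\<in>I. b0 i * L i j) * a m j)"
        by (simp add: sum_distrib_left sum_distrib_right, subst sum.swap, simp add: mult.assoc)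
      finally show ?thesis by (simp add: b0L)
    qed
    have bv0: "(\<Sum>i\<in>I. b m i * v i) = 0" if "m < r" for m
    proof -
      have "(\<Sum>i\<in>I. b m i * v i) = (\<Sum>j\<in>I. (\<Sum>i\<in>I. b m i * L i j) * v j)"
        using that by (simp add: bL)
      also have "\<dots> = (\<Sum>i\<in>I. b m i * (\<Sum>j\<in>I. L i j * v j))"
        by (simp add: sum_distrib_left sum_distrib_right, subst sum.swap, simp add: mult.assoc)
      finally show ?thesis by (simp add: Lv)
    qed
    define a' where "a' = (\<lambda>m. if m = r then v else a m)"
    define b' where "b' = (\<lambda>m. if m = r then b0 else b m)"
    have "K i j = (\<Sum>m<Suc r. a' m i * b' m j)" if "i \<in> I" "j \<in> I" for i j
      using L[OF that] by (simp add: a'_def b'_def L_def algebra_simps)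
    moreover have "(\<Sum>i\<in>I. b' m i * a' m' i) = (if m = m' then 1 else 0)"
      if "m < Suc r" "m' < Suc r" for m m'
      using that by (auto simp: a'_def b'_def less_Suc_eq orth bv bv0 b0a)
    ultimately show ?thesis by blast
  qed
qed

text \<open>Gaussian elimination. It serves twice: to bound spaces of forms by the number of
  separating functionals, and to bound \<open>card I\<close> by the size of a spanning
  family.\<close>

lemma homogeneous_system_nontrivial_solution:
  fixes a :: "'s \<Rightarrow> 'i \<Rightarrow> complex"
  assumes "finite S" "finite I" "card S < card I"
  shows "\<exists>c. (\<exists>i\<in>I. c i \<noteq> 0) \<and> (\<forall>s\<in>S. (\<Sum>i\<in>I. c i * a s i) = 0)"
  using assms
proof (induction S arbitrary: I a rule: finite_induct)
  case empty
  then obtain i where "i \<in> I" by fastforce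
  then show ?case by (intro exI[of _ "\<lambda>_. 1"]) auto
next
  case (insert s S)
  show ?case
  proof (cases "\<exists>i\<in>I. a s i \<noteq> 0")
    case False
    have "card S < card I" using insert by simp
    from insert.IH[OF insert.prems(1) this] show ?thesis using False by force
  next
    case True
    then obtain i0 where i0: "i0 \<in> I" "a s i0 \<noteq> 0" by blast
    define J where "J = I - {i0}"
    have J: "finite J" "card S < card J" "i0 \<notin> J" "I = insert i0 J"
      using insert i0 by (auto simp: J_def)
    from insert.IH[OF J(1,2), of "\<lambda>t i. a t i - a t i0 * a s i / a s i0"] obtain c where
      c: "\<exists>i\<in>J. c i \<noteq> 0" and
      eq: "\<And>t. t \<in> S \<Longrightarrow> (\<Sum>i\<in>J. c i * (a t i - a t i0 * a s i / a s i0)) = 0" by blast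
    define c0 where "c0 = - (\<Sum>i\<in>J. c i * a s i) / a s i0"
    define d where "d = c(i0 := c0)"
    have d: "(\<Sum>i\<in>I. d i * a t i) = c0 * a t i0 + (\<Sum>i\<in>J. c i * a t i)" for t
    proof -
      have "(\<Sum>i\<in>J. d i * a t i) = (\<Sum>i\<in>J. c i * a t i)"
        using J(3) by (intro sum.cong) (auto simp: d_def)
      then show ?thesis using J by (simp add: d_def)
    qed
    have "(\<Sum>i\<in>I. d i * a s i) = 0" using i0 by (simp add: d c0_def)
    moreover have "(\<Sum>i\<in>I. d i * a t i) = 0" if "t \<in> S" for t
    proof -
      have "(\<Sum>i\<in>J. c i * (a t i - a t i0 * a s i / a s i0))
         = (\<Sum>i\<in>J. c i * a t i) + c0 * a t i0"
        by (simp add: c0_def right_diff_distrib sum_subtractf sum_distrib_left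
            sum_distrib_right sum_divide_distrib mult_ac)
      then show ?thesis using eq[OF that] by (simp add: d add.commute)
    qed
    moreover have "\<exists>i\<in>I. d i \<noteq> 0" using c J by (auto simp: d_def)
    ultimately show ?thesis by blast
  qed
qed

text \<open>Stated through independent families, so that the set need not be known to be a subspace
  and the bound transfers directly to the \<open>GREATEST\<close> in
  \<open>tensor_mult\<close>.\<close>

definition dim_le :: "('j \<Rightarrow> complex) set \<Rightarrow> nat \<Rightarrow> bool" where
  "dim_le \<F> K \<longleftrightarrow> (\<forall>k (f :: nat \<Rightarrow> 'j \<Rightarrow> complex). (\<forall>i<k. f i \<in> \<F>) \<longrightarrow>
     (\<forall>c. (\<forall>j. (\<Sum>i<k. c i * f i j) = 0) \<longrightarrow> (\<forall>i<k. c i = 0)) \<longrightarrow> k \<le> K)"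

lemma dim_le_functionals:
  assumes "finite S" and "card S \<le> K"
    and lin: "\<And>k c f s. (\<And>i. i < k \<Longrightarrow> f i \<in> \<F>) \<Longrightarrow> s \<in> S \<Longrightarrow>
        ev s (\<lambda>j. \<Sum>i<(k::nat). c i * f i j) = (\<Sum>i<k. c i * ev s (f i))"
    and closed: "\<And>k c f. (\<And>i. i < k \<Longrightarrow> f i \<in> \<F>) \<Longrightarrow> (\<lambda>j. \<Sum>i<(k::nat). c i * f i j) \<in> \<F>"
    and inj: "\<And>f j. f \<in> \<F> \<Longrightarrow> (\<And>s. s \<in> S \<Longrightarrow> ev s f = (0::complex)) \<Longrightarrow> f j = 0"
  shows "dim_le \<F> K"
  unfolding dim_le_def
proof (intro allI impI, rule ccontr)
  fix k and f :: "nat \<Rightarrow> 'b \<Rightarrow> complex"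
  assume f: "\<forall>i<k. f i \<in> \<F>"
    and indep: "\<forall>c. (\<forall>j. (\<Sum>i<k. c i * f i j) = 0) \<longrightarrow> (\<forall>i<k. c i = 0)" and "\<not> k \<le> K"
  then have "card S < card {..<k}" using assms(2) by simp
  from homogeneous_system_nontrivial_solution[OF assms(1) _ this, of "\<lambda>s i. ev s (f i)"]
  obtain c where c: "\<exists>i<k. c i \<noteq> 0" and eq: "\<And>s. s \<in> S \<Longrightarrow> (\<Sum>i<k. c i * ev s (f i)) = 0"
    by auto
  have "(\<Sum>i<k. c i * f i j) = 0" for j
    using inj[of "\<lambda>j. \<Sum>i<k. c i * f i j"] closed[of k f c] lin[of k f _ c] eq f by simp
  then show False using indep c by blast
qed

text \<open>Pairwise proportionality is the form in which Gelfand's trick delivers multiplicity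
  one.\<close>

lemma dim_le_1I:
  assumes "\<And>f g i j. f \<in> \<F> \<Longrightarrow> g \<in> \<F> \<Longrightarrow> f i * g j = f j * g i"
  shows "dim_le \<F> 1"
  unfolding dim_le_def
proof (intro allI impI, rule ccontr)
  fix k and f :: "nat \<Rightarrow> 'a \<Rightarrow> complex"
  assume f: "\<forall>i<k. f i \<in> \<F>"
    and indep: "\<forall>c. (\<forall>j. (\<Sum>i<k. c i * f i j) = 0) \<longrightarrow> (\<forall>i<k. c i = 0)" and "\<not> k \<le> 1"
  then have k: "0 < k" "1 < k" by auto
  have two: "(\<Sum>i<k. (if i = 0 then x else if i = 1 then y else 0) * f i j) = x * f 0 j + y * f 1 j"
    for x y j
  proof -
    have "(\<Sum>i<k. (if i = 0 then x else if i = 1 then y else 0) * f i j)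
       = (\<Sum>i<k. (if i = 0 then x * f 0 j else 0) + (if i = 1 then y * f 1 j else 0))"
      by (intro sum.cong) auto
    then show ?thesis using k by (simp add: sum.distrib)
  qed
  have "f 1 j = 0" for j
  proof -
    have "\<forall>j'. (\<Sum>i<k. (if i = 0 then f 1 j else if i = 1 then - f 0 j else 0) * f i j') = 0"
      unfolding two using assms[of "f 0" "f 1"] f k by (auto simp: algebra_simps)
    from indep[rule_format, OF this[rule_format], of 0] k show ?thesis by simp
  qed
  then have "\<forall>j'. (\<Sum>i<k. (if i = 0 then 0 else if i = 1 then 1 else 0) * f i j') = 0"
    unfolding two by simp
  from indep[rule_format, OF this[rule_format], of 1] k show False by simp
qed

section \<open>Matrix representations of finite groups\<close>

definition app :: "'i set \<Rightarrow> ('i \<Rightarrow> 'i \<Rightarrow> complex) \<Rightarrow> ('i \<Rightarrow> complex) \<Rightarrow> 'i \<Rightarrow> complex" where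
  "app I K v = (\<lambda>i. \<Sum>j\<in>I. K i j * v j)"

lemma app_lincomb: "app I K (\<lambda>i. \<Sum>s\<in>S. c s * w s i) = (\<lambda>i. \<Sum>s\<in>S. c s * app I K (w s) i)"
  unfolding app_def
  by (rule ext, simp add: sum_distrib_left, subst sum.swap, simp add: mult_ac)

lemma app_scale: "app I K (\<lambda>i. c * v i) = (\<lambda>i. c * app I K v i)"
  by (simp add: app_def sum_distrib_left mult_ac)

lemma app_add: "app I K (\<lambda>i. v i + w i) = (\<lambda>i. app I K v i + app I K w i)"
  by (simp add: app_def ring_distribs sum.distrib)

lemma app_kernel_lincomb:
  "app I (\<lambda>i j. \<Sum>s\<in>S. c s * K s i j) v = (\<lambda>i. \<Sum>s\<in>S. c s * app I (K s) v i)"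
  unfolding app_def
  by (rule ext, simp add: sum_distrib_left sum_distrib_right, subst sum.swap, simp add: mult_ac)

locale fin_group =
  fixes G :: "'g set" and mul :: "'g \<Rightarrow> 'g \<Rightarrow> 'g" (infixl "\<odot>" 70) and one :: 'g
  assumes finite_G: "finite G"
    and closed [simp, intro]: "g \<in> G \<Longrightarrow> h \<in> G \<Longrightarrow> g \<odot> h \<in> G"
    and assoc: "g \<in> G \<Longrightarrow> h \<in> G \<Longrightarrow> k \<in> G \<Longrightarrow> (g \<odot> h) \<odot> k = g \<odot> (h \<odot> k)"
    and one_in [simp, intro]: "one \<in> G"
    and one_left [simp]: "g \<in> G \<Longrightarrow> one \<odot> g = g"
    and one_right [simp]: "g \<in> G \<Longrightarrow> g \<odot> one = g"
    and inverse_ex: "g \<in> G \<Longrightarrow> \<exists>h\<in>G. g \<odot> h = one \<and> h \<odot> g = one"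
begin

definition ginv :: "'g \<Rightarrow> 'g" where
  "ginv g = (SOME h. h \<in> G \<and> g \<odot> h = one \<and> h \<odot> g = one)"

lemma ginv:
  assumes "g \<in> G"
  shows ginv_in [simp, intro]: "ginv g \<in> G" and ginv_right [simp]: "g \<odot> ginv g = one"
    and ginv_left [simp]: "ginv g \<odot> g = one"
  using someI_ex[of "\<lambda>h. h \<in> G \<and> g \<odot> h = one \<and> h \<odot> g = one"] inverse_ex[OF assms]
  unfolding ginv_def by blast+

lemma ginv_eqI: "g \<in> G \<Longrightarrow> h \<in> G \<Longrightarrow> g \<odot> h = one \<Longrightarrow> ginv g = h"
  by (metis assoc ginv_in ginv_left one_left one_right)

lemma ginv_ginv [simp]: "g \<in> G \<Longrightarrow> ginv (ginv g) = g"
  by (simp add: ginv_eqI)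

lemma ginv_mul: "g \<in> G \<Longrightarrow> h \<in> G \<Longrightarrow> ginv (g \<odot> h) = ginv h \<odot> ginv g"
  by (rule ginv_eqI) (auto simp: assoc, metis assoc ginv_in ginv_right one_left)

lemma inv_mul_cancel [simp]: "g \<in> G \<Longrightarrow> h \<in> G \<Longrightarrow> ginv g \<odot> (g \<odot> h) = h"
  by (metis assoc ginv_in ginv_left one_left)

lemma mul_inv_cancel [simp]: "g \<in> G \<Longrightarrow> h \<in> G \<Longrightarrow> g \<odot> (ginv g \<odot> h) = h"
  by (metis assoc ginv_in ginv_right one_left)

lemma sum_ginv: "(\<Sum>g\<in>G. f (ginv g)) = (\<Sum>g\<in>G. f g)"
  by (rule sum.reindex_bij_witness[of _ ginv ginv]) auto

end

locale fin_rep = fin_group G mul one for G :: "'g set" and mul (infixl "\<odot>" 70) and one +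
  fixes I :: "'i set" and \<rho> :: "'g \<Rightarrow> 'i \<Rightarrow> 'i \<Rightarrow> complex"
  assumes finite_I: "finite I"
    and rep_mul: "g \<in> G \<Longrightarrow> h \<in> G \<Longrightarrow> i \<in> I \<Longrightarrow> j \<in> I \<Longrightarrow>
      \<rho> (g \<odot> h) i j = (\<Sum>k\<in>I. \<rho> g i k * \<rho> h k j)"
    and rep_one: "i \<in> I \<Longrightarrow> j \<in> I \<Longrightarrow> \<rho> one i j = (if i = j then 1 else 0)"
    and rep_supp: "g \<in> G \<Longrightarrow> i \<notin> I \<or> j \<notin> I \<Longrightarrow> \<rho> g i j = 0"
begin

definition act :: "'g \<Rightarrow> ('i \<Rightarrow> complex) \<Rightarrow> 'i \<Rightarrow> complex" where
  "act g = app I (\<rho> g)"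

text \<open>Vectors live on the whole index type and vanish off \<open>I\<close>, so that equality
  of vectors is equality of functions.\<close>

definition VS :: "('i \<Rightarrow> complex) set" where
  "VS = {v. \<forall>i. i \<notin> I \<longrightarrow> v i = 0}"

lemma VSD: "v \<in> VS \<Longrightarrow> i \<notin> I \<Longrightarrow> v i = 0"
  by (simp add: VS_def)

lemma act_in [simp, intro]: "g \<in> G \<Longrightarrow> act g v \<in> VS"
  by (simp add: act_def app_def VS_def rep_supp)

lemma lincomb_in [intro]: "(\<And>s. s \<in> S \<Longrightarrow> w s \<in> VS) \<Longrightarrow> (\<lambda>i. \<Sum>s\<in>S. c s * w s i) \<in> VS"
  by (simp add: VS_def)

lemma scale_in [intro]: "w \<in> VS \<Longrightarrow> (\<lambda>i. c * w i) \<in> VS"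
  by (simp add: VS_def)

lemma act_mul: assumes "g \<in> G" "h \<in> G" shows "act (g \<odot> h) v = act g (act h v)"
proof
  fix i
  show "act (g \<odot> h) v i = act g (act h v) i"
  proof (cases "i \<in> I")
    case True
    have "act (g \<odot> h) v i = (\<Sum>j\<in>I. \<Sum>k\<in>I. \<rho> g i k * \<rho> h k j * v j)"
      using True assms by (simp add: act_def app_def rep_mul sum_distrib_right)
    also have "\<dots> = (\<Sum>k\<in>I. \<rho> g i k * (\<Sum>j\<in>I. \<rho> h k j * v j))"
      by (subst sum.swap) (simp add: sum_distrib_left mult.assoc)
    finally show ?thesis by (simp add: act_def app_def)
  next
    case False
    then show ?thesis using assms by (simp add: act_def app_def rep_supp)
  qed
qed

lemma act_one [simp]: assumes "v \<in> VS" shows "act one v = v"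
proof
  fix i
  show "act one v i = v i"
  proof (cases "i \<in> I")
    case True
    have "act one v i = (\<Sum>j\<in>I. (if i = j then v j else 0))"
      unfolding act_def app_def using True by (intro sum.cong) (auto simp: rep_one)
    then show ?thesis using True finite_I by simp
  qed (use assms in \<open>simp add: act_def app_def rep_supp VS_def\<close>)
qed

lemma act_inv_left [simp]: "g \<in> G \<Longrightarrow> v \<in> VS \<Longrightarrow> act (ginv g) (act g v) = v"
  by (simp add: act_mul[symmetric])

lemma act_inv_right [simp]: "g \<in> G \<Longrightarrow> v \<in> VS \<Longrightarrow> act g (act (ginv g) v) = v"
  by (simp add: act_mul[symmetric])

lemma act_lincomb: "act g (\<lambda>i. \<Sum>s\<in>S. c s * w s i) = (\<lambda>i. \<Sum>s\<in>S. c s * act g (w s) i)"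
  by (simp add: act_def app_lincomb)

lemma act_sum: "act g (\<lambda>i. \<Sum>s\<in>S. w s i) = (\<lambda>i. \<Sum>s\<in>S. act g (w s) i)"
  using act_lincomb[where c = "\<lambda>_. 1"] by simp

lemma act_scale: "act g (\<lambda>i. c * v i) = (\<lambda>i. c * act g v i)"
  by (simp add: act_def app_scale)

lemma act_add: "act g (\<lambda>i. v i + w i) = (\<lambda>i. act g v i + act g w i)"
  by (simp add: act_def app_add)

lemma act_zero [simp]: "act g (\<lambda>i. 0) = (\<lambda>i. 0)"
  by (simp add: act_def app_def)

definition tr :: "('i \<Rightarrow> 'i \<Rightarrow> complex) \<Rightarrow> complex" where
  "tr K = (\<Sum>i\<in>I. K i i)"

lemma tr_conj: assumes "g \<in> G" "h \<in> G" shows "tr (\<rho> (g \<odot> h \<odot> ginv g)) = tr (\<rho> h)"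
proof -
  have "tr (\<rho> (g \<odot> h \<odot> ginv g)) = (\<Sum>i\<in>I. \<Sum>k\<in>I. \<rho> (g \<odot> h) i k * \<rho> (ginv g) k i)"
    using assms by (simp add: tr_def rep_mul)
  also have "\<dots> = (\<Sum>k\<in>I. \<Sum>i\<in>I. \<rho> (ginv g) k i * \<rho> (g \<odot> h) i k)"
    by (subst sum.swap) (simp add: mult.commute)
  also have "\<dots> = tr (\<rho> (ginv g \<odot> (g \<odot> h)))"
    using assms by (simp add: tr_def rep_mul del: inv_mul_cancel)
  finally show ?thesis using assms by simp
qed

lemma tr_one: "tr (\<rho> one) = of_nat (card I)"
proof -
  have "tr (\<rho> one) = (\<Sum>i\<in>I. 1)" unfolding tr_def by (intro sum.cong) (auto simp: rep_one)
  then show ?thesis by simp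
qed

text \<open>The trace of an idempotent is a natural number, and its image has a basis
  \<open>a\<close> with dual functionals \<open>b\<close>; multiplicities can then be read off from
  traces.\<close>

lemma idempotent_trace:
  assumes idem: "\<And>i j. i \<in> I \<Longrightarrow> j \<in> I \<Longrightarrow> (\<Sum>k\<in>I. K i k * K k j) = K i j"
    and supp: "\<And>i j. i \<notin> I \<Longrightarrow> K i j = 0"
  obtains r a b where "tr K = of_nat r" "\<And>m. m < r \<Longrightarrow> a m \<in> VS"
    "\<And>m. m < r \<Longrightarrow> app I K (a m) = a m"
    "\<And>m m'. m < r \<Longrightarrow> m' < r \<Longrightarrow> (\<Sum>i\<in>I. b m i * a m' i) = (if m = m' then 1 else 0)"
    "\<And>v. app I K v = (\<lambda>i. \<Sum>m<r. (\<Sum>j\<in>I. b m j * v j) * a m i)"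
proof -
  from idempotent_kernel_decomposition[OF finite_I idem] obtain r :: nat and a0 b where
      K: "\<And>i j. i \<in> I \<Longrightarrow> j \<in> I \<Longrightarrow> K i j = (\<Sum>m<r. a0 m i * b m j)" and
      orth0: "\<And>m m'. m < r \<Longrightarrow> m' < r \<Longrightarrow> (\<Sum>i\<in>I. b m i * a0 m' i) = (if m = m' then 1 else 0)"
    by blast
  define a where "a = (\<lambda>m i. if i \<in> I then a0 m i else 0)"
  have orth: "(\<Sum>i\<in>I. b m i * a m' i) = (if m = m' then 1 else 0)" if "m < r" "m' < r" for m m'
    using orth0[OF that] by (simp add: a_def)
  have app: "app I K v = (\<lambda>i. \<Sum>m<r. (\<Sum>j\<in>I. b m j * v j) * a m i)" for v
  proof
    fix i
    show "app I K v i = (\<Sum>m<r. (\<Sum>j\<in>I. b m j * v j) * a m i)"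
    proof (cases "i \<in> I")
      case True
      have "app I K v i = (\<Sum>j\<in>I. \<Sum>m<r. a0 m i * b m j * v j)"
        using True by (simp add: app_def K sum_distrib_right)
      also have "\<dots> = (\<Sum>m<r. (\<Sum>j\<in>I. b m j * v j) * a m i)"
        using True by (subst sum.swap) (simp add: a_def sum_distrib_left mult_ac)
      finally show ?thesis .
    qed (simp add: app_def supp a_def)
  qed
  have "tr K = (\<Sum>m<r. \<Sum>i\<in>I. b m i * a0 m i)"
    by (simp add: tr_def K, subst sum.swap, simp add: mult.commute)
  then have tr: "tr K = of_nat r" by (simp add: orth0)
  have "app I K (a m) = a m" if "m < r" for m
  proof
    fix i
    have "app I K (a m) i = (\<Sum>m'<r. (if m' = m then a m' i else 0))"
      unfolding app using that by (intro sum.cong) (auto simp: orth)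
    then show "app I K (a m) i = a m i" using that by simp
  qed
  then show ?thesis using that[OF tr, of a b] orth app by (auto simp: a_def VS_def)
qed

end

context fin_rep
begin

text \<open>Spanning is expressed dually, by the absence of functionals that kill the family; this
  is how group orbits of a vector will be counted.\<close>

lemma card_le_spanning:
  assumes "finite S"
    and "\<And>f i. (\<And>s. s \<in> S \<Longrightarrow> (\<Sum>i\<in>I. f i * w s i) = 0) \<Longrightarrow> i \<in> I \<Longrightarrow> f i = (0::complex)"
  shows "card I \<le> card S"
proof (rule ccontr)
  assume "\<not> card I \<le> card S"
  then have "card S < card I" by simp
  from homogeneous_system_nontrivial_solution[OF assms(1) finite_I this, of w] assms(2)
  show False by blast
qed

section \<open>Eigenvectors of elements of finite order and of commuting families\<close>

primrec gpow :: "'g \<Rightarrow> nat \<Rightarrow> 'g" where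
  "gpow g 0 = one" | "gpow g (Suc n) = g \<odot> gpow g n"

lemma gpow_in [simp, intro]: "g \<in> G \<Longrightarrow> gpow g n \<in> G"
  by (induction n) auto

lemma gpow_add: "g \<in> G \<Longrightarrow> gpow g (m + n) = gpow g m \<odot> gpow g n"
  by (induction m) (auto simp: assoc)

lemma finite_order:
  assumes "g \<in> G" obtains N where "N > 0" "gpow g N = one"
proof -
  have "\<not> inj (gpow g)"
  proof
    assume "inj (gpow g)"
    moreover have "finite (range (gpow g))"
      using assms by (intro finite_subset[OF _ finite_G]) auto
    ultimately show False using finite_imageD by blast
  qed
  then obtain m n where "m < n" "gpow g m = gpow g n"
    unfolding inj_def by (metis linorder_neq_iff)
  then have "gpow g m \<odot> gpow g (n - m) = gpow g m \<odot> one"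
    using gpow_add[OF assms, of m "n - m"] assms by simp
  then have "gpow g (n - m) = one"
    using assms by (metis inv_mul_cancel gpow_in one_in)
  then show ?thesis using that[of "n - m"] \<open>m < n\<close> by simp
qed

text \<open>The eigenvector is exhibited inside the cyclic span of \<open>v\<close>, so that it
  stays in any invariant subspace and keeps the eigenvalues of elements commuting with
  \<open>g\<close>.\<close>

lemma eigenvector_in_cyclic_span:
  assumes g: "g \<in> G" and v: "v \<in> VS" "v \<noteq> (\<lambda>_. 0)"
  shows "\<exists>(N::nat) c \<zeta>. (\<lambda>i. \<Sum>k\<le>N. c k * act (gpow g k) v i) \<noteq> (\<lambda>_. 0) \<and>
    act g (\<lambda>i. \<Sum>k\<le>N. c k * act (gpow g k) v i)
        = (\<lambda>i. \<zeta> * (\<Sum>k\<le>N. c k * act (gpow g k) v i))"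
proof -
  obtain M where M: "M > 0" "gpow g M = one" by (rule finite_order[OF g])
  then obtain N where N: "M = Suc N" by (cases M) auto
  define y where "y = (\<lambda>z::complex. \<lambda>i. \<Sum>k\<le>N. z ^ k * act (gpow g k) v i)"
  obtain i where i: "v i \<noteq> 0" using v(2) by auto
  \<comment> \<open>At a coordinate where \<open>v\<close> is nonzero, \<open>y z\<close> is a
    polynomial in \<open>z\<close> of degree at most \<open>M - 1\<close> with nonzero constant
    term, so it cannot vanish at all \<open>M\<close> roots of unity. For a root of unity
    \<open>z\<close>, applying \<open>g\<close> multiplies \<open>y z\<close> by
    \<open>1 / z\<close>.\<close>
  have "\<exists>z. z ^ M = 1 \<and> y z i \<noteq> 0"
  proof (rule ccontr)
    assume "\<not> ?thesis"
    then have sub: "{z. z ^ M = 1} \<subseteq> {z. (\<Sum>k\<le>N. act (gpow g k) v i * z ^ k) = 0}"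
      by (auto simp: y_def mult.commute)
    have bd: "finite {z. (\<Sum>k\<le>N. act (gpow g k) v i * z ^ k) = 0} \<and>
       card {z. (\<Sum>k\<le>N. act (gpow g k) v i * z ^ k) = 0} \<le> N"
      by (rule polyfun_rootbound[of _ 0]) (use i v in auto)
    have "card {z::complex. z ^ M = 1} \<le> N" using card_mono[OF _ sub] bd by auto
    then show False using card_roots_unity_eq[OF M(1)] N by simp
  qed
  then obtain z where z: "z ^ M = 1" "y z i \<noteq> 0" by blast
  have z0: "z \<noteq> 0" using z(1) M(1) by (auto simp: power_0_left)
  have "z * act g (y z) j = y z j" for j
  proof -
    have "z * act g (y z) j = (\<Sum>k\<le>N. z ^ Suc k * act (gpow g (Suc k)) v j)"
      unfolding y_def act_lincomb using g by (simp add: act_mul sum_distrib_left mult_ac)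
    also have "\<dots> = (\<Sum>k\<le>Suc N. z ^ k * act (gpow g k) v j) - act one v j"
      by (subst sum.atMost_Suc_shift) simp
    also have "\<dots> = y z j"
      using z(1) M v by (simp add: y_def N del: gpow.simps power_Suc) 
    finally show ?thesis .
  qed
  then have "act g (y z) = (\<lambda>j. (1 / z) * y z j)" using z0 by (auto simp: field_simps)
  moreover have "y z \<noteq> (\<lambda>_. 0)" using z(2) by (auto simp: fun_eq_iff)
  ultimately show ?thesis unfolding y_def by blast
qed

lemma act_gpow_closed:
  assumes "g \<in> G" "\<And>w. w \<in> W \<Longrightarrow> act g w \<in> W" "W \<subseteq> VS" "v \<in> W"
  shows "act (gpow g k) v \<in> W"
  using assms by (induction k) (auto simp: act_mul)

lemma joint_eigenvector:
  assumes S: "finite S" "S \<subseteq> G" and comm: "\<And>s t. s \<in> S \<Longrightarrow> t \<in> S \<Longrightarrow> s \<odot> t = t \<odot> s"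
    and W: "W \<subseteq> VS" "\<And>g w. g \<in> S \<Longrightarrow> w \<in> W \<Longrightarrow> act g w \<in> W"
      "\<And>(N::nat) c w. (\<And>k. k \<le> N \<Longrightarrow> w k \<in> W) \<Longrightarrow> (\<lambda>i. \<Sum>k\<le>N. c k * w k i) \<in> W"
    and v: "v \<in> W" "v \<noteq> (\<lambda>_. 0)"
  shows "\<exists>v\<in>W. v \<noteq> (\<lambda>_. 0) \<and> (\<exists>\<chi>. \<forall>s\<in>S. act s v = (\<lambda>i. \<chi> s * v i))"
proof -
  have "\<exists>v\<in>W. v \<noteq> (\<lambda>_. 0) \<and> (\<exists>\<chi>. \<forall>s\<in>F. act s v = (\<lambda>i. \<chi> s * v i))" if "F \<subseteq> S" for F
    using finite_subset[OF that S(1)] that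
  proof (induction F rule: finite_induct)
    case empty
    show ?case using v by auto
  next
    case (insert g F)
    then obtain v \<chi> where v: "v \<in> W" "v \<noteq> (\<lambda>_. 0)" and \<chi>: "\<And>s. s \<in> F \<Longrightarrow> act s v = (\<lambda>i. \<chi> s * v i)"
      by blast
    have g: "g \<in> S" "g \<in> G" using insert S by auto
    have "v \<in> VS" using v(1) W(1) by blast
    from eigenvector_in_cyclic_span[OF g(2) this v(2)] obtain N :: nat and c \<zeta> where
      nz: "(\<lambda>i. \<Sum>k\<le>N. c k * act (gpow g k) v i) \<noteq> (\<lambda>_. 0)" and
      ev: "act g (\<lambda>i. \<Sum>k\<le>N. c k * act (gpow g k) v i)
        = (\<lambda>i. \<zeta> * (\<Sum>k\<le>N. c k * act (gpow g k) v i))" by blast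
    define y where "y = (\<lambda>i. \<Sum>k\<le>N. c k * act (gpow g k) v i)"
    have \<zeta>: "act g y = (\<lambda>i. \<zeta> * y i)" using ev unfolding y_def .
    have yW: "y \<in> W" unfolding y_def
      by (rule W(3), rule act_gpow_closed) (use g v W in auto)
    have "act s y = (\<lambda>i. \<chi> s * y i)" if s: "s \<in> F" for s
    proof -
      have sG: "s \<in> S" "s \<in> G" using s insert S by auto
      have "s \<odot> gpow g k = gpow g k \<odot> s" for k
      proof (induction k)
        case (Suc k)
        then show ?case using sG g comm[of s g] by (simp, metis assoc gpow_in)
      qed (use sG in simp)
      then have "act s (act (gpow g k) v) = (\<lambda>i. \<chi> s * act (gpow g k) v i)" for k
        using sG g by (simp add: act_mul[symmetric]) (simp add: act_mul \<chi>[OF s] act_scale)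
      then show ?thesis
        by (simp add: y_def act_lincomb sum_distrib_left mult_ac)
    qed
    then have "\<forall>s\<in>insert g F. act s y = (\<lambda>i. (if s = g then \<zeta> else \<chi> s) * y i)"
      using \<zeta> by auto
    then show ?case using yW nz unfolding y_def by (intro bexI conjI exI) 
  qed
  from this[OF order_refl] show ?thesis .
qed

definition dual :: "'g \<Rightarrow> 'i \<Rightarrow> 'i \<Rightarrow> complex" where
  "dual g i j = \<rho> (ginv g) j i"

lemma fin_rep_dual: "fin_rep G mul one I dual"
proof
  show "dual (g \<odot> h) i j = (\<Sum>k\<in>I. dual g i k * dual h k j)"
    if "g \<in> G" "h \<in> G" "i \<in> I" "j \<in> I" for g h i j
    using that by (simp add: dual_def ginv_mul rep_mul mult.commute)
  show "dual one i j = (if i = j then 1 else 0)" if "i \<in> I" "j \<in> I" for i j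
    using that ginv_eqI[of one one] by (auto simp: dual_def rep_one)
qed (auto simp: finite_I dual_def rep_supp)

end

text \<open>Irreducibility is recorded through Burnside's theorem: the representing matrices span the
  full matrix algebra. In this form it passes to duals and to outer tensor products.\<close>

locale irr_rep = fin_rep G mul one I \<rho>
  for G :: "'g set" and mul (infixl "\<odot>" 70) and one and I :: "'i set" and \<rho> +
  assumes full: "i \<in> I \<Longrightarrow> j \<in> I \<Longrightarrow>
      \<exists>c. \<forall>a\<in>I. \<forall>b\<in>I. (\<Sum>g\<in>G. c g * \<rho> g a b) = (if a = i \<and> b = j then 1 else 0)"
    and I_nonempty: "I \<noteq> {}"
begin

lemma matrix_unit_act:
  assumes "i \<in> I" "j \<in> I"
  shows "\<exists>c. \<forall>v. (\<lambda>a. \<Sum>g\<in>G. c g * act g v a) = (\<lambda>a. if a = i then v j else 0)"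
proof -
  from full[OF assms] obtain c where
    c: "\<And>a b. a \<in> I \<Longrightarrow> b \<in> I \<Longrightarrow> (\<Sum>g\<in>G. c g * \<rho> g a b) = (if a = i \<and> b = j then 1 else 0)" by blast
  have "(\<Sum>g\<in>G. c g * act g v a) = (if a = i then v j else 0)" for v a
  proof (cases "a \<in> I")
    case True
    have "(\<Sum>g\<in>G. c g * act g v a) = (\<Sum>b\<in>I. (\<Sum>g\<in>G. c g * \<rho> g a b) * v b)"
      unfolding act_def app_def
      by (simp add: sum_distrib_left sum_distrib_right, subst sum.swap, simp add: mult_ac)
    also have "\<dots> = (\<Sum>b\<in>I. if b = j then (if a = i then v b else 0) else 0)"
      using True by (intro sum.cong) (auto simp: c)
    finally show ?thesis using assms finite_I by simp
  next
    case False
    then have "act g v a = 0" if "g \<in> G" for g using that by (simp add: act_def app_def rep_supp)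
    then show ?thesis using False assms by auto
  qed
  then show ?thesis by blast
qed

text \<open>The orbit of a nonzero vector spans: a combination of group elements acting as a matrix
  unit carries \<open>v\<close> to a nonzero multiple of any prescribed basis vector.\<close>

lemma functional_zero_on_orbit:
  assumes v: "v \<in> VS" "v \<noteq> (\<lambda>_. 0)" and f: "\<And>g. g \<in> G \<Longrightarrow> (\<Sum>i\<in>I. f i * act g v i) = 0"
    and i: "i \<in> I"
  shows "f i = 0"
proof -
  obtain j where j: "v j \<noteq> 0" using v(2) by auto
  then have "j \<in> I" using v(1) VSD by blast
  obtain c where c: "\<And>v. (\<lambda>a. \<Sum>g\<in>G. c g * act g v a) = (\<lambda>a. if a = i then v j else 0)"
    using matrix_unit_act[OF i \<open>j \<in> I\<close>] by blast
  have "(\<Sum>a\<in>I. f a * (\<Sum>g\<in>G. c g * act g v a)) = (\<Sum>g\<in>G. c g * (\<Sum>a\<in>I. f a * act g v a))"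
    by (simp add: sum_distrib_left, subst sum.swap, simp add: mult_ac)
  also have "\<dots> = 0" by (simp add: f)
  also have "(\<Sum>a\<in>I. f a * (\<Sum>g\<in>G. c g * act g v a)) = (\<Sum>a\<in>I. if a = i then f a * v j else 0)"
    unfolding fun_cong[OF c] by (intro sum.cong) auto
  finally show ?thesis using i j finite_I by simp
qed

text \<open>Schur's lemma from matrix units: \<open>z\<close> commutes with the combination that
  carries the basis vector at \<open>j\<close> to the one at \<open>i\<close>, so the scalar read
  off at the single index \<open>j\<close> is valid at every \<open>i\<close>.\<close>

lemma central_scalar:
  assumes z: "z \<in> G" "\<And>g. g \<in> G \<Longrightarrow> z \<odot> g = g \<odot> z"
  obtains \<omega> where "\<And>v. v \<in> VS \<Longrightarrow> act z v = (\<lambda>i. \<omega> * v i)"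
proof -
  obtain j where j: "j \<in> I" using I_nonempty by blast
  define \<delta> where "\<delta> = (\<lambda>(i::'i) a. if a = i then 1 else (0::complex))"
  define \<omega> where "\<omega> = act z (\<delta> j) j"
  have *: "act z (\<delta> i) = (\<lambda>a. \<omega> * \<delta> i a)" if i: "i \<in> I" for i
  proof -
    obtain c where c: "\<And>v. (\<lambda>a. \<Sum>g\<in>G. c g * act g v a) = (\<lambda>a. if a = i then v j else 0)"
      using matrix_unit_act[OF i j] by blast
    have \<delta>1: "\<delta> j j = 1" by (simp add: \<delta>_def)
    have "act z (\<delta> i) = act z (\<lambda>a. if a = i then \<delta> j j else 0)"
      unfolding \<delta>1 by (simp add: \<delta>_def)
    also have "\<dots> = (\<lambda>a. \<Sum>g\<in>G. c g * act z (act g (\<delta> j)) a)"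
      unfolding c[symmetric] act_lincomb ..
    also have "\<dots> = (\<lambda>a. \<Sum>g\<in>G. c g * act g (act z (\<delta> j)) a)"
      using z by (intro ext sum.cong) (auto simp: act_mul[symmetric])
    finally show ?thesis unfolding c by (auto simp: \<delta>_def \<omega>_def)
  qed
  have "act z v = (\<lambda>i. \<omega> * v i)" if v: "v \<in> VS" for v
  proof -
    have v': "(\<lambda>a. \<Sum>i\<in>I. v i * \<delta> i a) = v"
    proof
      fix a
      have "(\<Sum>i\<in>I. v i * \<delta> i a) = (\<Sum>i\<in>I. if i = a then v i else 0)"
        by (intro sum.cong) (auto simp: \<delta>_def)
      then show "(\<Sum>i\<in>I. v i * \<delta> i a) = v a" using v VSD finite_I by auto
    qed
    have "act z v = (\<lambda>a. \<Sum>i\<in>I. v i * act z (\<delta> i) a)"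
      using act_lincomb[where g = z and S = I and c = v and w = \<delta>] unfolding v' .
    also have "\<dots> = (\<lambda>a. \<Sum>i\<in>I. \<omega> * (v i * \<delta> i a))"
      by (intro ext sum.cong) (auto simp: *)
    also have "\<dots> = (\<lambda>a. \<omega> * v a)"
      by (simp only: sum_distrib_left[symmetric] fun_cong[OF v'])
    finally show ?thesis .
  qed
  then show ?thesis using that by blast
qed

lemma irr_rep_dual: "irr_rep G mul one I dual"
proof -
  interpret D: fin_rep G mul one I dual by (rule fin_rep_dual)
  show ?thesis
  proof
    fix i j assume ij: "i \<in> I" "j \<in> I"
    from full[OF ij(2) ij(1)] obtain c where
      c: "\<And>a b. a \<in> I \<Longrightarrow> b \<in> I \<Longrightarrow> (\<Sum>g\<in>G. c g * \<rho> g a b) = (if a = j \<and> b = i then 1 else 0)" by blast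
    have "(\<Sum>g\<in>G. c (ginv g) * dual g a b) = (if a = i \<and> b = j then 1 else 0)"
      if "a \<in> I" "b \<in> I" for a b
      using c[OF that(2,1)] sum_ginv[of "\<lambda>g. c g * \<rho> g b a"] by (auto simp: dual_def)
    then show "\<exists>c. \<forall>a\<in>I. \<forall>b\<in>I. (\<Sum>g\<in>G. c g * dual g a b) = (if a = i \<and> b = j then 1 else 0)"
      by (intro exI[of _ "\<lambda>g. c (ginv g)"]) blast
  qed (rule I_nonempty)
qed

text \<open>Gelfand's trick, relative to the representation: it suffices that the anti-involution
  fixes the compressed operators \<open>E \<rho>(g) E\<close> on this representation, not in the whole Hecke algebra.\<close>

definition twisted_sum :: "'g set \<Rightarrow> ('g \<Rightarrow> complex) \<Rightarrow> ('i \<Rightarrow> complex) \<Rightarrow> 'i \<Rightarrow> complex" where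
  "twisted_sum H \<chi> v = (\<lambda>i. \<Sum>h\<in>H. \<chi> (ginv h) * act h v i)"

lemma twisted_sum_lincomb: "twisted_sum H \<chi> (\<lambda>i. \<Sum>s\<in>S. c s * x s i)
    = (\<lambda>i. \<Sum>s\<in>S. c s * twisted_sum H \<chi> (x s) i)"
  unfolding twisted_sum_def act_lincomb
  by (rule ext, simp add: sum_distrib_left, subst sum.swap, simp add: mult_ac)

lemma gelfand_trick:
  assumes H: "H \<subseteq> G" "one \<in> H" "\<And>h k. h \<in> H \<Longrightarrow> k \<in> H \<Longrightarrow> h \<odot> k \<in> H"
      "\<And>h. h \<in> H \<Longrightarrow> ginv h \<in> H"
    and \<chi>: "\<And>h k. h \<in> H \<Longrightarrow> k \<in> H \<Longrightarrow> \<chi> (h \<odot> k) = \<chi> h * \<chi> k" "\<chi> one = (1::complex)"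
    and \<iota>: "\<And>g. g \<in> G \<Longrightarrow> \<iota> g \<in> G" "\<And>g h. g \<in> G \<Longrightarrow> h \<in> G \<Longrightarrow> \<iota> (g \<odot> h) = \<iota> h \<odot> \<iota> g"
      "\<And>h. h \<in> H \<Longrightarrow> \<iota> h \<in> H" "\<And>h. h \<in> H \<Longrightarrow> \<iota> (\<iota> h) = h" "\<And>h. h \<in> H \<Longrightarrow> \<chi> (\<iota> h) = \<chi> h"
    and E: "\<And>v g i. v \<in> VS \<Longrightarrow> (\<And>h. h \<in> H \<Longrightarrow> act h v = (\<lambda>i. \<chi> h * v i)) \<Longrightarrow> g \<in> G \<Longrightarrow>
      twisted_sum H \<chi> (act g v) i = twisted_sum H \<chi> (act (\<iota> g) v) i"
    and v: "v \<in> VS" "\<And>h. h \<in> H \<Longrightarrow> act h v = (\<lambda>i. \<chi> h * v i)"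
    and w: "w \<in> VS" "\<And>h. h \<in> H \<Longrightarrow> act h w = (\<lambda>i. \<chi> h * w i)"
  shows "v i * w j = v j * w i"
proof (cases "v = (\<lambda>_. 0)")
  case False
  define V where "V = {v \<in> VS. \<forall>h\<in>H. act h v = (\<lambda>i. \<chi> h * v i)}"
  define e where "e = twisted_sum H \<chi>"
  have e_def': "e = (\<lambda>v i. \<Sum>h\<in>H. \<chi> (ginv h) * act h v i)"
    by (rule ext) (simp add: e_def twisted_sum_def)
  have finH: "finite H" using H(1) finite_G finite_subset by blast
  define N where "N = (of_nat (card H) :: complex)"
  have N0: "N \<noteq> 0" using finH H(2) by (auto simp: N_def)
  have \<chi>inv: "\<chi> (ginv h) * \<chi> h = 1" if "h \<in> H" for h
    using that \<chi>(1)[of "ginv h" h] \<chi>(2) H by auto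
  have e_fix: "e x = (\<lambda>i. N * x i)" if "x \<in> V" for x
  proof -
    have "e x = (\<lambda>i. \<Sum>h\<in>H. \<chi> (ginv h) * \<chi> h * x i)"
      unfolding e_def' using that by (intro ext sum.cong) (auto simp: V_def mult.assoc)
    also have "\<dots> = (\<lambda>i. N * x i)" by (simp add: \<chi>inv N_def)
    finally show ?thesis .
  qed
  have e_V: "e x \<in> V" for x
  proof -
    have "act k (e x) = (\<lambda>i. \<chi> k * e x i)" if k: "k \<in> H" for k
    proof
      fix i
      have "act k (e x) i = (\<Sum>h\<in>H. \<chi> (ginv h) * act (k \<odot> h) x i)"
        unfolding e_def' act_lincomb using k H by (intro sum.cong) (auto simp: act_mul subset_iff)
      also have "\<dots> = (\<Sum>h\<in>H. \<chi> (ginv h \<odot> k) * act h x i)"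
        using k H by (intro sum.reindex_bij_witness[of _ "\<lambda>h. ginv k \<odot> h" "\<lambda>h. k \<odot> h"])
          (auto simp: subset_iff ginv_mul assoc)
      also have "\<dots> = \<chi> k * e x i"
        unfolding e_def' sum_distrib_left using k H by (intro sum.cong) (auto simp: \<chi>)
      finally show "act k (e x) i = \<chi> k * e x i" .
    qed
    moreover have "e x \<in> VS" unfolding e_def' using H(1) by (intro lincomb_in) auto
    ultimately show ?thesis by (simp add: V_def)
  qed
  note e_lin = twisted_sum_lincomb[of H \<chi>, folded e_def]
  have E': "e (act g x) = e (act (\<iota> g) x)" if "x \<in> V" "g \<in> G" for x g
    unfolding e_def using E[of x g] that by (auto simp: V_def)
  have act_e: "e (act g (e (act h x))) = (\<lambda>i. \<Sum>k\<in>H. \<chi> (ginv k) * e (act (g \<odot> k \<odot> h) x) i)"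
    if "g \<in> G" "h \<in> G" for g h x
  proof -
    have "act g (e (act h x)) = (\<lambda>i. \<Sum>k\<in>H. \<chi> (ginv k) * act (g \<odot> k \<odot> h) x i)"
      unfolding e_def' act_lincomb using that H(1)
      by (intro ext sum.cong) (auto simp: act_mul subset_iff)
    then show ?thesis by (simp add: e_lin)
  qed
  \<comment> \<open>Applying \<open>\<iota>\<close> to \<open>g k h\<close> reverses the product,
    and the reversed sum over \<open>H\<close> absorbs \<open>\<iota> k\<close> by reindexing. Hence
    the compressed operators commute.\<close>
  have comm: "e (act g (e (act h x))) = e (act h (e (act g x)))"
    if "g \<in> G" "h \<in> G" "x \<in> V" for g h x
  proof -
    have "e (act g (e (act h x))) = (\<lambda>i. \<Sum>k\<in>H. \<chi> (ginv k) * e (act (\<iota> h \<odot> \<iota> k \<odot> \<iota> g) x) i)"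
      unfolding act_e[OF that(1,2)]
    proof (intro ext sum.cong refl)
      fix i k assume k: "k \<in> H"
      then have kG: "k \<in> G" using H(1) by auto
      then have "e (act (g \<odot> k \<odot> h) x) = e (act (\<iota> (g \<odot> k \<odot> h)) x)"
        by (intro E') (use that in auto)
      also have "\<iota> (g \<odot> k \<odot> h) = \<iota> h \<odot> \<iota> k \<odot> \<iota> g"
        using that kG by (simp add: \<iota> assoc)
      finally show "\<chi> (ginv k) * e (act (g \<odot> k \<odot> h) x) i = \<chi> (ginv k) * e (act (\<iota> h \<odot> \<iota> k \<odot> \<iota> g) x) i"
        by simp
    qed
    also have "\<dots> = (\<lambda>i. \<Sum>k\<in>H. \<chi> (ginv k) * e (act (\<iota> h \<odot> k \<odot> \<iota> g) x) i)"
    proof (intro ext)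
      fix i
      have \<chi>\<iota>: "\<chi> (ginv (\<iota> k)) = \<chi> (ginv k)" if "k \<in> H" for k
      proof -
        have "\<chi> (ginv (\<iota> k)) * \<chi> k = \<chi> (ginv k) * \<chi> k" "\<chi> k \<noteq> 0"
          using \<chi>inv[OF that] \<chi>inv[OF \<iota>(3)[OF that]] \<iota>(5)[OF that] by auto
        then show ?thesis by simp
      qed
      show "(\<Sum>k\<in>H. \<chi> (ginv k) * e (act (\<iota> h \<odot> \<iota> k \<odot> \<iota> g) x) i)
        = (\<Sum>k\<in>H. \<chi> (ginv k) * e (act (\<iota> h \<odot> k \<odot> \<iota> g) x) i)"
        by (rule sum.reindex_bij_witness[of _ \<iota> \<iota>]) (auto simp: \<iota> \<chi>\<iota>)
    qed
    also have "\<dots> = e (act (\<iota> h) (e (act (\<iota> g) x)))"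
      using that by (simp add: act_e \<iota>)
    also have "\<dots> = e (act h (e (act g x)))"
      using that E'[of "e (act g x)" h] e_V E'[of x g] by simp
    finally show ?thesis .
  qed
  define \<epsilon> where "\<epsilon> = (\<lambda>i. e (\<lambda>a. if a = i then 1 else 0))"
  have unit: "e (\<lambda>a. if a = i then t else 0) = (\<lambda>a. t * \<epsilon> i a)" for i t
    using e_lin[where S = "{()}" and c = "\<lambda>_. t" and x = "\<lambda>_ a. if a = i then 1 else 0"] by (simp add: \<epsilon>_def if_distrib cong: if_cong)
  \<comment> \<open>Since the operators of the group span all matrices, \<open>g\<close> and
    \<open>h\<close> in the commutation relation may be replaced by the matrix units with indices
    (i, j) and (k, l); \<open>\<epsilon> i\<close> is the compression of the i-th basis vector.
    Contracting the resulting scalar identity with \<open>w\<close> and then with \<open>v\<close>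
    gives the proportionality.\<close>
  have key: "x l * \<epsilon> k j * \<epsilon> i m = x j * \<epsilon> i l * \<epsilon> k m"
    if I: "i \<in> I" "j \<in> I" "k \<in> I" "l \<in> I" and x: "x \<in> V" for i j k l m x
  proof -
    obtain c where c: "\<And>v. (\<lambda>a. \<Sum>g\<in>G. c g * act g v a) = (\<lambda>a. if a = i then v j else 0)"
      using matrix_unit_act[OF I(1,2)] by blast
    obtain d where d: "\<And>v. (\<lambda>a. \<Sum>g\<in>G. d g * act g v a) = (\<lambda>a. if a = k then v l else 0)"
      using matrix_unit_act[OF I(3,4)] by blast
    have ce: "(\<lambda>a. \<Sum>g\<in>G. c g * e (act g v) a) = (\<lambda>a. v j * \<epsilon> i a)" for v
      using arg_cong[OF c[of v], of e] unfolding e_lin unit .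
    have de: "(\<lambda>a. \<Sum>g\<in>G. d g * e (act g v) a) = (\<lambda>a. v l * \<epsilon> k a)" for v
      using arg_cong[OF d[of v], of e] unfolding e_lin unit .
    have "(\<lambda>a. \<Sum>g\<in>G. c g * e (act g (\<lambda>a. \<Sum>h\<in>G. d h * e (act h x) a)) a)
        = (\<lambda>a. \<Sum>h\<in>G. d h * e (act h (\<lambda>a. \<Sum>g\<in>G. c g * e (act g x) a)) a)"
      unfolding act_lincomb e_lin
      by (rule ext, simp add: sum_distrib_left, subst sum.swap, intro sum.cong refl)
        (simp add: comm[OF _ _ x] mult_ac)
    then have "(x l * \<epsilon> k j) * \<epsilon> i m = (x j * \<epsilon> i l) * \<epsilon> k m"
      unfolding ce de by (rule fun_cong)
    then show ?thesis .
  qed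
  have expand: "(\<Sum>k\<in>I. x k * \<epsilon> k j) = N * x j" if "x \<in> V" for x j
  proof -
    have "(\<lambda>a. \<Sum>k\<in>I. x k * (if a = k then 1 else 0)) = x"
      using that finite_I VSD by (auto simp: V_def fun_eq_iff if_distrib cong: if_cong)
    then have "e x = (\<lambda>j. \<Sum>k\<in>I. x k * \<epsilon> k j)"
      unfolding \<epsilon>_def using e_lin[where S = I and c = x and x = "\<lambda>k a. if a = k then 1 else 0"] by simp
    then show ?thesis using e_fix[OF that] by (metis (no_types))
  qed
  have VV: "v \<in> V" "w \<in> V" using v w by (auto simp: V_def)
  obtain l where l: "v l \<noteq> 0" using False by auto
  then have lI: "l \<in> I" using v VSD by blast
  have 1: "v l * w j * \<epsilon> i m = v j * \<epsilon> i l * w m" if "i \<in> I" "j \<in> I" for i j m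
  proof -
    have "N * (v l * w j * \<epsilon> i m) = (v l * \<epsilon> i m) * (\<Sum>k\<in>I. w k * \<epsilon> k j)"
      by (simp add: expand[OF VV(2)] mult_ac)
    also have "\<dots> = (\<Sum>k\<in>I. w k * (v l * \<epsilon> k j * \<epsilon> i m))"
      by (simp add: sum_distrib_left mult_ac)
    also have "\<dots> = (\<Sum>k\<in>I. w k * (v j * \<epsilon> i l * \<epsilon> k m))"
      using that lI VV by (intro sum.cong) (auto simp: key)
    also have "\<dots> = (v j * \<epsilon> i l) * (\<Sum>k\<in>I. w k * \<epsilon> k m)"
      by (simp add: sum_distrib_left mult_ac)
    also have "\<dots> = N * (v j * \<epsilon> i l * w m)" by (simp add: expand[OF VV(2)])
    finally show ?thesis using N0 by simp
  qed
  have 2: "w j * v m = v j * w m" if "j \<in> I" for j m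
  proof -
    have "v l * w j * (\<Sum>i\<in>I. v i * \<epsilon> i m) = (\<Sum>i\<in>I. v i * (v l * w j * \<epsilon> i m))"
      by (simp add: sum_distrib_left mult_ac)
    also have "\<dots> = (\<Sum>i\<in>I. v i * (v j * \<epsilon> i l * w m))"
      using that by (intro sum.cong) (auto simp: 1)
    also have "\<dots> = v j * w m * (\<Sum>i\<in>I. v i * \<epsilon> i l)"
      by (simp add: sum_distrib_left mult_ac)
    finally have "v l * w j * (N * v m) = v j * w m * (N * v l)" by (simp add: expand VV)
    then show ?thesis using N0 l by simp
  qed
  show ?thesis
  proof (cases "j \<in> I")
    case True then show ?thesis using 2[of j i] by (simp add: mult.commute)
  next
    case False then show ?thesis using VSD[OF v(1)] VSD[OF w(1)] by simp
  qed
qed simp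

end

section \<open>Finite chain rings\<close>

lemma even_card_fixpoint_free_involution:
  assumes "finite A" "\<And>x. x \<in> A \<Longrightarrow> f x \<in> A" "\<And>x. x \<in> A \<Longrightarrow> f (f x) = x" "\<And>x. x \<in> A \<Longrightarrow> f x \<noteq> x"
  shows "even (card A)"
  using assms
proof (induction A rule: finite_psubset_induct)
  case (psubset A)
  show ?case
  proof (cases "A = {}")
    case False
    then obtain x where x: "x \<in> A" by blast
    have "even (card (A - {x, f x}))"
    proof (rule psubset.IH)
      show "A - {x, f x} \<subset> A" using x by blast
      show "f y \<in> A - {x, f x}" if "y \<in> A - {x, f x}" for y
        using that psubset.prems x by (metis Diff_iff insert_iff singletonD)
    qed (use psubset.prems in auto)
    moreover have "card A = card (A - {x, f x}) + 2"
    proof -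
      have "{x, f x} \<subseteq> A" "card {x, f x} = 2" using x psubset.prems(1,3)[OF x] by auto
      then show ?thesis using card_Diff_subset[of "{x, f x}" A] card_mono[OF psubset.hyps(1), of "{x, f x}"]
        by simp
    qed
    ultimately show ?thesis by simp
  qed simp
qed

text \<open>Axiomatises the finite quotient of the discrete valuation ring: with every nonunit
  divisible by \<open>p\<close> the ideals are the powers of \<open>p\<close>, and
  \<open>p ^ (l - 1)\<close> being nonzero fixes the length of the chain.\<close>

locale chain_ring =
  fixes p :: "'r::comm_ring_1" and l q :: nat
  assumes fin: "finite (UNIV :: 'r set)" and l1: "l \<ge> 1"
    and p_pow_l: "p ^ l = 0" and p_pow_nz: "p ^ (l - 1) \<noteq> 0"
    and local: "\<And>x::'r. \<not> x dvd 1 \<Longrightarrow> p dvd x"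
    and q: "q = residue_card p" and odd_q: "odd q"
begin

lemma fin_set [simp, intro]: "finite (A :: 'r set)"
  using fin by (rule rev_finite_subset) simp

lemma p_nonunit: "\<not> p dvd 1"
proof
  assume "p dvd 1"
  then have "p ^ l dvd 1" by (metis dvd_power_same power_one)
  then have "(1::'r) = 0" by (simp add: p_pow_l)
  then show False using p_pow_nz by (metis mult_1_left mult_zero_left)
qed

lemma one_neq_zero [simp]: "(1::'r) \<noteq> 0" "(0::'r) \<noteq> 1"
  using p_nonunit by (metis dvd_0_right)+

lemma unit_iff: "x dvd 1 \<longleftrightarrow> \<not> p dvd x"
  using local p_nonunit dvd_trans by blast

definition rinv :: "'r \<Rightarrow> 'r" where "rinv x = (SOME y. x * y = 1)"

lemma rinv [simp]: assumes "\<not> p dvd x" shows "x * rinv x = 1" "rinv x * x = 1"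
proof -
  have "\<exists>y. x * y = 1" using assms local[of x] by (metis dvd_def)
  from someI_ex[OF this] show "x * rinv x = 1" by (simp add: rinv_def)
  then show "rinv x * x = 1" by (simp add: mult.commute)
qed

lemma rinv_unit [simp]: "\<not> p dvd x \<Longrightarrow> \<not> p dvd rinv x"
  using rinv(1) unit_iff by (metis dvd_triv_right)

lemma rinv_cancel [simp]: "\<not> p dvd x \<Longrightarrow> x * (rinv x * y) = y" "\<not> p dvd x \<Longrightarrow> rinv x * (x * y) = y"
  by (simp_all add: mult.assoc[symmetric])

lemma unit_mult: "\<not> p dvd x * y \<longleftrightarrow> \<not> p dvd x \<and> \<not> p dvd y"
  by (metis unit_iff is_unit_mult_iff)

lemma unit_add: "\<not> p dvd x \<Longrightarrow> p dvd y \<Longrightarrow> \<not> p dvd x + y"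
  by (metis dvd_add_left_iff)

lemma unit_cancel: "\<not> p dvd x \<Longrightarrow> x * y = x * z \<longleftrightarrow> y = z"
  by (metis rinv_cancel(2))

lemma p_pow_zero: "l \<le> k \<Longrightarrow> p ^ k = 0"
  by (metis le_add_diff_inverse mult_zero_left p_pow_l power_add)

lemma p_pow_nonzero: "k < l \<Longrightarrow> p ^ k \<noteq> 0"
proof
  assume "k < l" "p ^ k = 0"
  then have "l - 1 = k + (l - 1 - k)" by simp
  then have "p ^ (l - 1) = p ^ k * p ^ (l - 1 - k)" by (metis power_add)
  then show False using \<open>p ^ k = 0\<close> p_pow_nz by simp
qed

lemma valuation:
  assumes "x \<noteq> 0" obtains k u where "k < l" "\<not> p dvd u" "x = p ^ k * u"
proof -
  define P where "P = (\<lambda>k. p ^ k dvd x)"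
  have "P 0" by (simp add: P_def)
  moreover have bd: "\<forall>k. P k \<longrightarrow> k \<le> l"
  proof (intro allI impI, rule ccontr)
    fix k assume "P k" "\<not> k \<le> l"
    then have "p ^ k = 0" by (intro p_pow_zero) auto
    then show False using \<open>P k\<close> assms by (simp add: P_def)
  qed
  ultimately have "P (Greatest P)" using GreatestI_nat[of P 0 l] by blast
  then obtain u where u: "x = p ^ Greatest P * u" unfolding P_def by (auto elim: dvdE)
  have "Greatest P < l"
    using p_pow_zero[of "Greatest P"] u assms by (metis mult_zero_left not_le)
  moreover have "\<not> p dvd u"
  proof
    assume "p dvd u"
    then have "P (Suc (Greatest P))" using u unfolding P_def
      by (metis mult_dvd_mono dvd_refl power_Suc2)
    then show False using Greatest_le_nat[OF _ bd[rule_format]] by fastforce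
  qed
  ultimately show ?thesis using that u by blast
qed

lemma p_pow_mult_unit: "\<not> p dvd u \<Longrightarrow> p ^ k * u = 0 \<longleftrightarrow> l \<le> k"
  by (metis p_pow_nonzero p_pow_zero mult_zero_left not_le rinv(1) mult.assoc mult.right_neutral)

lemma p_pow_dvd_iff: assumes "\<not> p dvd u" "i \<le> l" shows "p ^ i dvd p ^ k * u \<longleftrightarrow> i \<le> k"
proof
  assume "p ^ i dvd p ^ k * u"
  then obtain y where y: "p ^ k * u = p ^ i * y" by (auto elim: dvdE)
  show "i \<le> k"
  proof (rule ccontr)
    assume "\<not> i \<le> k"
    then have "p ^ (l - i + k) * u = p ^ (l - i + i) * y"
      using y by (simp add: power_add mult.assoc)
    also have "\<dots> = 0" using assms(2) p_pow_l by simp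
    finally have "l \<le> l - i + k" using p_pow_mult_unit[OF assms(1)] by blast
    then show False using \<open>\<not> i \<le> k\<close> assms(2) by linarith
  qed
qed (simp add: le_imp_power_dvd dvd_mult2)

text \<open>Cancellation of \<open>p ^ k\<close> is limited to \<open>k + i <= l\<close>: beyond
  that \<open>p ^ (k + i)\<close> is zero and divisibility only says that \<open>p ^ k * x\<close>
  vanishes.\<close>

lemma mult_p_pow_dvd:
  assumes "p ^ (k + i) dvd p ^ k * x" "k + i \<le> l"
  shows "p ^ i dvd x"
proof (cases "x = 0")
  case False
  then obtain m u where mu: "\<not> p dvd u" "x = p ^ m * u" by (rule valuation)
  have "p ^ (k + i) dvd p ^ (k + m) * u" using assms(1) mu by (simp add: power_add mult.assoc)
  then have "k + i \<le> k + m" using p_pow_dvd_iff[OF mu(1) assms(2)] by blast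
  then show ?thesis using mu by (simp add: le_imp_power_dvd dvd_mult2)
qed simp

lemma p_pow_annihilator: "p ^ k * x = 0 \<Longrightarrow> k \<le> l \<Longrightarrow> p ^ (l - k) dvd x"
  using mult_p_pow_dvd[of k "l - k" x] by simp

lemma card_p_pow: assumes "k \<le> l" shows "card {x. p ^ k dvd x} = q ^ (l - k)"
proof -
  define R where "R = {(x, y). p dvd (x - y)}"
  have eq: "equiv UNIV R"
    unfolding R_def
  proof (rule equivI)
    show "sym {(x, y). p dvd x - y}" by (auto simp: sym_def) (metis dvd_minus_iff minus_diff_eq)
    show "trans {(x, y). p dvd x - y}"
    proof (rule transI, clarify)
      fix x y z assume "p dvd x - y" "p dvd y - z"
      then have "p dvd (x - y) + (y - z)" by (rule dvd_add)
      then show "p dvd x - z" by simp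
    qed
  qed (auto simp: refl_on_def)
  define rep where "rep = (\<lambda>C::'r set. SOME x. x \<in> C)"
  define Q where "Q = rep ` (UNIV // R)"
  have rep: "rep C \<in> C" if "C \<in> UNIV // R" for C
    unfolding rep_def using in_quotient_imp_non_empty[OF eq that] by (metis ex_in_conv someI_ex)
  have inj: "inj_on rep (UNIV // R)"
    by (rule inj_onI) (metis rep eq quotient_disj disjoint_iff)
  have cardQ: "card Q = q"
    unfolding Q_def q residue_card_def R_def[symmetric] by (rule card_image[OF inj])
  have Qex: "\<exists>r\<in>Q. p dvd x - r" for x
  proof -
    have "R `` {x} \<in> UNIV // R" by (rule quotientI) simp
    then have "rep (R `` {x}) \<in> Q" "rep (R `` {x}) \<in> R `` {x}" using rep by (auto simp: Q_def)
    then show ?thesis by (auto simp: R_def)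
  qed
  have Quniq: "r = r'" if rr: "r \<in> Q" "r' \<in> Q" "p dvd r - r'" for r r'
  proof -
    obtain C C' where C: "C \<in> UNIV // R" "C' \<in> UNIV // R" "r = rep C" "r' = rep C'"
      using rr by (auto simp: Q_def)
    have "(r, r') \<in> R" using rr by (simp add: R_def)
    then have "C = C'" using quotient_eqI[OF eq C(1,2) rep[OF C(1)] rep[OF C(2)]] C by simp
    then show ?thesis using C by simp
  qed
  \<comment> \<open>One digit of the p-adic expansion: an element of the k-th ideal is
    \<open>p ^ k\<close> times a residue representative plus an element of the next ideal.\<close>
  have step: "card {x. p ^ k dvd x} = q * card {x. p ^ Suc k dvd x}" if k: "k < l" for k
  proof -
    have "bij_betw (\<lambda>(r, y). p ^ k * r + y) (Q \<times> {x. p ^ Suc k dvd x}) {x. p ^ k dvd x}"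
      unfolding bij_betw_def
    proof
      show "inj_on (\<lambda>(r, y). p ^ k * r + y) (Q \<times> {x. p ^ Suc k dvd x})"
      proof (rule inj_onI, clarify)
        fix r y r' y'
        assume a: "r \<in> Q" "p ^ Suc k dvd y" "r' \<in> Q" "p ^ Suc k dvd y'"
          "p ^ k * r + y = p ^ k * r' + y'"
        have "p ^ k * (r - r') = y' - y" using a(5) by (simp add: algebra_simps)
        then have "p ^ (k + 1) dvd p ^ k * (r - r')" using a(2,4) by simp
        then have "p ^ 1 dvd r - r'" by (rule mult_p_pow_dvd) (use k in simp)
        then have "r = r'" using Quniq a by simp
        then show "r = r' \<and> y = y'" using a by simp
      qed
      show "(\<lambda>(r, y). p ^ k * r + y) ` (Q \<times> {x. p ^ Suc k dvd x}) = {x. p ^ k dvd x}"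
      proof (intro equalityI subsetI)
        fix z assume "z \<in> {x. p ^ k dvd x}"
        then obtain x where x: "z = p ^ k * x" by (auto elim: dvdE)
        obtain r where r: "r \<in> Q" "p dvd x - r" using Qex by blast
        have "z = p ^ k * r + p ^ k * (x - r)" by (simp add: x algebra_simps)
        moreover have "p ^ Suc k dvd p ^ k * (x - r)"
          using r(2) by (metis mult_dvd_mono dvd_refl power_Suc2)
        ultimately show "z \<in> (\<lambda>(r, y). p ^ k * r + y) ` (Q \<times> {x. p ^ Suc k dvd x})"
          using r(1) by (intro image_eqI[of _ _ "(r, p ^ k * (x - r))"]) auto
      next
        fix z assume "z \<in> (\<lambda>(r, y). p ^ k * r + y) ` (Q \<times> {x. p ^ Suc k dvd x})"
        then obtain r y where "z = p ^ k * r + y" "p ^ Suc k dvd y" by auto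
        moreover have "p ^ k dvd y" using \<open>p ^ Suc k dvd y\<close>
          by (metis dvd_trans le_imp_power_dvd lessI less_imp_le_nat)
        ultimately show "z \<in> {x. p ^ k dvd x}" by simp
      qed
    qed
    from bij_betw_same_card[OF this] show ?thesis by (simp add: card_cartesian_product cardQ)
  qed
  show ?thesis using assms
  proof (induction "l - k" arbitrary: k)
    case 0
    then have "k = l" by simp
    then have "{x. p ^ k dvd x} = {0}" by (auto simp: p_pow_l)
    then show ?case using \<open>k = l\<close> by simp
  next
    case (Suc m)
    then have k: "k < l" "m = l - Suc k" by auto
    then have "card {x. p ^ Suc k dvd x} = q ^ (l - Suc k)" using Suc.hyps(1)[of "Suc k"] by (simp del: power_Suc)
    then have "card {x. p ^ k dvd x} = q ^ Suc (l - Suc k)" using step[OF k(1)] by simp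
    also have "Suc (l - Suc k) = l - k" using k by simp
    finally show ?case .
  qed
qed

lemma card_R: "card (UNIV :: 'r set) = q ^ l"
  using card_p_pow[of 0] by simp

lemma q_ge_3: "q \<ge> 3"
proof -
  have "card {0, p ^ (l - 1)} \<le> card {x. p ^ (l - 1) dvd x}"
    by (rule card_mono[OF fin_set]) auto
  then have "q > 1" using card_p_pow[of "l - 1"] l1 p_pow_nz by simp
  then show ?thesis using odd_q by (cases "q = 2") auto
qed

lemma card_p_pow_unit:
  assumes "1 \<le> j" "j \<le> l"
  shows "card {b. p ^ (l - j) dvd b \<and> \<not> p ^ (l - j + 1) dvd b} = (q - 1) * q ^ (j - 1)"
proof -
  have eq: "{b. p ^ (l - j) dvd b \<and> \<not> p ^ (l - j + 1) dvd b}
      = {b. p ^ (l - j) dvd b} - {b. p ^ (l - j + 1) dvd b}" by auto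
  have "{b. p ^ (l - j + 1) dvd b} \<subseteq> {b. p ^ (l - j) dvd b}"
    by (auto intro: dvd_trans[OF le_imp_power_dvd])
  then have "card {b. p ^ (l - j) dvd b \<and> \<not> p ^ (l - j + 1) dvd b} = q ^ (l - (l - j)) - q ^ (l - (l - j + 1))"
    unfolding eq using assms card_p_pow[of "l - j"] card_p_pow[of "l - j + 1"] by (subst card_Diff_subset) auto
  also have "\<dots> = q ^ j - q ^ (j - 1)" using assms by (simp add: diff_diff_eq)
  also have "\<dots> = (q - 1) * q ^ (j - 1)"
    using assms by (cases j) (auto simp: algebra_simps)
  finally show ?thesis .
qed

lemma p_mult_top: "p * p ^ (l - 1) = 0"
  using p_pow_l l1 by (metis power_eq_if not_one_le_zero)

text \<open>If 2 were in the maximal ideal, \<open>p ^ (l - 1)\<close> would have additive order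
  two, and translation by it would pair off the \<open>q ^ l\<close> elements, an odd
  number.\<close>

lemma two_unit: "\<not> p dvd 2"
proof
  assume "p dvd 2"
  define e where "e = p ^ (l - 1)"
  have "e * p = 0" using p_mult_top by (simp add: e_def mult.commute)
  then have "e * 2 = 0" using \<open>p dvd 2\<close> by (metis dvdE mult.assoc mult_zero_left)
  then have "e + e = 0" by (simp add: mult_2_right)
  have "even (card (UNIV :: 'r set))"
    by (rule even_card_fixpoint_free_involution[where f = "\<lambda>x. x + e"])
      (use \<open>e + e = 0\<close> p_pow_nz in \<open>auto simp: e_def add.assoc\<close>)
  then show False using card_R odd_q by simp
qed

lemma top_mult_eq_0: "p ^ (l - 1) * x = 0 \<longleftrightarrow> p dvd x"
proof
  assume "p ^ (l - 1) * x = 0"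
  from p_pow_annihilator[OF this] show "p dvd x" using l1 by simp
next
  assume "p dvd x"
  then obtain y where "x = p * y" by (rule dvdE)
  then have "p ^ (l - 1) * x = (p * p ^ (l - 1)) * y" by (simp only: mult_ac)
  then show "p ^ (l - 1) * x = 0" by (simp only: p_mult_top mult_zero_left)
qed

text \<open>A joint eigenvector of all translations is a multiple of a character. Looking for it
  among functions whose sums over the cosets of the socle vanish excludes the characters that are
  trivial on the socle.\<close>

lemma additive_character_ex:
  "\<exists>\<psi> :: 'r \<Rightarrow> complex. (\<forall>x y. \<psi> (x + y) = \<psi> x * \<psi> y) \<and> \<psi> 0 = 1 \<and> (\<exists>x. \<psi> (p ^ (l - 1) * x) \<noteq> 1)"
proof -
  interpret R: fin_rep "UNIV :: 'r set" "(+)" 0 "UNIV :: 'r set" "\<lambda>g i j. if j = i + g then 1 else 0"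
  proof
    fix g h i j :: 'r
    have "(\<Sum>k\<in>UNIV. (if k = i + g then 1 else 0) * (if j = k + h then 1 else 0))
       = (\<Sum>k\<in>UNIV. if k = i + g then (if j = i + g + h then 1 else 0) else (0::complex))"
      by (intro sum.cong) auto
    then show "(if j = i + (g + h) then 1 else 0)
      = (\<Sum>k\<in>UNIV. (if k = i + g then 1 else 0) * (if j = k + h then 1 else (0::complex)))"
      by (simp add: add.assoc)
    show "\<exists>h\<in>UNIV. g + h = 0 \<and> h + g = 0" by (intro bexI[of _ "- g"]) auto
  qed (auto simp: add.assoc)
  have act: "R.act g f = (\<lambda>i. f (i + g))" for g f
    unfolding R.act_def app_def by (simp add: if_distrib[of "\<lambda>x. x * _"] cong: if_cong)
  have VS: "f \<in> R.VS" for f by (simp add: R.VS_def)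
  define e where "e = p ^ (l - 1)"
  define W where "W = {f :: 'r \<Rightarrow> complex. \<forall>x. (\<Sum>s\<in>UNIV. f (x + e * s)) = 0}"
  \<comment> \<open>The difference of the delta functions at 0 and \<open>e\<close> is a nonzero
    element of \<open>W\<close>.\<close>
  define v where "v = (\<lambda>x. if x = 0 then 1 else if x = e then - 1 else (0::complex))"
  have e0: "e \<noteq> 0" using p_pow_nz by (simp add: e_def)
  have vW: "v \<in> W"
  proof -
    have "(\<Sum>s\<in>UNIV. v (x + e * s)) = 0" for x
    proof -
      have "(\<Sum>s\<in>UNIV. (if x + e * s = 0 then 1 else (0::complex)))
          = (\<Sum>s\<in>UNIV. (if x + e * s = e then 1 else 0))"
        by (rule sum.reindex_bij_witness[of _ "\<lambda>s. s - 1" "\<lambda>s. s + 1"])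
          (auto simp: algebra_simps)
      moreover have "v y = (if y = 0 then 1 else 0) - (if y = e then 1 else 0)" for y
        using e0 by (auto simp: v_def)
      ultimately show ?thesis by (simp add: sum_subtractf)
    qed
    then show ?thesis by (simp add: W_def)
  qed
  have "\<exists>v\<in>W. v \<noteq> (\<lambda>_. 0) \<and> (\<exists>\<chi>. \<forall>s\<in>UNIV. R.act s v = (\<lambda>i. \<chi> s * v i))"
  proof (rule R.joint_eigenvector[OF fin])
    show "R.act g w \<in> W" if "w \<in> W" for g w
    proof -
      have eq: "(x + e * s) + g = (x + g) + e * s" for x s by (simp add: add_ac)
      show ?thesis using that unfolding act W_def mem_Collect_eq eq by blast
    qed
    show "(\<lambda>i. \<Sum>k\<le>(N::nat). c k * w k i) \<in> W" if "\<And>k. k \<le> N \<Longrightarrow> w k \<in> W" for N c w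
    proof -
      have "(\<Sum>s\<in>UNIV. \<Sum>k\<le>N. c k * w k (x + e * s)) = (\<Sum>k\<le>N. c k * (\<Sum>s\<in>UNIV. w k (x + e * s)))" for x
        by (subst sum.swap) (simp add: sum_distrib_left)
      then show ?thesis using that by (simp add: W_def)
    qed
    show "v \<noteq> (\<lambda>_. 0)" by (auto simp: v_def fun_eq_iff)
  qed (use vW in \<open>auto simp: VS add.commute\<close>)
  then obtain f \<chi> where f: "f \<in> W" "f \<noteq> (\<lambda>_. 0)" and \<chi>: "\<And>s x. f (x + s) = \<chi> s * f x"
    unfolding act by (metis UNIV_I)
  obtain x0 where x0: "f x0 \<noteq> 0" using f(2) by auto
  have "\<chi> (s + t) = \<chi> s * \<chi> t" for s t
    using \<chi>[of x0 "s + t"] \<chi>[of "x0 + s" t] \<chi>[of x0 s] x0 by (simp add: add.assoc)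
  moreover have "\<chi> 0 = 1" using \<chi>[of x0 0] x0 by simp
  moreover have "\<exists>x. \<chi> (e * x) \<noteq> 1"
  proof (rule ccontr)
    assume "\<not> ?thesis"
    then have "(\<Sum>s\<in>UNIV. f (x0 + e * s)) = of_nat (card (UNIV::'r set)) * f x0" by (simp add: \<chi>)
    then show False using f(1) x0 fin by (auto simp: W_def)
  qed
  ultimately show ?thesis by (auto simp: e_def)
qed

end

locale chain_ring_char = chain_ring p l q for p :: "'r::comm_ring_1" and l q +
  fixes \<psi> :: "'r \<Rightarrow> complex"
  assumes psi_add: "\<psi> (x + y) = \<psi> x * \<psi> y" and psi_0 [simp]: "\<psi> 0 = 1"
    and psi_nontriv: "\<exists>x. \<psi> (p ^ (l - 1) * x) \<noteq> 1"
begin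

lemma psi_minus: "\<psi> (- x) * \<psi> x = 1" "\<psi> x * \<psi> (- x) = 1"
  using psi_add[of "- x" x] psi_add[of x "- x"] by simp_all

lemma psi_nz [simp]: "\<psi> x \<noteq> 0"
  using psi_minus[of x] by auto

text \<open>Writing \<open>x = p ^ k * u\<close>, the factor \<open>rinv u * p ^ (l - 1 - k)\<close>
  moves \<open>x\<close> to the generator of the socle, where the character is nontrivial.\<close>

lemma psi_nondegenerate:
  assumes "x \<noteq> 0" shows "\<exists>b. \<psi> (x * b) \<noteq> 1"
proof -
  obtain y where y: "\<psi> (p ^ (l - 1) * y) \<noteq> 1" using psi_nontriv by blast
  obtain k u where k: "k < l" "\<not> p dvd u" "x = p ^ k * u" by (rule valuation[OF assms])
  have "x * (rinv u * p ^ (l - 1 - k) * y) = (u * rinv u) * (p ^ k * p ^ (l - 1 - k)) * y"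
    unfolding k(3) by (simp only: mult_ac)
  also have "\<dots> = p ^ (k + (l - 1 - k)) * y" by (simp only: power_add rinv(1)[OF k(2)] mult_1_left)
  also have "k + (l - 1 - k) = l - 1" using k by simp
  finally show ?thesis using y by metis
qed

lemma psi_eq_1_imp: "(\<And>b. \<psi> (x * b) = 1) \<Longrightarrow> x = 0"
  using psi_nondegenerate by blast

lemma psi_orthogonality: "(\<Sum>b\<in>UNIV. \<psi> (x * b)) = (if x = 0 then of_nat (card (UNIV :: 'r set)) else 0)"
proof (cases "x = 0")
  case False
  then obtain c where c: "\<psi> (x * c) \<noteq> 1" using psi_nondegenerate by blast
  have "\<psi> (x * c) * (\<Sum>b\<in>UNIV. \<psi> (x * b)) = (\<Sum>b\<in>UNIV. \<psi> (x * (b + c)))"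
    by (simp add: sum_distrib_left psi_add distrib_left mult.commute)
  also have "\<dots> = (\<Sum>b\<in>UNIV. \<psi> (x * b))"
    by (rule sum.reindex_bij_witness[of _ "\<lambda>b. b - c" "\<lambda>b. b + c"]) auto
  finally show ?thesis using c False by simp
qed simp

end

section \<open>Spectral projections for additive one-parameter subgroups\<close>

context fin_rep
begin

lemma app_unit: "j \<in> I \<Longrightarrow> app I K (\<lambda>a. if a = j then 1 else 0) i = K i j"
  unfolding app_def using finite_I by (simp add: if_distrib[of "\<lambda>x. _ * x"] cong: if_cong)

lemma unit_in_VS [simp]: "j \<in> I \<Longrightarrow> (\<lambda>a. if a = j then 1 else 0) \<in> VS"
  by (auto simp: VS_def)

lemma kernel_eqI:
  assumes "\<And>v. v \<in> VS \<Longrightarrow> app I K v = app I L v" and "j \<in> I"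
  shows "K i j = L i j"
  using assms(1)[OF unit_in_VS[OF assms(2)]] app_unit[OF assms(2)] by (metis (no_types, lifting))

lemma idempotent_of_app:
  assumes "\<And>v. v \<in> VS \<Longrightarrow> app I K (app I K v) = app I K v" "i \<in> I" "j \<in> I"
  shows "(\<Sum>k\<in>I. K i k * K k j) = K i j"
proof -
  have "(\<lambda>k. app I K (\<lambda>a. if a = j then 1 else 0) k) = (\<lambda>k. K k j)"
    using app_unit[OF assms(3)] by auto
  then have "app I K (\<lambda>k. K k j) = (\<lambda>k. K k j)"
    using assms(1)[OF unit_in_VS[OF assms(3)]] by simp
  then show ?thesis unfolding app_def by (metis (no_types))
qed

text \<open>Meaningful for projections, whose trace is a natural number.\<close>

definition rank :: "('i \<Rightarrow> 'i \<Rightarrow> complex) \<Rightarrow> nat" where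
  "rank K = (SOME r. tr K = of_nat r)"

definition proj_kernel :: "('i \<Rightarrow> 'i \<Rightarrow> complex) \<Rightarrow> bool" where
  "proj_kernel K \<longleftrightarrow> (\<forall>v\<in>VS. app I K (app I K v) = app I K v) \<and> (\<forall>i j. i \<notin> I \<longrightarrow> K i j = 0)"

lemma proj_kernel_decomposition:
  assumes "proj_kernel K"
  obtains a b where "tr K = of_nat (rank K)" "\<And>m. m < rank K \<Longrightarrow> a m \<in> VS"
    "\<And>m. m < rank K \<Longrightarrow> app I K (a m) = a m"
    "\<And>m m'. m < rank K \<Longrightarrow> m' < rank K \<Longrightarrow> (\<Sum>i\<in>I. b m i * a m' i) = (if m = m' then 1 else 0)"
    "\<And>v. app I K v = (\<lambda>i. \<Sum>m<rank K. (\<Sum>j\<in>I. b m j * v j) * a m i)"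
proof -
  have idem: "(\<Sum>k\<in>I. K i k * K k j) = K i j" if "i \<in> I" "j \<in> I" for i j
    using assms that by (intro idempotent_of_app) (auto simp: proj_kernel_def)
  have supp: "K i j = 0" if "i \<notin> I" for i j
    using assms that by (auto simp: proj_kernel_def)
  show ?thesis
  proof (rule idempotent_trace[OF idem supp])
    fix r a b
    assume *: "tr K = of_nat r" "\<And>m. m < r \<Longrightarrow> a m \<in> VS" "\<And>m. m < r \<Longrightarrow> app I K (a m) = a m"
      "\<And>m m'. m < r \<Longrightarrow> m' < r \<Longrightarrow> (\<Sum>i\<in>I. b m i * a m' i) = (if m = m' then 1 else 0)"
      "\<And>v. app I K v = (\<lambda>i. \<Sum>m<r. (\<Sum>j\<in>I. b m j * v j) * a m i)"
    have "tr K = of_nat (rank K)" unfolding rank_def by (rule someI[where x = r]) (rule *(1))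
    then have "rank K = r" using *(1) by simp
    then show thesis using that[of a b] * by simp
  qed
qed

lemma rank_trace: "proj_kernel K \<Longrightarrow> tr K = of_nat (rank K)"
  by (rule proj_kernel_decomposition)

lemma rank_0: "proj_kernel K \<Longrightarrow> rank K = 0 \<Longrightarrow> app I K v = (\<lambda>_. 0)"
  by (erule proj_kernel_decomposition) simp

lemma rank_pos: assumes "proj_kernel K" "v \<noteq> (\<lambda>_. 0)" "app I K v = v" shows "rank K > 0"
  using rank_0[OF assms(1), of v] assms by (metis neq0_conv)

lemma rank_pos_vector:
  assumes "proj_kernel K" "rank K > 0"
  shows "\<exists>v\<in>VS. v \<noteq> (\<lambda>_. 0) \<and> app I K v = v"
proof (rule proj_kernel_decomposition[OF assms(1)])
  fix a b
  assume *: "\<And>m. m < rank K \<Longrightarrow> a m \<in> VS" "\<And>m. m < rank K \<Longrightarrow> app I K (a m) = a m"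
      "\<And>m m'. m < rank K \<Longrightarrow> m' < rank K \<Longrightarrow> (\<Sum>i\<in>I. b m i * a m' i) = (if m = m' then 1 else 0)"
  have "a 0 \<noteq> (\<lambda>_. 0)" using *(3)[OF assms(2) assms(2)] by auto
  then show ?thesis using * assms(2) by blast
qed

lemma rank_1_line:
  assumes "proj_kernel K" "rank K = 1"
  shows "\<exists>\<xi>\<in>VS. \<xi> \<noteq> (\<lambda>_. 0) \<and> app I K \<xi> = \<xi> \<and> (\<forall>v. \<exists>c. app I K v = (\<lambda>i. c * \<xi> i))"
proof (rule proj_kernel_decomposition[OF assms(1)])
  fix a b
  assume *: "\<And>m. m < rank K \<Longrightarrow> a m \<in> VS" "\<And>m. m < rank K \<Longrightarrow> app I K (a m) = a m"
      "\<And>m m'. m < rank K \<Longrightarrow> m' < rank K \<Longrightarrow> (\<Sum>i\<in>I. b m i * a m' i) = (if m = m' then 1 else 0)"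
      "\<And>v. app I K v = (\<lambda>i. \<Sum>m<rank K. (\<Sum>j\<in>I. b m j * v j) * a m i)"
  have "a 0 \<noteq> (\<lambda>_. 0)" using *(3)[of 0 0] assms(2) by auto
  moreover have "\<exists>c. app I K v = (\<lambda>i. c * a 0 i)" for v
    using *(4)[of v] assms(2) by (auto intro: exI[of _ "\<Sum>j\<in>I. b 0 j * v j"])
  ultimately show ?thesis using *(1,2)[of 0] assms(2) by (intro bexI[of _ "a 0"]) auto
qed

lemma rank_le_1I:
  assumes "proj_kernel K"
    and "\<And>v w i j. v \<in> VS \<Longrightarrow> w \<in> VS \<Longrightarrow> app I K v = v \<Longrightarrow> app I K w = w \<Longrightarrow> v i * w j = v j * w i"
  shows "rank K \<le> 1"
proof (rule proj_kernel_decomposition[OF assms(1)], rule ccontr)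
  fix a b
  assume *: "\<And>m. m < rank K \<Longrightarrow> a m \<in> VS" "\<And>m. m < rank K \<Longrightarrow> app I K (a m) = a m"
      "\<And>m m'. m < rank K \<Longrightarrow> m' < rank K \<Longrightarrow> (\<Sum>i\<in>I. b m i * a m' i) = (if m = m' then 1 else 0)"
    and "\<not> rank K \<le> 1"
  then have r: "0 < rank K" "1 < rank K" by auto
  have eq: "a 0 i * a 1 j = a 0 j * a 1 i" for i j using assms(2) * r by blast
  have "a 1 j = 0" for j
  proof -
    have "a 1 j = (\<Sum>i\<in>I. b 0 i * a 0 i) * a 1 j" using *(3)[OF r(1) r(1)] by simp
    also have "\<dots> = (\<Sum>i\<in>I. b 0 i * (a 0 i * a 1 j))" by (simp add: sum_distrib_right mult.assoc)
    also have "\<dots> = (\<Sum>i\<in>I. b 0 i * (a 0 j * a 1 i))" by (intro sum.cong refl) (subst eq, rule refl)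
    also have "\<dots> = a 0 j * (\<Sum>i\<in>I. b 0 i * a 1 i)" by (simp add: sum_distrib_left mult_ac)
    finally show ?thesis using *(3)[OF r] by simp
  qed
  then show False using *(3)[OF r(2) r(2)] by simp
qed

text \<open>The complement \<open>L\<close> of a projection is a projection too, and the two traces
  add up to \<open>card I\<close>.\<close>

lemma rank_le_card: assumes K: "proj_kernel K" shows "rank K \<le> card I"
proof -
  define L where "L = (\<lambda>i j. \<rho> one i j - K i j)"
  have supp: "K i j = 0" if "i \<notin> I" for i j using K that by (auto simp: proj_kernel_def)
  have L: "app I L v = (\<lambda>i. v i - app I K v i)" if "v \<in> VS" for v
    using act_one[OF that] unfolding act_def
    by (auto simp: L_def app_def left_diff_distrib sum_subtractf fun_eq_iff)
  have KVS: "app I K v \<in> VS" for v by (auto simp: VS_def app_def supp)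
  have "app I L (app I L v) = app I L v" if v: "v \<in> VS" for v
  proof -
    have "app I K (\<lambda>i. v i - app I K v i) = (\<lambda>i. app I K v i - app I K (app I K v) i)"
      by (simp add: app_def right_diff_distrib sum_subtractf)
    also have "\<dots> = (\<lambda>i. 0)" using K v by (auto simp: proj_kernel_def)
    finally have "app I K (app I L v) = (\<lambda>i. 0)" using v by (simp add: L)
    moreover have "app I L v \<in> VS" using v KVS[of v] by (simp add: L VS_def)
    ultimately show ?thesis using L by simp
  qed
  moreover have "L i j = 0" if "i \<notin> I" for i j using that by (simp add: L_def supp rep_supp)
  ultimately have "proj_kernel L" by (simp add: proj_kernel_def)
  from rank_trace[OF this] have "of_nat (rank L) = tr (\<rho> one) - tr K"
    by (simp add: L_def tr_def sum_subtractf)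
  also have "\<dots> = of_nat (card I) - of_nat (rank K)" by (simp add: tr_one rank_trace[OF K])
  finally have "(of_nat (rank L + rank K) :: complex) = of_nat (card I)" by simp
  then have "rank L + rank K = card I" by (simp only: of_nat_eq_iff)
  then show ?thesis by simp
qed

end

locale char_rep = chain_ring_char p l q \<psi> + fin_rep G mul one I \<rho>
  for p :: "'r::comm_ring_1" and l q \<psi> and G :: "'g set" and mul and one and I :: "'i set" and \<rho>
begin

definition cardR :: complex where "cardR = of_nat (card (UNIV :: 'r set))"

lemma cardR_nz [simp]: "cardR \<noteq> 0"
  using fin by (simp add: cardR_def)

lemma psi_orthogonality_minus: "(\<Sum>b\<in>UNIV. \<psi> (- (x * b))) = (if x = 0 then cardR else 0)"
  using psi_orthogonality[of "- x"] by (simp add: cardR_def)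

text \<open>Additivity is demanded of the action only, because \<open>Dd\<close> below is additive
  merely up to elements that act trivially.\<close>

definition onepar :: "('r \<Rightarrow> 'g) \<Rightarrow> bool" where
  "onepar h \<longleftrightarrow> (\<forall>x. h x \<in> G) \<and> (\<forall>x y v. act (h (x + y)) v = act (h x) (act (h y) v)) \<and> h 0 = one"

definition specK :: "('r \<Rightarrow> 'g) \<Rightarrow> 'r \<Rightarrow> 'i \<Rightarrow> 'i \<Rightarrow> complex" where
  "specK h b = (\<lambda>i j. \<Sum>x\<in>UNIV. (\<psi> (- (b * x)) / cardR) * \<rho> (h x) i j)"

definition spec :: "('r \<Rightarrow> 'g) \<Rightarrow> 'r \<Rightarrow> ('i \<Rightarrow> complex) \<Rightarrow> 'i \<Rightarrow> complex" where
  "spec h b = app I (specK h b)"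

lemma spec_eq: "spec h b v = (\<lambda>i. \<Sum>x\<in>UNIV. (\<psi> (- (b * x)) / cardR) * act (h x) v i)"
  unfolding spec_def specK_def act_def by (rule app_kernel_lincomb)

lemma spec_lincomb: "spec h b (\<lambda>i. \<Sum>s\<in>S. c s * w s i) = (\<lambda>i. \<Sum>s\<in>S. c s * spec h b (w s) i)"
  unfolding spec_def by (rule app_lincomb)

lemma spec_in [simp, intro]: "onepar h \<Longrightarrow> spec h b v \<in> VS"
  unfolding spec_eq onepar_def by (intro lincomb_in) auto

lemma spec_eigen: assumes h: "onepar h" shows "act (h y) (spec h b v) = (\<lambda>i. \<psi> (b * y) * spec h b v i)"
proof
  fix i
  have "act (h y) (spec h b v) i = (\<Sum>x\<in>UNIV. (\<psi> (- (b * x)) / cardR) * act (h (y + x)) v i)"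
    unfolding spec_eq act_lincomb using h by (simp add: onepar_def)
  also have "\<dots> = (\<Sum>x\<in>UNIV. (\<psi> (- (b * (x - y))) / cardR) * act (h x) v i)"
    by (rule sum.reindex_bij_witness[of _ "\<lambda>x. x - y" "\<lambda>x. y + x"]) auto
  also have "\<dots> = (\<Sum>x\<in>UNIV. \<psi> (b * y) * ((\<psi> (- (b * x)) / cardR) * act (h x) v i))"
  proof (intro sum.cong refl)
    fix x
    have "- (b * (x - y)) = b * y + - (b * x)" by (simp add: algebra_simps)
    then show "(\<psi> (- (b * (x - y))) / cardR) * act (h x) v i
        = \<psi> (b * y) * ((\<psi> (- (b * x)) / cardR) * act (h x) v i)"
      by (simp only: psi_add) simp
  qed
  finally show "act (h y) (spec h b v) i = \<psi> (b * y) * spec h b v i"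
    by (simp add: spec_eq sum_distrib_left)
qed

lemma spec_sum: assumes h: "onepar h" and v: "v \<in> VS" shows "(\<Sum>b\<in>UNIV. spec h b v i) = v i"
proof -
  have "(\<Sum>b\<in>UNIV. spec h b v i) = (\<Sum>x\<in>UNIV. (\<Sum>b\<in>UNIV. \<psi> (- x * b)) / cardR * act (h x) v i)"
    unfolding spec_eq by (subst sum.swap) (simp add: sum_distrib_right sum_distrib_left sum_divide_distrib mult_ac)
  also have "\<dots> = (\<Sum>x\<in>UNIV. if x = 0 then act (h x) v i else 0)"
    by (intro sum.cong) (auto simp: psi_orthogonality_minus)
  also have "\<dots> = v i" using h v by (simp add: onepar_def)
  finally show ?thesis .
qed

lemma spec_of_eigen:
  assumes "\<And>x. act (h x) v = (\<lambda>i. \<psi> (c * x) * v i)"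
  shows "spec h b v = (\<lambda>i. if b = c then v i else 0)"
proof
  fix i
  have "spec h b v i = (\<Sum>x\<in>UNIV. (\<psi> ((c - b) * x)) / cardR * v i)"
    unfolding spec_eq assms
  proof (intro sum.cong refl)
    fix x
    have "(c - b) * x = c * x + - (b * x)" by (simp add: algebra_simps)
    then show "\<psi> (- (b * x)) / cardR * (\<psi> (c * x) * v i) = \<psi> ((c - b) * x) / cardR * v i"
      by (simp only: psi_add) simp
  qed
  also have "\<dots> = (\<Sum>x\<in>UNIV. \<psi> ((c - b) * x)) / cardR * v i"
    by (simp add: sum_distrib_right sum_divide_distrib)
  finally show "spec h b v i = (if b = c then v i else 0)"
    by (auto simp: psi_orthogonality cardR_def[symmetric])
qed

lemma spec_fix_iff:
  "onepar h \<Longrightarrow> spec h b v = v \<longleftrightarrow> (\<forall>x. act (h x) v = (\<lambda>i. \<psi> (b * x) * v i))"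
proof
  assume "onepar h" "spec h b v = v"
  then show "\<forall>x. act (h x) v = (\<lambda>i. \<psi> (b * x) * v i)" using spec_eigen[of h _ b v] by simp
qed (use spec_of_eigen[of h v b b] in auto)

lemma spec_proj: assumes h: "onepar h" shows "proj_kernel (specK h b)"
  unfolding proj_kernel_def
proof (intro conjI ballI allI impI)
  fix v
  have "spec h b (spec h b v) = spec h b v"
    using spec_of_eigen[of h "spec h b v" b b] spec_eigen[OF h] by simp
  then show "app I (specK h b) (app I (specK h b) v) = app I (specK h b) v" by (simp add: spec_def)
next
  fix i j assume "i \<notin> I"
  then show "specK h b i j = 0" using h by (simp add: specK_def onepar_def rep_supp)
qed

definition mult :: "('r \<Rightarrow> 'g) \<Rightarrow> 'r \<Rightarrow> nat" where
  "mult h b = rank (specK h b)"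

lemma tr_specK: "tr (specK h b) = (\<Sum>x\<in>UNIV. (\<psi> (- (b * x)) / cardR) * tr (\<rho> (h x)))"
  unfolding tr_def specK_def by (subst sum.swap) (simp add: sum_distrib_left)

lemma sum_mult: assumes h: "onepar h" shows "(\<Sum>b\<in>UNIV. mult h b) = card I"
proof -
  have "(of_nat (\<Sum>b\<in>UNIV. mult h b) :: complex) = (\<Sum>b\<in>UNIV. tr (specK h b))"
    by (simp add: mult_def rank_trace[OF spec_proj[OF h]])
  also have "\<dots> = (\<Sum>x\<in>UNIV. (\<Sum>b\<in>UNIV. \<psi> (- x * b)) / cardR * tr (\<rho> (h x)))"
    unfolding tr_specK by (subst sum.swap) (simp add: sum_distrib_right sum_distrib_left sum_divide_distrib mult_ac)
  also have "\<dots> = (\<Sum>x\<in>UNIV. if x = 0 then tr (\<rho> (h x)) else 0)"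
    by (intro sum.cong) (auto simp: psi_orthogonality_minus)
  also have "\<dots> = of_nat (card I)" using h by (simp add: onepar_def tr_one)
  finally show ?thesis by (simp only: of_nat_eq_iff)
qed

text \<open>Conjugation preserves traces, so substituting \<open>a * x\<close> in the Fourier sum
  turns the character with parameter \<open>b\<close> into the one with parameter
  \<open>a * b\<close>.\<close>

lemma mult_conj:
  assumes h: "onepar h" and g: "g \<in> G" and a: "\<not> p dvd a"
    and conj: "\<And>x. mul (mul g (h x)) (ginv g) = h (a * x)"
  shows "mult h (a * b) = mult h b"
proof -
  have "tr (specK h b) = (\<Sum>x\<in>UNIV. (\<psi> (- (b * x)) / cardR) * tr (\<rho> (h x)))" by (rule tr_specK)
  also have "\<dots> = (\<Sum>x\<in>UNIV. (\<psi> (- (a * b * x)) / cardR) * tr (\<rho> (h x)))"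
  proof (rule sum.reindex_bij_witness[of _ "\<lambda>x. a * x" "\<lambda>x. rinv a * x"])
    fix x
    have "tr (\<rho> (h (rinv a * x))) = tr (\<rho> (h x))"
      using tr_conj[OF g, of "h (rinv a * x)"] h conj[of "rinv a * x"] a by (simp add: onepar_def)
    moreover have "a * b * (rinv a * x) = (a * rinv a) * (b * x)" by (simp only: mult_ac)
    then have "a * b * (rinv a * x) = b * x" using a by simp
    ultimately show "\<psi> (- (a * b * (rinv a * x))) / cardR * tr (\<rho> (h (rinv a * x)))
      = \<psi> (- (b * x)) / cardR * tr (\<rho> (h x))" by simp
  qed (use a in auto)
  also have "\<dots> = tr (specK h (a * b))" by (rule tr_specK[symmetric])
  finally have "(of_nat (mult h b) :: complex) = of_nat (mult h (a * b))"
    by (simp add: mult_def rank_trace[OF spec_proj[OF h], symmetric])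
  then show ?thesis by (simp only: of_nat_eq_iff)
qed

lemma mult_0: "onepar h \<Longrightarrow> mult h b = 0 \<Longrightarrow> spec h b v = (\<lambda>_. 0)"
  unfolding mult_def spec_def by (rule rank_0[OF spec_proj])

lemma mult_pos: "onepar h \<Longrightarrow> v \<noteq> (\<lambda>_. 0) \<Longrightarrow> spec h b v = v \<Longrightarrow> mult h b > 0"
  unfolding mult_def spec_def by (rule rank_pos[OF spec_proj])

lemma mult_pos_vector: "onepar h \<Longrightarrow> mult h b > 0 \<Longrightarrow> \<exists>v\<in>VS. v \<noteq> (\<lambda>_. 0) \<and> spec h b v = v"
  unfolding mult_def spec_def by (rule rank_pos_vector[OF spec_proj])

lemma mult_1_line: "onepar h \<Longrightarrow> mult h b = 1 \<Longrightarrow>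
  \<exists>\<xi>\<in>VS. \<xi> \<noteq> (\<lambda>_. 0) \<and> spec h b \<xi> = \<xi> \<and> (\<forall>v. \<exists>c. spec h b v = (\<lambda>i. c * \<xi> i))"
  unfolding mult_def spec_def by (rule rank_1_line[OF spec_proj])

lemma spec_nonzero: assumes "onepar h" "v \<in> VS" "v \<noteq> (\<lambda>_. 0)" shows "\<exists>b. spec h b v \<noteq> (\<lambda>_. 0)"
proof (rule ccontr)
  assume "\<not> ?thesis"
  then have "v i = 0" for i using spec_sum[OF assms(1,2), of i] by simp
  then show False using assms(3) by auto
qed

end

section \<open>Two by two matrices and simultaneous conjugation\<close>

fun mm :: "'r::comm_ring_1 m2 \<Rightarrow> 'r m2 \<Rightarrow> 'r m2" where
  "mm (M2 a b c d) (M2 a' b' c' d') = M2 (a * a' + b * c') (a * b' + b * d') (c * a' + d * c') (c * b' + d * d')"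

fun mdet :: "'r::comm_ring_1 m2 \<Rightarrow> 'r" where
  "mdet (M2 a b c d) = a * d - b * c"

fun madj :: "'r::comm_ring_1 m2 \<Rightarrow> 'r m2" where
  "madj (M2 a b c d) = M2 d (- b) (- c) a"

fun msc :: "'r::comm_ring_1 \<Rightarrow> 'r m2 \<Rightarrow> 'r m2" where
  "msc t (M2 a b c d) = M2 (t * a) (t * b) (t * c) (t * d)"

definition mid :: "'r::comm_ring_1 m2" where "mid = M2 1 0 0 1"

lemma mm_assoc: "mm (mm A B) C = mm A (mm B C)"
  by (cases A; cases B; cases C) (simp add: algebra_simps)

lemma mm_mid [simp]: "mm mid A = A" "mm A mid = A"
  by (cases A; simp add: mid_def)+

lemma mdet_mm: "mdet (mm A B) = mdet A * mdet B"
  by (cases A; cases B) (simp add: algebra_simps)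

lemma mdet_mid [simp]: "mdet mid = 1" by (simp add: mid_def)

lemma mdet_madj [simp]: "mdet (madj A) = mdet A" by (cases A) (simp add: algebra_simps)

lemma madj_madj [simp]: "madj (madj A) = A" by (cases A) simp

lemma madj_mm: "madj (mm A B) = mm (madj B) (madj A)"
  by (cases A; cases B) (simp add: algebra_simps)

lemma mm_madj: "mm A (madj A) = msc (mdet A) mid" "mm (madj A) A = msc (mdet A) mid"
  by (cases A; simp add: algebra_simps mid_def)+

lemma msc_mm: "mm (msc t A) B = msc t (mm A B)" "mm A (msc t B) = msc t (mm A B)"
  by (cases A; cases B; simp add: algebra_simps)+

lemma msc_msc: "msc s (msc t A) = msc (s * t) A" "msc 1 A = A"
  by (cases A; simp add: algebra_simps)+

text \<open>Many matrix identities below hold only modulo relations. Explicit cofactors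
  \<open>m\<close> and \<open>k\<close> reduce each of them to a polynomial identity that
  \<open>algebra_simps\<close> decides.\<close>

lemma eq_by_cofactors:
  fixes a b :: "'r::comm_ring_1"
  assumes "v = 0" "w = 0" "a - b = m * v + k * w"
  shows "a = b"
  using assms by simp

section \<open>Conjugacy of matrices over a chain ring\<close>

context chain_ring
begin

definition minv :: "'r m2 \<Rightarrow> 'r m2" where "minv A = msc (rinv (mdet A)) (madj A)"

lemma minv: assumes "\<not> p dvd mdet A" shows "mm A (minv A) = mid" "mm (minv A) A = mid"
  using assms by (simp_all add: minv_def msc_mm mm_madj msc_msc)

lemma mdet_conj: assumes "\<not> p dvd mdet A" "mm A X = mm X' A" shows "mdet X' = mdet X"
proof -
  have "mdet A * mdet X = mdet A * mdet X'"
    using arg_cong[OF assms(2), of mdet] by (simp add: mdet_mm mult.commute)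
  then show ?thesis using unit_cancel[OF assms(1)] by metis
qed

lemma common_content:
  assumes "\<not> (x = 0 \<and> y = 0 \<and> z = 0)"
  obtains k x1 y1 z1 where "k < l" "x = p ^ k * x1" "y = p ^ k * y1" "z = p ^ k * z1"
    "\<not> (p dvd x1 \<and> p dvd y1 \<and> p dvd z1)"
proof -
  define P where "P = (\<lambda>k. p ^ k dvd x \<and> p ^ k dvd y \<and> p ^ k dvd z)"
  have bd: "k < l" if "P k" for k
  proof (rule ccontr)
    assume "\<not> k < l"
    then have "p ^ k = 0" by (simp add: p_pow_zero)
    then show False using that assms by (simp add: P_def)
  qed
  have "P 0" by (simp add: P_def)
  then have G: "P (Greatest P)" using GreatestI_nat[of P 0 l] bd less_imp_le by blast
  then obtain x1 y1 z1 where *: "x = p ^ Greatest P * x1" "y = p ^ Greatest P * y1" "z = p ^ Greatest P * z1"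
    unfolding P_def by (auto elim!: dvdE)
  have "\<not> (p dvd x1 \<and> p dvd y1 \<and> p dvd z1)"
  proof
    assume d: "p dvd x1 \<and> p dvd y1 \<and> p dvd z1"
    have step: "p ^ Suc (Greatest P) dvd p ^ Greatest P * t" if "p dvd t" for t
      using that by (metis mult_dvd_mono dvd_refl power_Suc2)
    have PI: "P n \<longleftrightarrow> p ^ n dvd x \<and> p ^ n dvd y \<and> p ^ n dvd z" for n by (simp add: P_def)
    have "p ^ Suc (Greatest P) dvd x \<and> p ^ Suc (Greatest P) dvd y \<and> p ^ Suc (Greatest P) dvd z"
      using d step[of x1] step[of y1] step[of z1] *[symmetric] by (simp del: power_Suc)
    then have "P (Suc (Greatest P))" using PI by blast
    then have "Suc (Greatest P) \<le> Greatest P"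
      by (rule Greatest_le_nat[of P _ l]) (rule less_imp_le[OF bd])
    then show False by simp
  qed
  then show ?thesis using that[OF bd[OF G] *] by blast
qed

text \<open>Since 2 is invertible, half the trace splits off; the traceless rest is
  \<open>p ^ k\<close> times a matrix that is nonzero modulo \<open>p\<close>. Such a matrix has
  square \<open>d\<close> and a cyclic vector.\<close>

lemma companion_form:
  obtains A a d i where "\<not> p dvd mdet A" "mm Y A = mm A (M2 a (p ^ i * d) (p ^ i) a)"
proof (cases Y)
  case (M2 y11 y12 y21 y22)
  define h where "h = rinv 2"
  have h: "h + h = 1" unfolding h_def mult_2[symmetric] by (rule rinv(1)[OF two_unit])
  define a x where "a = h * (y11 + y22)" "x = h * (y11 - y22)"
  have y: "y11 = a + x" "y22 = a - x"
  proof -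
    have "a + x = (h + h) * y11" "a - x = (h + h) * y22" by (simp_all add: a_x_def algebra_simps)
    then show "y11 = a + x" "y22 = a - x" by (simp_all add: h)
  qed
  show ?thesis
  proof (cases "x = 0 \<and> y12 = 0 \<and> y21 = 0")
    \<comment> \<open>A scalar matrix is the case \<open>i = l\<close>, because
      \<open>p ^ l = 0\<close>.\<close>
    case True
    then show ?thesis
      using that[of mid a l 0] M2 y by (auto simp: p_pow_l p_nonunit)
  next
    case False
    then obtain k x1 y1 z1 where k: "k < l" "x = p ^ k * x1" "y12 = p ^ k * y1" "y21 = p ^ k * z1"
      "\<not> (p dvd x1 \<and> p dvd y1 \<and> p dvd z1)" by (rule common_content)
    define d where "d = x1 * x1 + y1 * z1"
    \<comment> \<open>In each case the columns of the base change are a cyclic vector and its image;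
      the cyclic vector is the first basis vector, the second one, or their sum.\<close>
    consider "\<not> p dvd z1" | "\<not> p dvd y1" | "p dvd y1" "p dvd z1" "\<not> p dvd x1" using k(5) by blast
    then show ?thesis
    proof cases
      case 1
      show ?thesis by (rule that[of "M2 1 x1 0 z1" a k d])
          (use 1 in \<open>auto simp: M2 y k d_def algebra_simps\<close>)
    next
      case 2
      show ?thesis by (rule that[of "M2 0 y1 1 (- x1)" a k d])
          (use 2 in \<open>auto simp: M2 y k d_def algebra_simps\<close>)
    next
      case 3
      have "\<not> p dvd (- 2 * x1) + (z1 - y1)"
        using 3 by (intro unit_add) (auto simp: unit_mult two_unit)
      then have "\<not> p dvd mdet (M2 1 (x1 + y1) 1 (z1 - x1))" by (simp add: algebra_simps)
      then show ?thesis by (rule that[of _ a k d]) (auto simp: M2 y k d_def algebra_simps)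
    qed
  qed
qed

text \<open>Abstracts the compressed operator at a triple whose third entry is normalised to 1.
  Conjugacy is written \<open>mm A X = mm X' A\<close> to keep inverses out; \<open>Xs s\<close> is
  \<open>X\<close> times a conjugate of the deepest upper unipotents, over which a cuspidal first
  factor sums to zero.\<close>

definition cuspidal_pair_function :: "'r \<Rightarrow> 'r \<Rightarrow> ('r m2 \<Rightarrow> 'r m2 \<Rightarrow> complex) \<Rightarrow> bool" where
  "cuspidal_pair_function x0 y0 f \<longleftrightarrow>
     (\<forall>A X Y X' Y'. \<not> p dvd mdet A \<longrightarrow> mdet X = x0 \<longrightarrow> mdet Y = y0 \<longrightarrow>
        mm A X = mm X' A \<longrightarrow> mm A Y = mm Y' A \<longrightarrow> f X Y = f X' Y') \<and>
     (\<forall>A X Y Xs. \<not> p dvd mdet A \<longrightarrow> mdet X = x0 \<longrightarrow> mdet Y = y0 \<longrightarrow>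
        (\<forall>s. mm (Xs s) A = mm X (mm A (M2 1 (p ^ (l - 1) * s) 0 1))) \<longrightarrow> (\<Sum>s\<in>UNIV. f (Xs s) Y) = 0)"

lemma cuspidal_pair_conj:
  assumes "cuspidal_pair_function x0 y0 f" "\<not> p dvd mdet A" "mdet X = x0" "mdet Y = y0"
    "mm A X = mm X' A" "mm A Y = mm Y' A"
  shows "f X Y = f X' Y'"
  using conjunct1[OF assms(1)[unfolded cuspidal_pair_function_def], rule_format, OF assms(2-)] .

lemma cuspidal_pair_sum:
  assumes "cuspidal_pair_function x0 y0 f" "\<not> p dvd mdet A" "mdet X = x0" "mdet Y = y0"
    "\<And>s. mm (Xs s) A = mm X (mm A (M2 1 (p ^ (l - 1) * s) 0 1))"
  shows "(\<Sum>s\<in>UNIV. f (Xs s) Y) = 0"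
  using conjunct2[OF assms(1)[unfolded cuspidal_pair_function_def], rule_format, OF assms(2-)] .

text \<open>The adjugate turns right multiplication by a unipotent into left multiplication by its
  inverse. As \<open>X\<close> is invertible, the latter is right multiplication by a conjugate
  unipotent, with base change \<open>mm X A\<close> in place of \<open>A\<close>.\<close>

lemma cuspidal_pair_adj:
  assumes f: "cuspidal_pair_function x0 y0 f" and x0: "\<not> p dvd x0"
  shows "cuspidal_pair_function x0 y0 (\<lambda>X Y. f (madj X) (madj Y))"
  unfolding cuspidal_pair_function_def
proof (intro conjI allI impI)
  fix A X Y X' Y' assume a: "\<not> p dvd mdet A" "mdet X = x0" "mdet Y = y0" "mm A X = mm X' A" "mm A Y = mm Y' A"
  have "mm (madj A) (madj X') = mm (madj X) (madj A)" "mm (madj A) (madj Y') = mm (madj Y) (madj A)"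
    using a(4,5) by (metis madj_mm)+
  moreover have "mdet (madj X') = x0" "mdet (madj Y') = y0"
    using mdet_conj[OF a(1) a(4)] mdet_conj[OF a(1) a(5)] a by auto
  ultimately have "f (madj X') (madj Y') = f (madj X) (madj Y)"
    using a(1) by (intro cuspidal_pair_conj[OF f, of "madj A"]) auto
  then show "f (madj X) (madj Y) = f (madj X') (madj Y')" ..
next
  fix A X Y Xs
  assume a: "\<not> p dvd mdet A" "mdet X = x0" "mdet Y = y0"
    "\<forall>s. mm (Xs s) A = mm X (mm A (M2 1 (p ^ (l - 1) * s) 0 1))"
  define U where "U = (\<lambda>s. M2 1 (p ^ (l - 1) * s) 0 1)"
  have UU: "mm (U s) (U (- s)) = mid" for s by (simp add: U_def mid_def)
  have "mm (madj (Xs (- s))) (mm X A) = mm (madj X) (mm (mm X A) (U s))" for s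
  proof -
    have eq: "mm (Xs (- s)) A = mm X (mm A (U (- s)))" using a(4) by (simp add: U_def)
    have det: "mdet (Xs (- s)) = x0"
    proof -
      have "mdet A * mdet (Xs (- s)) = mdet A * mdet X"
        using arg_cong[OF eq, of mdet] by (simp add: mdet_mm U_def mult_ac)
      then show ?thesis using unit_cancel[OF a(1)] a(2) by metis
    qed
    have "mm X A = mm (Xs (- s)) (mm A (U s))"
      using arg_cong[OF eq, of "\<lambda>Z. mm Z (U s)"] UU[of "- s"] by (simp add: mm_assoc)
    then have "mm (madj (Xs (- s))) (mm X A) = msc x0 (mm A (U s))"
      by (simp add: mm_assoc[symmetric] mm_madj det msc_mm)
    also have "\<dots> = mm (madj X) (mm (mm X A) (U s))"
      by (simp add: mm_assoc[symmetric] mm_madj a(2) msc_mm)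
    finally show ?thesis .
  qed
  moreover have "\<not> p dvd mdet (mm X A)" using a x0 by (simp add: mdet_mm unit_mult)
  ultimately have "(\<Sum>s\<in>UNIV. f (madj (Xs (- s))) (madj Y)) = 0"
    using a(2,3) unfolding U_def by (intro cuspidal_pair_sum[OF f, where X = "madj X"]) auto
  also have "(\<Sum>s\<in>UNIV. f (madj (Xs (- s))) (madj Y)) = (\<Sum>s\<in>UNIV. f (madj (Xs s)) (madj Y))"
    by (rule sum.reindex_bij_witness[of _ uminus uminus]) auto
  finally show "(\<Sum>s\<in>UNIV. f (madj (Xs s)) (madj Y)) = 0" .
qed


text \<open>Write \<open>Y = a + p^i M\<close> with \<open>M\<close> a companion matrix and \<open>X = b + c M + p^k N\<close> with \<open>N\<close> upper
  triangular of trace zero. Conjugation by the commutator \<open>[M, N]\<close> sends both to their adjugates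
  whenever that commutator is invertible. Otherwise \<open>M\<close>, \<open>N\<close> have a common eigenline modulo \<open>p\<close>, and
  cuspidality along the unipotent group of this line applies.\<close>

lemma cuspidal_pair_companion:
  assumes x0: "\<not> p dvd x0"
    and X: "mdet X = x0" and Y: "Y = M2 a (p ^ i * d) (p ^ i) a" "mdet Y = y0"
  shows "(\<exists>A. \<not> p dvd mdet A \<and> mm A X = mm (madj X) A \<and> mm A Y = mm (madj Y) A)
    \<or> (\<forall>f. cuspidal_pair_function x0 y0 f \<longrightarrow> f X Y = 0)
    \<or> (\<exists>\<kappa> b c. mdet (M2 b (c * d) c b) = x0 \<and>
        (\<forall>f. cuspidal_pair_function x0 y0 f \<longrightarrow> f X Y = \<kappa> * f (M2 b (c * d) c b) Y))"
proof (cases X)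
  case (M2 x11 x12 c x22)
  define e where "e = p ^ (l - 1)"
  have ep: "e * p = 0" using p_mult_top by (simp only: e_def mult.commute)
  have ep': "e * t = 0" if "p dvd t" for t
    using that top_mult_eq_0 unfolding e_def by blast
  define h where "h = rinv 2"
  have h: "2 * h = 1" using rinv(1)[OF two_unit] by (simp add: h_def)
  define b P Q where "b = h * (x11 + x22)" "P = h * (x11 - x22)" "Q = x12 - c * d"
  have "b + P = 2 * h * x11" "b - P = 2 * h * x22" "x12 = c * d + Q"
    by (simp_all add: b_P_Q_def algebra_simps)
  then have Xe: "X = M2 (b + P) (c * d + Q) c (b - P)" by (simp add: M2 h)
  show ?thesis
  proof (cases "P = 0 \<and> Q = 0 \<and> (0::'r) = 0")
    case True
    have "\<not> p dvd mdet (M2 1 0 0 (- 1))" by (simp add: p_nonunit)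
    moreover have "mm (M2 1 0 0 (- 1)) X = mm (madj X) (M2 1 0 0 (- 1))"
      "mm (M2 1 0 0 (- 1)) Y = mm (madj Y) (M2 1 0 0 (- 1))"
      using True by (auto simp: Xe Y)
    ultimately show ?thesis by blast
  next
    case False
    then obtain k P1 Q1 z1 where k: "k < l" "P = p ^ k * P1" "Q = p ^ k * Q1" "0 = p ^ k * z1"
      "\<not> (p dvd P1 \<and> p dvd Q1 \<and> p dvd z1)" by (rule common_content)
    have "p dvd z1" using p_pow_annihilator[of k z1] k
      by (metis dvd_trans le_imp_power_dvd less_imp_le_nat power_one_right zero_less_diff Suc_leI One_nat_def)
    then have PQ: "\<not> (p dvd P1 \<and> p dvd Q1)" using k(5) by blast
    \<comment> \<open>The commutator of the companion matrix with \<open>N\<close> after removing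
      \<open>p ^ k\<close>. A commutator of traceless two by two matrices anticommutes with both of
      them.\<close>
    define C where "C = M2 (- Q1) (- 2 * d * P1) (2 * P1) Q1"
    show ?thesis
    proof (cases "p dvd mdet C")
      case False
      have "mm C X = mm (madj X) C" "mm C Y = mm (madj Y) C"
        by (simp_all add: C_def Xe Y k algebra_simps)
      then show ?thesis using False by blast
    next
      case True
      then have disc: "p dvd 4 * d * P1 * P1 - Q1 * Q1" by (simp add: C_def algebra_simps)
      have P1: "\<not> p dvd P1"
      proof
        assume P1: "p dvd P1"
        have "Q1 * Q1 = 4 * d * P1 * P1 - (4 * d * P1 * P1 - Q1 * Q1)" by simp
        moreover have "p dvd 4 * d * P1 * P1" using P1 by (rule dvd_mult)
        ultimately have "p dvd Q1 * Q1" using disc by (metis dvd_diff)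
        then show False using PQ P1 unit_mult[of Q1 Q1] by blast
      qed
      have P2: "\<not> p dvd 2 * P1" using P1 two_unit by (simp add: unit_mult)
      \<comment> \<open>The vector with entries \<open>- \<sigma>\<close> and 1 is an eigenvector of
        \<open>N\<close>, and modulo \<open>p\<close> also one of the companion matrix, because its
        eigenvalues are the square roots of \<open>d\<close>. The number \<open>\<xi>\<close> below
        is the eigenvalue of \<open>X\<close> on it modulo \<open>p\<close>.\<close>
      define \<sigma> where "\<sigma> = Q1 * rinv (2 * P1)"
      have Q1: "Q1 = 2 * \<sigma> * P1"
      proof -
        have "2 * \<sigma> * P1 = Q1 * (2 * P1 * rinv (2 * P1))" by (simp only: \<sigma>_def mult_ac)
        then show ?thesis using P2 by simp
      qed
      have Q: "Q = 2 * \<sigma> * P" by (simp add: k Q1 mult_ac)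
      have d\<sigma>: "p dvd d - \<sigma> * \<sigma>"
      proof -
        have "4 * d * P1 * P1 - Q1 * Q1 = (2 * P1 * (2 * P1)) * (d - \<sigma> * \<sigma>)"
          unfolding Q1 by (simp add: algebra_simps)
        then have "p dvd (2 * P1 * (2 * P1)) * (d - \<sigma> * \<sigma>)" using disc by simp
        then show ?thesis using P2 unit_mult by blast
      qed
      have W0: "e * d - e * (\<sigma> * \<sigma>) = 0"
        using ep'[OF d\<sigma>] by (simp add: algebra_simps)
      define \<xi> where "\<xi> = b - P - \<sigma> * c"
      have \<xi>: "\<not> p dvd \<xi>"
      proof
        assume "p dvd \<xi>"
        have "x0 = \<xi> * (b + P + \<sigma> * c) - c * c * (d - \<sigma> * \<sigma>)"
          unfolding X[symmetric] Xe Q \<xi>_def by (simp add: algebra_simps)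
        then have "p dvd x0" using \<open>p dvd \<xi>\<close> d\<sigma> by (metis dvd_diff dvd_mult dvd_mult2)
        then show False using x0 by simp
      qed
      \<comment> \<open>\<open>E (s * \<xi>)\<close> is \<open>X\<close> times the unipotent with
        parameter \<open>p ^ (l - 1) * s\<close> along the eigenline.\<close>
      define E where "E = (\<lambda>t. M2 (b + P - e * t * \<sigma>) (c * d + Q - e * t * d) (c + e * t) (b - P + e * t * \<sigma>))"
      define A0 where "A0 = M2 (- \<sigma>) 1 1 0"
      have A0: "\<not> p dvd mdet A0" by (simp add: A0_def p_nonunit)
      have pert: "mm (E (s * \<xi>)) A0 = mm X (mm A0 (M2 1 (p ^ (l - 1) * s) 0 1))" for s
        unfolding e_def[symmetric] E_def A0_def Xe Q \<xi>_def mm.simps m2.inject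
      proof (intro conjI)
        show "(b + P - e * (s * (b - P - \<sigma> * c)) * \<sigma>) * - \<sigma> + (c * d + 2 * \<sigma> * P - e * (s * (b - P - \<sigma> * c)) * d) * 1 =
          (b + P) * (- \<sigma> * 1 + 1 * 0) + (c * d + 2 * \<sigma> * P) * (1 * 1 + 0 * 0)"
          by (rule eq_by_cofactors[OF W0 W0, of _ _ "- (s * (b - P - \<sigma> * c))" 0]) (simp add: algebra_simps)
        show "(b + P - e * (s * (b - P - \<sigma> * c)) * \<sigma>) * 1 + (c * d + 2 * \<sigma> * P - e * (s * (b - P - \<sigma> * c)) * d) * 0 =
          (b + P) * (- \<sigma> * (e * s) + 1 * 1) + (c * d + 2 * \<sigma> * P) * (1 * (e * s) + 0 * 1)"
          by (rule eq_by_cofactors[OF W0 W0, of _ _ "- (s * c)" 0]) (simp add: algebra_simps)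
      qed (simp_all add: algebra_simps)
      show ?thesis
      proof (cases "k < l - 1 \<or> p dvd \<sigma>")
        case True
        have "f X Y = 0" if f: "cuspidal_pair_function x0 y0 f" for f
        proof -
          have "f (E (s * \<xi>)) Y = f X Y" for s
          proof -
            define \<tau> where "\<tau> = s * \<xi> * rinv (2 * P1)"
            have \<tau>: "2 * P1 * \<tau> = s * \<xi>"
            proof -
              have "2 * P1 * \<tau> = s * \<xi> * (2 * P1 * rinv (2 * P1))" by (simp only: \<tau>_def mult_ac)
              then show ?thesis using P2 by simp
            qed
            \<comment> \<open>Conjugation by 1 plus \<open>\<epsilon>\<close> times the companion
              matrix fixes \<open>Y\<close> and moves \<open>X\<close>, to first order, by
              \<open>\<epsilon>\<close> times the commutator with \<open>N\<close>. The choice of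
              \<open>\<epsilon>\<close> makes this equal to the unipotent perturbation. The
              second-order terms die because \<open>p\<close> divides
              \<open>\<epsilon> * \<sigma>\<close> and \<open>\<epsilon> * d\<close> while
              \<open>e * p = 0\<close>. So all summands in the cuspidality relation agree.\<close>
            define \<epsilon> where "\<epsilon> = p ^ (l - 1 - k) * \<tau>"
            have "p ^ k * p ^ (l - 1 - k) = e" unfolding e_def power_add[symmetric] using k by simp
            moreover have "\<epsilon> * P * 2 = (p ^ k * p ^ (l - 1 - k)) * (2 * P1 * \<tau>)"
              unfolding \<epsilon>_def k(2) by (simp only: mult_ac)
            ultimately have eps: "\<epsilon> * P * 2 = e * (s * \<xi>)" by (simp only: \<tau>)
            have z: "e * \<epsilon> * \<sigma> = 0" "e * \<epsilon> * d = 0" and u: "p dvd \<epsilon> * \<epsilon> * d"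
            proof -
              have "p dvd \<epsilon> \<or> p dvd \<sigma>"
              proof (cases "k < l - 1")
                case True
                then have "p dvd p ^ (l - 1 - k)" by (intro dvd_power disjI1) linarith
                then show ?thesis by (simp add: \<epsilon>_def)
              qed (use True in blast)
              then have "p dvd \<epsilon> * \<sigma>" "p dvd \<epsilon> * \<sigma> * \<sigma>" by auto
              moreover have "\<epsilon> * d = \<epsilon> * \<sigma> * \<sigma> + \<epsilon> * (d - \<sigma> * \<sigma>)" by (simp add: algebra_simps)
              ultimately have "p dvd \<epsilon> * \<sigma>" "p dvd \<epsilon> * d" using d\<sigma> by auto
              then show "e * \<epsilon> * \<sigma> = 0" "e * \<epsilon> * d = 0" "p dvd \<epsilon> * \<epsilon> * d"
                using ep'[of "\<epsilon> * \<sigma>"] ep'[of "\<epsilon> * d"] by (simp_all add: mult.assoc)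
            qed
            define A1 where "A1 = M2 1 (\<epsilon> * d) \<epsilon> 1"
            have "\<not> p dvd 1 + (- (\<epsilon> * \<epsilon> * d))" using u by (intro unit_add) (auto simp: p_nonunit)
            then have A1: "\<not> p dvd mdet A1" by (simp add: A1_def mult_ac)
            define T where "T = s * \<xi>"
            have w: "\<epsilon> * P * 2 - e * T = 0" using eps by (simp add: T_def)
            have 1: "mm A1 X = mm (E (s * \<xi>)) A1"
              unfolding A1_def Xe E_def Q T_def[symmetric] mm.simps m2.inject
            proof (intro conjI)
              show "1 * (b + P) + \<epsilon> * d * c = (b + P - e * T * \<sigma>) * 1 + (c * d + 2 * \<sigma> * P - e * T * d) * \<epsilon>"
                by (rule eq_by_cofactors[OF w z(2), of _ _ "- \<sigma>" T]) (simp add: algebra_simps)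
              show "1 * (c * d + 2 * \<sigma> * P) + \<epsilon> * d * (b - P)
                  = (b + P - e * T * \<sigma>) * (\<epsilon> * d) + (c * d + 2 * \<sigma> * P - e * T * d) * 1"
                by (rule eq_by_cofactors[OF w z(2), of _ _ "- d" "T * \<sigma>"]) (simp add: algebra_simps)
              show "\<epsilon> * (b + P) + 1 * c = (c + e * T) * 1 + (b - P + e * T * \<sigma>) * \<epsilon>"
                by (rule eq_by_cofactors[OF w z(1), of _ _ 1 "- T"]) (simp add: algebra_simps)
              show "\<epsilon> * (c * d + 2 * \<sigma> * P) + 1 * (b - P) = (c + e * T) * (\<epsilon> * d) + (b - P + e * T * \<sigma>) * 1"
                by (rule eq_by_cofactors[OF w z(2), of _ _ \<sigma> "- T"]) (simp add: algebra_simps)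
            qed
            have 2: "mm A1 Y = mm Y A1" by (simp add: A1_def Y algebra_simps)
            show ?thesis using cuspidal_pair_conj[OF f A1 X Y(2) 1 2] by simp
          qed
          then have "(\<Sum>s\<in>(UNIV::'r set). f X Y) = 0"
            using cuspidal_pair_sum[OF f A0 X Y(2) pert] by simp
          then show ?thesis using fin by simp
        qed
        then show ?thesis by blast
      next
        case False
        then have kl: "k = l - 1" and \<sigma>: "\<not> p dvd \<sigma>" using k by auto
        have P: "P = e * P1" by (simp add: k kl e_def)
        \<comment> \<open>Now \<open>P\<close> lies in the socle and is a perturbation of the same
          kind. Recentring by \<open>r\<close> describes the whole coset as \<open>Z t\<close>, with
          \<open>Z 0\<close> in the algebra generated by the companion matrix.\<close>
        define r where "r = P1 * rinv \<sigma>"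
        have r: "r * \<sigma> = P1" "\<not> p dvd r" using \<sigma> P1 by (auto simp: r_def mult.assoc unit_mult)
        define c' where "c' = c + e * r"
        define Z where "Z = (\<lambda>t. M2 (b - e * t * \<sigma>) (c' * d - e * t * d) (c' + e * t) (b + e * t * \<sigma>))"
        have EZ: "E t = Z (t - r)" for t
          unfolding E_def Z_def c'_def P Q r(1)[symmetric] m2.inject
        proof (intro conjI)
          show "c * d + 2 * \<sigma> * (e * (r * \<sigma>)) - e * t * d = (c + e * r) * d - e * (t - r) * d"
            by (rule eq_by_cofactors[OF W0 W0, of _ _ "- (2 * r)" 0]) (simp add: algebra_simps)
        qed (simp_all add: algebra_simps)
        have XZ: "X = Z (- r)" using EZ[of 0] by (simp add: E_def Xe)
        have Zconj: "\<exists>A. \<not> p dvd mdet A \<and> mm A (Z 1) = mm (Z t) A \<and> mm A Y = mm Y A" if t: "\<not> p dvd t" for t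
        proof -
          \<comment> \<open>Chosen so that \<open>\<alpha>\<close> plus \<open>\<beta>\<close> times
            the companion matrix has the eigenvalues 1 and \<open>t\<close> modulo \<open>p\<close>;
            conjugating by it multiplies the socle perturbation by \<open>t\<close> and fixes
            \<open>Y\<close>.\<close>
          define \<alpha> \<beta> where "\<alpha> = h * (1 + t)" "\<beta> = h * (1 - t) * rinv \<sigma>"
          have \<beta>\<sigma>: "\<beta> * \<sigma> = h * (1 - t)" using \<sigma> by (simp add: \<alpha>_\<beta>_def mult.assoc)
          have "\<alpha> + \<beta> * \<sigma> = 2 * h" "\<alpha> - \<beta> * \<sigma> = 2 * h * t"
            unfolding \<beta>\<sigma> by (simp_all add: \<alpha>_\<beta>_def algebra_simps)
          then have ab: "\<alpha> + \<beta> * \<sigma> = 1" "\<alpha> - \<beta> * \<sigma> = t" by (simp_all add: h)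
          have \<alpha>1: "\<alpha> = 1 - \<beta> * \<sigma>" using ab(1) by (simp add: algebra_simps)
          then have t1: "t = 1 - 2 * (\<beta> * \<sigma>)" using ab(2) by (simp add: algebra_simps)
          have "t = (\<alpha> + \<beta> * \<sigma>) * (\<alpha> - \<beta> * \<sigma>)" by (simp add: ab)
          then have det: "mdet (M2 \<alpha> (\<beta> * d) \<beta> \<alpha>) = t + - (\<beta> * \<beta> * (d - \<sigma> * \<sigma>))" by (simp add: algebra_simps)
          have "\<not> p dvd mdet (M2 \<alpha> (\<beta> * d) \<beta> \<alpha>)"
            unfolding det using t d\<sigma> by (intro unit_add) auto
          moreover have "mm (M2 \<alpha> (\<beta> * d) \<beta> \<alpha>) (Z 1) = mm (Z t) (M2 \<alpha> (\<beta> * d) \<beta> \<alpha>)"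
            unfolding Z_def mm.simps m2.inject \<alpha>1 t1
          proof (intro conjI)
            show "(1 - \<beta> * \<sigma>) * (b - e * 1 * \<sigma>) + \<beta> * d * (c' + e * 1) =
              (b - e * (1 - 2 * (\<beta> * \<sigma>)) * \<sigma>) * (1 - \<beta> * \<sigma>) + (c' * d - e * (1 - 2 * (\<beta> * \<sigma>)) * d) * \<beta>"
              by (rule eq_by_cofactors[OF W0 W0, of _ _ "2 * ((1 - \<beta> * \<sigma>) * \<beta>)" 0]) (simp add: algebra_simps)
            show "\<beta> * (c' * d - e * 1 * d) + (1 - \<beta> * \<sigma>) * (b + e * 1 * \<sigma>) =
              (c' + e * (1 - 2 * (\<beta> * \<sigma>))) * (\<beta> * d) + (b + e * (1 - 2 * (\<beta> * \<sigma>)) * \<sigma>) * (1 - \<beta> * \<sigma>)"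
              by (rule eq_by_cofactors[OF W0 W0, of _ _ "- (2 * ((1 - \<beta> * \<sigma>) * \<beta>))" 0]) (simp add: algebra_simps)
          qed (simp_all add: algebra_simps)
          moreover have "mm (M2 \<alpha> (\<beta> * d) \<beta> \<alpha>) Y = mm Y (M2 \<alpha> (\<beta> * d) \<beta> \<alpha>)" by (simp add: Y algebra_simps)
          ultimately show ?thesis by blast
        qed
        have r': "\<not> p dvd - r" using r by simp
        have Z1: "mdet (Z 1) = x0" using Zconj[OF r'] mdet_conj XZ X by metis
        have Z0: "mdet (Z 0) = x0"
        proof -
          have "mm (E (r * rinv \<xi> * \<xi>)) A0 = mm X (mm A0 (M2 1 (p ^ (l - 1) * (r * rinv \<xi>)) 0 1))" by (rule pert)
          moreover have "r * rinv \<xi> * \<xi> = r" using \<xi> by (simp add: mult.assoc)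
          ultimately have "mm (Z 0) A0 = mm X (mm A0 (M2 1 (p ^ (l - 1) * (r * rinv \<xi>)) 0 1))" by (simp add: EZ)
          from arg_cong[OF this, of mdet] have "mdet A0 * mdet (Z 0) = mdet A0 * mdet X"
            by (simp add: mdet_mm mult.commute)
          then show ?thesis using unit_cancel[OF A0] X by metis
        qed
        \<comment> \<open>All nonunits \<open>t\<close> give \<open>Z 0\<close> and all units give
          conjugates of \<open>Z 1\<close>. Cuspidality therefore fixes the ratio of the two values
          by these counts, in the same way for every \<open>f\<close>.\<close>
        define np nu where "np = (of_nat (card {t. p dvd t}) :: complex)" "nu = (of_nat (card {t. \<not> p dvd t}) :: complex)"
        have nu: "nu \<noteq> 0"
        proof -
          have "1 \<in> {t. \<not> p dvd t}" using p_nonunit by simp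
          then have "card {t. \<not> p dvd t} > 0" by (intro card_gt_0_iff[THEN iffD2]) auto
          then show ?thesis unfolding np_nu_def(2) by (metis less_irrefl of_nat_eq_0_iff)
        qed
        have "f X Y = - (np / nu) * f (Z 0) Y" if f: "cuspidal_pair_function x0 y0 f" for f
        proof -
          have unit: "f (Z t) Y = f (Z 1) Y" if t: "\<not> p dvd t" for t
          proof -
            obtain A where "\<not> p dvd mdet A" "mm A (Z 1) = mm (Z t) A" "mm A Y = mm Y A" using Zconj[OF t] by blast
            from cuspidal_pair_conj[OF f this(1) Z1 Y(2) this(2,3)] show ?thesis ..
          qed
          have nonunit: "f (Z t) Y = f (Z 0) Y" if "p dvd t" for t
            using ep'[OF that] by (simp add: Z_def)
          have "0 = (\<Sum>s\<in>UNIV. f (E (s * \<xi>)) Y)" using cuspidal_pair_sum[OF f A0 X Y(2) pert] by simp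
          also have "\<dots> = (\<Sum>t\<in>UNIV. f (Z t) Y)"
            by (rule sum.reindex_bij_witness[of _ "\<lambda>t. (t + r) * rinv \<xi>" "\<lambda>s. s * \<xi> - r"])
              (use \<xi> in \<open>auto simp: EZ mult.assoc\<close>)
          also have "\<dots> = (\<Sum>t\<in>{t. p dvd t}. f (Z t) Y) + (\<Sum>t\<in>{t. \<not> p dvd t}. f (Z t) Y)"
            by (subst sum.union_disjoint[symmetric]) (auto intro!: sum.cong)
          also have "(\<Sum>t\<in>{t. p dvd t}. f (Z t) Y) = (\<Sum>t\<in>{t. p dvd t}. f (Z 0) Y)"
            by (intro sum.cong refl nonunit) simp
          also have "(\<Sum>t\<in>{t. \<not> p dvd t}. f (Z t) Y) = (\<Sum>t\<in>{t. \<not> p dvd t}. f (Z 1) Y)"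
            by (intro sum.cong refl unit) simp
          also have "(\<Sum>t\<in>{t. p dvd t}. f (Z 0) Y) + (\<Sum>t\<in>{t. \<not> p dvd t}. f (Z 1) Y)
              = np * f (Z 0) Y + nu * f (Z 1) Y" by (simp add: np_nu_def)
          finally have "nu * f (Z 1) Y = - (np * f (Z 0) Y)" by (metis add.commute eq_neg_iff_add_eq_0)
          then have "f (Z 1) Y = - (np / nu) * f (Z 0) Y" using nu by (simp add: field_simps)
          then show ?thesis using unit[OF r'] XZ by simp
        qed
        moreover have "Z 0 = M2 b (c' * d) c' b" by (simp add: Z_def)
        ultimately show ?thesis using Z0 by metis
      qed
    qed
  qed
qed

text \<open>In the third alternative of the preceding lemma the factor \<open>\<kappa>\<close> is
  chosen before \<open>f\<close>, so it is common to \<open>f\<close> and to its adjugate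
  \<open>f'\<close>; this is what allows the two to be compared.\<close>

theorem cuspidal_pair_function_adj:
  assumes f: "cuspidal_pair_function x0 y0 f" and x0: "\<not> p dvd x0" and X: "mdet X = x0" and Y: "mdet Y = y0"
  shows "f X Y = f (madj X) (madj Y)"
proof -
  define f' where "f' = (\<lambda>X Y. f (madj X) (madj Y))"
  have f': "cuspidal_pair_function x0 y0 f'" unfolding f'_def by (rule cuspidal_pair_adj[OF f x0])
  have companion: "f X Y = f' X Y" if X: "mdet X = x0" and Y: "Y = M2 a (p ^ i * d) (p ^ i) a" "mdet Y = y0" for X Y a i d
  proof -
    have conj: "f X Y = f' X Y" if "\<not> p dvd mdet A" "mm A X = mm (madj X) A" "mm A Y = mm (madj Y) A" "mdet X = x0" for A X
      unfolding f'_def using cuspidal_pair_conj[OF f that(1) that(4) Y(2) that(2,3)] .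
    consider A where "\<not> p dvd mdet A" "mm A X = mm (madj X) A" "mm A Y = mm (madj Y) A"
      | "f X Y = 0" "f' X Y = 0"
      | \<kappa> b c where "mdet (M2 b (c * d) c b) = x0" "f X Y = \<kappa> * f (M2 b (c * d) c b) Y"
          "f' X Y = \<kappa> * f' (M2 b (c * d) c b) Y"
      using cuspidal_pair_companion[OF x0 X Y] f f' by metis
    then show ?thesis
    proof cases
      case 1 then show ?thesis using conj X by blast
    next
      case 2 then show ?thesis by simp
    next
      case 3
      \<comment> \<open>The diagonal matrix with entries 1 and -1 conjugates every matrix of this
        companion algebra to its adjugate.\<close>
      have "f (M2 b (c * d) c b) Y = f' (M2 b (c * d) c b) Y"
        by (rule conj[of "M2 1 0 0 (- 1)"]) (use 3 in \<open>auto simp: p_nonunit Y\<close>)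
      then show ?thesis using 3 by simp
    qed
  qed
  obtain A a d i where A: "\<not> p dvd mdet A" "mm Y A = mm A (M2 a (p ^ i * d) (p ^ i) a)" by (rule companion_form)
  define Y' X' where "Y' = M2 a (p ^ i * d) (p ^ i) a" "X' = mm (minv A) (mm X A)"
  have eqX: "mm A X' = mm X A" using minv[OF A(1)] by (simp add: Y'_X'_def mm_assoc[symmetric])
  have eqY: "mm A Y' = mm Y A" using A(2) by (simp add: Y'_X'_def)
  have det: "mdet X' = x0" "mdet Y' = y0"
    using mdet_conj[OF A(1) eqX] mdet_conj[OF A(1) eqY] X Y by auto
  have "f X Y = f X' Y'" "f' X Y = f' X' Y'"
    using cuspidal_pair_conj[OF f A(1) det eqX eqY] cuspidal_pair_conj[OF f' A(1) det eqX eqY] by auto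
  then show ?thesis using companion[OF det(1) Y'_X'_def(1) det(2)] by (simp add: f'_def)
qed

end

section \<open>Central extensions of matrix groups\<close>

text \<open>Both \<open>GL\<^sub>2\<close> and the unitary group are quotients of groups of pairs \<open>(c, X)\<close> with \<open>X\<close> an invertible matrix
  over the small ring and \<open>c\<close> a scalar in a commutative monoid subject to a condition on \<open>c\<close> and \<open>det X\<close>.\<close>

definition ext_carrier :: "('c \<Rightarrow> 'r::comm_ring_1 \<Rightarrow> bool) \<Rightarrow> ('c \<times> 'r m2) set" where
  "ext_carrier ok = {(c, X). ok c (mdet X)}"

definition ext_mul :: "('c \<Rightarrow> 'c \<Rightarrow> 'c) \<Rightarrow> 'c \<times> 'r::comm_ring_1 m2 \<Rightarrow> 'c \<times> 'r m2 \<Rightarrow> 'c \<times> 'r m2" where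
  "ext_mul cm g h = (cm (fst g) (fst h), mm (snd g) (snd h))"

definition ext_one :: "'c \<Rightarrow> 'c \<times> 'r::comm_ring_1 m2" where
  "ext_one c1 = (c1, mid)"

lemma ext_mul_simp [simp]: "ext_mul cm (c, X) (d, Y) = (cm c d, mm X Y)"
  by (simp add: ext_mul_def)

lemma finite_m2: assumes "finite (UNIV :: 'r set)" shows "finite (UNIV :: 'r m2 set)"
proof -
  have "(UNIV :: 'r m2 set) \<subseteq> (\<lambda>(a, b, c, d). M2 a b c d) ` (UNIV \<times> UNIV \<times> UNIV \<times> UNIV)"
  proof
    fix X :: "'r m2"
    show "X \<in> (\<lambda>(a, b, c, d). M2 a b c d) ` (UNIV \<times> UNIV \<times> UNIV \<times> UNIV)"
      by (rule image_eqI[of _ _ "(m11 X, m12 X, m21 X, m22 X)"]) auto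
  qed
  then show ?thesis using assms by (meson finite_SigmaI finite_imageI finite_subset)
qed

text \<open>\<open>ok_ex\<close> makes every unit a determinant, so any two units are the diagonal
  of a torus element for a suitable scalar part. That torus is what makes all primitive characters
  of \<open>U\<close> conjugate.\<close>

locale ext_group = chain_ring_char p l q \<psi>
  for p :: "'r::comm_ring_1" and l q \<psi> +
  fixes cm :: "'c \<Rightarrow> 'c \<Rightarrow> 'c" and c1 :: 'c and ok :: "'c \<Rightarrow> 'r \<Rightarrow> bool"
  assumes fin_c: "finite (UNIV :: 'c set)"
    and cm_assoc: "cm (cm c c') c'' = cm c (cm c' c'')" and cm_comm: "cm c c' = cm c' c"
    and cm_one [simp]: "cm c1 c = c"
    and ok_unit: "ok c a \<Longrightarrow> \<not> p dvd a" and ok_one: "ok c1 1"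
    and ok_mul: "ok c a \<Longrightarrow> ok c' a' \<Longrightarrow> ok (cm c c') (a * a')"
    and ok_ex: "\<not> p dvd a \<Longrightarrow> \<exists>c. ok c a"
    and ok_inv: "ok c a \<Longrightarrow> \<exists>c'. cm c c' = c1 \<and> ok c' (rinv a)"
begin

lemma cm_one_right [simp]: "cm a c1 = a" by (metis cm_comm cm_one)

lemma rinv_unique: "\<not> p dvd x \<Longrightarrow> x * y = 1 \<Longrightarrow> y = rinv x"
  by (metis rinv_cancel(2) mult.right_neutral)

lemma rinv_one [simp]: "rinv 1 = 1"
  using rinv_unique[of 1 1] p_nonunit by simp

lemma mdet_minv: "\<not> p dvd mdet A \<Longrightarrow> mdet (minv A) = rinv (mdet A)"
  by (rule rinv_unique) (auto simp: minv(1) simp flip: mdet_mm)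

lemma ext_fin_group: "fin_group (ext_carrier ok) (ext_mul cm) (ext_one c1)"
proof
  show "finite (ext_carrier ok)"
    using finite_Prod_UNIV[OF fin_c finite_m2[OF fin]] finite_subset subset_UNIV by blast
  show "\<exists>h\<in>ext_carrier ok. ext_mul cm g h = ext_one c1 \<and> ext_mul cm h g = ext_one c1"
    if gG: "g \<in> ext_carrier ok" for g
  proof -
    obtain c X where g: "g = (c, X)" "ok c (mdet X)" using gG by (auto simp: ext_carrier_def)
    obtain c' where c': "cm c c' = c1" "ok c' (rinv (mdet X))" using ok_inv[OF g(2)] by blast
    have u: "\<not> p dvd mdet X" using ok_unit g by blast
    show ?thesis
      using u c' minv[OF u] mdet_minv[OF u] g
      by (intro bexI[of _ "(c', minv X)"]) (auto simp: ext_carrier_def ext_one_def cm_comm[of c'])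
  qed
qed (auto simp: ext_carrier_def ext_mul_def ext_one_def cm_assoc mm_assoc mdet_mm ok_mul ok_one)

end

locale ext_rep = ext_group p l q \<psi> cm c1 ok + irr_rep "ext_carrier ok" "ext_mul cm" "ext_one c1" I \<rho>
  for p :: "'r::comm_ring_1" and l q \<psi> and cm :: "'c \<Rightarrow> 'c \<Rightarrow> 'c" and c1 ok and I :: "'i set" and \<rho>

sublocale ext_rep \<subseteq> char_rep p l q \<psi> "ext_carrier ok" "ext_mul cm" "ext_one c1" I \<rho> ..

definition mcong :: "'r::comm_ring_1 \<Rightarrow> 'r m2 \<Rightarrow> 'r m2 \<Rightarrow> bool" where
  "mcong a X Y \<longleftrightarrow> a dvd m11 X - m11 Y \<and> a dvd m12 X - m12 Y \<and> a dvd m21 X - m21 Y \<and> a dvd m22 X - m22 Y"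

lemma mcong_mm_right: "mcong a X Y \<Longrightarrow> mcong a (mm X Z) (mm Y Z)"
proof (cases X; cases Y; cases Z)
  fix x1 x2 x3 x4 y1 y2 y3 y4 z1 z2 z3 z4
  assume *: "mcong a X Y" "X = M2 x1 x2 x3 x4" "Y = M2 y1 y2 y3 y4" "Z = M2 z1 z2 z3 z4"
  have "a dvd (x1 - y1) * z + (x2 - y2) * w" "a dvd (x3 - y3) * z + (x4 - y4) * w" for z w
    using * by (auto simp: mcong_def intro!: dvd_add dvd_mult2)
  from this[of z1 z3] this[of z2 z4] show ?thesis by (simp add: mcong_def * algebra_simps)
qed

lemma mcong_mm_left: "mcong a X Y \<Longrightarrow> mcong a (mm Z X) (mm Z Y)"
proof (cases X; cases Y; cases Z)
  fix x1 x2 x3 x4 y1 y2 y3 y4 z1 z2 z3 z4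
  assume *: "mcong a X Y" "X = M2 x1 x2 x3 x4" "Y = M2 y1 y2 y3 y4" "Z = M2 z1 z2 z3 z4"
  have "a dvd z * (x1 - y1) + w * (x3 - y3)" "a dvd z * (x2 - y2) + w * (x4 - y4)" for z w
    using * by (auto simp: mcong_def intro!: dvd_add dvd_mult)
  from this[of z1 z2] this[of z3 z4] show ?thesis by (simp add: mcong_def * algebra_simps)
qed

context ext_rep
begin

abbreviation "GG \<equiv> ext_carrier ok"
abbreviation "gm \<equiv> ext_mul cm"

definition uu :: "'r \<Rightarrow> 'c \<times> 'r m2" where "uu x = (c1, M2 1 x 0 1)"
definition ub :: "'r \<Rightarrow> 'c \<times> 'r m2" where "ub z = (c1, M2 1 0 z 1)"
definition ww :: "'c \<times> 'r m2" where "ww = (c1, M2 0 1 (- 1) 0)"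
definition dg :: "'c \<Rightarrow> 'r \<Rightarrow> 'r \<Rightarrow> 'c \<times> 'r m2" where "dg c a b = (c, M2 a 0 0 b)"

lemma GG_iff: "(c, X) \<in> GG \<longleftrightarrow> ok c (mdet X)" by (simp add: ext_carrier_def)

lemma uu_in [simp, intro]: "uu x \<in> GG" by (simp add: uu_def GG_iff ok_one)
lemma ub_in [simp, intro]: "ub x \<in> GG" by (simp add: ub_def GG_iff ok_one)
lemma ww_in [simp, intro]: "ww \<in> GG" by (simp add: ww_def GG_iff ok_one)
lemma sl_in [simp, intro]: "mdet X = 1 \<Longrightarrow> (c1, X) \<in> GG" by (simp add: GG_iff ok_one)
lemma dg_in: "dg c a b \<in> GG \<longleftrightarrow> ok c (a * b)" by (simp add: dg_def GG_iff)

lemma dg_units: "dg c a b \<in> GG \<Longrightarrow> \<not> p dvd a" "dg c a b \<in> GG \<Longrightarrow> \<not> p dvd b"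
  unfolding dg_in using ok_unit unit_mult by blast+

lemma dg_ex: "\<not> p dvd a \<Longrightarrow> \<not> p dvd b \<Longrightarrow> \<exists>c. dg c a b \<in> GG"
  using ok_ex[of "a * b"] by (simp add: dg_in unit_mult)

lemma onepar_uu [simp]: "onepar uu"
proof -
  have "act (uu (x + y)) v = act (uu x) (act (uu y) v)" for x y v
    by (simp add: act_mul[symmetric]) (simp add: uu_def add.commute)
  then show ?thesis by (simp add: onepar_def) (simp add: uu_def ext_one_def mid_def)
qed

text \<open>The level is tested on matrices of determinant 1 with trivial scalar part, so it does
  not change under twists by characters of the determinant and the scalar part.\<close>

definition triv :: "nat \<Rightarrow> bool" where
  "triv i \<longleftrightarrow> (\<forall>X v. mdet X = 1 \<longrightarrow> mcong (p ^ i) X mid \<longrightarrow> v \<in> VS \<longrightarrow> act (c1, X) v = v)"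

lemma triv_top: "triv l"
  unfolding triv_def
proof (intro allI impI)
  fix X and v assume "mdet X = 1" "mcong (p ^ l) X mid" "v \<in> VS"
  then have "X = mid" by (cases X) (simp add: mcong_def p_pow_l mid_def)
  then show "act (c1, X) v = v" using \<open>v \<in> VS\<close> act_one by (simp add: ext_one_def)
qed

lemma act_cong:
  assumes "triv j" "(c, X) \<in> GG" "(c, Y) \<in> GG" "mdet X = mdet Y" "mcong (p ^ j) X Y"
  shows "act (c, X) v = act (c, Y) v"
proof -
  have u: "\<not> p dvd mdet Y" using assms(3) ok_unit by (simp add: GG_iff)
  define Z where "Z = mm X (minv Y)"
  have XZ: "X = mm Z Y" using minv[OF u] by (simp add: Z_def mm_assoc)
  have dZ: "mdet Z = 1" using u assms(4) by (simp add: Z_def mdet_mm mdet_minv)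
  have "mcong (p ^ j) Z mid" using mcong_mm_right[OF assms(5), of "minv Y"] minv[OF u] by (simp add: Z_def)
  then have "act (c1, Z) (act (c, Y) v) = act (c, Y) v" using assms(1,3) dZ unfolding triv_def by blast
  moreover have "gm (c1, Z) (c, Y) = (c, X)" using XZ by simp
  ultimately show ?thesis using act_mul[of "(c1, Z)" "(c, Y)" v] dZ assms(3) by simp
qed

lemma kernel_fixed_on_orbit:
  assumes v: "v \<in> VS" "v \<noteq> (\<lambda>_. 0)" and s: "s \<in> GG"
    and fixd: "\<And>g. g \<in> GG \<Longrightarrow> act s (act g v) = act g v" and w: "w \<in> VS"
  shows "act s w = w"
proof -
  have "\<rho> s i j - \<rho> (ext_one c1) i j = 0" if j: "j \<in> I" for i j
  proof (rule functional_zero_on_orbit[OF v _ j])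
    fix g assume g: "g \<in> GG"
    have "act s (act g v) i = act (ext_one c1) (act g v) i" using fixd[OF g] g by simp
    then show "(\<Sum>k\<in>I. (\<rho> s i k - \<rho> (ext_one c1) i k) * act g v k) = 0"
      unfolding act_def app_def by (simp add: left_diff_distrib sum_subtractf)
  qed
  then have "act s w = act (ext_one c1) w" by (simp add: act_def app_def)
  then show ?thesis using w by simp
qed

text \<open>The congruence kernel is normal, so one fixed vector makes its entire orbit fixed, and
  the orbit spans.\<close>

lemma fixed_imp_triv:
  assumes v: "v \<in> VS" "v \<noteq> (\<lambda>_. 0)"
    and fixd: "\<And>X. mdet X = 1 \<Longrightarrow> mcong (p ^ i) X mid \<Longrightarrow> act (c1, X) v = v"
  shows "triv i"
  unfolding triv_def
proof (intro allI impI)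
  fix X w assume X: "mdet X = 1" "mcong (p ^ i) X mid" and w: "w \<in> VS"
  show "act (c1, X) w = w"
  proof (rule kernel_fixed_on_orbit[OF v _ _ w])
    fix g assume g: "g \<in> GG"
    obtain c Y where gY: "g = (c, Y)" by (cases g)
    have u: "\<not> p dvd mdet Y" using g ok_unit gY by (simp add: GG_iff)
    define Z where "Z = mm (minv Y) (mm X Y)"
    have "mdet Z = 1" using u X by (simp add: Z_def mdet_mm mdet_minv)
    moreover have "mcong (p ^ i) Z mid"
      using mcong_mm_left[OF mcong_mm_right[OF X(2), of Y], of "minv Y"] minv[OF u] by (simp add: Z_def)
    ultimately have Z: "act (c1, Z) v = v" "(c1, Z) \<in> GG" using fixd by auto
    have "gm (c1, X) g = gm g (c1, Z)"
      using minv[OF u] by (simp add: gY Z_def mm_assoc[symmetric])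
    then have "act (c1, X) (act g v) = act g (act (c1, Z) v)"
      using act_mul[of "(c1, X)" g v] act_mul[of g "(c1, Z)" v] g Z X by simp
    then show "act (c1, X) (act g v) = act g v" using Z by simp
  qed (use X in auto)
qed

text \<open>At level 0 the action depends only on the scalar part and the determinant. It is
  therefore commutative, each element acts by a scalar, and irreducibility leaves dimension
  one.\<close>

lemma triv_0_card: assumes "triv 0" shows "card I = 1"
proof -
  have comm: "act (gm g h) v = act (gm h g) v" if gh: "g \<in> GG" "h \<in> GG" for g h v
  proof -
    obtain c X d Y where *: "g = (c, X)" "h = (d, Y)" by (cases g; cases h)
    have "gm g h \<in> GG" "gm h g \<in> GG" using gh by auto
    then show ?thesis unfolding * ext_mul_simp
      by (simp only: cm_comm[of d]) (rule act_cong[OF assms], auto simp: mdet_mm mult.commute mcong_def)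
  qed
  have scal: "\<exists>\<omega>. \<forall>v\<in>VS. act g v = (\<lambda>i. \<omega> * v i)" if g: "g \<in> GG" for g
  proof -
    obtain j where j: "j \<in> I" using I_nonempty by blast
    define \<delta> where "\<delta> = (\<lambda>(i::'i) a. if a = i then 1 else (0::complex))"
    define \<omega> where "\<omega> = act g (\<delta> j) j"
    have *: "\<rho> g a i = \<omega> * \<delta> i a" if i: "i \<in> I" for i a
    proof -
      obtain k where k: "\<And>v. (\<lambda>a. \<Sum>h\<in>GG. k h * act h v a) = (\<lambda>a. if a = i then v j else 0)"
        using matrix_unit_act[OF i j] by blast
      have k1: "(\<lambda>a. \<Sum>h\<in>GG. k h * act h (\<delta> j) a) = \<delta> i" unfolding k by (auto simp: \<delta>_def)
      have "act g (\<delta> i) = (\<lambda>a. \<Sum>h\<in>GG. k h * act g (act h (\<delta> j)) a)"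
        unfolding k1[symmetric] act_lincomb ..
      also have "\<dots> = (\<lambda>a. \<Sum>h\<in>GG. k h * act h (act g (\<delta> j)) a)"
        using g comm by (intro ext sum.cong refl) (simp flip: act_mul)
      also have "\<dots> = (\<lambda>a. \<omega> * \<delta> i a)" unfolding k by (auto simp: \<delta>_def \<omega>_def)
      finally show ?thesis using app_unit[OF i, of "\<rho> g" a] by (simp add: act_def \<delta>_def fun_eq_iff)
    qed
    have "act g v = (\<lambda>i. \<omega> * v i)" if v: "v \<in> VS" for v
    proof
      fix a
      have "act g v a = (\<Sum>i\<in>I. if i = a then \<omega> * v a else 0)"
        unfolding act_def app_def by (intro sum.cong refl) (auto simp: * \<delta>_def)
      then show "act g v a = \<omega> * v a" using finite_I VSD[OF v] by simp
    qed
    then show ?thesis by blast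
  qed
  have "i = j" if ij: "i \<in> I" "j \<in> I" for i j
  proof (rule ccontr)
    assume "i \<noteq> j"
    obtain k where k: "\<And>v. (\<lambda>a. \<Sum>h\<in>GG. k h * act h v a) = (\<lambda>a. if a = i then v j else 0)"
      using matrix_unit_act[OF ij] by blast
    obtain \<omega> where \<omega>: "\<And>g v. g \<in> GG \<Longrightarrow> v \<in> VS \<Longrightarrow> act g v = (\<lambda>i. \<omega> g * v i)"
      using scal by metis
    have "(\<Sum>h\<in>GG. k h * act h (\<lambda>a. if a = j then 1 else 0) i) = 0"
      using \<omega>[OF _ unit_in_VS[OF ij(2)]] \<open>i \<noteq> j\<close> by simp
    then show False using fun_cong[OF k[of "\<lambda>a. if a = j then 1 else 0"], of i] by simp
  qed
  then obtain i where "I = {i}" using I_nonempty by blast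
  then show ?thesis by simp
qed

end

section \<open>Representations of exact level\<close>

locale level_rep = ext_rep p l q \<psi> cm c1 ok I \<rho>
  for p :: "'r::comm_ring_1" and l q \<psi> and cm :: "'c \<Rightarrow> 'c \<Rightarrow> 'c" and c1 ok and I :: "'i set" and \<rho> +
  fixes j :: nat
  assumes j1: "1 \<le> j" and jl: "j \<le> l" and trivj: "triv j" and ntriv: "\<not> triv (j - 1)"
begin

text \<open>Modulo \<open>p ^ j\<close> the multiples of \<open>f\<close> form the last congruence
  layer. Characters of \<open>U\<close> that are trivial on multiples of \<open>p ^ j\<close> have
  parameters divisible by \<open>\<beta>\<close>; they are primitive, that is nontrivial on the last
  layer, when \<open>\<beta> * p\<close> does not divide them.\<close>

definition f :: 'r where "f = p ^ (j - 1)"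
definition \<beta> :: 'r where "\<beta> = p ^ (l - j)"

lemma pj: "p ^ j = f * p"
  using j1 by (simp add: f_def power_Suc2[symmetric] del: power_Suc)

lemma pj_dvd: "p dvd x \<Longrightarrow> p ^ j dvd f * x"
  unfolding pj by (rule mult_dvd_mono) auto

lemma \<beta>f: "\<beta> * f = p ^ (l - 1)"
  unfolding \<beta>_def f_def power_add[symmetric] using j1 jl by simp

lemma \<beta>p: "\<beta> * p = p ^ (l - j + 1)" by (simp add: \<beta>_def)

lemma p_dvd_f: "2 \<le> j \<Longrightarrow> p dvd f"
  unfolding f_def by (rule dvd_power) simp

lemma unit_1f: "2 \<le> j \<Longrightarrow> \<not> p dvd 1 + f * s"
  using p_dvd_f by (intro unit_add) (auto simp: p_nonunit)

lemma act_eqI: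
  assumes "g = (c, X)" "h = (c, Y)" "g \<in> GG" "h \<in> GG" "mdet X = mdet Y" "mcong (p ^ j) X Y"
  shows "act g v = act h v"
  using assms act_cong[OF trivj, of c X Y v] by simp

lemma act_id [simp]: "v \<in> VS \<Longrightarrow> act (c1, M2 1 0 0 1) v = v"
  using act_one by (simp add: ext_one_def mid_def)

lemma dg_uu: "dg c a b \<in> GG \<Longrightarrow> gm (dg c a b) (uu x) = gm (uu (a * rinv b * x)) (dg c a b)"
proof -
  assume "dg c a b \<in> GG"
  then have "\<not> p dvd b" by (rule dg_units)
  moreover have "a * rinv b * x * b = a * x * (b * rinv b)" by (simp only: mult_ac)
  ultimately show ?thesis by (simp add: dg_def uu_def)
qed

lemma act_dg_uu: "dg c a b \<in> GG \<Longrightarrow>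
    act (dg c a b) (act (uu x) v) = act (uu (a * rinv b * x)) (act (dg c a b) v)"
  by (simp add: act_mul[symmetric] dg_uu)

lemma act_uu_uu: "act (uu x) (act (uu y) v) = act (uu (x + y)) v"
  using onepar_uu by (simp add: onepar_def)

lemma mult_uu_unit: assumes "\<not> p dvd a" shows "mult uu (a * b) = mult uu b"
proof -
  obtain c where c: "dg c a 1 \<in> GG" using dg_ex[OF assms, of 1] p_nonunit by auto
  show ?thesis
  proof (rule mult_conj[OF onepar_uu c assms])
    fix x
    have "gm (gm (uu (a * x)) (dg c a 1)) (ginv (dg c a 1)) = uu (a * x)" using c by (simp add: assoc)
    then show "gm (gm (dg c a 1) (uu x)) (ginv (dg c a 1)) = uu (a * x)" using dg_uu[OF c, of x] by simp
  qed
qed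

lemma mult_uu_supp: assumes "mult uu b > 0" shows "\<beta> dvd b"
proof -
  obtain v where v: "v \<in> VS" "v \<noteq> (\<lambda>_. 0)" "spec uu b v = v" using mult_pos_vector[OF onepar_uu assms] by blast
  obtain i where i: "v i \<noteq> 0" using v(2) by auto
  have "\<psi> (p ^ j * b * x) = 1" for x
  proof -
    have "act (uu (p ^ j * x)) v = v"
      using trivj v(1) unfolding triv_def uu_def by (auto simp: mcong_def mid_def)
    moreover have "act (uu (p ^ j * x)) v i = \<psi> (b * (p ^ j * x)) * v i"
      using v(3) spec_fix_iff[OF onepar_uu] by simp
    ultimately show ?thesis using i by (simp add: mult_ac)
  qed
  then have "p ^ j * b = 0" by (rule psi_eq_1_imp)
  then show ?thesis unfolding \<beta>_def by (rule p_pow_annihilator[OF _ jl])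
qed

definition dimN :: nat where "dimN = (\<Sum>b\<in>{b. \<beta> * p dvd b}. mult uu b)"

text \<open>The primitive parameters are the unit multiples of \<open>\<beta>\<close>, hence
  conjugate under the torus and of equal multiplicity; the remaining characters are collected in
  \<open>dimN\<close>.\<close>

lemma dim_formula: "card I = (q - 1) * q ^ (j - 1) * mult uu \<beta> + dimN"
proof -
  have "card I = (\<Sum>b\<in>UNIV. mult uu b)" using sum_mult[OF onepar_uu] by simp
  also have "\<dots> = (\<Sum>b\<in>{b. \<beta> dvd b}. mult uu b)"
  proof (rule sum.mono_neutral_right)
    show "\<forall>b\<in>UNIV - {b. \<beta> dvd b}. mult uu b = 0" using mult_uu_supp by auto
  qed auto
  also have "\<dots> = (\<Sum>b\<in>{b. \<beta> dvd b \<and> \<not> \<beta> * p dvd b}. mult uu b) + dimN"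
    unfolding dimN_def
    by (subst sum.union_disjoint[symmetric]) (auto intro!: sum.cong dest: dvd_mult_left)
  also have "(\<Sum>b\<in>{b. \<beta> dvd b \<and> \<not> \<beta> * p dvd b}. mult uu b)
      = (\<Sum>b\<in>{b. \<beta> dvd b \<and> \<not> \<beta> * p dvd b}. mult uu \<beta>)"
  proof (intro sum.cong refl)
    fix b assume "b \<in> {b. \<beta> dvd b \<and> \<not> \<beta> * p dvd b}"
    then obtain t where t: "b = \<beta> * t" and "\<not> \<beta> * p dvd b" by (auto elim!: dvdE)
    then have "\<not> p dvd t" by (auto intro: mult_dvd_mono)
    note t = t this
    then show "mult uu b = mult uu \<beta>" using mult_uu_unit[OF t(2), of \<beta>] by (simp add: mult.commute)
  qed
  also have "\<dots> = (q - 1) * q ^ (j - 1) * mult uu \<beta>"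
    using card_p_pow_unit[OF j1 jl] by (simp add: \<beta>p) (simp add: \<beta>_def)
  finally show ?thesis .
qed

definition NN :: "('i \<Rightarrow> complex) set" where
  "NN = {v \<in> VS. \<forall>s. act (uu (f * s)) v = v}"

lemma NN_VS: "v \<in> NN \<Longrightarrow> v \<in> VS" by (simp add: NN_def)

lemma act_spec_uu: "act (uu y) (spec uu b v) = spec uu b (act (uu y) v)"
  unfolding spec_eq act_lincomb act_uu_uu by (simp add: add.commute)

lemma spec_uu_NN: assumes "v \<in> NN" "spec uu b v \<noteq> (\<lambda>_. 0)" shows "\<beta> * p dvd b"
proof -
  obtain i where i: "spec uu b v i \<noteq> 0" using assms(2) by auto
  have "\<psi> (f * b * s) = 1" for s
  proof -
    have "act (uu (f * s)) (spec uu b v) = spec uu b v"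
      using assms(1) by (simp add: act_spec_uu NN_def)
    then have "(\<lambda>i. \<psi> (b * (f * s)) * spec uu b v i) = spec uu b v"
      using spec_eigen[OF onepar_uu, of "f * s" b v] by simp
    from fun_cong[OF this, of i] have "\<psi> (b * (f * s)) * spec uu b v i = spec uu b v i" .
    then show ?thesis using i by (simp add: mult_ac)
  qed
  then have "f * b = 0" by (rule psi_eq_1_imp)
  then have "p ^ (l - (j - 1)) dvd b" unfolding f_def by (rule p_pow_annihilator) (use jl in simp)
  moreover have "l - (j - 1) = l - j + 1" using j1 jl by simp
  ultimately show ?thesis unfolding \<beta>p by metis
qed

lemma \<beta>pf: "\<beta> * p * f = 0"
proof -
  have "\<beta> * p * f = p * p ^ (l - 1)" unfolding \<beta>f[symmetric] by (simp only: mult_ac)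
  then show ?thesis by (simp only: p_mult_top)
qed

lemma eigen_NN: assumes "v \<in> VS" "spec uu b v = v" "\<beta> * p dvd b" shows "v \<in> NN"
proof -
  obtain t where t: "b = \<beta> * p * t" using assms(3) by (rule dvdE)
  have "b * (f * s) = (\<beta> * p * f) * (t * s)" for s by (simp only: t mult_ac)
  then have "b * (f * s) = 0" for s by (simp add: \<beta>pf)
  then have "act (uu (f * s)) v = v" for s
    using assms(2) spec_fix_iff[OF onepar_uu, of b v] by simp
  then show ?thesis using assms(1) by (simp add: NN_def)
qed

lemma spec_NN: "v \<in> NN \<Longrightarrow> spec uu b v \<in> NN"
  by (simp add: NN_def act_spec_uu)

lemma dimN_pos_iff: "dimN > 0 \<longleftrightarrow> (\<exists>v\<in>NN. v \<noteq> (\<lambda>_. 0))"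
proof
  assume "dimN > 0"
  then obtain b where "\<beta> * p dvd b" "mult uu b > 0"
    unfolding dimN_def by (metis (mono_tags, lifting) gr0I mem_Collect_eq sum.neutral less_irrefl)
  then show "\<exists>v\<in>NN. v \<noteq> (\<lambda>_. 0)" using mult_pos_vector[OF onepar_uu] eigen_NN by metis
next
  assume "\<exists>v\<in>NN. v \<noteq> (\<lambda>_. 0)"
  then obtain v where v: "v \<in> NN" "v \<noteq> (\<lambda>_. 0)" by blast
  obtain b where b: "spec uu b v \<noteq> (\<lambda>_. 0)" using spec_nonzero[OF onepar_uu NN_VS[OF v(1)] v(2)] by auto
  then have "\<beta> * p dvd b" using spec_uu_NN v by blast
  moreover have "mult uu b > 0" using mult_0[OF onepar_uu, of b v] b by (metis neq0_conv)
  ultimately show "dimN > 0" unfolding dimN_def by (intro sum_pos2[of _ b]) auto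
qed

text \<open>The torus direction of the last layer: for \<open>2 <= j\<close> and modulo
  \<open>p ^ j\<close> the diagonal is \<open>1 + f * s\<close> and
  \<open>1 - f * s\<close>.\<close>

definition Dd :: "'r \<Rightarrow> 'c \<times> 'r m2" where "Dd s = (c1, M2 (1 + f * s) 0 0 (rinv (1 + f * s)))"

lemma Dd_in [simp]: "2 \<le> j \<Longrightarrow> Dd s \<in> GG" using unit_1f by (simp add: Dd_def)

lemma rinv_1f: assumes "2 \<le> j" shows "p ^ j dvd rinv (1 + f * s) - (1 - f * s)"
proof -
  define r where "r = rinv (1 + f * s)"
  have r: "(1 + f * s) * r = 1" unfolding r_def by (rule rinv(1)[OF unit_1f[OF assms]])
  have "r * ((1 + f * s) * (1 - f * s)) = ((1 + f * s) * r) * (1 - f * s)" by (simp only: mult_ac)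
  then have "r - (1 - f * s) = r * (1 - (1 + f * s) * (1 - f * s))"
    by (simp only: r right_diff_distrib) simp
  also have "1 - (1 + f * s) * (1 - f * s) = f * (f * s * s)" by (simp add: algebra_simps)
  finally have "rinv (1 + f * s) - (1 - f * s) = rinv (1 + f * s) * (f * (f * s * s))" by (simp only: r_def)
  then show ?thesis using pj_dvd[of "f * s * s"] p_dvd_f[OF assms] by (simp add: dvd_mult)
qed

lemma onepar_Dd: assumes "2 \<le> j" shows "onepar Dd"
proof -
  have "act (Dd (x + y)) v = act (Dd x) (act (Dd y) v)" for x y v
  proof -
    have "act (Dd (x + y)) v = act (gm (Dd x) (Dd y)) v"
    proof (rule act_eqI)
      show "Dd (x + y) = (c1, M2 (1 + f * (x + y)) 0 0 (rinv (1 + f * (x + y))))" by (simp add: Dd_def)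
      show "gm (Dd x) (Dd y) = (c1, M2 ((1 + f * x) * (1 + f * y)) 0 0 (rinv (1 + f * x) * rinv (1 + f * y)))"
        by (simp add: Dd_def)
      have 1: "p ^ j dvd (1 + f * x) * (1 + f * y) - (1 + f * (x + y))"
        using pj_dvd[of "f * x * y"] p_dvd_f[OF assms] by (simp add: algebra_simps)
      have "rinv (1 + f * (x + y)) - rinv (1 + f * x) * rinv (1 + f * y)
         = rinv (1 + f * (x + y)) * (rinv (1 + f * x) * rinv (1 + f * y)) * ((1 + f * x) * (1 + f * y) - (1 + f * (x + y)))"
      proof -
        define a b c where "a = 1 + f * x" "b = 1 + f * y" "c = 1 + f * (x + y)"
        have u: "\<not> p dvd a" "\<not> p dvd b" "\<not> p dvd c" using unit_1f[OF assms] by (auto simp: a_b_c_def)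
        have "rinv c * (rinv a * rinv b) * (a * b - c) = rinv c * ((rinv a * a) * (rinv b * b)) - (rinv c * c) * (rinv a * rinv b)"
          by (simp add: algebra_simps)
        also have "\<dots> = rinv c - rinv a * rinv b" using u by simp
        finally show ?thesis by (simp add: a_b_c_def)
      qed
      then have 2: "p ^ j dvd rinv (1 + f * (x + y)) - rinv (1 + f * x) * rinv (1 + f * y)" using 1 by (simp add: dvd_mult)
      have 3: "p ^ j dvd (1 + f * (x + y)) - (1 + f * x) * (1 + f * y)" using 1 by (metis dvd_minus_iff minus_diff_eq)
      show "mcong (p ^ j) (M2 (1 + f * (x + y)) 0 0 (rinv (1 + f * (x + y))))
         (M2 ((1 + f * x) * (1 + f * y)) 0 0 (rinv (1 + f * x) * rinv (1 + f * y)))"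
        unfolding mcong_def m2.sel using 2 3 by simp
      define a b where "a = 1 + f * x" "b = 1 + f * y"
      have u: "\<not> p dvd a" "\<not> p dvd b" using unit_1f[OF assms] by (auto simp: a_b_def)
      have "(a * b) * (rinv a * rinv b) = (a * rinv a) * (b * rinv b)" by (simp only: mult_ac)
      then have "(a * b) * (rinv a * rinv b) = 1" using u by simp
      then show "mdet (M2 (1 + f * (x + y)) 0 0 (rinv (1 + f * (x + y)))) =
         mdet (M2 ((1 + f * x) * (1 + f * y)) 0 0 (rinv (1 + f * x) * rinv (1 + f * y)))"
        using unit_1f[OF assms] by (simp add: a_b_def)
    qed (use assms in auto)
    then show ?thesis using assms by (simp add: act_mul)
  qed
  then show ?thesis using assms by (simp add: onepar_def) (simp add: Dd_def ext_one_def mid_def)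
qed

text \<open>For \<open>2 <= j\<close> products of two multiples of \<open>f\<close> vanish modulo
  \<open>p ^ j\<close>. The last layer is then an additive copy of the traceless matrices over the
  residue field and splits into its three coordinate directions.\<close>

lemma act_S:
  assumes "2 \<le> j" and X: "X = M2 (1 + f * x) (f * y) (f * z) (1 + f * t)" and "mdet X = 1"
  shows "act (c1, X) v = act (uu (f * y)) (act (ub (f * z)) (act (Dd x) v))"
proof -
  have ff: "p ^ j dvd f * (f * u)" for u using p_dvd_f[OF assms(1)] by (intro pj_dvd) simp
  have trace: "p ^ j dvd f * x + f * t"
  proof -
    have "f * x + f * t = f * (f * (y * z - x * t))"
      using assms(3) by (simp add: X algebra_simps)
    then show ?thesis using ff by metis
  qed
  have "act (c1, X) v = act (gm (uu (f * y)) (gm (ub (f * z)) (Dd x))) v"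
  proof (rule act_eqI)
    let ?r = "rinv (1 + f * x)"
    show "gm (uu (f * y)) (gm (ub (f * z)) (Dd x)) =
        (c1, M2 (1 + f * x + f * y * (f * z * (1 + f * x))) (f * y * ?r) (f * z * (1 + f * x)) ?r)"
      by (simp add: uu_def ub_def Dd_def)
    obtain k where k: "?r = 1 - f * x + f * p * k"
    proof -
      obtain k where "?r - (1 - f * x) = p ^ j * k" using rinv_1f[OF assms(1), of x] by (rule dvdE)
      then have "?r = 1 - f * x + f * p * k" by (simp add: pj algebra_simps)
      then show ?thesis using that by blast
    qed
    show "mcong (p ^ j) X (M2 (1 + f * x + f * y * (f * z * (1 + f * x))) (f * y * ?r) (f * z * (1 + f * x)) ?r)"
      unfolding mcong_def X m2.sel
    proof (intro conjI)
      have "1 + f * x - (1 + f * x + f * y * (f * z * (1 + f * x))) = f * (f * (- (y * z * (1 + f * x))))"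
        by (simp add: algebra_simps)
      then show "p ^ j dvd 1 + f * x - (1 + f * x + f * y * (f * z * (1 + f * x)))" using ff by metis
      have "f * y - f * y * ?r = f * (f * (y * x - p * (y * k)))"
        unfolding k by (simp add: algebra_simps)
      then show "p ^ j dvd f * y - f * y * ?r" using ff by metis
      have "f * z - f * z * (1 + f * x) = f * (f * (- (z * x)))" by (simp add: algebra_simps)
      then show "p ^ j dvd f * z - f * z * (1 + f * x)" using ff by metis
      have "1 + f * t - ?r = (f * x + f * t) - p ^ j * k" unfolding k pj by (simp add: algebra_simps)
      moreover have "p ^ j dvd (f * x + f * t) - p ^ j * k" using trace by (rule dvd_diff) simp
      ultimately show "p ^ j dvd 1 + f * t - ?r" by (simp only:)
    qed
    show "mdet X = mdet (M2 (1 + f * x + f * y * (f * z * (1 + f * x))) (f * y * ?r) (f * z * (1 + f * x)) ?r)"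
    proof -
      have "mdet (snd (gm (uu (f * y)) (gm (ub (f * z)) (Dd x)))) = 1"
        using unit_1f[OF assms(1), of x] by (simp add: ext_mul_def mdet_mm uu_def ub_def Dd_def del: mm.simps)
      then show ?thesis using assms(3) by (simp add: uu_def ub_def Dd_def)
    qed
  qed (use assms in auto)
  then show ?thesis using assms(1) by (simp add: act_mul)
qed

lemma S_form:
  assumes "mcong (p ^ (j - 1)) X mid"
  obtains x y z t where "X = M2 (1 + f * x) (f * y) (f * z) (1 + f * t)"
proof (cases X)
  case (M2 a b c d)
  have "f dvd a - 1" "f dvd b" "f dvd c" "f dvd d - 1"
    using assms M2 by (auto simp: mcong_def mid_def f_def)
  then obtain x y z t where "a - 1 = f * x" "b = f * y" "c = f * z" "d - 1 = f * t" by (auto elim!: dvdE)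
  then show ?thesis using that[of x y z t] M2 by (simp add: algebra_simps)
qed

lemma no_fixed_vector:
  assumes "2 \<le> j" "v \<in> VS" "\<And>y. act (uu (f * y)) v = v" "\<And>z. act (ub (f * z)) v = v" "\<And>x. act (Dd x) v = v"
  shows "v = (\<lambda>_. 0)"
proof (rule ccontr)
  assume v: "v \<noteq> (\<lambda>_. 0)"
  have "triv (j - 1)"
  proof (rule fixed_imp_triv[OF assms(2) v])
    fix X assume X: "mdet X = 1" "mcong (p ^ (j - 1)) X mid"
    obtain x y z t where "X = M2 (1 + f * x) (f * y) (f * z) (1 + f * t)" by (rule S_form[OF X(2)])
    from act_S[OF assms(1) this X(1)] show "act (c1, X) v = v" using assms(3-5) by simp
  qed
  then show False using ntriv by simp
qed

lemma ww_uu: "gm ww (gm (uu y) (ginv ww)) = ub (- y)"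
proof -
  have "ginv ww = (c1, M2 0 (- 1) 1 0)"
    by (rule ginv_eqI) (auto simp: ww_def ext_one_def mid_def)
  then show ?thesis by (simp add: ww_def uu_def ub_def)
qed

text \<open>Without primitive characters the elements \<open>uu (f * s)\<close> would act trivially,
  hence also their conjugates; these generate the last layer, against the exactness of the
  level.\<close>

lemma mult_uu_pos: "mult uu \<beta> > 0"
proof (rule ccontr)
  assume "\<not> ?thesis"
  then have m0: "mult uu \<beta> = 0" by simp
  have sp: "spec uu b v = (\<lambda>_. 0)" if "\<not> \<beta> * p dvd b" for b v
  proof -
    have "mult uu b = 0"
    proof (cases "\<beta> dvd b")
      case True
      then obtain t where t: "b = \<beta> * t" by (rule dvdE)
      then have "\<not> p dvd t" using that by (auto intro: mult_dvd_mono)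
      then show ?thesis using mult_uu_unit[of t \<beta>] m0 t by (simp add: mult.commute)
    qed (use mult_uu_supp in blast)
    then show ?thesis by (rule mult_0[OF onepar_uu])
  qed
  have U: "act (uu (f * s)) v = v" if v: "v \<in> VS" for v s
  proof
    fix i
    have v': "(\<lambda>i. \<Sum>b\<in>UNIV. 1 * spec uu b v i) = v" using spec_sum[OF onepar_uu v] by auto
    have "act (uu (f * s)) v i = (\<Sum>b\<in>UNIV. 1 * act (uu (f * s)) (spec uu b v) i)"
      using act_lincomb[where S = UNIV and c = "\<lambda>_. 1" and w = "\<lambda>b. spec uu b v"] v' by metis
    also have "\<dots> = (\<Sum>b\<in>UNIV. spec uu b v i)"
    proof (intro sum.cong refl)
      fix b
      show "1 * act (uu (f * s)) (spec uu b v) i = spec uu b v i"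
      proof (cases "\<beta> * p dvd b")
        case True
        have "spec uu b (spec uu b v) = spec uu b v"
          using spec_proj[OF onepar_uu, of b] v unfolding proj_kernel_def spec_def by blast
        then have "spec uu b v \<in> NN" using True by (intro eigen_NN) auto
        then have "act (uu (f * s)) (spec uu b v) = spec uu b v" unfolding NN_def by blast
        then show ?thesis by simp
      qed (simp add: sp)
    qed
    finally show "act (uu (f * s)) v i = v i" using spec_sum[OF onepar_uu v] by simp
  qed
  have B: "act (ub (f * s)) v = v" if v: "v \<in> VS" for v s
  proof -
    have "act (ub (f * s)) v = act ww (act (uu (f * (- s))) (act (ginv ww) v))"
      using ww_uu[of "f * (- s)"] by (simp add: act_mul[symmetric])
    then show ?thesis using U[of "act (ginv ww) v" "- s"] v by simp
  qed
  have "triv (j - 1)"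
  proof (cases "2 \<le> j")
    case True
    have D: "act (Dd s) v = v" if v: "v \<in> VS" for v s
    proof -
      have 1: "act (ub 1) (act (uu (f * (- s))) (act (ub (- 1)) v)) = v"
      proof -
        have "act (ub 1) (act (ub (- 1)) v) = v"
          using v by (simp add: act_mul[symmetric]) (simp add: ub_def)
        then show ?thesis using U[of "act (ub (- 1)) v" "- s"] by simp
      qed
      \<comment> \<open>Conjugating an upper unipotent of the last layer by \<open>ub 1\<close>
        creates a diagonal component, from which \<open>Dd s\<close> is isolated.\<close>
      define X where "X = M2 (1 + f * s) (f * (- s)) (f * s) (1 + f * (- s))"
      have X: "gm (ub 1) (gm (uu (f * (- s))) (ub (- 1))) = (c1, X)"
        by (simp add: ub_def uu_def X_def)
      have "mdet X = 1" by (simp add: X_def algebra_simps)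
      then have "act (c1, X) v = act (uu (f * (- s))) (act (ub (f * s)) (act (Dd s) v))"
        by (rule act_S[OF True X_def])
      also have "\<dots> = act (Dd s) v"
        using U[of "act (ub (f * s)) (act (Dd s) v)" "- s"] B[of "act (Dd s) v" s] True by simp
      finally have "act (c1, X) v = act (Dd s) v" .
      moreover have "act (c1, X) v = v" unfolding X[symmetric] using 1 by (simp add: act_mul)
      ultimately show ?thesis by simp
    qed
    show ?thesis unfolding triv_def
    proof (intro allI impI)
      fix X v assume X: "mdet X = 1" "mcong (p ^ (j - 1)) X mid" "v \<in> VS"
      obtain x y z t where "X = M2 (1 + f * x) (f * y) (f * z) (1 + f * t)" by (rule S_form[OF X(2)])
      from act_S[OF True this X(1)] show "act (c1, X) v = v" using U B D X(3) by simp
    qed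
  next
    case False
    then have "j = 1" using j1 by simp
    then have f1: "f = 1" unfolding f_def by simp
    have U1: "act (uu s) v = v" if "v \<in> VS" for v s using U[OF that, of s] f1 by simp
    have B1: "act (ub s) v = v" if "v \<in> VS" for v s using B[OF that, of s] f1 by simp
    \<comment> \<open>For \<open>j = 1\<close> the layer is all of \<open>SL2\<close>. A matrix with
      unit lower left entry is a product of three elementary ones; any other matrix acquires such an
      entry after multiplication by \<open>ub 1\<close>.\<close>
    have cu: "act (c1, X) v = v" if X: "mdet X = 1" "\<not> p dvd m21 X" and v: "v \<in> VS" for X v
    proof (cases X)
      case (M2 a b c d)
      have c: "\<not> p dvd c" using X M2 by simp
      have "(a - 1) * rinv c * ((1 + (c * ((d - 1) * rinv c)))) + (d - 1) * rinv c = b"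
      proof -
        have "c * ((a - 1) * rinv c * ((1 + (c * ((d - 1) * rinv c)))) + (d - 1) * rinv c) = 
           (c * rinv c) * ((a - 1) * (1 + (c * rinv c) * (d - 1)) + (d - 1))" by (simp add: algebra_simps)
        also have "\<dots> = a * d - 1" using c by (simp add: algebra_simps)
        also have "\<dots> = c * b" using X(1) M2 by (simp add: algebra_simps)
        finally show ?thesis using unit_cancel[OF c] by blast
      qed
      moreover have "c * ((d - 1) * rinv c) = d - 1"
      proof -
        have "c * ((d - 1) * rinv c) = (c * rinv c) * (d - 1)" by (simp only: mult_ac)
        then show ?thesis using c by simp
      qed
      moreover have "(a - 1) * rinv c * c = a - 1" using c by (simp add: mult.assoc)
      ultimately have "gm (uu ((a - 1) * rinv c)) (gm (ub c) (uu ((d - 1) * rinv c))) = (c1, X)"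
        by (simp add: uu_def ub_def M2 add.commute)
      then have "act (c1, X) v = act (uu ((a - 1) * rinv c)) (act (ub c) (act (uu ((d - 1) * rinv c)) v))"
        by (simp add: act_mul[symmetric])
      then show ?thesis using U1 B1 v by simp
    qed
    have "act (c1, X) v = v" if X: "mdet X = 1" and v: "v \<in> VS" for X v
    proof (cases "p dvd m21 X")
      case True
      obtain a b c d where M2: "X = M2 a b c d" by (cases X)
      have "\<not> p dvd a"
      proof
        assume "p dvd a"
        then have "p dvd a * d - b * c" using True M2 by (intro dvd_diff) auto
        then show False using X M2 p_nonunit by simp
      qed
      then have "\<not> p dvd m21 (mm (M2 1 0 1 1) X)" using True M2 by (simp add: unit_add)
      then have "act (c1, mm (M2 1 0 1 1) X) v = v" using X v by (intro cu) (auto simp: mdet_mm)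
      moreover have "(c1, mm (M2 1 0 1 1) X) = gm (ub 1) (c1, X)" by (simp add: ub_def)
      ultimately have "act (ub 1) (act (c1, X) v) = v" using X by (simp add: act_mul)
      moreover have "act (ub 1) (act (c1, X) v) = act (c1, X) v" using B1 X by simp
      ultimately show ?thesis by simp
    qed (use cu X v in blast)
    then show ?thesis unfolding triv_def by blast
  qed
  then show False using ntriv by simp
qed

end

section \<open>Uniqueness of Whittaker vectors\<close>

context level_rep
begin

subsection \<open>Uniqueness of Whittaker vectors\<close>

text \<open>Gelfand's trick with the reflection in the antidiagonal, which fixes each
  \<open>uu x\<close>. A double coset of \<open>U\<close> is either stable under the reflection
  modulo \<open>p ^ j\<close> or supports no operator equivariant for the primitive
  character.\<close>

lemma mult_uu_le_1: "mult uu \<beta> \<le> 1"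
  unfolding mult_def
proof (rule rank_le_1I[OF spec_proj[OF onepar_uu]])
  fix v w i i'
  assume v: "v \<in> VS" "app I (specK uu \<beta>) v = v" and w: "w \<in> VS" "app I (specK uu \<beta>) w = w"
  define H where "H = range uu"
  define \<chi> where "\<chi> = (\<lambda>g :: 'c \<times> 'r m2. \<psi> (\<beta> * m12 (snd g)))"
  define \<iota> where "\<iota> = (\<lambda>g :: 'c \<times> 'r m2. (fst g, M2 (m22 (snd g)) (m12 (snd g)) (m21 (snd g)) (m11 (snd g))))"
  have \<chi>u [simp]: "\<chi> (uu x) = \<psi> (\<beta> * x)" for x by (simp add: \<chi>_def uu_def)
  have \<iota>u [simp]: "\<iota> (uu x) = uu x" for x by (simp add: \<iota>_def uu_def)
  have uu_mul: "gm (uu x) (uu y) = uu (x + y)" for x y by (simp add: uu_def add.commute)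
  have uu_inv: "ginv (uu x) = uu (- x)" for x
    by (rule ginv_eqI) (auto simp: uu_mul, simp add: uu_def ext_one_def mid_def)
  have eig: "act h v = (\<lambda>i. \<chi> h * v i)" if "v \<in> VS" "app I (specK uu \<beta>) v = v" "h \<in> H" for v h
    using that spec_fix_iff[OF onepar_uu, of \<beta> v] unfolding spec_def H_def by auto
  show "v i * w i' = v i' * w i"
  proof (rule gelfand_trick[where H = H and \<chi> = \<chi> and \<iota> = \<iota>])
    show "H \<subseteq> GG" by (auto simp: H_def)
    have "uu 0 = ext_one c1" by (simp add: uu_def ext_one_def mid_def)
    then show "ext_one c1 \<in> H" unfolding H_def by (metis rangeI)
    show "\<chi> (ext_one c1) = 1" by (simp add: \<chi>_def ext_one_def mid_def)
    show "gm h k \<in> H" "\<chi> (gm h k) = \<chi> h * \<chi> k" if "h \<in> H" "k \<in> H" for h k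
      using that by (auto simp: H_def uu_mul distrib_left psi_add)
    show "ginv h \<in> H" "\<iota> h \<in> H" "\<iota> (\<iota> h) = h" "\<chi> (\<iota> h) = \<chi> h" if "h \<in> H" for h
      using that by (auto simp: H_def uu_inv)
    show "\<iota> g \<in> GG" if "g \<in> GG" for g
      using that by (cases g; cases "snd g") (auto simp: \<iota>_def GG_iff mult.commute)
    show "\<iota> (gm g h) = gm (\<iota> h) (\<iota> g)" if "g \<in> GG" "h \<in> GG" for g h
      by (cases g; cases h; cases "snd g"; cases "snd h") (auto simp: \<iota>_def cm_comm mult_ac add_ac)
    show "act h v = (\<lambda>i. \<chi> h * v i)" "act h w = (\<lambda>i. \<chi> h * w i)" if "h \<in> H" for h
      using eig v w that by blast+
  next
    fix x g i
    assume x: "x \<in> VS" "\<And>h. h \<in> H \<Longrightarrow> act h x = (\<lambda>i. \<chi> h * x i)" and g: "g \<in> GG"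
    define T where "T = (\<lambda>g. twisted_sum H \<chi> (act g x))"
    have inj: "inj uu" by (auto simp: inj_def uu_def)
    have T_sum: "T g = (\<lambda>i. \<Sum>y\<in>UNIV. \<psi> (- (\<beta> * y)) * act (uu y) (act g x) i)" for g
      unfolding T_def twisted_sum_def H_def by (simp add: sum.reindex[OF inj] uu_inv)
    have T: "T (gm (uu a) (gm g (uu b))) = (\<lambda>i. \<psi> (\<beta> * (a + b)) * T g i)" if g: "g \<in> GG" for g a b
    proof
      fix i
      have "act (gm (uu a) (gm g (uu b))) x = (\<lambda>i. \<psi> (\<beta> * b) * act (uu a) (act g x) i)"
        using g x(2)[of "uu b"] by (simp add: act_mul H_def act_scale)
      then have "T (gm (uu a) (gm g (uu b))) i
         = (\<Sum>y\<in>UNIV. \<psi> (- (\<beta> * y)) * (\<psi> (\<beta> * b) * act (uu (y + a)) (act g x) i))"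
        by (simp add: T_sum act_scale act_uu_uu)
      also have "\<dots> = (\<Sum>y\<in>UNIV. \<psi> (- (\<beta> * (y - a))) * (\<psi> (\<beta> * b) * act (uu y) (act g x) i))"
        by (rule sum.reindex_bij_witness[of _ "\<lambda>y. y - a" "\<lambda>y. y + a"]) auto
      also have "\<dots> = (\<Sum>y\<in>UNIV. \<psi> (\<beta> * (a + b)) * (\<psi> (- (\<beta> * y)) * act (uu y) (act g x) i))"
      proof (intro sum.cong refl)
        fix y
        have "\<psi> (- (\<beta> * (y - a))) * \<psi> (\<beta> * b) = \<psi> (\<beta> * (a + b)) * \<psi> (- (\<beta> * y))"
          unfolding psi_add[symmetric] by (simp add: algebra_simps)
        then show "\<psi> (- (\<beta> * (y - a))) * (\<psi> (\<beta> * b) * act (uu y) (act g x) i)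
          = \<psi> (\<beta> * (a + b)) * (\<psi> (- (\<beta> * y)) * act (uu y) (act g x) i)"
          by (simp only: mult.assoc[symmetric])
      qed
      finally show "T (gm (uu a) (gm g (uu b))) i = \<psi> (\<beta> * (a + b)) * T g i"
        by (simp add: T_sum sum_distrib_left)
    qed
    have T_eq: "T g = T h" if "\<And>v. act g v = act h v" for g h using that by (simp add: T_def)
    \<comment> \<open>If no \<open>uu y\<close> conjugates \<open>g\<close> to its reflection, the
      lower left entry is more divisible than \<open>d - a\<close>. Then some \<open>y\<close> and
      \<open>z\<close> satisfy \<open>uu y g uu z = g\<close> modulo \<open>p ^ j\<close> although
      the character at \<open>y + z\<close> is not 1.\<close>
    have zero: "T (\<kappa>, M2 a b c d) = (\<lambda>_. 0)"
      if G: "(\<kappa>, M2 a b c d) \<in> GG" and no: "\<And>y. \<not> p ^ j dvd d - a - y * c" for \<kappa> a b c d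
    proof -
      have cn: "p dvd c"
      proof (rule ccontr)
        assume c: "\<not> p dvd c"
        have "d - a - (d - a) * rinv c * c = 0" using c by (simp add: mult.assoc)
        then show False using no[of "(d - a) * rinv c"] by simp
      qed
      have a: "\<not> p dvd a"
      proof
        assume "p dvd a"
        then have "p dvd a * d - b * c" using cn by (intro dvd_diff) auto
        then show False using G ok_unit by (auto simp: GG_iff)
      qed
      have "d - a \<noteq> 0" using no[of 0] by auto
      then obtain m u where m: "m < l" "\<not> p dvd u" "d - a = p ^ m * u" by (rule valuation)
      have mj: "m < j"
      proof (rule ccontr)
        assume "\<not> m < j"
        then have "p ^ j dvd d - a" unfolding m(3) by (simp add: le_imp_power_dvd)
        then show False using no[of 0] by simp
      qed
      have cm: "p ^ (m + 1) dvd c"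
      proof (cases "c = 0")
        case False
        then obtain k w where k: "k < l" "\<not> p dvd w" "c = p ^ k * w" by (rule valuation)
        have "m < k"
        proof (rule ccontr)
          assume "\<not> m < k"
          then have "p ^ m = p ^ (m - k) * p ^ k" by (simp flip: power_add)
          moreover have "(p ^ (m - k) * u * rinv w) * c = (p ^ (m - k) * p ^ k) * u * (w * rinv w)"
            by (simp only: k(3) mult_ac)
          ultimately have "d - a = (p ^ (m - k) * u * rinv w) * c" using k(2) by (simp add: m(3))
          then show False using no[of "p ^ (m - k) * u * rinv w"] by simp
        qed
        then show ?thesis unfolding k(3) by (intro dvd_mult2 le_imp_power_dvd) simp
      qed simp
      obtain y0 where y0: "\<psi> (p ^ (l - 1) * y0) \<noteq> 1" using psi_nontriv by blast
      \<comment> \<open>The power is the smallest for which \<open>y * c\<close> certainly vanishes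
        modulo \<open>p ^ j\<close>; since \<open>d - a\<close> has valuation only \<open>m\<close>,
        the sum \<open>y + z\<close> still reaches the last layer, and the unit factors make it
        \<open>f * y0\<close>.\<close>
      define y where "y = p ^ (j - 1 - m) * (- (a * rinv u * y0))"
      define z where "z = - (y * d * rinv a)"
      have yc: "p ^ j dvd y * c"
      proof -
        have "p ^ (j - 1 - m) * p ^ (m + 1) dvd y * c" unfolding y_def using cm by (intro mult_dvd_mono) auto
        moreover have "p ^ (j - 1 - m) * p ^ (m + 1) = p ^ j" unfolding power_add[symmetric] using mj by simp
        ultimately show ?thesis by metis
      qed
      have zc: "p ^ j dvd z * c"
      proof -
        have "z * c = (y * c) * (- (d * rinv a))" by (simp add: z_def)
        then show ?thesis using yc by (metis dvd_mult2)
      qed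
      have za: "z * a = - (y * d)" using a by (simp add: z_def mult.assoc)
      have "act (gm (uu y) (gm (\<kappa>, M2 a b c d) (uu z))) v = act (\<kappa>, M2 a b c d) v" for v
      proof (rule act_eqI[where c = \<kappa>])
        show "gm (uu y) (gm (\<kappa>, M2 a b c d) (uu z)) = (\<kappa>, M2 (a + y * c) (a * z + b + y * (c * z + d)) c (c * z + d))"
          by (simp add: uu_def)
        show "mcong (p ^ j) (M2 (a + y * c) (a * z + b + y * (c * z + d)) c (c * z + d)) (M2 a b c d)"
          unfolding mcong_def m2.sel
        proof (intro conjI)
          have "a * z + b + y * (c * z + d) - b = (y * c) * z" using za by (simp add: algebra_simps)
          then show "p ^ j dvd a * z + b + y * (c * z + d) - b" using yc by (metis dvd_mult2)
          show "p ^ j dvd c * z + d - d" using zc by (simp add: mult.commute)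
        qed (use yc in auto)
        show "mdet (M2 (a + y * c) (a * z + b + y * (c * z + d)) c (c * z + d)) = mdet (M2 a b c d)"
          by (simp add: algebra_simps)
      qed (use G in auto)
      from T_eq[OF this] have fixT: "T (\<kappa>, M2 a b c d) = (\<lambda>i. \<psi> (\<beta> * (y + z)) * T (\<kappa>, M2 a b c d) i)"
        using T[OF G, of y z] by simp
      moreover have "\<psi> (\<beta> * (y + z)) \<noteq> 1"
      proof -
        have "a * (y + z) = y * (a - d)" using za by (simp add: algebra_simps)
        then have "y + z = rinv a * (y * (a - d))" using a by (metis rinv_cancel(2))
        also have "\<dots> = (rinv a * a) * (rinv u * u) * (p ^ (j - 1 - m) * p ^ m) * y0"
        proof -
          have "a - d = - (p ^ m * u)" using m(3) by (simp add: algebra_simps)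
          then show ?thesis unfolding y_def
            by (simp only: mult_minus_left mult_minus_right minus_minus mult_ac)
        qed
        also have "\<dots> = f * y0"
        proof -
          have "p ^ (j - 1 - m) * p ^ m = f" unfolding f_def power_add[symmetric] using mj by simp
          then show ?thesis using a m(2) by simp
        qed
        finally have "\<beta> * (y + z) = p ^ (l - 1) * y0" unfolding \<beta>f[symmetric] by (simp add: mult.assoc)
        then show ?thesis using y0 by simp
      qed
      ultimately have "T (\<kappa>, M2 a b c d) i = 0" for i
        using fun_cong[OF fixT, of i] by (metis mult_cancel_right1)
      then show ?thesis by auto
    qed
    obtain \<kappa> X where gX: "g = (\<kappa>, X)" by (cases g)
    obtain a b c d where X: "X = M2 a b c d" by (cases X)
    have \<iota>g: "\<iota> g = (\<kappa>, M2 d b c a)" by (simp add: \<iota>_def gX X)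
    have G: "(\<kappa>, M2 a b c d) \<in> GG" "(\<kappa>, M2 d b c a) \<in> GG" using g gX X by (auto simp: GG_iff mult.commute)
    have "T g = T (\<iota> g)"
    proof (cases "\<exists>y. p ^ j dvd d - a - y * c")
      case True
      then obtain y where y: "p ^ j dvd d - a - y * c" by blast
      have "act (gm (uu y) (gm (\<kappa>, M2 a b c d) (uu (- y)))) v = act (\<kappa>, M2 d b c a) v" for v
      proof (rule act_eqI[where c = \<kappa>])
        show "gm (uu y) (gm (\<kappa>, M2 a b c d) (uu (- y)))
          = (\<kappa>, M2 (a + y * c) (a * (- y) + b + y * (c * (- y) + d)) c (c * (- y) + d))"
          by (simp add: uu_def)
        show "mcong (p ^ j) (M2 (a + y * c) (a * (- y) + b + y * (c * (- y) + d)) c (c * (- y) + d)) (M2 d b c a)"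
          unfolding mcong_def m2.sel
        proof (intro conjI)
          have "a + y * c - d = - (d - a - y * c)" by simp
          then show "p ^ j dvd a + y * c - d" using y by (simp only: dvd_minus_iff)
          have "a * (- y) + b + y * (c * (- y) + d) - b = y * (d - a - y * c)" by (simp add: algebra_simps)
          then show "p ^ j dvd a * (- y) + b + y * (c * (- y) + d) - b" using y by (metis dvd_mult)
          have "c * (- y) + d - a = d - a - y * c" by (simp add: algebra_simps)
          then show "p ^ j dvd c * (- y) + d - a" using y by metis
        qed simp
        show "mdet (M2 (a + y * c) (a * (- y) + b + y * (c * (- y) + d)) c (c * (- y) + d)) = mdet (M2 d b c a)"
          by (simp add: algebra_simps)
      qed (use G in auto)
      from T_eq[OF this] have "T (\<kappa>, M2 d b c a) = T (\<kappa>, M2 a b c d)" using T[OF G(1), of y "- y"] by simp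
      then show ?thesis unfolding \<iota>g by (simp add: gX X)
    next
      case False
      have "\<not> p ^ j dvd a - d - y * c" for y
      proof
        assume "p ^ j dvd a - d - y * c"
        then have "p ^ j dvd - (a - d - y * c)" by (simp only: dvd_minus_iff)
        moreover have "- (a - d - y * c) = d - a - (- y) * c" by (simp add: algebra_simps)
        ultimately show False using False by metis
      qed
      then have "T (\<kappa>, M2 d b c a) = T (\<kappa>, M2 a b c d)" using False zero[OF G(1)] zero[OF G(2)] by simp
      then show ?thesis unfolding \<iota>g by (simp add: gX X)
    qed
    then show "twisted_sum H \<chi> (act g x) i = twisted_sum H \<chi> (act (\<iota> g) x) i" by (simp add: T_def)
  qed (use v w in auto)
qed

lemma mult_uu_1: "mult uu \<beta> = 1"
  using mult_uu_pos mult_uu_le_1 by simp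

lemma dim_formula': "card I = (q - 1) * q ^ (j - 1) + dimN"
  using dim_formula mult_uu_1 by simp

end

section \<open>Vectors fixed by the deepest unipotent subgroup\<close>

context chain_ring
begin

text \<open>Every fibre of \<open>F\<close> on this ideal contains a full coset of the ideal
  generated by \<open>p ^ i\<close>.\<close>

lemma card_image_mod:
  assumes "k \<le> i" "i \<le> l" and F: "\<And>x y. p ^ i dvd x - y \<Longrightarrow> F x = F y"
  shows "card (F ` {x. p ^ k dvd x}) \<le> q ^ (i - k)"
proof -
  define A where "A = {x. p ^ k dvd x}"
  have ki: "p ^ k dvd p ^ i" using assms(1) by (rule le_imp_power_dvd)
  have fib: "q ^ (l - i) \<le> card {x \<in> A. F x = y}" if yA: "y \<in> F ` A" for y
  proof -
    obtain x where x: "x \<in> A" "y = F x" using yA by blast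
    have "card {t. p ^ i dvd t} = card ((\<lambda>t. x + t) ` {t. p ^ i dvd t})"
      by (rule card_image[symmetric]) (simp add: inj_on_def)
    also have "\<dots> \<le> card {x \<in> A. F x = y}"
    proof (rule card_mono)
      show "(\<lambda>t. x + t) ` {t. p ^ i dvd t} \<subseteq> {x \<in> A. F x = y}"
      proof (intro subsetI CollectI conjI)
        fix s assume "s \<in> (\<lambda>t. x + t) ` {t. p ^ i dvd t}"
        then obtain t where t: "s = x + t" "p ^ i dvd t" by blast
        have "p ^ k dvd t" using ki t(2) by (rule dvd_trans)
        then show "s \<in> A" using x(1) t(1) by (simp add: A_def)
        show "F s = y" unfolding x(2) by (rule F) (simp add: t)
      qed
    qed simp
    finally show ?thesis using card_p_pow[OF assms(2)] by simp
  qed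
  have "card (F ` A) * q ^ (l - i) \<le> (\<Sum>y\<in>F ` A. card {x \<in> A. F x = y})"
    using sum_bounded_below[of "F ` A" "q ^ (l - i)" "\<lambda>y. card {x \<in> A. F x = y}"] fib by simp
  also have "\<dots> = card A"
    using sum.image_gen[of A "\<lambda>_. 1::nat" F] by simp
  also have "\<dots> = q ^ (i - k) * q ^ (l - i)"
    using assms card_p_pow[of k] unfolding A_def power_add[symmetric] by simp
  finally show ?thesis using q_ge_3 by (simp add: A_def)
qed

end

context level_rep
begin

lemma act_nonzero: "g \<in> GG \<Longrightarrow> v \<in> VS \<Longrightarrow> v \<noteq> (\<lambda>_. 0) \<Longrightarrow> act g v \<noteq> (\<lambda>_. 0)"
  by (metis act_inv_left act_zero)

lemma NN_T: assumes "v \<in> NN" "dg c a b \<in> GG" shows "act (dg c a b) v \<in> NN"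
proof -
  have u: "\<not> p dvd a" "\<not> p dvd b" using dg_units assms(2) by blast+
  have "act (uu (f * s)) (act (dg c a b) v) = act (dg c a b) v" for s
  proof -
    have "a * rinv b * (f * (b * rinv a * s)) = (a * rinv a) * (b * rinv b) * (f * s)" by (simp only: mult_ac)
    then have "a * rinv b * (f * (b * rinv a * s)) = f * s" using u by simp
    then have "act (uu (f * s)) (act (dg c a b) v) = act (dg c a b) (act (uu (f * (b * rinv a * s))) v)"
      using act_dg_uu[OF assms(2)] by simp
    also have "act (uu (f * (b * rinv a * s))) v = v" using assms(1) unfolding NN_def by blast
    finally show ?thesis .
  qed
  then show ?thesis using assms(2) unfolding NN_def by blast
qed

lemma NN_add_f: "v \<in> NN \<Longrightarrow> act (uu (x + f * s)) v = act (uu x) v"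
  unfolding act_uu_uu[symmetric] by (simp add: NN_def)

lemma NN_lincomb: "(\<And>s. s \<in> S \<Longrightarrow> w s \<in> NN) \<Longrightarrow> (\<lambda>i. \<Sum>s\<in>S. c s * w s i) \<in> NN"
  unfolding NN_def using lincomb_in[of S w c] by (simp add: act_lincomb)

text \<open>On \<open>N\<close> the parameter of \<open>uu\<close> matters only modulo
  \<open>f\<close>, and a torus element with \<open>a\<close> congruent to \<open>b\<close> modulo
  \<open>f\<close> scales it by 1 modulo \<open>f\<close>.\<close>

lemma act_T'_uu:
  assumes "v \<in> NN" "dg c a b \<in> GG" "f dvd a - b"
  shows "act (dg c a b) (act (uu x) v) = act (uu x) (act (dg c a b) v)"
proof -
  obtain k where k: "a - b = f * k" using assms(3) by (rule dvdE)
  have u: "\<not> p dvd b" using dg_units assms(2) by blast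
  have "a * rinv b * x = (b + f * k) * rinv b * x" using k by (metis add.commute diff_add_cancel)
  also have "\<dots> = (b * rinv b) * x + f * (k * rinv b * x)" by (simp add: algebra_simps)
  finally have "a * rinv b * x = x + f * (k * rinv b * x)" using u by simp
  then show ?thesis using act_dg_uu[OF assms(2)] NN_add_f[OF NN_T[OF assms(1,2)]] by simp
qed

lemma Dd_dg: "Dd s = dg c1 (1 + f * s) (rinv (1 + f * s))" by (simp add: Dd_def dg_def)

lemma f_dvd_Dd: assumes "2 \<le> j" shows "f dvd (1 + f * s) - rinv (1 + f * s)"
proof -
  obtain k where "rinv (1 + f * s) - (1 - f * s) = p ^ j * k" using rinv_1f[OF assms] by (rule dvdE)
  then have "(1 + f * s) - rinv (1 + f * s) = f * (2 * s - p * k)" by (simp add: pj algebra_simps)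
  then show ?thesis by simp
qed

lemma Dd_NN: "2 \<le> j \<Longrightarrow> v \<in> NN \<Longrightarrow> act (Dd s) v \<in> NN"
  using NN_T Dd_in unfolding Dd_dg by blast

lemma Dd_uu: "2 \<le> j \<Longrightarrow> v \<in> NN \<Longrightarrow> act (Dd s) (act (uu x) v) = act (uu x) (act (Dd s) v)"
  using act_T'_uu f_dvd_Dd Dd_in unfolding Dd_dg by blast

lemma uu_f_ub:
  assumes "p dvd z" shows "act (uu (f * s)) (act (ub z) v) = act (ub z) (act (uu (f * s)) v)"
proof -
  have "act (gm (uu (f * s)) (ub z)) v = act (gm (ub z) (uu (f * s))) v"
  proof (rule act_eqI)
    show "gm (uu (f * s)) (ub z) = (c1, M2 (1 + f * s * z) (f * s) z 1)" by (simp add: uu_def ub_def)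
    show "gm (ub z) (uu (f * s)) = (c1, M2 1 (f * s) z (z * (f * s) + 1))" by (simp add: uu_def ub_def)
    have "p ^ j dvd f * (s * z)" using assms by (intro pj_dvd) simp
    then show "mcong (p ^ j) (M2 (1 + f * s * z) (f * s) z 1) (M2 1 (f * s) z (z * (f * s) + 1))"
      by (simp add: mcong_def mult_ac)
  qed (auto simp: algebra_simps)
  then show ?thesis by (simp add: act_mul)
qed

lemma Dd_ub:
  assumes "2 \<le> j" "p dvd z" shows "act (Dd s) (act (ub z) v) = act (ub z) (act (Dd s) v)"
proof -
  let ?a = "1 + f * s" let ?r = "rinv (1 + f * s)"
  have "act (gm (Dd s) (ub z)) v = act (gm (ub z) (Dd s)) v"
  proof (rule act_eqI)
    show "gm (Dd s) (ub z) = (c1, M2 ?a 0 (?r * z) ?r)" by (simp add: Dd_def ub_def)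
    show "gm (ub z) (Dd s) = (c1, M2 ?a 0 (z * ?a) ?r)" by (simp add: Dd_def ub_def)
    obtain k where k: "?a - ?r = f * k" using f_dvd_Dd[OF assms(1)] by (rule dvdE)
    have "?r * z - z * ?a = - (z * (?a - ?r))"
      by (simp only: right_diff_distrib minus_diff_eq mult.commute[of ?r z])
    also have "\<dots> = f * (- (z * k))" unfolding k by (simp add: mult_ac)
    finally have "p ^ j dvd ?r * z - z * ?a" using pj_dvd[of "- (z * k)"] assms(2) by simp
    then show "mcong (p ^ j) (M2 ?a 0 (?r * z) ?r) (M2 ?a 0 (z * ?a) ?r)"
      unfolding mcong_def m2.sel by simp
  qed (use assms in auto)
  then show ?thesis using assms(1) by (simp add: act_mul)
qed

text \<open>The commutator relation behind the next induction: moving \<open>ub z\<close> past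
  \<open>uu x\<close> on \<open>N\<close> costs the torus element
  \<open>Dd \<theta>\<close>.\<close>

lemma uu_ub_Dd:
  assumes "2 \<le> j" "p dvd z" "x * z = f * \<theta>" "v \<in> NN"
  shows "act (uu x) (act (ub z) v) = act (ub z) (act (Dd \<theta>) (act (uu x) v))"
proof -
  let ?a = "1 + f * \<theta>" let ?r = "rinv (1 + f * \<theta>)"
  have ar: "?a * ?r = 1" by (rule rinv(1)[OF unit_1f[OF assms(1)]])
  have "act (gm (uu x) (ub z)) v = act (gm (ub z) (gm (Dd \<theta>) (uu (x * ?r)))) v"
  proof (rule act_eqI)
    show "gm (uu x) (ub z) = (c1, M2 ?a x z 1)" by (simp add: uu_def ub_def assms(3))
    have "?a * (x * ?r) = (?a * ?r) * x" by (simp only: mult_ac)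
    then have axr: "?a * (x * ?r) = x" by (simp only: ar mult_1_left)
    have zx: "z * x = f * \<theta>" using assms(3) by (simp add: mult.commute)
    show "gm (ub z) (gm (Dd \<theta>) (uu (x * ?r))) = (c1, M2 ?a x (z * ?a) (f * \<theta> + ?r))"
      unfolding ub_def Dd_def uu_def ext_mul_simp mm.simps using axr zx by simp
    have "p dvd z * \<theta>" using assms(2) by simp
    from pj_dvd[OF this] have 1: "p ^ j dvd z - z * ?a" by (simp add: algebra_simps)
    have "1 - (f * \<theta> + ?r) = - (?r - (1 - f * \<theta>))" by (simp only: minus_diff_eq diff_diff_eq)
    then have 2: "p ^ j dvd 1 - (f * \<theta> + ?r)" using rinv_1f[OF assms(1), of \<theta>] by (simp only: dvd_minus_iff)
    show "mcong (p ^ j) (M2 ?a x z 1) (M2 ?a x (z * ?a) (f * \<theta> + ?r))"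
      unfolding mcong_def m2.sel using 1 2 by simp
    have "a * (t + r) - x * (z * a) = a * r + a * (t - z * x)" for a r t by (simp add: algebra_simps)
    then have "mdet (M2 ?a x (z * ?a) (f * \<theta> + ?r)) = ?a * ?r + ?a * (f * \<theta> - z * x)" by (simp only: mdet.simps)
    also have "\<dots> = 1" by (simp only: ar zx diff_self mult_zero_right add_0_right)
    also have "\<dots> = mdet (M2 ?a x z 1)" using assms(3) by simp
    finally show "mdet (M2 ?a x z 1) = mdet (M2 ?a x (z * ?a) (f * \<theta> + ?r))" ..
  qed (use assms in auto)
  then have eq: "act (uu x) (act (ub z) v) = act (ub z) (act (Dd \<theta>) (act (uu (x * ?r)) v))"
    using assms(1) by (simp add: act_mul)
  obtain k where "?r - (1 - f * \<theta>) = p ^ j * k" using rinv_1f[OF assms(1)] by (rule dvdE)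
  then have "?r = 1 + f * (p * k - \<theta>)" by (simp add: pj algebra_simps)
  then have "x * ?r = x * (1 + f * (p * k - \<theta>))" by (rule arg_cong)
  also have "\<dots> = x + f * (x * (p * k - \<theta>))" by (simp add: algebra_simps)
  finally have "x * ?r = x + f * (x * (p * k - \<theta>))" .
  then have "act (uu (x * ?r)) v = act (uu x) v" using NN_add_f[OF assms(4)] by simp
  then show ?thesis using eq by simp
qed

text \<open>Descending induction on \<open>i\<close>. A character that agrees with the wanted one on
  multiples of \<open>p ^ Suc n\<close> is off by some \<open>\<gamma>\<close> on multiples of
  \<open>p ^ n\<close>. Translation by a suitable \<open>ub z\<close> changes it there by a value of
  the \<open>Dd\<close>-character, and because that character has unit parameter \<open>y\<close>
  every \<open>\<gamma>\<close> can be cancelled.\<close>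

lemma characters_in_NN:
  assumes j2: "2 \<le> j" and v: "v \<in> NN" "v \<noteq> (\<lambda>_. 0)" "spec Dd (p ^ (l - 1) * y) v = v" and y: "\<not> p dvd y"
    and i: "i \<le> j - 1"
  shows "\<forall>b. \<beta> * p dvd b \<longrightarrow> (\<exists>v'\<in>NN. v' \<noteq> (\<lambda>_. 0) \<and> spec Dd (p ^ (l - 1) * y) v' = v' \<and>
           (\<forall>x. act (uu (p ^ i * x)) v' = (\<lambda>n. \<psi> (b * (p ^ i * x)) * v' n)))"
  using i
proof (induction rule: inc_induct)
  case base
  show ?case
  proof (intro allI impI bexI[of _ v] conjI)
    fix b x assume "\<beta> * p dvd b"
    then obtain t where t: "b = \<beta> * p * t" by (rule dvdE)
    have "b * (p ^ (j - 1) * x) = (\<beta> * p * f) * (t * x)" by (simp only: t f_def mult_ac)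
    then have "b * (p ^ (j - 1) * x) = 0" by (simp only: \<beta>pf mult_zero_left)
    then show "act (uu (p ^ (j - 1) * x)) v = (\<lambda>n. \<psi> (b * (p ^ (j - 1) * x)) * v n)"
      using v(1) by (simp add: NN_def f_def)
  qed (use v in auto)
next
  case (step n)
  show ?case
  proof (intro allI impI)
    fix b assume b: "\<beta> * p dvd b"
    from step.IH b obtain v1 where v1: "v1 \<in> NN" "v1 \<noteq> (\<lambda>_. 0)" "spec Dd (p ^ (l - 1) * y) v1 = v1"
      and e1: "\<And>x. act (uu (p ^ Suc n * x)) v1 = (\<lambda>i. \<psi> (b * (p ^ Suc n * x)) * v1 i)" by blast
    obtain b' where b': "spec uu b' v1 \<noteq> (\<lambda>_. 0)" using spec_nonzero[OF onepar_uu NN_VS[OF v1(1)] v1(2)] by blast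
    define w where "w = spec uu b' v1"
    have w: "w \<in> NN" "w \<noteq> (\<lambda>_. 0)" using spec_NN[OF v1(1)] b' by (auto simp: w_def)
    have wU: "act (uu x) w = (\<lambda>i. \<psi> (b' * x) * w i)" for x unfolding w_def by (rule spec_eigen[OF onepar_uu])
    have D1: "act (Dd s) v1 = (\<lambda>i. \<psi> (p ^ (l - 1) * y * s) * v1 i)" for s
      using v1(3) spec_fix_iff[OF onepar_Dd[OF j2]] by blast
    have wD: "act (Dd s) w = (\<lambda>i. \<psi> (p ^ (l - 1) * y * s) * w i)" for s
      unfolding w_def spec_eq act_lincomb Dd_uu[OF j2 v1(1)] D1 act_scale
      by (simp add: sum_distrib_left mult_ac)
    obtain i0 where i0: "w i0 \<noteq> 0" using w(2) by auto
    have "p ^ Suc n * (b' - b) = 0"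
    proof (rule psi_eq_1_imp)
      fix x
      have "act (uu (p ^ Suc n * x)) w = spec uu b' (\<lambda>i. \<psi> (b * (p ^ Suc n * x)) * v1 i)"
        unfolding w_def act_spec_uu e1 ..
      also have "\<dots> = (\<lambda>i. \<psi> (b * (p ^ Suc n * x)) * w i)" unfolding w_def spec_def app_scale ..
      finally have "\<psi> (b' * (p ^ Suc n * x)) * w i0 = \<psi> (b * (p ^ Suc n * x)) * w i0"
        using wU[of "p ^ Suc n * x"] by (metis (no_types))
      then have "\<psi> (b' * (p ^ Suc n * x)) = \<psi> (b * (p ^ Suc n * x))" using i0 by simp
      moreover have "b' * (p ^ Suc n * x) = p ^ Suc n * (b' - b) * x + b * (p ^ Suc n * x)"
        by (simp add: algebra_simps)
      ultimately show "\<psi> (p ^ Suc n * (b' - b) * x) = 1" using psi_add psi_nz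
        by (metis mult_cancel_right1)
    qed
    then have "p ^ (l - Suc n) dvd b' - b" by (rule p_pow_annihilator) (use step jl in simp)
    then obtain \<gamma> where "b' - b = p ^ (l - Suc n) * \<gamma>" by (rule dvdE)
    then have b'b: "b' = b + p ^ (l - Suc n) * \<gamma>" by (simp add: algebra_simps)
    \<comment> \<open>\<open>\<sigma>\<close> solves \<open>y * \<sigma> = - \<gamma>\<close>; the
      power of \<open>p\<close> in \<open>z\<close> puts \<open>p ^ n * z\<close> exactly into the
      multiples of \<open>f\<close>, where \<open>Dd\<close> measures it.\<close>
    define \<sigma> where "\<sigma> = - (\<gamma> * rinv y)"
    define z where "z = p ^ (j - 1 - n) * \<sigma>"
    have "p dvd p ^ (j - 1 - n)" using step.hyps by (intro dvd_power disjI1) linarith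
    then have pz: "p dvd z" by (simp add: z_def)
    define v2 where "v2 = act (ub z) w"
    have "v2 \<in> NN" using w(1) pz by (simp add: NN_def v2_def uu_f_ub)
    moreover have "v2 \<noteq> (\<lambda>_. 0)" unfolding v2_def by (rule act_nonzero) (use w in \<open>auto simp: NN_def\<close>)
    moreover have "spec Dd (p ^ (l - 1) * y) v2 = v2"
      unfolding spec_fix_iff[OF onepar_Dd[OF j2]] v2_def Dd_ub[OF j2 pz] wD act_scale by simp
    moreover have "act (uu (p ^ n * x)) v2 = (\<lambda>i. \<psi> (b * (p ^ n * x)) * v2 i)" for x
    proof -
      have "(p ^ n * x) * z = (p ^ n * p ^ (j - 1 - n)) * (x * \<sigma>)" by (simp only: z_def mult_ac)
      also have "p ^ n * p ^ (j - 1 - n) = f" unfolding f_def power_add[symmetric] using step.hyps by simp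
      finally have th: "(p ^ n * x) * z = f * (x * \<sigma>)" .
      have "act (uu (p ^ n * x)) v2 = (\<lambda>i. \<psi> (b' * (p ^ n * x)) * (\<psi> (p ^ (l - 1) * y * (x * \<sigma>)) * v2 i))"
        unfolding v2_def uu_ub_Dd[OF j2 pz th w(1)] wU act_scale wD by simp
      also have "\<dots> = (\<lambda>i. \<psi> (b * (p ^ n * x)) * v2 i)"
      proof -
        have "y * \<sigma> = - \<gamma>" using y by (simp add: \<sigma>_def mult.left_commute)
        then have "p ^ (l - 1) * y * (x * \<sigma>) = - (p ^ (l - 1) * x * \<gamma>)"
          by (metis (no_types, opaque_lifting) mult.assoc mult.commute mult_minus_right)
        moreover have "p ^ (l - Suc n) * p ^ n = p ^ (l - 1)"
          unfolding power_add[symmetric] using step.hyps jl by simp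
        then have "p ^ (l - Suc n) * \<gamma> * (p ^ n * x) = p ^ (l - 1) * x * \<gamma>"
          by (metis (no_types, opaque_lifting) mult.assoc mult.commute)
        ultimately have "b' * (p ^ n * x) + p ^ (l - 1) * y * (x * \<sigma>) = b * (p ^ n * x)"
          by (simp add: b'b distrib_right)
        then have "\<psi> (b' * (p ^ n * x)) * \<psi> (p ^ (l - 1) * y * (x * \<sigma>)) = \<psi> (b * (p ^ n * x))"
          by (simp only: psi_add[symmetric])
        then show ?thesis by (simp only: mult.assoc[symmetric])
      qed
      finally show ?thesis .
    qed
    ultimately show "\<exists>v'\<in>NN. v' \<noteq> (\<lambda>_. 0) \<and> spec Dd (p ^ (l - 1) * y) v' = v' \<and>
           (\<forall>x. act (uu (p ^ n * x)) v' = (\<lambda>i. \<psi> (b * (p ^ n * x)) * v' i))" by blast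
  qed
qed

lemma uu_eigenvectors:
  assumes "2 \<le> j" "v \<in> NN" "v \<noteq> (\<lambda>_. 0)" "spec Dd (p ^ (l - 1) * y) v = v" "\<not> p dvd y" "\<beta> * p dvd b"
  shows "\<exists>v'\<in>NN. v' \<noteq> (\<lambda>_. 0) \<and> spec Dd (p ^ (l - 1) * y) v' = v' \<and> spec uu b v' = v'"
  using characters_in_NN[OF assms(1-5), of 0] assms(6) spec_fix_iff[OF onepar_uu] by auto

lemma card_nonprimitive: "card {b. \<beta> * p dvd b} = q ^ (j - 1)"
proof -
  have "l - (l - j + 1) = j - 1" using j1 jl by simp
  then show ?thesis using card_p_pow[of "l - j + 1"] j1 jl unfolding \<beta>p by simp
qed

lemma dimN_ge:
  assumes "2 \<le> j" "v \<in> NN" "v \<noteq> (\<lambda>_. 0)" "spec Dd (p ^ (l - 1) * y) v = v" "\<not> p dvd y"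
  shows "q ^ (j - 1) \<le> dimN"
proof -
  have "1 \<le> mult uu b" if "\<beta> * p dvd b" for b
    using uu_eigenvectors[OF assms that] mult_pos[OF onepar_uu] by (metis One_nat_def Suc_leI)
  then have "card {b. \<beta> * p dvd b} * 1 \<le> dimN"
    unfolding dimN_def using sum_bounded_below[of "{b. \<beta> * p dvd b}" 1 "mult uu"] by simp
  then show ?thesis by (simp add: card_nonprimitive)
qed

text \<open>\<open>Dd (p * s)\<close> acts trivially, so a parameter occurring in \<open>N\<close>
  is annihilated by \<open>p\<close>; if it is nonzero it is a unit multiple of
  \<open>p ^ (l - 1)\<close>.\<close>

lemma Dd_dichotomy:
  assumes j2: "2 \<le> j"
  shows "(\<exists>v y. v \<in> NN \<and> v \<noteq> (\<lambda>_. 0) \<and> \<not> p dvd y \<and> spec Dd (p ^ (l - 1) * y) v = v)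
    \<or> (\<forall>v\<in>NN. \<forall>s. act (Dd s) v = v)"
proof (rule disjCI)
  assume none: "\<not> (\<forall>v\<in>NN. \<forall>s. act (Dd s) v = v)"
  note D = onepar_Dd[OF j2]
  from none obtain v s where v: "v \<in> NN" "act (Dd s) v \<noteq> v" by blast
  have "\<exists>b. b \<noteq> 0 \<and> spec Dd b v \<noteq> (\<lambda>_. 0)"
  proof (rule ccontr)
    assume a: "\<not> ?thesis"
    have "spec Dd 0 v = v"
    proof
      fix i
      have "(\<Sum>b\<in>UNIV. spec Dd b v i) = (\<Sum>b\<in>(UNIV::'r set). if b = 0 then spec Dd 0 v i else 0)"
      proof (intro sum.cong refl)
        fix b show "spec Dd b v i = (if b = 0 then spec Dd 0 v i else 0)"
          using a by (cases "b = 0") (auto simp: fun_eq_iff)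
      qed
      then show "spec Dd 0 v i = v i" using spec_sum[OF D NN_VS[OF v(1)], of i] by simp
    qed
    then show False using v(2) spec_fix_iff[OF D, of 0 v] by simp
  qed
  then obtain b where b: "b \<noteq> 0" "spec Dd b v \<noteq> (\<lambda>_. 0)" by blast
  define w where "w = spec Dd b v"
  have w: "w \<in> NN" unfolding w_def spec_eq by (rule NN_lincomb) (use Dd_NN[OF j2 v(1)] in blast)
  have wD: "act (Dd s) w = (\<lambda>i. \<psi> (b * s) * w i)" for s unfolding w_def by (rule spec_eigen[OF D])
  obtain i where i: "w i \<noteq> 0" using b(2) by (auto simp: w_def)
  have "p * b = 0"
  proof (rule psi_eq_1_imp)
    fix s
    have "act (Dd (p * s)) w = w"
    proof -
      have "act (Dd (p * s)) w = act (c1, M2 1 0 0 1) w"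
      proof (rule act_eqI)
        show "Dd (p * s) = (c1, M2 (1 + f * (p * s)) 0 0 (rinv (1 + f * (p * s))))" by (simp add: Dd_def)
        have 1: "p ^ j dvd f * (p * s)" by (rule pj_dvd) simp
        have "rinv (1 + f * (p * s)) - 1 = (rinv (1 + f * (p * s)) - (1 - f * (p * s))) - f * (p * s)" by simp
        moreover have "p ^ j dvd (rinv (1 + f * (p * s)) - (1 - f * (p * s))) - f * (p * s)"
          by (rule dvd_diff[OF rinv_1f[OF j2] 1])
        ultimately have 2: "p ^ j dvd rinv (1 + f * (p * s)) - 1" by metis
        show "mcong (p ^ j) (M2 (1 + f * (p * s)) 0 0 (rinv (1 + f * (p * s)))) (M2 1 0 0 1)"
          unfolding mcong_def m2.sel using 1 2 by simp
      qed (use j2 unit_1f[OF j2] in auto)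
      then show ?thesis using NN_VS[OF w] by simp
    qed
    then have "w i = \<psi> (b * (p * s)) * w i" using wD[of "p * s"] by (metis (no_types))
    then show "\<psi> (p * b * s) = 1" using i by (simp add: mult_ac)
  qed
  then have "p ^ (l - 1) dvd b" using p_pow_annihilator[of 1 b] l1 by simp
  then obtain y where y: "b = p ^ (l - 1) * y" by (rule dvdE)
  have "\<not> p dvd y" using b(1) y top_mult_eq_0 by blast
  moreover have "spec Dd b w = w" using wD spec_fix_iff[OF D] by blast
  ultimately show "\<exists>v y. v \<in> NN \<and> v \<noteq> (\<lambda>_. 0) \<and> \<not> p dvd y \<and> spec Dd (p ^ (l - 1) * y) v = v"
    using w b(2) y unfolding w_def by blast
qed

end

section \<open>Borel eigenvectors\<close>

context chain_ring
begin

lemma rinv_mult [simp]: "\<not> p dvd c \<Longrightarrow> c * (d * rinv c) = d" "\<not> p dvd c \<Longrightarrow> d * rinv c * c = d"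
proof -
  assume c: "\<not> p dvd c"
  have "c * (d * rinv c) = d * (c * rinv c)" by (simp only: mult.left_commute)
  then show "c * (d * rinv c) = d" using c by simp
  show "d * rinv c * c = d" using c by (simp add: mult.assoc)
qed

end

context ext_rep
begin

text \<open>Bruhat decomposition over a local ring: a unit lower left entry puts \<open>g\<close>
  into the open cell; otherwise the upper left entry is a unit and a lower unipotent with parameter
  in the maximal ideal remains.\<close>

lemma borel_orbit:
  assumes v: "v \<in> VS" and U: "\<And>x. act (uu x) v = v"
    and T: "\<And>c a b. dg c a b \<in> GG \<Longrightarrow> act (dg c a b) v = (\<lambda>i. \<chi> (dg c a b) * v i)" and g: "g \<in> GG"
  shows "\<exists>k. (\<exists>x. act g v = (\<lambda>i. k * act (uu x) (act ww v) i))
    \<or> (\<exists>z. p dvd z \<and> act g v = (\<lambda>i. k * act (ub z) v i))"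
proof -
  obtain \<kappa> a b c d where gX: "g = (\<kappa>, M2 a b c d)" by (cases g; cases "snd g") auto
  define D where "D = a * d - b * c"
  have ok: "ok \<kappa> D" using g by (simp add: gX GG_iff D_def)
  have D: "\<not> p dvd D" using ok_unit[OF ok] .
  show ?thesis
  proof (cases "p dvd c")
    case False
    define t where "t = dg \<kappa> (- c) (- (D * rinv c))"
    have "c * (D * rinv c) = (c * rinv c) * D" by (simp only: mult_ac)
    then have tG: "t \<in> GG" using ok False by (simp add: t_def dg_in)
    have "g = gm (uu (a * rinv c)) (gm ww (gm t (uu (d * rinv c))))"
    proof -
      have 1: "a * rinv c * c = a" using False by simp
      have 2: "c * (d * rinv c) = d" using False by simp
      have "c * (- (D * rinv c) + a * rinv c * d) = (c * rinv c) * (a * d - D)" by (simp add: algebra_simps)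
      then have "c * (- (D * rinv c) + a * rinv c * d) = c * b" using False by (simp add: D_def mult.commute)
      then have 3: "- (D * rinv c) + a * rinv c * d = b" using unit_cancel[OF False] by blast
      show ?thesis using 1 2 3 by (simp add: gX uu_def ww_def t_def dg_def)
    qed
    then have "act g v = act (uu (a * rinv c)) (act ww (act t (act (uu (d * rinv c)) v)))"
      using tG by (simp add: act_mul)
    also have "\<dots> = (\<lambda>i. \<chi> t * act (uu (a * rinv c)) (act ww v) i)"
      using T tG unfolding t_def by (simp add: U act_scale)
    finally show ?thesis by blast
  next
    case True
    have a: "\<not> p dvd a"
    proof
      assume "p dvd a"
      then have "p dvd D" unfolding D_def using True by (intro dvd_diff) auto
      then show False using D by simp
    qed
    define t where "t = dg \<kappa> a (D * rinv a)"
    have "a * (D * rinv a) = (a * rinv a) * D" by (simp only: mult_ac)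
    then have tG: "t \<in> GG" using ok a by (simp add: t_def dg_in)
    have "g = gm (ub (c * rinv a)) (gm t (uu (b * rinv a)))"
    proof -
      have 1: "c * rinv a * a = c" using a by (simp add: mult.assoc)
      have 2: "a * (b * rinv a) = b" using a by simp
      have "a * (c * rinv a * b + D * rinv a) = (a * rinv a) * (c * b + D)" by (simp add: algebra_simps)
      then have "a * (c * rinv a * b + D * rinv a) = a * d" using a by (simp add: D_def mult.commute)
      then have 3: "c * rinv a * b + D * rinv a = d" using unit_cancel[OF a] by blast
      show ?thesis using 1 2 3 by (simp add: gX uu_def ub_def t_def dg_def)
    qed
    then have "act g v = act (ub (c * rinv a)) (act t (act (uu (b * rinv a)) v))"
      using tG by (simp add: act_mul)
    also have "\<dots> = (\<lambda>i. \<chi> t * act (ub (c * rinv a)) v i)"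
      using T tG unfolding t_def by (simp add: U act_scale)
    finally have "act g v = (\<lambda>i. \<chi> t * act (ub (c * rinv a)) v i)" .
    moreover have "p dvd c * rinv a" using True by simp
    ultimately show ?thesis by blast
  qed
qed

lemma torus_eigenvector:
  assumes W: "W \<subseteq> VS" "\<And>c a b w. dg c a b \<in> GG \<Longrightarrow> w \<in> W \<Longrightarrow> act (dg c a b) w \<in> W"
      "\<And>(N::nat) c w. (\<And>k. k \<le> N \<Longrightarrow> w k \<in> W) \<Longrightarrow> (\<lambda>i. \<Sum>k\<le>N. c k * w k i) \<in> W"
    and v: "v \<in> W" "v \<noteq> (\<lambda>_. 0)"
  shows "\<exists>v\<in>W. v \<noteq> (\<lambda>_. 0) \<and> (\<exists>\<chi>. \<forall>c a b. dg c a b \<in> GG \<longrightarrow> act (dg c a b) v = (\<lambda>i. \<chi> (dg c a b) * v i))"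
proof -
  define S where "S = {g \<in> GG. \<exists>c a b. g = dg c a b}"
  have "\<exists>v\<in>W. v \<noteq> (\<lambda>_. 0) \<and> (\<exists>\<chi>. \<forall>s\<in>S. act s v = (\<lambda>i. \<chi> s * v i))"
  proof (rule joint_eigenvector[OF _ _ _ W(1) _ W(3) v])
    show "finite S" "S \<subseteq> GG" using finite_G by (auto simp: S_def)
    show "gm s t = gm t s" if "s \<in> S" "t \<in> S" for s t
      using that by (auto simp: S_def dg_def cm_comm mult.commute)
    show "act g w \<in> W" if "g \<in> S" "w \<in> W" for g w using that W(2) by (auto simp: S_def)
  qed
  then show ?thesis unfolding S_def by blast
qed

end

context level_rep
begin

text \<open>Up to scalars the orbit is an image of the projective line modulo \<open>p ^ j\<close>,
  with \<open>q ^ j\<close> points in the open cell and \<open>q ^ (j - 1)\<close> outside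
  it.\<close>

lemma borel_eigenvector_card:
  assumes v: "v \<in> VS" "v \<noteq> (\<lambda>_. 0)" and U: "\<And>x. act (uu x) v = v"
    and T: "\<And>c a b. dg c a b \<in> GG \<Longrightarrow> act (dg c a b) v = (\<lambda>i. \<chi> (dg c a b) * v i)"
  shows "card I \<le> (q + 1) * q ^ (j - 1)"
proof -
  define F where "F = (\<lambda>x. act (uu x) (act ww v))"
  define F' where "F' = (\<lambda>z. act (ub z) v)"
  have F: "F x = F y" if "p ^ j dvd x - y" for x y
    unfolding F_def by (rule act_eqI[where c = c1 and X = "M2 1 x 0 1" and Y = "M2 1 y 0 1"])
      (use that in \<open>auto simp: uu_def mcong_def\<close>)
  have F': "F' x = F' y" if "p ^ j dvd x - y" for x y
    unfolding F'_def by (rule act_eqI[where c = c1 and X = "M2 1 0 x 1" and Y = "M2 1 0 y 1"])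
      (use that in \<open>auto simp: ub_def mcong_def\<close>)
  define S where "S = F ` {x. p ^ 0 dvd x} \<union> F' ` {x. p ^ 1 dvd x}"
  have "card I \<le> card S"
  proof (rule card_le_spanning[where w = "\<lambda>s. s"])
    show "finite S" by (simp add: S_def)
    fix h i assume h: "\<And>s. s \<in> S \<Longrightarrow> (\<Sum>i\<in>I. h i * s i) = 0" and i: "i \<in> I"
    show "h i = 0"
    proof (rule functional_zero_on_orbit[OF v _ i])
      fix g assume "g \<in> GG"
      from borel_orbit[OF v(1) U T this] obtain k where
        "(\<exists>x. act g v = (\<lambda>i. k * F x i)) \<or> (\<exists>z. p dvd z \<and> act g v = (\<lambda>i. k * F' z i))"
        unfolding F_def F'_def by blast
      moreover have "F x \<in> S" for x by (simp add: S_def)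
      moreover have "F' z \<in> S" if "p dvd z" for z using that by (simp add: S_def)
      ultimately obtain s where s: "s \<in> S" and gs: "act g v = (\<lambda>i. k * s i)" by blast
      have "(\<Sum>i\<in>I. h i * act g v i) = k * (\<Sum>i\<in>I. h i * s i)"
        unfolding gs by (simp add: sum_distrib_left mult_ac)
      then show "(\<Sum>i\<in>I. h i * act g v i) = 0" using h[OF s] by simp
    qed
  qed
  also have "card S \<le> card (F ` {x. p ^ 0 dvd x}) + card (F' ` {x. p ^ 1 dvd x})"
    unfolding S_def by (rule card_Un_le)
  also have "\<dots> \<le> q ^ (j - 0) + q ^ (j - 1)"
    by (intro add_mono card_image_mod F F') (use j1 jl in auto)
  also have "\<dots> = (q + 1) * q ^ (j - 1)" using j1 by (cases j) auto
  finally show ?thesis .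
qed

section \<open>Unipotent groups of the last layer attached to lines\<close>

definition hf :: "'r \<Rightarrow> 'c \<times> 'r m2" where "hf s = uu (f * s)"

lemma onepar_hf: "onepar hf"
  unfolding onepar_def hf_def by (auto simp: distrib_left act_uu_uu) (simp add: uu_def ext_one_def mid_def)

lemma f_ann_iff: "b * f = 0 \<longleftrightarrow> \<beta> * p dvd b"
proof
  assume "b * f = 0"
  then have "f * b = 0" by (simp add: mult.commute)
  then have "p ^ (l - (j - 1)) dvd b" unfolding f_def by (rule p_pow_annihilator) (use jl in simp)
  moreover have "l - (j - 1) = l - j + 1" using j1 jl by simp
  ultimately show "\<beta> * p dvd b" unfolding \<beta>p by metis
next
  assume "\<beta> * p dvd b"
  then obtain t where "b = \<beta> * p * t" by (rule dvdE)
  then have "b * f = (\<beta> * p * f) * t" by (simp only: mult_ac)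
  then show "b * f = 0" by (simp only: \<beta>pf mult_zero_left)
qed

lemma spec_hf: assumes v: "v \<in> VS" shows "spec hf 0 v = (\<lambda>i. \<Sum>b\<in>{b. \<beta> * p dvd b}. spec uu b v i)"
proof
  fix i
  have v': "(\<lambda>i. \<Sum>b\<in>UNIV. 1 * spec uu b v i) = v" using spec_sum[OF onepar_uu v] by auto
  have "act (hf x) (spec uu b v) = (\<lambda>i. \<psi> (b * f * x) * spec uu b v i)" for b x
    unfolding hf_def using spec_eigen[OF onepar_uu, of "f * x" b v] by (simp add: mult.assoc)
  then have e: "spec hf 0 (spec uu b v) = (\<lambda>i. if \<beta> * p dvd b then spec uu b v i else 0)" for b
    using spec_of_eigen[of hf "spec uu b v" "b * f" 0] f_ann_iff[of b] by auto
  have "spec hf 0 v i = (\<Sum>b\<in>UNIV. 1 * spec hf 0 (spec uu b v) i)"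
    using spec_lincomb[where S = UNIV and c = "\<lambda>_. 1" and w = "\<lambda>b. spec uu b v" and h = hf and b = 0] v' by metis
  also have "\<dots> = (\<Sum>b\<in>UNIV. if \<beta> * p dvd b then spec uu b v i else 0)" unfolding e by simp
  also have "\<dots> = (\<Sum>b\<in>{b. \<beta> * p dvd b}. spec uu b v i)" by (simp add: sum.If_cases)
  finally show "spec hf 0 v i = (\<Sum>b\<in>{b. \<beta> * p dvd b}. spec uu b v i)" .
qed

text \<open>The projection onto \<open>N\<close> is the sum of the Fourier projections for the
  nonprimitive parameters. Thus \<open>dimN\<close> is a trace, and conjugates of the deep unipotent
  group have fixed spaces of the same dimension.\<close>

lemma tr_hf: "tr (specK hf 0) = of_nat dimN"
proof -
  have "specK hf 0 i i = (\<Sum>b\<in>{b. \<beta> * p dvd b}. 1 * specK uu b i i)" if "i \<in> I" for i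
  proof (rule kernel_eqI[OF _ that, where K = "specK hf 0" and L = "\<lambda>i j. \<Sum>b\<in>{b. \<beta> * p dvd b}. 1 * specK uu b i j"])
    fix v assume "v \<in> VS"
    then show "app I (specK hf 0) v = app I (\<lambda>i j. \<Sum>b\<in>{b. \<beta> * p dvd b}. 1 * specK uu b i j) v"
      unfolding app_kernel_lincomb using spec_hf by (simp add: spec_def)
  qed
  then have "tr (specK hf 0) = (\<Sum>b\<in>{b. \<beta> * p dvd b}. tr (specK uu b))"
    unfolding tr_def by (simp, subst sum.swap, simp)
  also have "\<dots> = of_nat dimN"
    unfolding dimN_def by (simp add: mult_def rank_trace[OF spec_proj[OF onepar_uu]])
  finally show ?thesis .
qed

lemma S_commute:
  assumes "2 \<le> j" "mdet X = 1" "mdet Y = 1" "mcong (p ^ (j - 1)) X mid" "mcong (p ^ (j - 1)) Y mid"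
  shows "act (c1, X) (act (c1, Y) v) = act (c1, Y) (act (c1, X) v)"
proof -
  have ff: "p ^ j dvd f * (f * u)" for u using p_dvd_f[OF assms(1)] by (intro pj_dvd) simp
  obtain x y z t where X: "X = M2 (1 + f * x) (f * y) (f * z) (1 + f * t)" by (rule S_form[OF assms(4)])
  obtain x' y' z' t' where Y: "Y = M2 (1 + f * x') (f * y') (f * z') (1 + f * t')" by (rule S_form[OF assms(5)])
  have "act (gm (c1, X) (c1, Y)) v = act (gm (c1, Y) (c1, X)) v"
  proof (rule act_eqI[where c = c1])
    show "gm (c1, X) (c1, Y) = (c1, mm X Y)" "gm (c1, Y) (c1, X) = (c1, mm Y X)" by simp_all
    show "mdet (mm X Y) = mdet (mm Y X)" by (simp add: mdet_mm mult.commute)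
    show "mcong (p ^ j) (mm X Y) (mm Y X)"
      unfolding mcong_def X Y mm.simps m2.sel
    proof (intro conjI)
      have "(1 + f * x) * (1 + f * x') + f * y * (f * z') - ((1 + f * x') * (1 + f * x) + f * y' * (f * z))
         = f * (f * (y * z' - y' * z))" by (simp add: algebra_simps)
      then show "p ^ j dvd (1 + f * x) * (1 + f * x') + f * y * (f * z') - ((1 + f * x') * (1 + f * x) + f * y' * (f * z))"
        using ff by metis
      have "(1 + f * x) * (f * y') + f * y * (1 + f * t') - ((1 + f * x') * (f * y) + f * y' * (1 + f * t))
         = f * (f * (x * y' + y * t' - x' * y - y' * t))" by (simp add: algebra_simps)
      then show "p ^ j dvd (1 + f * x) * (f * y') + f * y * (1 + f * t') - ((1 + f * x') * (f * y) + f * y' * (1 + f * t))"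
        using ff by metis
      have "f * z * (1 + f * x') + (1 + f * t) * (f * z') - (f * z' * (1 + f * x) + (1 + f * t') * (f * z))
         = f * (f * (z * x' + t * z' - z' * x - t' * z))" by (simp add: algebra_simps)
      then show "p ^ j dvd f * z * (1 + f * x') + (1 + f * t) * (f * z') - (f * z' * (1 + f * x) + (1 + f * t') * (f * z))"
        using ff by metis
      have "f * z * (f * y') + (1 + f * t) * (1 + f * t') - (f * z' * (f * y) + (1 + f * t') * (1 + f * t))
         = f * (f * (z * y' - z' * y))" by (simp add: algebra_simps)
      then show "p ^ j dvd f * z * (f * y') + (1 + f * t) * (1 + f * t') - (f * z' * (f * y) + (1 + f * t') * (1 + f * t))"
        using ff by metis
    qed
  qed (use assms in \<open>auto simp: mdet_mm\<close>)
  then show ?thesis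
    using act_mul[of "(c1, X)" "(c1, Y)" v] act_mul[of "(c1, Y)" "(c1, X)" v] assms by simp
qed

text \<open>The identity plus \<open>f * s\<close> times the nilpotent matrix whose image and kernel
  are the line through the vector with entries \<open>x\<close> and 1; it is
  \<open>uu (f * s)\<close> conjugated by \<open>uu x\<close> and \<open>ww\<close>.\<close>

definition lineM :: "'r \<Rightarrow> 'r \<Rightarrow> 'r m2" where
  "lineM x s = M2 (1 + f * (- (s * x))) (f * (s * x * x)) (f * (- s)) (1 + f * (s * x))"

definition hx :: "'r \<Rightarrow> 'r \<Rightarrow> 'c \<times> 'r m2" where "hx x s = (c1, lineM x s)"

lemma lineM_det: "mdet (lineM x s) = 1" by (simp add: lineM_def algebra_simps)

lemma lineM_S: "mcong (p ^ (j - 1)) (lineM x s) mid"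
  unfolding f_def[symmetric] by (simp add: lineM_def mcong_def mid_def)

lemma hx_in [simp]: "hx x s \<in> GG" using lineM_det by (simp add: hx_def)

lemma onepar_hx: "onepar (hx x)"
proof -
  have "hx x (s + t) = gm (hx x s) (hx x t)" for s t by (simp add: hx_def lineM_def algebra_simps)
  moreover have "hx x 0 = ext_one c1" by (simp add: hx_def lineM_def ext_one_def mid_def)
  ultimately show ?thesis by (simp add: onepar_def act_mul)
qed

lemma hx_conj: "gm (gm (uu x) ww) (uu (f * s)) = gm (hx x s) (gm (uu x) ww)"
  by (simp add: uu_def ww_def hx_def lineM_def algebra_simps)

lemma tr_hx: "tr (specK (hx x) 0) = of_nat dimN"
proof -
  have "tr (\<rho> (hx x s)) = tr (\<rho> (hf s))" for s
  proof -
    let ?g = "gm (uu x) ww"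
    have "gm (gm ?g (uu (f * s))) (ginv ?g) = hx x s" unfolding hx_conj by (simp add: assoc)
    then show ?thesis using tr_conj[of ?g "uu (f * s)"] by (simp add: hf_def)
  qed
  then show ?thesis unfolding tr_hf[symmetric] tr_specK by simp
qed

lemma hx_cong: assumes "p dvd x - x'" shows "act (hx x s) v = act (hx x' s) v"
proof (rule act_eqI[where c = c1])
  show "hx x s = (c1, lineM x s)" "hx x' s = (c1, lineM x' s)" by (simp_all add: hx_def)
  show "mdet (lineM x s) = mdet (lineM x' s)" by (simp add: lineM_det)
  obtain k where k: "x - x' = p * k" using assms by (rule dvdE)
  have pf: "p ^ j dvd f * (p * u)" for u by (rule pj_dvd) simp
  have "1 + f * (- (s * x)) - (1 + f * (- (s * x'))) = f * ((x - x') * (- s))" by (simp add: algebra_simps)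
  moreover have "f * (s * x * x) - f * (s * x' * x') = f * ((x - x') * (s * (x + x')))" by (simp add: algebra_simps)
  moreover have "1 + f * (s * x) - (1 + f * (s * x')) = f * ((x - x') * s)" by (simp add: algebra_simps)
  ultimately show "mcong (p ^ j) (lineM x s) (lineM x' s)"
    unfolding lineM_def mcong_def m2.sel k using pf by (simp add: mult.assoc del: mult_minus_right)
qed auto

text \<open>The last layer is commutative, so the product of the two projections lands in vectors
  fixed by both groups. Conjugating one line to the standard position puts such a vector into
  \<open>N\<close>; with \<open>Dd\<close> trivial there, the second line yields the lower
  unipotents, and the whole last layer fixes the vector.\<close>

lemma lines_orthogonal:
  assumes j2: "2 \<le> j" and D: "\<And>v s. v \<in> NN \<Longrightarrow> act (Dd s) v = v" and r: "\<not> p dvd x - x'"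
  shows "spec (hx x) 0 (spec (hx x') 0 v) = (\<lambda>_. 0)"
proof -
  define v2 where "v2 = spec (hx x) 0 (spec (hx x') 0 v)"
  have v2: "v2 \<in> VS" unfolding v2_def by (rule spec_in[OF onepar_hx])
  have fix1: "act (hx x s) v2 = v2" for s
    unfolding v2_def using spec_eigen[OF onepar_hx[of x], of s 0] by simp
  have fix2: "act (hx x' s) v2 = v2" for s
  proof -
    have c: "act (hx x' s) (act (hx x t) w) = act (hx x t) (act (hx x' s) w)" for t w
      unfolding hx_def by (rule S_commute[OF j2 lineM_det lineM_det lineM_S lineM_S])
    have "act (hx x' s) v2 = spec (hx x) 0 (act (hx x' s) (spec (hx x') 0 v))"
      unfolding v2_def spec_eq[of "hx x"] act_lincomb c ..
    also have "act (hx x' s) (spec (hx x') 0 v) = spec (hx x') 0 v"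
      using spec_eigen[OF onepar_hx[of x'], of s 0] by simp
    finally show ?thesis by (simp add: v2_def)
  qed
  define g where "g = gm (uu x') ww"
  have g: "g \<in> GG" by (simp add: g_def)
  define y where "y = act (ginv g) v2"
  have y: "y \<in> VS" "act g y = v2" using g v2 by (auto simp: y_def)
  have fixy: "act h y = y" if "h \<in> GG" "k \<in> GG" "gm g h = gm k g" "act k v2 = v2" for h k
  proof -
    have "act g (act h y) = act k (act g y)" using that g by (simp add: act_mul[symmetric])
    then have "act g (act h y) = act g y" using that(4) y(2) by simp
    then have "act (ginv g) (act g (act h y)) = act (ginv g) (act g y)" by simp
    then show ?thesis using g that(1) y(1) by simp
  qed
  have yu: "act (uu (f * s)) y = y" for s
    by (rule fixy[of _ "hx x' s"]) (use hx_conj fix2 in \<open>auto simp: g_def\<close>)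
  then have yN: "y \<in> NN" using y by (simp add: NN_def)
  define r where "r = x - x'"
  have ur: "\<not> p dvd r * r" using r by (simp add: r_def unit_mult)
  have "act (ub (f * z)) y = y" for z
  proof -
    \<comment> \<open>The second line contributes \<open>- (s * r * r)\<close> in the lower left
      corner; \<open>s\<close> makes this the given \<open>z\<close>.\<close>
    define s where "s = - (z * rinv (r * r))"
    have sz: "- (s * r * r) = z" using ur by (simp add: s_def mult.assoc)
    define X where "X = M2 (1 + f * (s * r)) (f * s) (f * (- (s * r * r))) (1 + f * (- (s * r)))"
    have dX: "mdet X = 1" by (simp add: X_def algebra_simps)
    have "act (c1, X) y = y"
    proof (rule fixy[of _ "hx x s"])
      show "gm g (c1, X) = gm (hx x s) g"
        by (simp add: g_def uu_def ww_def hx_def lineM_def X_def r_def algebra_simps)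
    qed (use dX fix1 in auto)
    moreover have "act (c1, X) y = act (uu (f * s)) (act (ub (f * z)) (act (Dd (s * r)) y))"
      using act_S[OF j2 X_def dX] sz by simp
    ultimately have 1: "act (uu (f * s)) (act (ub (f * z)) y) = y" using D[OF yN] by simp
    have "act (ub (f * z)) y = act (uu (f * (- s))) (act (uu (f * s)) (act (ub (f * z)) y))"
      unfolding act_uu_uu by (simp add: uu_def)
    also have "\<dots> = y" unfolding 1 by (rule yu)
    finally show ?thesis .
  qed
  then have "y = (\<lambda>_. 0)" using D[OF yN] yu by (intro no_fixed_vector[OF j2 y(1)]) auto
  then have "v2 = (\<lambda>_. 0)" using y(2) by simp
  then show ?thesis by (simp add: v2_def)
qed

text \<open>The residues of \<open>x\<close> modulo \<open>p\<close> give \<open>q\<close> lines,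
  hence \<open>q\<close> mutually orthogonal projections, each of rank \<open>dimN\<close>.\<close>

lemma dimN_lines:
  assumes j2: "2 \<le> j" and D: "\<And>v s. v \<in> NN \<Longrightarrow> act (Dd s) v = v"
  shows "q * dimN \<le> card I"
proof -
  \<comment> \<open>The sum below runs over the whole ring and meets each residue class
    \<open>q ^ (l - 1)\<close> times.\<close>
  define Q where "Q = (of_nat (q ^ (l - 1)) :: complex)"
  have Q0: "Q \<noteq> 0" using q_ge_3 by (simp add: Q_def)
  define K where "K = (\<lambda>i k. \<Sum>x\<in>UNIV. (1 / Q) * specK (hx x) 0 i k)"
  have app: "app I K v = (\<lambda>i. \<Sum>x\<in>UNIV. (1 / Q) * spec (hx x) 0 v i)" for v
    unfolding K_def spec_def by (rule app_kernel_lincomb)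
  have orth: "spec (hx x) 0 (spec (hx x') 0 v) = (\<lambda>i. if p dvd x - x' then spec (hx x') 0 v i else 0)" for x x' v
  proof (cases "p dvd x - x'")
    case True
    then have "spec (hx x) 0 w = spec (hx x') 0 w" for w unfolding spec_eq using hx_cong by simp
    moreover have "spec (hx x') 0 (spec (hx x') 0 v) = spec (hx x') 0 v"
      using spec_eigen[OF onepar_hx] spec_fix_iff[OF onepar_hx] by blast
    ultimately show ?thesis using True by simp
  qed (use lines_orthogonal[OF j2 D] in simp)
  have cnt: "card {x. p dvd x - x'} = q ^ (l - 1)" for x'
  proof -
    have "card {x. p dvd x - x'} = card ((\<lambda>t. t + x') ` {t. p ^ 1 dvd t})"
      by (rule arg_cong[where f = card]) (auto simp: image_iff, metis diff_add_cancel)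
    also have "\<dots> = card {t. p ^ 1 dvd t}" by (rule card_image) (simp add: inj_on_def)
    finally show ?thesis using card_p_pow[of 1] l1 by simp
  qed
  have "proj_kernel K"
    unfolding proj_kernel_def
  proof (intro conjI ballI allI impI)
    fix v
    have "app I K (app I K v) i = app I K v i" for i
    proof -
      have "app I K (app I K v) i = (\<Sum>x\<in>UNIV. (1 / Q) * (\<Sum>x'\<in>UNIV. (1 / Q) * spec (hx x) 0 (spec (hx x') 0 v) i))"
        unfolding app[of "app I K v"] unfolding app[of v] spec_lincomb ..
      also have "\<dots> = (\<Sum>x'\<in>UNIV. \<Sum>x\<in>UNIV. if p dvd x - x' then (1 / Q) * ((1 / Q) * spec (hx x') 0 v i) else 0)"
        unfolding orth sum_distrib_left by (subst sum.swap) (auto intro!: sum.cong)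
      also have "\<dots> = (\<Sum>x'\<in>UNIV. Q * ((1 / Q) * ((1 / Q) * spec (hx x') 0 v i)))"
        by (simp add: sum.If_cases cnt Q_def)
      also have "\<dots> = app I K v i" using Q0 by (simp add: app)
      finally show ?thesis .
    qed
    then show "app I K (app I K v) = app I K v" by auto
  next
    fix i k assume "i \<notin> I"
    then show "K i k = 0" using onepar_hx by (simp add: K_def specK_def rep_supp)
  qed
  from rank_trace[OF this] rank_le_card[OF this] have r: "tr K = of_nat (rank K)" "rank K \<le> card I" by auto
  have "tr K = (\<Sum>x\<in>(UNIV::'r set). (1 / Q) * tr (specK (hx x) 0))"
    unfolding K_def tr_def by (subst sum.swap) (simp add: sum_distrib_left)
  also have "\<dots> = of_nat (q ^ l) * (1 / Q) * of_nat dimN" by (simp add: tr_hx card_R)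
  also have "of_nat (q ^ l) = of_nat q * Q" unfolding Q_def using l1 by (cases l) auto
  also have "of_nat q * Q * (1 / Q) * of_nat dimN = of_nat (q * dimN)" using Q0 by simp
  finally have "(of_nat (rank K) :: complex) = of_nat (q * dimN)" using r by simp
  then have "rank K = q * dimN" by (simp only: of_nat_eq_iff)
  then show ?thesis using r by simp
qed

end

section \<open>Principal series\<close>

context level_rep
begin

lemma act_uu_dg:
  assumes "dg c a b \<in> GG" shows "act (uu x) (act (dg c a b) v) = act (dg c a b) (act (uu (b * rinv a * x)) v)"
proof -
  have u: "\<not> p dvd a" "\<not> p dvd b" using dg_units assms by blast+
  have "a * rinv b * (b * rinv a * x) = (a * rinv a) * (b * rinv b) * x" by (simp only: mult_ac)
  then show ?thesis using act_dg_uu[OF assms, of "b * rinv a * x"] u by simp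
qed

lemma Dd_dg_commute: assumes "2 \<le> j" "dg c a b \<in> GG" shows "act (Dd s) (act (dg c a b) v) = act (dg c a b) (act (Dd s) v)"
proof -
  have "gm (Dd s) (dg c a b) = gm (dg c a b) (Dd s)" by (simp add: Dd_def dg_def mult.commute)
  then show ?thesis using assms by (simp add: act_mul[symmetric])
qed

text \<open>The torus normalises \<open>U\<close> and commutes with \<open>Dd\<close>, so it
  preserves the \<open>U\<close>-fixed vectors with the given \<open>Dd\<close>-character and has a
  joint eigenvector among them.\<close>

lemma borel_vector_ex:
  assumes v0: "v0 \<in> NN" "v0 \<noteq> (\<lambda>_. 0)"
    and y: "2 \<le> j \<Longrightarrow> \<not> p dvd y \<and> spec Dd (p ^ (l - 1) * y) v0 = v0"
  shows "\<exists>v \<chi>. v \<in> VS \<and> v \<noteq> (\<lambda>_. 0) \<and> (\<forall>x. act (uu x) v = v) \<and>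
    (\<forall>c a b. dg c a b \<in> GG \<longrightarrow> act (dg c a b) v = (\<lambda>i. \<chi> (dg c a b) * v i)) \<and>
    (2 \<le> j \<longrightarrow> (\<forall>s. act (Dd s) v = (\<lambda>i. \<psi> (p ^ (l - 1) * y * s) * v i)))"
proof -
  define W where "W = {v \<in> VS. (\<forall>x. act (uu x) v = v) \<and>
    (2 \<le> j \<longrightarrow> (\<forall>s. act (Dd s) v = (\<lambda>i. \<psi> (p ^ (l - 1) * y * s) * v i)))}"
  have "\<exists>v. v \<in> W \<and> v \<noteq> (\<lambda>_. 0)"
  proof (cases "2 \<le> j")
    case True
    from uu_eigenvectors[OF True v0 conjunct2[OF y[OF True]] conjunct1[OF y[OF True]], of 0] obtain v' where
      v': "v' \<in> NN" "v' \<noteq> (\<lambda>_. 0)" "spec Dd (p ^ (l - 1) * y) v' = v'" "spec uu 0 v' = v'" by auto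
    then have "v' \<in> W"
      using spec_fix_iff[OF onepar_uu, of 0 v'] spec_fix_iff[OF onepar_Dd[OF True]] NN_VS by (simp add: W_def)
    then show ?thesis using v' by blast
  next
    case False
    then have "j = 1" using j1 by simp
    then have "f = 1" unfolding f_def by simp
    have "act (uu x) v0 = v0" for x
    proof -
      have "act (uu (f * x)) v0 = v0" using v0 unfolding NN_def by blast
      then show ?thesis using \<open>f = 1\<close> by simp
    qed
    then have "v0 \<in> W" using v0 False by (simp add: W_def NN_def)
    then show ?thesis using v0 by blast
  qed
  then obtain w where w: "w \<in> W" "w \<noteq> (\<lambda>_. 0)" by blast
  have "\<exists>v\<in>W. v \<noteq> (\<lambda>_. 0) \<and> (\<exists>\<chi>. \<forall>c a b. dg c a b \<in> GG \<longrightarrow> act (dg c a b) v = (\<lambda>i. \<chi> (dg c a b) * v i))"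
  proof (rule torus_eigenvector[OF _ _ _ w])
    show "W \<subseteq> VS" by (auto simp: W_def)
    show "act (dg c a b) v \<in> W" if "dg c a b \<in> GG" "v \<in> W" for c a b v
      using that act_uu_dg[OF that(1)] Dd_dg_commute[OF _ that(1)] by (simp add: W_def act_scale)
    show "(\<lambda>i. \<Sum>k\<le>(N::nat). c k * w k i) \<in> W" if "\<And>k. k \<le> N \<Longrightarrow> w k \<in> W" for N c w
      using that lincomb_in[of "{..N}" w c] by (simp add: W_def act_lincomb sum_distrib_left sum_distrib_right mult_ac)
  qed
  then obtain v \<chi> where "v \<in> W" "v \<noteq> (\<lambda>_. 0)"
    "\<And>c a b. dg c a b \<in> GG \<Longrightarrow> act (dg c a b) v = (\<lambda>i. \<chi> (dg c a b) * v i)" by blast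
  then show ?thesis unfolding W_def by (intro exI[of _ v] exI[of _ \<chi>]) simp
qed

text \<open>If \<open>N\<close> is zero the dimension formula decides. Otherwise a nontrivial
  \<open>Dd\<close>-character, or \<open>j = 1\<close>, leads to a Borel eigenvector and the
  projective line; a trivial one makes the lines orthogonal, which bounds \<open>dimN\<close> by
  \<open>q ^ (j - 1)\<close>.\<close>

theorem level_card: "card I \<le> (q + 1) * q ^ (j - 1)"
proof -
  have count: "card I \<le> (q + 1) * q ^ (j - 1)"
    if "v0 \<in> NN" "v0 \<noteq> (\<lambda>_. 0)" "2 \<le> j \<Longrightarrow> \<not> p dvd y \<and> spec Dd (p ^ (l - 1) * y) v0 = v0" for v0 y
    using borel_vector_ex[OF that] borel_eigenvector_card by blast
  consider "dimN = 0" | "dimN > 0" "j = 1" | "dimN > 0" "2 \<le> j" using j1 by linarith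
  then show ?thesis
  proof cases
    case 1
    then have "card I = (q - 1) * q ^ (j - 1)" using dim_formula' by simp
    also have "\<dots> \<le> (q + 1) * q ^ (j - 1)" by (rule mult_le_mono1) simp
    finally show ?thesis .
  next
    case 2
    then show ?thesis using count dimN_pos_iff by auto
  next
    case 3
    from Dd_dichotomy[OF 3(2)] show ?thesis
    proof
      assume "\<exists>v y. v \<in> NN \<and> v \<noteq> (\<lambda>_. 0) \<and> \<not> p dvd y \<and> spec Dd (p ^ (l - 1) * y) v = v"
      then show ?thesis using count by blast
    next
      assume "\<forall>v\<in>NN. \<forall>s. act (Dd s) v = v"
      then have "q * dimN \<le> (q - 1) * q ^ (j - 1) + dimN" using dimN_lines[OF 3(2)] dim_formula' by auto
      then have "(q - 1) * dimN \<le> (q - 1) * q ^ (j - 1)" by (simp add: diff_mult_distrib)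
      then have "dimN \<le> q ^ (j - 1)" using q_ge_3 by simp
      then have "card I \<le> (q - 1) * q ^ (j - 1) + q ^ (j - 1)" using dim_formula' by simp
      also have "\<dots> = (q - 1 + 1) * q ^ (j - 1)" by (simp only: distrib_right mult_1)
      also have "\<dots> \<le> (q + 1) * q ^ (j - 1)" by (rule mult_le_mono1) simp
      finally show ?thesis .
    qed
  qed
qed

end

context ext_rep
begin

text \<open>A representation that is trivial on the kernel at \<open>l - 1\<close> has some exact
  level \<open>j < l\<close>, and \<open>level_card\<close> at that level bounds its dimension;
  level 0 would force dimension one.\<close>

lemma large_imp_not_triv:
  assumes "card I > 1" and "2 \<le> l \<Longrightarrow> card I > (q + 1) * q ^ (l - 2)"
  shows "\<not> triv (l - 1)"
proof
  assume t: "triv (l - 1)"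
  define j where "j = (LEAST j. triv j)"
  have j: "triv j" unfolding j_def by (rule LeastI[of triv, OF t])
  have jl: "j \<le> l - 1" unfolding j_def by (rule Least_le[of triv, OF t])
  have j0: "j \<noteq> 0" using triv_0_card j assms(1) by (cases "j = 0") auto
  have n: "\<not> triv (j - 1)" using not_less_Least[of "j - 1" triv] j0 unfolding j_def by simp
  interpret L: level_rep p l q \<psi> cm c1 ok I \<rho> j
    by unfold_locales (use j jl j0 n l1 in auto)
  have l2: "2 \<le> l" using jl j0 by simp
  have "card I \<le> (q + 1) * q ^ (j - 1)" by (rule L.level_card)
  also have "\<dots> \<le> (q + 1) * q ^ (l - 2)" using jl q_ge_3 by (intro mult_le_mono2 power_increasing) auto
  finally show False using assms(2)[OF l2] by simp
qed

end

section \<open>Borel eigenvectors at the top level\<close>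

locale top_rep = level_rep p l q \<psi> cm c1 ok I \<rho> l
  for p :: "'r::comm_ring_1" and l q \<psi> and cm :: "'c \<Rightarrow> 'c \<Rightarrow> 'c" and c1 ok and I :: "'i set" and \<rho>
begin

lemma \<beta>1 [simp]: "\<beta> = 1" by (simp add: \<beta>_def)

lemma f_mult_0: "p dvd x \<Longrightarrow> f * x = 0" using pj_dvd[of x] by (simp add: p_pow_l)

definition eigen :: "('i \<Rightarrow> complex) \<Rightarrow> ('c \<Rightarrow> 'r \<Rightarrow> 'r \<Rightarrow> complex) \<Rightarrow> bool" where
  "eigen v \<chi> \<longleftrightarrow> v \<in> VS \<and> v \<noteq> (\<lambda>_. 0) \<and> (\<forall>x. act (uu x) v = v) \<and>
     (\<forall>c a b. dg c a b \<in> GG \<longrightarrow> act (dg c a b) v = (\<lambda>i. \<chi> c a b * v i))"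

text \<open>The standard intertwining operator of the principal series, a sum over the open cell; it
  exchanges the two torus arguments of the character.\<close>

definition vw :: "('i \<Rightarrow> complex) \<Rightarrow> 'i \<Rightarrow> complex" where
  "vw v = (\<lambda>i. \<Sum>x\<in>UNIV. act (uu x) (act ww v) i)"

lemma dg_swap: "dg c a b \<in> GG \<longleftrightarrow> dg c b a \<in> GG" by (simp add: dg_in mult.commute)

lemma act_dg_ww: "dg c a b \<in> GG \<Longrightarrow> act (dg c a b) (act ww v) = act ww (act (dg c b a) v)"
proof -
  assume "dg c a b \<in> GG"
  moreover have "gm (dg c a b) ww = gm ww (dg c b a)" by (simp add: dg_def ww_def)
  ultimately show ?thesis using dg_swap by (simp add: act_mul[symmetric])
qed

lemma vw_VS: "vw v \<in> VS"
  unfolding vw_def using lincomb_in[of UNIV "\<lambda>x. act (uu x) (act ww v)" "\<lambda>_. 1"] by simp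

lemma uu_vw: "act (uu y) (vw v) = vw v"
proof
  fix i
  have "act (uu y) (vw v) i = (\<Sum>x\<in>UNIV. act (uu (y + x)) (act ww v) i)"
    unfolding vw_def act_sum act_uu_uu ..
  also have "\<dots> = vw v i" unfolding vw_def
    by (rule sum.reindex_bij_witness[of _ "\<lambda>x. x - y" "\<lambda>x. y + x"]) auto
  finally show "act (uu y) (vw v) i = vw v i" .
qed

lemma dg_vw: assumes v: "eigen v \<chi>" and t: "dg c a b \<in> GG"
  shows "act (dg c a b) (vw v) = (\<lambda>i. \<chi> c b a * vw v i)"
proof
  fix i
  have u: "\<not> p dvd a" "\<not> p dvd b" using dg_units t by blast+
  have "act (dg c a b) (vw v) i = (\<Sum>x\<in>UNIV. \<chi> c b a * act (uu (a * rinv b * x)) (act ww v) i)"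
    unfolding vw_def act_sum act_dg_uu[OF t] act_dg_ww[OF t]
    using v t dg_swap[of c a b] by (simp add: eigen_def act_scale)
  also have "\<dots> = (\<Sum>x\<in>UNIV. \<chi> c b a * act (uu x) (act ww v) i)"
  proof (rule sum.reindex_bij_witness[of _ "\<lambda>x. b * rinv a * x" "\<lambda>x. a * rinv b * x"])
    fix x
    have "a * rinv b * (b * rinv a * x) = (a * rinv a) * (b * rinv b) * x"
      "b * rinv a * (a * rinv b * x) = (a * rinv a) * (b * rinv b) * x" by (simp_all only: mult_ac)
    then show "a * rinv b * (b * rinv a * x) = x" "b * rinv a * (a * rinv b * x) = x" using u by simp_all
  qed auto
  finally show "act (dg c a b) (vw v) i = \<chi> c b a * vw v i" by (simp add: vw_def sum_distrib_left)
qed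

lemma eigen_orbit:
  assumes v: "eigen v \<chi>" and g: "g \<in> GG"
  shows "\<exists>k. (\<exists>x. act g v = (\<lambda>i. k * act (uu x) (act ww v) i))
    \<or> (\<exists>z. p dvd z \<and> act g v = (\<lambda>i. k * act (ub z) v i))"
  by (rule borel_orbit[where \<chi> = "\<lambda>g. \<chi> (fst g) (m11 (snd g)) (m22 (snd g))"])
    (use v g in \<open>auto simp: eigen_def\<close>, simp add: dg_def)

text \<open>In the maximal dimension the cell vectors are independent. A relation would express the
  open-cell vector at 0 through the others, and one vector fewer than the dimension would
  span.\<close>

lemma vw_independent:
  assumes v: "eigen v \<chi>" and n: "card I = (q + 1) * q ^ (l - 1)"
  shows "(\<lambda>i. vw v i + \<kappa> * v i) \<noteq> (\<lambda>_. 0)"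
proof
  assume rel: "(\<lambda>i. vw v i + \<kappa> * v i) = (\<lambda>_. 0)"
  define S where "S = (Inl ` (UNIV - {0}) \<union> Inr ` {z. p ^ 1 dvd z} :: ('r + 'r) set)"
  define F where "F = (\<lambda>s. case s of Inl x \<Rightarrow> act (uu x) (act ww v) | Inr z \<Rightarrow> act (ub z) v)"
  have vV: "v \<in> VS" "v \<noteq> (\<lambda>_. 0)" using v by (auto simp: eigen_def)
  have "card I \<le> card S"
  proof (rule card_le_spanning[where w = F])
    show "finite S" by (simp add: S_def)
    fix h i assume h: "\<And>s. s \<in> S \<Longrightarrow> (\<Sum>i\<in>I. h i * F s i) = 0" and i: "i \<in> I"
    have hz: "(\<Sum>i\<in>I. h i * act (ub z) v i) = 0" if "p dvd z" for z
      using h[of "Inr z"] that by (simp add: S_def F_def)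
    have hx: "(\<Sum>i\<in>I. h i * act (uu x) (act ww v) i) = 0" if "x \<noteq> 0" for x
      using h[of "Inl x"] that by (simp add: S_def F_def)
    have ub0: "act (ub 0) v = v" using vV by (simp add: ub_def)
    have hv: "(\<Sum>i\<in>I. h i * v i) = 0" using hz[of 0] ub0 by simp
    have "0 = (\<Sum>i\<in>I. h i * (vw v i + \<kappa> * v i))" using fun_cong[OF rel] by simp
    also have "\<dots> = (\<Sum>i\<in>I. h i * vw v i) + \<kappa> * (\<Sum>i\<in>I. h i * v i)"
      by (simp add: distrib_left sum.distrib sum_distrib_left mult_ac)
    also have "(\<Sum>i\<in>I. h i * vw v i) = (\<Sum>x\<in>UNIV. \<Sum>i\<in>I. h i * act (uu x) (act ww v) i)"
      unfolding vw_def sum_distrib_left by (rule sum.swap)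
    also have "\<dots> = (\<Sum>x\<in>UNIV. if x = 0 then \<Sum>i\<in>I. h i * act (uu x) (act ww v) i else 0)"
      using hx by (intro sum.cong refl) auto
    also have "\<dots> = (\<Sum>i\<in>I. h i * act (uu 0) (act ww v) i)" by simp
    finally have h0: "(\<Sum>i\<in>I. h i * act (uu 0) (act ww v) i) = 0" using hv by simp
    show "h i = 0"
    proof (rule functional_zero_on_orbit[OF vV _ i])
      fix g assume "g \<in> GG"
      from eigen_orbit[OF v this] obtain k where
        "(\<exists>x. act g v = (\<lambda>i. k * act (uu x) (act ww v) i)) \<or> (\<exists>z. p dvd z \<and> act g v = (\<lambda>i. k * act (ub z) v i))" by blast
      then show "(\<Sum>i\<in>I. h i * act g v i) = 0"
      proof
        assume "\<exists>x. act g v = (\<lambda>i. k * act (uu x) (act ww v) i)"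
        then obtain x where x: "act g v = (\<lambda>i. k * act (uu x) (act ww v) i)" by blast
        have "(\<Sum>i\<in>I. h i * act g v i) = k * (\<Sum>i\<in>I. h i * act (uu x) (act ww v) i)"
          unfolding x by (simp add: sum_distrib_left mult_ac)
        then show ?thesis using hx h0 by (cases "x = 0") auto
      next
        assume "\<exists>z. p dvd z \<and> act g v = (\<lambda>i. k * act (ub z) v i)"
        then obtain z where z: "p dvd z" "act g v = (\<lambda>i. k * act (ub z) v i)" by blast
        have "(\<Sum>i\<in>I. h i * act g v i) = k * (\<Sum>i\<in>I. h i * act (ub z) v i)"
          unfolding z(2) by (simp add: sum_distrib_left mult_ac)
        then show ?thesis using hz[OF z(1)] by simp
      qed
    qed
  qed
  also have "card S \<le> card (UNIV - {0::'r}) + card {z. p ^ 1 dvd z}"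
    unfolding S_def by (rule order_trans[OF card_Un_le]) (intro add_mono card_image_le, auto)
  also have "\<dots> = (q ^ l - 1) + q ^ (l - 1)" using card_R card_p_pow[of 1] l1 by simp
  also have "\<dots> < q ^ l + q ^ (l - 1)" using q_ge_3 by simp
  also have "\<dots> = (q + 1) * q ^ (l - 1)" using l1 by (cases l) auto
  finally show False using n by simp
qed

lemma eigen_vw:
  assumes "eigen v \<chi>" "card I = (q + 1) * q ^ (l - 1)"
  shows "eigen (vw v) (\<lambda>c a b. \<chi> c b a)"
  using vw_independent[OF assms, of 0] dg_vw[OF assms(1)] uu_vw vw_VS by (simp add: eigen_def)

lemma chi_nz: assumes v: "eigen v \<chi>" and t: "dg c a b \<in> GG" shows "\<chi> c a b \<noteq> 0"
proof
  assume "\<chi> c a b = 0"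
  then have "act (dg c a b) v = (\<lambda>_. 0)" using v t by (simp add: eigen_def)
  then show False using act_nonzero[OF t, of v] v by (simp add: eigen_def)
qed

text \<open>For \<open>l = 1\<close> a nonzero \<open>x\<close> is a unit, so
  \<open>ww uu x ww\<close> lies in the open cell, with torus part of diagonal \<open>- x\<close>
  and \<open>- rinv x\<close>.\<close>

lemma ww_vw:
  assumes v: "eigen v \<chi>" and l: "l = 1"
  shows "act ww (vw v) = (\<lambda>i. \<chi> c1 (- 1) (- 1) * v i +
    (\<Sum>x\<in>UNIV - {0}. \<chi> c1 (- x) (- rinv x) * act (uu (- rinv x)) (act ww v) i))"
proof
  fix i
  have p0: "p = 0" using p_pow_l l by simp
  have u: "\<not> p dvd x" if "x \<noteq> 0" for x using that p0 by simp
  have G1: "dg c1 (- 1) (- 1) \<in> GG" by (simp add: dg_in ok_one)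
  have GX: "dg c1 (- x) (- rinv x) \<in> GG" if "x \<noteq> 0" for x using u[OF that] by (simp add: dg_in ok_one)
  have e: "act ww (act (uu x) (act ww v)) i =
    (if x = 0 then \<chi> c1 (- 1) (- 1) * v i else \<chi> c1 (- x) (- rinv x) * act (uu (- rinv x)) (act ww v) i)" for x
  proof (cases "x = 0")
    case True
    have "act ww (act (uu 0) (act ww v)) = act (dg c1 (- 1) (- 1)) v"
      by (simp add: act_mul[symmetric]) (simp add: ww_def uu_def dg_def)
    then show ?thesis using True v G1 by (simp add: eigen_def)
  next
    case False
    have "gm ww (gm (uu x) ww) = gm (uu (- rinv x)) (gm ww (gm (dg c1 (- x) (- rinv x)) (uu (- rinv x))))"
      using u[OF False] by (simp add: ww_def uu_def dg_def)
    then have "act ww (act (uu x) (act ww v)) = act (uu (- rinv x)) (act ww (act (dg c1 (- x) (- rinv x)) (act (uu (- rinv x)) v)))"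
      using GX[OF False] by (simp add: act_mul[symmetric])
    also have "\<dots> = (\<lambda>i. \<chi> c1 (- x) (- rinv x) * act (uu (- rinv x)) (act ww v) i)"
      using v GX[OF False] by (simp add: eigen_def act_scale)
    finally show ?thesis using False by simp
  qed
  have "act ww (vw v) i = (\<Sum>x\<in>UNIV. act ww (act (uu x) (act ww v)) i)" unfolding vw_def act_sum ..
  also have "\<dots> = act ww (act (uu 0) (act ww v)) i + (\<Sum>x\<in>UNIV - {0}. act ww (act (uu x) (act ww v)) i)"
    by (rule sum.remove) auto
  also have "\<dots> = \<chi> c1 (- 1) (- 1) * v i +
      (\<Sum>x\<in>UNIV - {0}. \<chi> c1 (- x) (- rinv x) * act (uu (- rinv x)) (act ww v) i)"
    unfolding e by (intro arg_cong2[where f = "(+)"] sum.cong) auto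
  finally show "act ww (vw v) i = \<chi> c1 (- 1) (- 1) * v i +
      (\<Sum>x\<in>UNIV - {0}. \<chi> c1 (- x) (- rinv x) * act (uu (- rinv x)) (act ww v) i)" .
qed

text \<open>Multiplication by this determinant-one element takes the torus element with diagonal 1,
  \<open>a\<close> to its swap, on which a symmetric character has the same value.\<close>

lemma chi_SL:
  assumes v: "eigen v \<chi>" and sym: "\<And>c a b. dg c a b \<in> GG \<Longrightarrow> \<chi> c a b = \<chi> c b a" and a: "\<not> p dvd a"
  shows "\<chi> c1 a (rinv a) = 1"
proof -
  obtain c where c: "dg c a 1 \<in> GG" using dg_ex[OF a, of 1] p_nonunit by auto
  have G: "dg c1 a (rinv a) \<in> GG" using a by (simp add: dg_in ok_one)
  have c': "dg c 1 a \<in> GG" using c dg_swap by blast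
  have "gm (dg c1 a (rinv a)) (dg c 1 a) = dg c a 1" using a by (simp add: dg_def)
  then have "act (dg c a 1) v = act (dg c1 a (rinv a)) (act (dg c 1 a) v)" using G c' by (simp add: act_mul[symmetric])
  then have eq: "(\<lambda>i. \<chi> c a 1 * v i) = (\<lambda>i. \<chi> c 1 a * (\<chi> c1 a (rinv a) * v i))"
    using v c c' G by (simp add: eigen_def act_scale)
  have "v \<noteq> (\<lambda>_. 0)" using v by (simp add: eigen_def)
  then obtain i where "v i \<noteq> 0" by auto
  then have "\<chi> c a 1 = \<chi> c 1 a * \<chi> c1 a (rinv a)" using fun_cong[OF eq, of i] by simp
  then show ?thesis using sym[OF c] chi_nz[OF v c'] by simp
qed

lemma one_line_card:
  assumes v: "v \<in> VS" "v \<noteq> (\<lambda>_. 0)" and line: "\<And>g. g \<in> GG \<Longrightarrow> \<exists>k. act g v = (\<lambda>i. k * v i)"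
  shows "card I \<le> 1"
proof -
  have "card I \<le> card {()}"
  proof (rule card_le_spanning[where w = "\<lambda>_. v"])
    fix h i assume h: "\<And>s. s \<in> {()} \<Longrightarrow> (\<Sum>i\<in>I. h i * v i) = 0" and i: "i \<in> I"
    show "h i = 0"
    proof (rule functional_zero_on_orbit[OF v _ i])
      fix g assume "g \<in> GG"
      then obtain k where k: "act g v = (\<lambda>i. k * v i)" using line by blast
      have "(\<Sum>i\<in>I. h i * act g v i) = k * (\<Sum>i\<in>I. h i * v i)" unfolding k by (simp add: sum_distrib_left mult_ac)
      then show "(\<Sum>i\<in>I. h i * act g v i) = 0" using h by simp
    qed
  qed simp
  then show ?thesis by simp
qed

text \<open>The second conclusion is what the form estimates consume: an element of
  \<open>T'\<close> separating the two conjugate characters decides which cells vanish.\<close>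

theorem principal_series:
  assumes n: "card I = (q + 1) * q ^ (l - 1)"
  shows "\<exists>v \<chi> v'. eigen v \<chi> \<and> eigen v' (\<lambda>c a b. \<chi> c b a) \<and>
    (\<exists>c a b. dg c a b \<in> GG \<and> f dvd a - b \<and> \<chi> c a b \<noteq> \<chi> c b a)"
proof -
  have dN: "dimN = 2 * q ^ (l - 1)"
  proof -
    have "(q + 1) * q ^ (l - 1) = (q - 1) * q ^ (l - 1) + dimN" using dim_formula' n by simp
    moreover have "(q + 1) * q ^ (l - 1) = (q - 1) * q ^ (l - 1) + 2 * q ^ (l - 1)"
      using q_ge_3 by (simp add: distrib_right[symmetric])
    ultimately show ?thesis by simp
  qed
  have Qpos: "q ^ (l - 1) > 0" using q_ge_3 by simp
  show ?thesis
  proof (cases "2 \<le> l")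
    case True
    \<comment> \<open>Otherwise \<open>q\<close> orthogonal copies of \<open>N\<close> would fit
      into the space, giving \<open>2 * q <= q + 1\<close>.\<close>
    have "\<not> (\<forall>v\<in>NN. \<forall>s. act (Dd s) v = v)"
    proof
      assume "\<forall>v\<in>NN. \<forall>s. act (Dd s) v = v"
      then have "q * dimN \<le> card I" by (intro dimN_lines[OF True]) auto
      then have "(2 * q) * q ^ (l - 1) \<le> (q + 1) * q ^ (l - 1)" using dN n by (simp add: mult_ac)
      then have "2 * q \<le> q + 1" using Qpos by (metis mult_le_cancel2)
      then show False using q_ge_3 by simp
    qed
    with Dd_dichotomy[OF True] obtain v0 y where v0: "v0 \<in> NN" "v0 \<noteq> (\<lambda>_. 0)" and y: "\<not> p dvd y"
      and v0y: "spec Dd (p ^ (l - 1) * y) v0 = v0" by blast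
    from borel_vector_ex[OF v0, of y] y v0y obtain v \<chi>0 where v: "v \<in> VS" "v \<noteq> (\<lambda>_. 0)" "\<forall>x. act (uu x) v = v"
      "\<forall>c a b. dg c a b \<in> GG \<longrightarrow> act (dg c a b) v = (\<lambda>i. \<chi>0 (dg c a b) * v i)"
      and D: "\<And>s. act (Dd s) v = (\<lambda>i. \<psi> (p ^ (l - 1) * y * s) * v i)" using True by auto
    define \<chi> where "\<chi> = (\<lambda>c a b. \<chi>0 (dg c a b))"
    have e: "eigen v \<chi>" using v by (simp add: eigen_def \<chi>_def)
    obtain i where i: "v i \<noteq> 0" using v(2) by auto
    have rs: "rinv (1 + f * s) = 1 - f * s" for s
      using rinv_1f[OF True, of s] by (simp add: p_pow_l)
    have chiD: "\<chi> c1 (1 + f * s) (1 - f * s) = \<psi> (p ^ (l - 1) * y * s)" for s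
    proof -
      have "Dd s = dg c1 (1 + f * s) (1 - f * s)" using Dd_dg rs by simp
      moreover have "Dd s \<in> GG" using True by simp
      ultimately have "act (Dd s) v = (\<lambda>i. \<chi> c1 (1 + f * s) (1 - f * s) * v i)" using e by (simp add: eigen_def)
      then have "\<chi> c1 (1 + f * s) (1 - f * s) * v i = \<psi> (p ^ (l - 1) * y * s) * v i" using D[of s] by (metis (no_types))
      then show ?thesis using i by simp
    qed
    obtain x where x: "\<psi> (p ^ (l - 1) * x) \<noteq> 1" using psi_nontriv by blast
    have u2: "\<not> p dvd 2 * y" using two_unit y by (simp add: unit_mult)
    \<comment> \<open>The two characters at \<open>Dd s\<close> are inverse values of
      \<open>\<psi>\<close>; this \<open>s\<close> makes their quotient
      \<open>\<psi> (p ^ (l - 1) * x)\<close>.\<close>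
    define s where "s = x * rinv (2 * y)"
    have "\<chi> c1 (1 + f * s) (1 - f * s) \<noteq> \<chi> c1 (1 - f * s) (1 + f * s)"
    proof
      assume "\<chi> c1 (1 + f * s) (1 - f * s) = \<chi> c1 (1 - f * s) (1 + f * s)"
      then have "\<psi> (p ^ (l - 1) * y * s) = \<psi> (- (p ^ (l - 1) * y * s))" using chiD[of s] chiD[of "- s"] by simp
      then have "\<psi> (p ^ (l - 1) * y * s) * \<psi> (p ^ (l - 1) * y * s) = 1" using psi_minus(1)[of "p ^ (l - 1) * y * s"] by simp
      then have "\<psi> (p ^ (l - 1) * y * s + p ^ (l - 1) * y * s) = 1" by (simp only: psi_add)
      moreover have "p ^ (l - 1) * y * s + p ^ (l - 1) * y * s = p ^ (l - 1) * (2 * y * (x * rinv (2 * y)))"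
        unfolding s_def by (simp only: mult_2 distrib_left distrib_right mult_ac)
      ultimately show False using x rinv_mult(1)[OF u2, of x] by simp
    qed
    moreover have "dg c1 (1 + f * s) (1 - f * s) \<in> GG" using Dd_in[OF True, of s] Dd_dg[of s] rs by simp
    moreover have "f dvd (1 + f * s) - (1 - f * s)"
    proof -
      have "(1 + f * s) - (1 - f * s) = f * (s + s)" by (simp add: algebra_simps)
      then show ?thesis by simp
    qed
    ultimately show ?thesis using e eigen_vw[OF e n] by blast
  next
    case False
    then have l: "l = 1" using l1 by simp
    then have f1: "f = 1" unfolding f_def by simp
    have "dimN > 0" using dN Qpos by simp
    then obtain v0 where v0: "v0 \<in> NN" "v0 \<noteq> (\<lambda>_. 0)" using dimN_pos_iff by blast
    from borel_vector_ex[OF v0, of 1] False obtain v \<chi>0 where v: "v \<in> VS" "v \<noteq> (\<lambda>_. 0)" "\<forall>x. act (uu x) v = v"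
      "\<forall>c a b. dg c a b \<in> GG \<longrightarrow> act (dg c a b) v = (\<lambda>i. \<chi>0 (dg c a b) * v i)" by auto
    define \<chi> where "\<chi> = (\<lambda>c a b. \<chi>0 (dg c a b))"
    have e: "eigen v \<chi>" using v by (simp add: eigen_def \<chi>_def)
    have "\<exists>c a b. dg c a b \<in> GG \<and> \<chi> c a b \<noteq> \<chi> c b a"
    proof (rule ccontr)
      assume "\<not> ?thesis"
      then have sym: "\<chi> c a b = \<chi> c b a" if "dg c a b \<in> GG" for c a b using that by blast
      have p0: "p = 0" using p_pow_l l by simp
      have u: "\<not> p dvd x" if "x \<noteq> 0" for x using that p0 by simp
      have r1: "rinv (- 1) = - 1" using rinv_unique[of "- 1" "- 1"] p_nonunit by simp
      have x1: "\<chi> c1 (- 1) (- 1) = 1" using chi_SL[OF e sym, of "- 1"] r1 p_nonunit by simp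
      have xx: "\<chi> c1 (- x) (- rinv x) = 1" if "x \<noteq> 0" for x
      proof -
        have "- rinv x = rinv (- x)" using u[OF that] by (intro rinv_unique) auto
        then show ?thesis using chi_SL[OF e sym, of "- x"] u[OF that] by simp
      qed
      have ri: "- rinv (- rinv x) = x" and ri0: "rinv x \<noteq> 0" if "x \<noteq> 0" for x
      proof -
        have ux: "\<not> p dvd x" using u that by simp
        have "x = rinv (rinv x)" using ux by (intro rinv_unique) auto
        moreover have "- rinv (rinv x) = rinv (- rinv x)" using ux by (intro rinv_unique) auto
        ultimately show "- rinv (- rinv x) = x" by (metis minus_minus)
        show "rinv x \<noteq> 0" using rinv_unit[OF ux] by auto
      qed
      \<comment> \<open>For a Weyl invariant character the formula for \<open>ww_vw\<close> shows
        that \<open>vw v + v\<close> is fixed by \<open>ww\<close>. Being a Borel eigenvector as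
        well, it would span an invariant line.\<close>
      define y where "y = (\<lambda>i. vw v i + 1 * v i)"
      have y: "y \<in> VS" "y \<noteq> (\<lambda>_. 0)" using vw_independent[OF e n, of 1] vw_VS[of v] v(1) by (auto simp: y_def VS_def)
      have "act ww (vw v) = (\<lambda>i. v i + (vw v i - act ww v i))"
      proof
        fix i
        have "(\<Sum>x\<in>UNIV - {0}. \<chi> c1 (- x) (- rinv x) * act (uu (- rinv x)) (act ww v) i)
            = (\<Sum>x\<in>UNIV - {0}. act (uu (- rinv x)) (act ww v) i)" by (intro sum.cong) (auto simp: xx)
        also have "\<dots> = (\<Sum>x\<in>UNIV - {0}. act (uu x) (act ww v) i)"
          by (rule sum.reindex_bij_witness[of _ "\<lambda>x. - rinv x" "\<lambda>x. - rinv x"]) (auto simp: ri ri0)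
        also have "\<dots> = vw v i - act (uu 0) (act ww v) i"
          unfolding vw_def by (simp add: sum_diff1)
        also have "act (uu 0) (act ww v) = act ww v" by (simp add: uu_def)
        finally show "act ww (vw v) i = v i + (vw v i - act ww v i)"
          unfolding ww_vw[OF e l] x1 by simp
      qed
      then have wy: "act ww y = y" unfolding y_def act_add by (simp add: fun_eq_iff)
      have ey: "eigen y \<chi>"
      proof -
        have "act (dg c a b) y = (\<lambda>i. \<chi> c a b * y i)" if t: "dg c a b \<in> GG" for c a b
        proof -
          have "act (dg c a b) v = (\<lambda>i. \<chi> c a b * v i)" using e t by (simp add: eigen_def)
          then show ?thesis using dg_vw[OF e t] sym[OF t] by (simp add: y_def act_add distrib_left)
        qed
        moreover have "act (uu x) y = y" for x using e uu_vw by (simp add: y_def act_add eigen_def)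
        ultimately show ?thesis using y by (simp add: eigen_def)
      qed
      have "\<exists>k. act g y = (\<lambda>i. k * y i)" if "g \<in> GG" for g
      proof -
        have "act (uu x) (act ww y) = y" for x using wy ey by (simp add: eigen_def)
        moreover have "act (ub z) y = y" if "p dvd z" for z using that p0 y by (simp add: ub_def)
        ultimately show ?thesis using eigen_orbit[OF ey that] by auto
      qed
      then have "card I \<le> 1" by (rule one_line_card[OF y])
      then show False using n l q_ge_3 by simp
    qed
    then obtain c a b where "dg c a b \<in> GG" "\<chi> c a b \<noteq> \<chi> c b a" by blast
    moreover have "f dvd a - b" using f1 by simp
    ultimately show ?thesis using e eigen_vw[OF e n] by blast
  qed
qed

end

section \<open>The representations of split nonsemisimple type\<close>

context top_rep
begin

lemma functional_lincomb:
  assumes "(\<lambda>i. \<Sum>s\<in>S. w s i) = v" "\<And>s. s \<in> S \<Longrightarrow> (\<Sum>i\<in>I. h i * w s i) = (0::complex)"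
  shows "(\<Sum>i\<in>I. h i * v i) = 0"
proof -
  have "(\<Sum>i\<in>I. h i * v i) = (\<Sum>s\<in>S. \<Sum>i\<in>I. h i * w s i)"
    unfolding assms(1)[symmetric] sum_distrib_left by (rule sum.swap)
  then show ?thesis using assms(2) by simp
qed

lemma act_inj: "g \<in> GG \<Longrightarrow> v \<in> VS \<Longrightarrow> w \<in> VS \<Longrightarrow> act g v = act g w \<Longrightarrow> v = w"
  by (metis act_inv_left)

text \<open>One vector serves all primitive parameters: if \<open>a * b = b0\<close>, then
  \<open>dg c a 1\<close> carries the line of \<open>b0\<close> to the line of \<open>b\<close>, and
  both are lines by multiplicity one.\<close>

lemma whittaker_vector:
  assumes "\<not> p dvd b0"
  shows "\<exists>\<xi>\<in>VS. spec uu b0 \<xi> = \<xi> \<and> (\<forall>b v c a. dg c a 1 \<in> GG \<longrightarrow> a * b = b0 \<longrightarrow>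
     (\<exists>k. spec uu b v = (\<lambda>i. k * act (dg c a 1) \<xi> i)))"
proof -
  have "mult uu b0 = 1" using mult_uu_unit[OF assms, of 1] mult_uu_1 by simp
  then obtain \<xi> where \<xi>: "\<xi> \<in> VS" "spec uu b0 \<xi> = \<xi>" and line: "\<And>v. \<exists>c. spec uu b0 v = (\<lambda>i. c * \<xi> i)"
    using mult_1_line[OF onepar_uu] by metis
  have "\<exists>k. spec uu b v = (\<lambda>i. k * act (dg c a 1) \<xi> i)" if c: "dg c a 1 \<in> GG" and ab: "a * b = b0" for b v c a
  proof -
    define w where "w = spec uu b v"
    have wV: "w \<in> VS" by (simp add: w_def)
    have wU: "act (uu x) w = (\<lambda>i. \<psi> (b * x) * w i)" for x unfolding w_def by (rule spec_eigen[OF onepar_uu])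
    define y where "y = act (ginv (dg c a 1)) w"
    have yV: "y \<in> VS" and dy: "act (dg c a 1) y = w" using c wV by (auto simp: y_def)
    have "act (uu x) y = (\<lambda>i. \<psi> (b0 * x) * y i)" for x
    proof (rule act_inj[OF c])
      have "b * (a * x) = b0 * x" using ab by (metis mult.assoc mult.commute)
      then show "act (dg c a 1) (act (uu x) y) = act (dg c a 1) (\<lambda>i. \<psi> (b0 * x) * y i)"
        using act_dg_uu[OF c] dy wU[of "a * x"] by (simp add: act_scale)
    qed (use yV in auto)
    then have "spec uu b0 y = y" using spec_fix_iff[OF onepar_uu] by blast
    then obtain k where k: "y = (\<lambda>i. k * \<xi> i)" using line[of y] by auto
    have "w = (\<lambda>i. k * act (dg c a 1) \<xi> i)" using dy unfolding k act_scale by simp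
    then show ?thesis unfolding w_def by blast
  qed
  then show ?thesis using \<xi> by blast
qed

lemma NN_part: assumes v: "v \<in> VS" shows "(\<lambda>i. \<Sum>b\<in>{b. p dvd b}. spec uu b v i) \<in> NN"
proof -
  have "spec uu b v \<in> NN" if "p dvd b" for b
  proof (rule eigen_NN)
    show "spec uu b (spec uu b v) = spec uu b v"
      using spec_eigen[OF onepar_uu] spec_fix_iff[OF onepar_uu] by blast
  qed (use that in auto)
  then show ?thesis using NN_lincomb[of "{b. p dvd b}" "\<lambda>b. spec uu b v" "\<lambda>_. 1"] by simp
qed

lemma functional_zero_if:
  assumes v: "v \<in> VS" and prim: "\<And>b. \<not> p dvd b \<Longrightarrow> (\<Sum>i\<in>I. h i * spec uu b v i) = (0::complex)"
    and N: "\<And>w. w \<in> NN \<Longrightarrow> (\<Sum>i\<in>I. h i * w i) = 0"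
  shows "(\<Sum>i\<in>I. h i * v i) = 0"
proof -
  define w where "w = (\<lambda>i. \<Sum>b\<in>{b. p dvd b}. spec uu b v i)"
  define w' where "w' = (\<lambda>i. \<Sum>b\<in>{b. \<not> p dvd b}. spec uu b v i)"
  have "v = (\<lambda>i. w i + w' i)"
  proof
    fix i
    have "v i = (\<Sum>b\<in>UNIV. spec uu b v i)" using spec_sum[OF onepar_uu v] by simp
    also have "\<dots> = (\<Sum>b\<in>{b. p dvd b}. spec uu b v i) + (\<Sum>b\<in>{b. \<not> p dvd b}. spec uu b v i)"
      by (subst sum.union_disjoint[symmetric]) (auto intro!: sum.cong)
    finally show "v i = w i + w' i" by (simp add: w_def w'_def)
  qed
  then have "(\<Sum>i\<in>I. h i * v i) = (\<Sum>i\<in>I. h i * w i) + (\<Sum>i\<in>I. h i * w' i)"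
    by (simp add: distrib_left sum.distrib)
  also have "(\<Sum>i\<in>I. h i * w i) = 0" using N NN_part[OF v] by (simp add: w_def)
  also have "(\<Sum>i\<in>I. h i * w' i) = 0" by (rule functional_lincomb[OF w'_def[symmetric]]) (use prim in auto)
  finally show ?thesis by simp
qed

text \<open>Lower unipotents with parameter in the maximal ideal commute with
  \<open>uu (f * s)\<close> modulo the level, so they act on \<open>N\<close> and serve to decompose
  it.\<close>

definition hb :: "'r \<Rightarrow> 'c \<times> 'r m2" where "hb s = ub (p * s)"

lemma onepar_hb: "onepar hb"
proof -
  have "gm (ub x) (ub y) = ub (x + y)" for x y by (simp add: ub_def)
  then have "act (ub (x + y)) v = act (ub x) (act (ub y) v)" for x y v by (metis act_mul ub_in)
  then show ?thesis by (simp add: onepar_def hb_def distrib_left) (simp add: ub_def ext_one_def mid_def)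
qed

lemma hb_NN: "v \<in> NN \<Longrightarrow> act (hb s) v \<in> NN"
  unfolding NN_def hb_def by (simp add: uu_f_ub)

lemma spec_hb_NN: "v \<in> NN \<Longrightarrow> spec hb b v \<in> NN"
  unfolding spec_eq by (rule NN_lincomb) (rule hb_NN)

lemma spec_hf_NN: "v \<in> NN \<Longrightarrow> spec hf 0 v = v"
  using spec_fix_iff[OF onepar_hf, of 0 v] by (simp add: NN_def hf_def)

lemma spec_hf_in: "v \<in> VS \<Longrightarrow> spec hf 0 v \<in> NN"
  using spec_eigen[OF onepar_hf, of _ 0 v] spec_in[OF onepar_hf] by (simp add: NN_def hf_def)

text \<open>The projection onto the part of \<open>N\<close> on which \<open>hb\<close> has
  parameter \<open>b\<close>. Written as a double sum over group elements, its trace can be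
  transported by torus conjugation.\<close>

definition KK :: "'r \<Rightarrow> 'i \<Rightarrow> 'i \<Rightarrow> complex" where
  "KK b = (\<lambda>i k. \<Sum>(x, y)\<in>UNIV \<times> UNIV. (\<psi> (- (b * x)) / cardR / cardR) * \<rho> (gm (hb x) (hf y)) i k)"

lemma hb_hf_in: "hb x \<in> GG" "hf y \<in> GG" by (simp_all add: hb_def hf_def)

lemma KK_app: "app I (KK b) v = spec hb b (spec hf 0 v)"
proof
  fix i
  have "app I (KK b) v i = (\<Sum>s\<in>UNIV \<times> UNIV. (\<psi> (- (b * fst s)) / cardR / cardR) * act (gm (hb (fst s)) (hf (snd s))) v i)"
    unfolding KK_def act_def using app_kernel_lincomb[where S = "UNIV \<times> UNIV"
      and c = "\<lambda>s. \<psi> (- (b * fst s)) / cardR / cardR" and K = "\<lambda>s. \<rho> (gm (hb (fst s)) (hf (snd s)))"]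
    by (simp add: case_prod_beta)
  also have "\<dots> = (\<Sum>x\<in>UNIV. \<Sum>y\<in>UNIV. (\<psi> (- (b * x)) / cardR / cardR) * act (gm (hb x) (hf y)) v i)"
    by (subst sum.cartesian_product) (simp add: case_prod_beta)
  also have "\<dots> = spec hb b (spec hf 0 v) i"
    unfolding spec_eq act_lincomb using hb_hf_in by (simp add: act_mul sum_distrib_left)
  finally show "app I (KK b) v i = spec hb b (spec hf 0 v) i" .
qed

lemma KK_proj: "proj_kernel (KK b)"
  unfolding proj_kernel_def
proof (intro conjI ballI allI impI)
  fix v assume v: "v \<in> VS"
  have "spec hb b (spec hf 0 v) \<in> NN" using spec_hb_NN[OF spec_hf_in[OF v]] .
  moreover have "spec hb b (spec hb b w) = spec hb b w" for w
    using spec_eigen[OF onepar_hb] spec_fix_iff[OF onepar_hb] by blast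
  ultimately show "app I (KK b) (app I (KK b) v) = app I (KK b) v" unfolding KK_app by (simp add: spec_hf_NN)
next
  fix i k assume "i \<notin> I"
  then show "KK b i k = 0" using hb_hf_in by (simp add: KK_def rep_supp case_prod_beta)
qed

lemma tr_KK: "tr (KK b) = (\<Sum>x\<in>UNIV. \<Sum>y\<in>UNIV. (\<psi> (- (b * x)) / cardR / cardR) * tr (\<rho> (gm (hb x) (hf y))))"
proof -
  have "tr (KK b) = (\<Sum>s\<in>UNIV \<times> UNIV. \<Sum>i\<in>I. (\<psi> (- (b * fst s)) / cardR / cardR) * \<rho> (gm (hb (fst s)) (hf (snd s))) i i)"
    unfolding tr_def KK_def by (subst sum.swap) (simp add: case_prod_beta)
  also have "\<dots> = (\<Sum>s\<in>UNIV \<times> UNIV. (\<psi> (- (b * fst s)) / cardR / cardR) * tr (\<rho> (gm (hb (fst s)) (hf (snd s)))))"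
    by (simp add: tr_def sum_distrib_left)
  finally show ?thesis by (subst sum.cartesian_product) (simp add: case_prod_beta)
qed

lemma hb_hf_conj: assumes c: "dg c a 1 \<in> GG"
  shows "gm (gm (dg c a 1) (gm (hb x) (hf y))) (ginv (dg c a 1)) = gm (hb (rinv a * x)) (hf (a * y))"
proof -
  have a: "\<not> p dvd a" using dg_units(1)[OF c] .
  have 1: "p * (rinv a * x) * a = p * x"
  proof -
    have "p * (rinv a * x) * a = (a * rinv a) * (p * x)" by (simp only: mult_ac)
    then show ?thesis using a by simp
  qed
  have 2: "p * (rinv a * x) * (f * (a * y)) = p * x * (f * y)"
  proof -
    have "p * (rinv a * x) * (f * (a * y)) = (p * (rinv a * x) * a) * (f * y)" by (simp only: mult_ac)
    then show ?thesis using 1 by simp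
  qed
  have "gm (dg c a 1) (gm (hb x) (hf y)) = gm (gm (hb (rinv a * x)) (hf (a * y))) (dg c a 1)"
    using 1 2 by (simp add: dg_def hb_def hf_def ub_def uu_def)
  then show ?thesis using c hb_hf_in by (simp add: assoc)
qed

lemma rank_KK_unit: assumes a: "\<not> p dvd a" shows "rank (KK (a * b)) = rank (KK b)"
proof -
  obtain c where c: "dg c a 1 \<in> GG" using dg_ex[OF a, of 1] p_nonunit by auto
  have t: "tr (\<rho> (gm (hb x) (hf y))) = tr (\<rho> (gm (hb (rinv a * x)) (hf (a * y))))" for x y
    using tr_conj[OF c, of "gm (hb x) (hf y)"] hb_hf_in hb_hf_conj[OF c] by simp
  have "tr (KK b) = (\<Sum>x\<in>UNIV. \<Sum>y\<in>UNIV. (\<psi> (- (b * x)) / cardR / cardR) * tr (\<rho> (gm (hb (rinv a * x)) (hf (a * y)))))"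
    unfolding tr_KK t[symmetric] ..
  also have "\<dots> = (\<Sum>x\<in>UNIV. \<Sum>y\<in>UNIV. (\<psi> (- (b * x)) / cardR / cardR) * tr (\<rho> (gm (hb (rinv a * x)) (hf y))))"
  proof (rule sum.cong[OF refl])
    fix x
    show "(\<Sum>y\<in>UNIV. (\<psi> (- (b * x)) / cardR / cardR) * tr (\<rho> (gm (hb (rinv a * x)) (hf (a * y)))))
       = (\<Sum>y\<in>UNIV. (\<psi> (- (b * x)) / cardR / cardR) * tr (\<rho> (gm (hb (rinv a * x)) (hf y))))"
      by (rule sum.reindex_bij_witness[of _ "\<lambda>y. rinv a * y" "\<lambda>y. a * y"]) (use a in auto)
  qed
  also have "\<dots> = (\<Sum>x\<in>UNIV. \<Sum>y\<in>UNIV. (\<psi> (- (a * b * x)) / cardR / cardR) * tr (\<rho> (gm (hb x) (hf y))))"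
  proof (rule sum.reindex_bij_witness[of _ "\<lambda>x. a * x" "\<lambda>x. rinv a * x"])
    fix x
    have "a * b * (rinv a * x) = (a * rinv a) * (b * x)" by (simp only: mult_ac)
    then have "a * b * (rinv a * x) = b * x" using a by simp
    then show "(\<Sum>y\<in>UNIV. (\<psi> (- (a * b * (rinv a * x))) / cardR / cardR) * tr (\<rho> (gm (hb (rinv a * x)) (hf y))))
       = (\<Sum>y\<in>UNIV. (\<psi> (- (b * x)) / cardR / cardR) * tr (\<rho> (gm (hb (rinv a * x)) (hf y))))" by simp
  qed (use a in auto)
  also have "\<dots> = tr (KK (a * b))" by (rule tr_KK[symmetric])
  finally have "(of_nat (rank (KK b)) :: complex) = of_nat (rank (KK (a * b)))" by (simp add: rank_trace[OF KK_proj, symmetric])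
  then show ?thesis by (simp only: of_nat_eq_iff)
qed

lemma sum_rank_KK: "(\<Sum>b\<in>UNIV. rank (KK b)) = dimN"
proof -
  have "(of_nat (\<Sum>b\<in>UNIV. rank (KK b)) :: complex) = (\<Sum>b\<in>UNIV. tr (KK b))" by (simp add: rank_trace[OF KK_proj])
  also have "\<dots> = (\<Sum>x\<in>UNIV. \<Sum>y\<in>UNIV. (\<Sum>b\<in>UNIV. \<psi> (- (x * b))) * (1 / cardR / cardR * tr (\<rho> (gm (hb x) (hf y)))))"
  proof -
    have "(\<Sum>b\<in>UNIV. tr (KK b)) = (\<Sum>x\<in>UNIV. \<Sum>b\<in>UNIV. \<Sum>y\<in>UNIV. (\<psi> (- (b * x)) / cardR / cardR) * tr (\<rho> (gm (hb x) (hf y))))"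
      unfolding tr_KK by (rule sum.swap)
    also have "\<dots> = (\<Sum>x\<in>UNIV. \<Sum>y\<in>UNIV. \<Sum>b\<in>UNIV. (\<psi> (- (b * x)) / cardR / cardR) * tr (\<rho> (gm (hb x) (hf y))))"
      by (rule sum.cong[OF refl]) (rule sum.swap)
    finally show ?thesis by (simp add: sum_distrib_right sum_divide_distrib mult.commute)
  qed
  also have "\<dots> = (\<Sum>x\<in>UNIV. if x = 0 then (\<Sum>y\<in>UNIV. 1 / cardR * tr (\<rho> (gm (hb x) (hf y)))) else 0)"
    by (intro sum.cong refl) (auto simp: psi_orthogonality_minus sum_distrib_left)
  also have "\<dots> = (\<Sum>y\<in>UNIV. 1 / cardR * tr (\<rho> (gm (hb 0) (hf y))))" by simp
  also have "\<dots> = tr (specK hf 0)"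
  proof -
    have "gm (hb 0) (hf y) = hf y" for y by (simp add: hb_def hf_def ub_def uu_def)
    then show ?thesis unfolding tr_specK by simp
  qed
  also have "\<dots> = of_nat dimN" by (rule tr_hf)
  finally show ?thesis by (simp only: of_nat_eq_iff)
qed

lemma sns_dimN:
  assumes "card I = (if l = 1 then q else (q ^ 2 - 1) * q ^ (l - 2))"
  shows "l = 1 \<Longrightarrow> dimN = 1" "2 \<le> l \<Longrightarrow> dimN = (q - 1) * q ^ (l - 2)"
proof -
  show "dimN = 1" if "l = 1" using assms dim_formula' that q_ge_3 by simp
  assume l: "2 \<le> l"
  have 1: "q ^ (l - 1) = q * q ^ (l - 2)" using l by (metis Suc_1 Suc_diff_Suc Suc_le_lessD power_Suc)
  have 2: "q ^ 2 - 1 = (q - 1) * (q + 1)" by (simp add: power2_eq_square algebra_simps)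
  have "card I = (q ^ 2 - 1) * q ^ (l - 2)" using assms l by simp
  also have "\<dots> = (q - 1) * (q * q ^ (l - 2)) + (q - 1) * q ^ (l - 2)" unfolding 2 by (simp only: distrib_left distrib_right mult_ac mult_1)
  finally show "dimN = (q - 1) * q ^ (l - 2)" using dim_formula' unfolding 1 by simp
qed

text \<open>A nontrivial \<open>Dd\<close>-character in \<open>N\<close> would bring in all
  \<open>q ^ (l - 1)\<close> nonprimitive characters of \<open>U\<close>, more than
  \<open>dimN\<close> leaves room for.\<close>

lemma sns_Dd:
  assumes n: "card I = (if l = 1 then q else (q ^ 2 - 1) * q ^ (l - 2))" and l: "2 \<le> l" and v: "v \<in> NN"
  shows "act (Dd s) v = v"
proof -
  have 1: "q ^ (l - 1) = q * q ^ (l - 2)" using l by (metis Suc_1 Suc_diff_Suc Suc_le_lessD power_Suc)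
  have "dimN < q ^ (l - 1)" unfolding 1 sns_dimN(2)[OF n l] using q_ge_3 by simp
  then show ?thesis using Dd_dichotomy[OF l] dimN_ge[OF l] v by (meson not_le)
qed

lemma sns_line:
  assumes n: "card I = (if l = 1 then q else (q ^ 2 - 1) * q ^ (l - 2))" and l: "l = 1"
    and v: "v \<in> NN" "v \<noteq> (\<lambda>_. 0)" and w: "w \<in> NN"
  shows "\<exists>k. w = (\<lambda>i. k * v i)"
proof -
  have p0: "p = 0" using p_pow_l l by simp
  have f1: "f = 1" unfolding f_def using l by simp
  have zero: "Collect ((dvd) 0) = {0::'r}" by auto
  have "mult uu 0 = 1" using sns_dimN(1)[OF n l] unfolding dimN_def by (simp add: p0 zero)
  then obtain \<xi> where \<xi>: "\<And>v. \<exists>c. spec uu 0 v = (\<lambda>i. c * \<xi> i)" using mult_1_line[OF onepar_uu] by metis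
  have "spec uu 0 x = x" if "x \<in> NN" for x
    using that spec_fix_iff[OF onepar_uu, of 0 x] f1 by (auto simp: NN_def)
  then obtain a b where a: "v = (\<lambda>i. a * \<xi> i)" and b: "w = (\<lambda>i. b * \<xi> i)" using \<xi>[of v] \<xi>[of w] v w by auto
  have "a \<noteq> 0" using a v(2) by auto
  then have "w = (\<lambda>i. b / a * v i)" unfolding a b by simp
  then show ?thesis by blast
qed

text \<open>Here \<open>N\<close> is a line, so the intertwining operator acts on it by a scalar
  \<open>\<kappa>\<close>; comparing torus characters shows that a nonzero \<open>\<kappa>\<close>
  forces Weyl invariance.\<close>

lemma sns_eigen:
  assumes n: "card I = (if l = 1 then q else (q ^ 2 - 1) * q ^ (l - 2))" and l: "l = 1"
  shows "\<exists>v \<chi>. v \<in> NN \<and> eigen v \<chi> \<and> (\<forall>c a b. dg c a b \<in> GG \<longrightarrow> \<chi> c a b = \<chi> c b a)"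
proof -
  have f1: "f = 1" unfolding f_def using l by simp
  have "dimN > 0" using sns_dimN(1)[OF n l] by simp
  then obtain v0 where v0: "v0 \<in> NN" "v0 \<noteq> (\<lambda>_. 0)" using dimN_pos_iff by blast
  from borel_vector_ex[OF v0, of 1] l obtain v \<chi>0 where v: "v \<in> VS" "v \<noteq> (\<lambda>_. 0)" "\<forall>x. act (uu x) v = v"
    "\<forall>c a b. dg c a b \<in> GG \<longrightarrow> act (dg c a b) v = (\<lambda>i. \<chi>0 (dg c a b) * v i)" by auto
  define \<chi> where "\<chi> = (\<lambda>c a b. \<chi>0 (dg c a b))"
  have e: "eigen v \<chi>" using v by (simp add: eigen_def \<chi>_def)
  have vN: "v \<in> NN" "vw v \<in> NN" using v uu_vw vw_VS by (auto simp: NN_def)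
  obtain \<kappa> where k: "vw v = (\<lambda>i. \<kappa> * v i)" using sns_line[OF n l vN(1) v(2) vN(2)] by blast
  obtain i where i: "v i \<noteq> 0" using v(2) by auto
  \<comment> \<open>If \<open>vw v\<close> were zero, summing the formula \<open>ww_vw\<close> over
    all translates by \<open>U\<close> would leave only \<open>cardR\<close> times
    \<open>\<chi> c1 (- 1) (- 1)\<close> times \<open>v\<close>, because the other terms sum to
    multiples of \<open>vw v\<close>.\<close>
  have "\<kappa> \<noteq> 0"
  proof
    assume "\<kappa> = 0"
    then have vw0: "vw v = (\<lambda>_. 0)" using k by simp
    have G1: "dg c1 (- 1) (- 1) \<in> GG" by (simp add: dg_in ok_one)
    define C where "C = (\<lambda>x. \<chi> c1 (- x) (- rinv x))"
    have z: "\<chi> c1 (- 1) (- 1) * v i + (\<Sum>x\<in>UNIV - {0}. C x * act (uu (- rinv x)) (act ww v) i) = 0" for i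
      using fun_cong[OF ww_vw[OF e l], of i] vw0 by (simp add: C_def)
    have z': "(\<lambda>i. \<chi> c1 (- 1) (- 1) * v i + (\<Sum>x\<in>UNIV - {0}. C x * act (uu (- rinv x)) (act ww v) i)) = (\<lambda>_. 0)"
      using z by auto
    have "act (uu y) v i = v i" for y using v by simp
    then have zy: "\<chi> c1 (- 1) (- 1) * v i + (\<Sum>x\<in>UNIV - {0}. C x * act (uu (y + - rinv x)) (act ww v) i) = 0" for y
      using fun_cong[OF arg_cong[OF z', of "act (uu y)"], of i]
      by (simp add: act_add act_scale act_lincomb act_uu_uu)
    have "(\<Sum>y\<in>UNIV. act (uu (y + - rinv x)) (act ww v) i) = vw v i" for x
      unfolding vw_def by (rule sum.reindex_bij_witness[of _ "\<lambda>y. y + rinv x" "\<lambda>y. y + - rinv x"]) auto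
    then have s: "(\<Sum>y\<in>UNIV. \<Sum>x\<in>UNIV - {0}. C x * act (uu (y + - rinv x)) (act ww v) i) = 0"
      unfolding vw0 by (subst sum.swap) (simp add: sum_distrib_left[symmetric])
    have "0 = (\<Sum>y\<in>(UNIV::'r set). \<chi> c1 (- 1) (- 1) * v i + (\<Sum>x\<in>UNIV - {0}. C x * act (uu (y + - rinv x)) (act ww v) i))"
      unfolding zy by simp
    also have "\<dots> = cardR * (\<chi> c1 (- 1) (- 1) * v i)" unfolding sum.distrib s by (simp add: cardR_def)
    finally show False using chi_nz[OF e G1] i by simp
  qed
  have "\<chi> c a b = \<chi> c b a" if t: "dg c a b \<in> GG" for c a b
  proof -
    have "act (dg c a b) (vw v) = (\<lambda>i. \<kappa> * (\<chi> c a b * v i))" unfolding k act_scale using e t by (simp add: eigen_def)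
    then have "\<kappa> * (\<chi> c a b * v i) = \<chi> c b a * (\<kappa> * v i)" using dg_vw[OF e t] k by (metis (no_types))
    then show ?thesis using \<open>\<kappa> \<noteq> 0\<close> i by simp
  qed
  then show ?thesis using vN e by blast
qed

lemma sns_torus_scalar:
  assumes n: "card I = (if l = 1 then q else (q ^ 2 - 1) * q ^ (l - 2))"
    and t: "dg c a b \<in> GG" "f dvd a - b"
  shows "\<exists>k. \<forall>v\<in>NN. act (dg c a b) v = (\<lambda>i. k * v i) \<and> act (dg c b a) v = (\<lambda>i. k * v i)"
proof (cases "l = 1")
  case True
  from sns_eigen[OF n True] obtain v \<chi> where v: "v \<in> NN" "eigen v \<chi>"
    and sym: "\<And>c a b. dg c a b \<in> GG \<Longrightarrow> \<chi> c a b = \<chi> c b a" by blast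
  have t': "dg c b a \<in> GG" using t dg_swap by blast
  have "act (dg c a b) w = (\<lambda>i. \<chi> c a b * w i) \<and> act (dg c b a) w = (\<lambda>i. \<chi> c a b * w i)" if w: "w \<in> NN" for w
  proof -
    obtain k where k: "w = (\<lambda>i. k * v i)" using sns_line[OF n True v(1) _ w] v(2) by (auto simp: eigen_def)
    show ?thesis unfolding k act_scale using v(2) t t' sym[OF t(1)] by (auto simp: eigen_def)
  qed
  then show ?thesis by blast
next
  case False
  then have l2: "2 \<le> l" using l1 by simp
  obtain k where k: "a - b = f * k" using t(2) by (rule dvdE)
  \<comment> \<open>Half sum and half difference: the torus element is the central one with entry
    \<open>m\<close> times some \<open>Dd s\<close>, and its swap belongs to \<open>- s\<close>. As
    \<open>f * f = 0\<close> gives \<open>a * b = m * m\<close>, the same scalar part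
    \<open>c\<close> is admissible for the central factor.\<close>
  define m where "m = (a + b) * rinv 2"
  define h where "h = k * rinv 2"
  have ff: "f * f = 0" using f_mult_0 p_dvd_f[OF l2] by blast
  have two: "2 * (x * rinv 2) = x" for x using two_unit by simp
  have a: "a = m + f * h"
  proof -
    have "2 * a = 2 * (m + f * h)" unfolding m_def h_def distrib_left two
      using k two[of "f * k"] by (simp add: mult.assoc) (metis diff_add_cancel add.commute)
    then show ?thesis using unit_cancel[OF two_unit] by blast
  qed
  have b: "b = m - f * h"
  proof -
    have "2 * b = 2 * (m - f * h)" unfolding m_def h_def right_diff_distrib two
      using k two[of "f * k"] by (simp add: mult.assoc) (simp add: algebra_simps)
    then show ?thesis using unit_cancel[OF two_unit] by blast
  qed
  have "a * b = m * m - (f * f) * (h * h)" unfolding a b by (simp add: algebra_simps)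
  then have ab: "a * b = m * m" using ff by simp
  then have mu: "\<not> p dvd m" using dg_units[OF t(1)] unit_mult by metis
  define s where "s = h * rinv m"
  have ms: "m * s = h" unfolding s_def using mu by simp
  have mG: "dg c m m \<in> GG" using t(1) ab by (simp add: dg_in)
  have "gm (dg c m m) g = gm g (dg c m m)" for g
    by (cases g; cases "snd g") (simp add: dg_def cm_comm mult.commute)
  then obtain \<omega> where w: "\<And>v. v \<in> VS \<Longrightarrow> act (dg c m m) v = (\<lambda>i. \<omega> * v i)"
    using central_scalar[OF mG] by metis
  have rs: "rinv (1 + f * s) = 1 - f * s" for s using rinv_1f[OF l2, of s] by (simp add: p_pow_l)
  have mfs: "m * (f * s) = f * h" using ms by (metis mult.left_commute)
  have "Dd s = dg c1 (1 + f * s) (1 - f * s)" for s using Dd_dg rs by simp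
  then have ga: "gm (dg c m m) (Dd s) = dg c a b" and gb: "gm (dg c m m) (Dd (- s)) = dg c b a"
    unfolding a b by (simp_all add: dg_def distrib_left right_diff_distrib mfs)
  have "act (dg c a b) v = (\<lambda>i. \<omega> * v i) \<and> act (dg c b a) v = (\<lambda>i. \<omega> * v i)" if v: "v \<in> NN" for v
  proof -
    have vV: "v \<in> VS" using NN_VS[OF v] .
    have "act (dg c a b) v = act (dg c m m) (act (Dd s) v)" "act (dg c b a) v = act (dg c m m) (act (Dd (- s)) v)"
      unfolding ga[symmetric] gb[symmetric] using mG Dd_in[OF l2] by (simp_all add: act_mul)
    then show ?thesis using sns_Dd[OF n l2 v] w[OF vV] by simp
  qed
  then show ?thesis by blast
qed

lemma KK_fix: assumes "v \<in> VS" "app I (KK b) v = v" shows "v \<in> NN" "act (hb x) v = (\<lambda>i. \<psi> (b * x) * v i)"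
proof -
  have 1: "spec hb b (spec hf 0 v) = v" using assms KK_app by simp
  then show vN: "v \<in> NN" using spec_hb_NN[OF spec_hf_in[OF assms(1)]] by metis
  then have "spec hb b v = v" using 1 spec_hf_NN by simp
  then show "act (hb x) v = (\<lambda>i. \<psi> (b * x) * v i)" using spec_fix_iff[OF onepar_hb] by blast
qed

text \<open>A parameter of \<open>hb\<close> is divisible by \<open>p\<close> because
  \<open>hb\<close> factors through multiplication by \<open>p\<close>. If it were divisible by
  \<open>p ^ 2\<close>, the lower unipotents of the last layer would fix the vector, leaving a
  vector fixed by the whole layer. The remaining parameters are one orbit of the units with
  \<open>(q - 1) * q ^ (l - 2)\<close> elements, which equals \<open>dimN\<close>.\<close>

lemma sns_rank_KK:
  assumes n: "card I = (if l = 1 then q else (q ^ 2 - 1) * q ^ (l - 2))" and l: "2 \<le> l"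
  shows "\<not> (p dvd b \<and> \<not> p ^ 2 dvd b) \<Longrightarrow> rank (KK b) = 0" "rank (KK p) = 1"
proof -
  show z: "rank (KK b) = 0" if b: "\<not> (p dvd b \<and> \<not> p ^ 2 dvd b)" for b
  proof (rule ccontr)
    assume "rank (KK b) \<noteq> 0"
    then obtain v where v: "v \<in> VS" "v \<noteq> (\<lambda>_. 0)" "app I (KK b) v = v" using rank_pos_vector[OF KK_proj] by blast
    note K = KK_fix[OF v(1,3)]
    obtain i where i: "v i \<noteq> 0" using v(2) by auto
    have "\<psi> (p ^ (l - 1) * b * y) = 1" for y
    proof -
      have "hb (p ^ (l - 1) * y) = ub 0" unfolding hb_def using p_mult_top by (simp add: mult.assoc[symmetric])
      then have "act (hb (p ^ (l - 1) * y)) v = v" using v(1) by (simp add: ub_def)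
      then have "\<psi> (b * (p ^ (l - 1) * y)) * v i = v i" using K(2)[of "p ^ (l - 1) * y"] by (metis (no_types))
      then show ?thesis using i by (simp add: mult_ac)
    qed
    then have "p ^ (l - 1) * b = 0" by (rule psi_eq_1_imp)
    then have pb: "p dvd b" using top_mult_eq_0 by blast
    then have "p ^ 2 dvd b" using b by blast
    then obtain t where t: "b = p ^ 2 * t" by (rule dvdE)
    have pp: "p ^ 2 * p ^ (l - 2) = 0" using p_pow_l l by (metis le_add_diff_inverse power_add)
    have fp: "f = p * p ^ (l - 2)" unfolding f_def using l by (metis Suc_1 Suc_diff_Suc Suc_le_lessD power_Suc)
    have "act (ub (f * z)) v = v" for z
    proof -
      have "b * (p ^ (l - 2) * z) = (p ^ 2 * p ^ (l - 2)) * (t * z)" unfolding t by (simp only: mult_ac)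
      then have "b * (p ^ (l - 2) * z) = 0" using pp by simp
      moreover have "ub (f * z) = hb (p ^ (l - 2) * z)" unfolding hb_def fp by (simp add: mult.assoc)
      ultimately show ?thesis using K(2)[of "p ^ (l - 2) * z"] by simp
    qed
    then have "v = (\<lambda>_. 0)" using no_fixed_vector[OF l v(1)] K(1) sns_Dd[OF n l K(1)] by (simp add: NN_def)
    then show False using v(2) by blast
  qed
  define S where "S = {b. p ^ (l - (l - 1)) dvd b \<and> \<not> p ^ (l - (l - 1) + 1) dvd b}"
  have ll: "l - (l - 1) = 1" using l1 by simp
  have S: "S = {b. p dvd b \<and> \<not> p ^ 2 dvd b}" unfolding S_def ll by (simp add: numeral_2_eq_2)
  have cS: "card S = (q - 1) * q ^ (l - 2)" unfolding S_def using card_p_pow_unit[of "l - 1"] l by (simp add: numeral_2_eq_2)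
  have "rank (KK b) = rank (KK p)" if b: "b \<in> S" for b
  proof -
    obtain u where u: "b = p * u" using b S by blast
    then have "\<not> p dvd u" using b mult_dvd_mono[OF dvd_refl, of p u p] unfolding S by (auto simp: power2_eq_square)
    then show ?thesis using rank_KK_unit[of u p] u by (simp add: mult.commute)
  qed
  then have "card S * rank (KK p) = (\<Sum>b\<in>S. rank (KK b))" by simp
  also have "\<dots> = (\<Sum>b\<in>UNIV. rank (KK b))" by (rule sum.mono_neutral_left) (use z S in auto)
  also have "\<dots> = card S" unfolding sum_rank_KK cS using sns_dimN(2)[OF n l] .
  finally show "rank (KK p) = 1" using cS q_ge_3 by simp
qed

text \<open>For \<open>2 <= l\<close> every eigenline of \<open>hb\<close> in \<open>N\<close> is a
  torus translate of the one with parameter \<open>p\<close>; for \<open>l = 1\<close> the space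
  \<open>N\<close> is itself a line. So one torus orbit spans \<open>N\<close>.\<close>

lemma sns_generator:
  assumes n: "card I = (if l = 1 then q else (q ^ 2 - 1) * q ^ (l - 2))"
  shows "\<exists>\<eta>\<in>NN. \<forall>h. (\<forall>c a b. dg c a b \<in> GG \<longrightarrow> (\<Sum>i\<in>I. h i * act (dg c a b) \<eta> i) = (0::complex)) \<longrightarrow>
    (\<forall>w\<in>NN. (\<Sum>i\<in>I. h i * w i) = 0)"
proof (cases "l = 1")
  case True
  from sns_eigen[OF n True] obtain v \<chi> where v: "v \<in> NN" "eigen v \<chi>" by blast
  have "(\<Sum>i\<in>I. h i * w i) = 0"
    if h: "\<forall>c a b. dg c a b \<in> GG \<longrightarrow> (\<Sum>i\<in>I. h i * act (dg c a b) v i) = 0" and w: "w \<in> NN" for h w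
  proof -
    obtain k where k: "w = (\<lambda>i. k * v i)" using sns_line[OF n True v(1) _ w] v(2) by (auto simp: eigen_def)
    have "act (dg c1 1 1) v = v" using NN_VS[OF v(1)] by (simp add: dg_def)
    moreover have "dg c1 1 1 \<in> GG" by (simp add: dg_in ok_one)
    ultimately have "(\<Sum>i\<in>I. h i * v i) = 0" using h by metis
    then have "k * (\<Sum>i\<in>I. h i * v i) = 0" by simp
    then show ?thesis unfolding k sum_distrib_left by (simp add: mult_ac)
  qed
  then show ?thesis using v(1) by blast
next
  case False
  then have l2: "2 \<le> l" using l1 by simp
  from rank_1_line[OF KK_proj sns_rank_KK(2)[OF n l2]] obtain \<eta> where \<eta>: "\<eta> \<in> VS" "app I (KK p) \<eta> = \<eta>"
    and line: "\<And>v. \<exists>c. app I (KK p) v = (\<lambda>i. c * \<eta> i)" by metis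
  have "(\<Sum>i\<in>I. h i * w i) = 0"
    if h: "\<forall>c a b. dg c a b \<in> GG \<longrightarrow> (\<Sum>i\<in>I. h i * act (dg c a b) \<eta> i) = 0" and w: "w \<in> NN" for h w
  proof (rule functional_lincomb[where S = UNIV and w = "\<lambda>b. spec hb b w"])
    show "(\<lambda>i. \<Sum>b\<in>UNIV. spec hb b w i) = w" using spec_sum[OF onepar_hb NN_VS[OF w]] by auto
    fix b
    show "(\<Sum>i\<in>I. h i * spec hb b w i) = 0"
    proof (cases "p dvd b \<and> \<not> p ^ 2 dvd b")
      case b: False
      have "spec hb b w = app I (KK b) w" using spec_hf_NN[OF w] by (simp add: KK_app)
      then have "spec hb b w = (\<lambda>_. 0)" using rank_0[OF KK_proj sns_rank_KK(1)[OF n l2 b]] by simp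
      then show ?thesis by simp
    next
      case True
      then obtain u where u: "b = p * u" by blast
      then have uu: "\<not> p dvd u" using True mult_dvd_mono[OF dvd_refl, of p u p] by (auto simp: power2_eq_square)
      obtain c where c: "dg c u 1 \<in> GG" using dg_ex[OF uu, of 1] p_nonunit by auto
      define w' where "w' = spec hb b w"
      have w'N: "w' \<in> NN" using spec_hb_NN[OF w] by (simp add: w'_def)
      have w'H: "act (hb x) w' = (\<lambda>i. \<psi> (b * x) * w' i)" for x unfolding w'_def by (rule spec_eigen[OF onepar_hb])
      define y where "y = act (ginv (dg c u 1)) w'"
      have yV: "y \<in> VS" and dy: "act (dg c u 1) y = w'" using c NN_VS[OF w'N] by (auto simp: y_def)
      have "act (uu (f * s)) y = y" for s
      proof (rule act_inj[OF c])
        have "act (dg c u 1) (act (uu (f * s)) y) = act (uu (f * (u * s))) w'"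
          using act_dg_uu[OF c] dy by (simp add: mult_ac)
        then show "act (dg c u 1) (act (uu (f * s)) y) = act (dg c u 1) y" using w'N dy by (simp add: NN_def)
      qed (use yV in auto)
      then have yN: "y \<in> NN" using yV by (simp add: NN_def)
      have "act (hb x) y = (\<lambda>i. \<psi> (p * x) * y i)" for x
      proof (rule act_inj[OF c])
        have e: "p * (rinv u * x) * u = p * x"
        proof -
          have "p * (rinv u * x) * u = (u * rinv u) * (p * x)" by (simp only: mult_ac)
          then show ?thesis using uu by simp
        qed
        have "gm (dg c u 1) (hb x) = gm (hb (rinv u * x)) (dg c u 1)"
          using e by (simp add: dg_def hb_def ub_def)
        then have "act (dg c u 1) (act (hb x) y) = act (hb (rinv u * x)) w'"
          using c hb_hf_in dy by (metis act_mul)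
        also have "\<dots> = (\<lambda>i. \<psi> (p * x) * w' i)" unfolding w'H u
          using e by (simp add: mult_ac)
        finally show "act (dg c u 1) (act (hb x) y) = act (dg c u 1) (\<lambda>i. \<psi> (p * x) * y i)"
          unfolding act_scale dy .
      qed (use yV hb_hf_in in auto)
      then have "spec hb p y = y" using spec_fix_iff[OF onepar_hb] by blast
      then have "app I (KK p) y = y" using spec_hf_NN[OF yN] by (simp add: KK_app)
      then obtain k where k: "y = (\<lambda>i. k * \<eta> i)" using line[of y] by auto
      have "w' = (\<lambda>i. k * act (dg c u 1) \<eta> i)" using dy unfolding k act_scale by simp
      then have "(\<Sum>i\<in>I. h i * w' i) = k * (\<Sum>i\<in>I. h i * act (dg c u 1) \<eta> i)"
        by (simp add: sum_distrib_left mult_ac)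
      then show ?thesis using h c unfolding w'_def by simp
    qed
  qed
  moreover have "\<eta> \<in> NN" using KK_fix(1)[OF \<eta>] .
  ultimately show ?thesis by blast
qed

section \<open>Torus and unipotents on the cells of a Borel eigenvector\<close>

lemma eigen_VS: "eigen v \<chi> \<Longrightarrow> v \<in> VS" "eigen v \<chi> \<Longrightarrow> v \<noteq> (\<lambda>_. 0)" by (auto simp: eigen_def)

lemma eigen_uu: "eigen v \<chi> \<Longrightarrow> act (uu x) v = v" by (simp add: eigen_def)

lemma eigen_dg: "eigen v \<chi> \<Longrightarrow> dg c a b \<in> GG \<Longrightarrow> act (dg c a b) v = (\<lambda>i. \<chi> c a b * v i)"
  by (simp add: eigen_def)

lemma eigen_ww: "eigen v \<chi> \<Longrightarrow> dg c a b \<in> GG \<Longrightarrow> act (dg c a b) (act ww v) = (\<lambda>i. \<chi> c b a * act ww v i)"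
  using act_dg_ww dg_swap by (simp add: eigen_def act_scale)

text \<open>Since \<open>a - b\<close> is a multiple of \<open>f\<close> and
  \<open>f * z = 0\<close>, elements of \<open>T'\<close> commute with \<open>ub z\<close>. Off the
  open cell \<open>T'\<close> thus acts by \<open>\<chi>\<close>, on \<open>act ww v\<close> by the
  conjugate of \<open>\<chi>\<close>; cells are told apart by this difference.\<close>

lemma eigen_ub:
  assumes v: "eigen v \<chi>" and t: "dg c a b \<in> GG" "f dvd a - b" and z: "p dvd z"
  shows "act (dg c a b) (act (ub z) v) = (\<lambda>i. \<chi> c a b * act (ub z) v i)"
proof -
  obtain k where k: "a - b = f * k" using t(2) by (rule dvdE)
  have "z * a - b * z = f * z * k" using k by (metis mult.commute mult.assoc left_diff_distrib)
  then have "z * a = b * z" using f_mult_0[OF z] by simp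
  then have "gm (dg c a b) (ub z) = gm (ub z) (dg c a b)" by (simp add: dg_def ub_def)
  then have "act (dg c a b) (act (ub z) v) = act (ub z) (act (dg c a b) v)" using t(1) by (simp add: act_mul[symmetric])
  then show ?thesis using v t(1) by (simp add: eigen_def act_scale)
qed

lemma eigen_ub_uu_f: "eigen v \<chi> \<Longrightarrow> p dvd z \<Longrightarrow> act (uu (f * s)) (act (ub z) v) = act (ub z) v"
  by (simp add: uu_f_ub eigen_def)

lemma eigen_uu_ub:
  assumes v: "eigen v \<chi>" and z: "p dvd z"
  shows "\<exists>k z'. p dvd z' \<and> act (uu x) (act (ub z) v) = (\<lambda>i. k * act (ub z') v i)"
proof -
  define a where "a = 1 + x * z"
  have a: "\<not> p dvd a" unfolding a_def using z by (intro unit_add) (auto simp: p_nonunit)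
  have G: "dg c1 a (rinv a) \<in> GG" using a by (simp add: dg_in ok_one)
  have "z * rinv a * (x * rinv a) * a + rinv a = (1 + x * z) * rinv a" 
  proof -
    have "z * rinv a * (x * rinv a) * a = (z * x * rinv a) * (rinv a * a)" by (simp only: mult_ac)
    then show ?thesis using a by (simp add: algebra_simps)
  qed
  then have e: "z * rinv a * (x * rinv a) * a + rinv a = 1" using a by (simp add: a_def)
  have e2: "z * rinv a * a * (x * rinv a) + rinv a = 1" using e by (simp only: mult_ac)
  have "gm (uu x) (ub z) = gm (ub (z * rinv a)) (gm (dg c1 a (rinv a)) (uu (x * rinv a)))"
    using a e e2 by (simp add: uu_def ub_def dg_def mult.assoc) (simp add: a_def)
  then have "act (uu x) (act (ub z) v) = act (ub (z * rinv a)) (act (dg c1 a (rinv a)) (act (uu (x * rinv a)) v))"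
    using G by (simp add: act_mul[symmetric])
  then have "act (uu x) (act (ub z) v) = (\<lambda>i. \<chi> c1 a (rinv a) * act (ub (z * rinv a)) v i)"
    using v G by (simp add: eigen_def act_scale)
  moreover have "p dvd z * rinv a" using z by simp
  ultimately show ?thesis by blast
qed

end

context ext_rep
begin

lemma top_rep_if_large:
  assumes "card I > 1" "2 \<le> l \<Longrightarrow> card I > (q + 1) * q ^ (l - 2)"
  shows "top_rep p l q \<psi> cm c1 ok I \<rho>"
  by unfold_locales (use l1 triv_top large_imp_not_triv[OF assms] in auto)

end

section \<open>Invariant trilinear forms\<close>

text \<open>Trilinear forms are recorded by their values on basis vectors and set to zero elsewhere,
  so that equal forms are equal functions.\<close>

definition inv_forms :: "'g set \<Rightarrow> 'i set \<Rightarrow> ('g \<Rightarrow> 'i \<Rightarrow> 'i \<Rightarrow> complex) \<Rightarrow> 'j set \<Rightarrow> ('g \<Rightarrow> 'j \<Rightarrow> 'j \<Rightarrow> complex)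
    \<Rightarrow> 'k set \<Rightarrow> ('g \<Rightarrow> 'k \<Rightarrow> 'k \<Rightarrow> complex) \<Rightarrow> ('i \<times> 'j \<times> 'k \<Rightarrow> complex) set" where
  "inv_forms G I \<rho> J \<sigma> K \<tau> = {F. (\<forall>s. s \<notin> I \<times> J \<times> K \<longrightarrow> F s = 0) \<and>
     (\<forall>g\<in>G. \<forall>i\<in>I. \<forall>j\<in>J. \<forall>k\<in>K. (\<Sum>i'\<in>I. \<Sum>j'\<in>J. \<Sum>k'\<in>K. F (i', j', k') * (\<rho> g i' i * \<sigma> g j' j * \<tau> g k' k)) = F (i, j, k))}"

lemma mult_middle_unique:
  fixes m n x y :: complex
  assumes "m * x * n = 1" "m * y * n = 1" shows "x = y"
proof -
  have "m * n \<noteq> 0" using assms(1) by auto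
  moreover have "(m * n) * x = (m * n) * y" using assms by (simp add: mult_ac)
  ultimately show ?thesis by simp
qed

lemma dim_le_reindex:
  assumes "dim_le \<F>' K" "\<And>F. F \<in> \<F> \<Longrightarrow> (\<lambda>s. F (\<pi> s)) \<in> \<F>'" "surj \<pi>"
  shows "dim_le \<F> K"
  unfolding dim_le_def
proof (intro allI impI)
  fix k :: nat and f assume f: "\<forall>i<k. f i \<in> \<F>"
    and ind: "\<forall>c. (\<forall>j. (\<Sum>i<k. c i * f i j) = 0) \<longrightarrow> (\<forall>i<k. c i = 0)"
  have "\<forall>c. (\<forall>j. (\<Sum>i<k. c i * f i (\<pi> j)) = 0) \<longrightarrow> (\<forall>i<k. c i = 0)"
    using ind assms(3) by (metis surjD)
  then show "k \<le> K" using assms(1)[unfolded dim_le_def, rule_format, of k "\<lambda>i s. f i (\<pi> s)"] f assms(2) by blast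
qed

lemma dim_le_swap12:
  assumes "dim_le (inv_forms G J \<sigma> I \<rho> K \<tau>) N" shows "dim_le (inv_forms G I \<rho> J \<sigma> K \<tau>) N"
proof (rule dim_le_reindex[OF assms, where \<pi> = "\<lambda>s. (fst (snd s), fst s, snd (snd s))"])
  fix F assume "F \<in> inv_forms G I \<rho> J \<sigma> K \<tau>"
  then show "(\<lambda>s. F (fst (snd s), fst s, snd (snd s))) \<in> inv_forms G J \<sigma> I \<rho> K \<tau>"
    unfolding inv_forms_def by (auto simp: mult_ac sum.swap[of _ J I])
next
  show "surj (\<lambda>s. (fst (snd s), fst s, snd (snd s)))"
    by (rule surjI[where f = "\<lambda>s. (fst (snd s), fst s, snd (snd s))"]) simp
qed

lemma dim_le_swap23:
  assumes "dim_le (inv_forms G I \<rho> K \<tau> J \<sigma>) N" shows "dim_le (inv_forms G I \<rho> J \<sigma> K \<tau>) N"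
proof (rule dim_le_reindex[OF assms, where \<pi> = "\<lambda>s. (fst s, snd (snd s), fst (snd s))"])
  fix F assume "F \<in> inv_forms G I \<rho> J \<sigma> K \<tau>"
  then show "(\<lambda>s. F (fst s, snd (snd s), fst (snd s))) \<in> inv_forms G I \<rho> K \<tau> J \<sigma>"
    unfolding inv_forms_def by (auto simp: mult_ac sum.swap[of _ K J])
next
  show "surj (\<lambda>s. (fst s, snd (snd s), fst (snd s)))"
    by (rule surjI[where f = "\<lambda>s. (fst s, snd (snd s), fst (snd s))"]) simp
qed

locale tri_rep = A: top_rep p l q \<psi> cm c1 ok I \<rho> + B: top_rep p l q \<psi> cm c1 ok J \<sigma> + C: top_rep p l q \<psi> cm c1 ok K \<tau>
  for p :: "'r::comm_ring_1" and l q \<psi> and cm :: "'c \<Rightarrow> 'c \<Rightarrow> 'c" and c1 ok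
    and I :: "'i set" and \<rho> and J :: "'j set" and \<sigma> and K :: "'k set" and \<tau>
begin

abbreviation "Forms \<equiv> inv_forms A.GG I \<rho> J \<sigma> K \<tau>"

definition tri :: "('i \<times> 'j \<times> 'k \<Rightarrow> complex) \<Rightarrow> ('i \<Rightarrow> complex) \<Rightarrow> ('j \<Rightarrow> complex) \<Rightarrow> ('k \<Rightarrow> complex) \<Rightarrow> complex" where
  "tri F x y z = (\<Sum>i\<in>I. \<Sum>j\<in>J. \<Sum>k\<in>K. F (i, j, k) * (x i * y j * z k))"

lemma tri_fst: "tri F x y z = (\<Sum>i\<in>I. (\<Sum>j\<in>J. \<Sum>k\<in>K. F (i, j, k) * (y j * z k)) * x i)"
  by (simp only: tri_def sum_distrib_left sum_distrib_right mult_ac)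

lemma tri_snd: "tri F x y z = (\<Sum>j\<in>J. (\<Sum>i\<in>I. \<Sum>k\<in>K. F (i, j, k) * (x i * z k)) * y j)"
  by (simp only: tri_def sum.swap[of _ I J] sum_distrib_left sum_distrib_right mult_ac)

lemma tri_trd: "tri F x y z = (\<Sum>k\<in>K. (\<Sum>i\<in>I. \<Sum>j\<in>J. F (i, j, k) * (x i * y j)) * z k)"
proof -
  have "tri F x y z = (\<Sum>i\<in>I. \<Sum>k\<in>K. \<Sum>j\<in>J. F (i, j, k) * (x i * y j * z k))"
    unfolding tri_def by (rule sum.cong[OF refl]) (rule sum.swap)
  also have "\<dots> = (\<Sum>k\<in>K. \<Sum>i\<in>I. \<Sum>j\<in>J. F (i, j, k) * (x i * y j * z k))" by (rule sum.swap)
  finally show ?thesis by (simp only: sum_distrib_left sum_distrib_right mult_ac)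
qed

lemma tri_scale: "tri F (\<lambda>i. a * x i) y z = a * tri F x y z" "tri F x (\<lambda>i. a * y i) z = a * tri F x y z"
  "tri F x y (\<lambda>i. a * z i) = a * tri F x y z"
  by (simp_all add: tri_def sum_distrib_left mult_ac)

lemma tri_lincomb: "tri (\<lambda>s. \<Sum>m<(N::nat). c m * F m s) x y z = (\<Sum>m<N. c m * tri (F m) x y z)"
  unfolding tri_def
  by (simp only: sum_distrib_left sum_distrib_right sum.swap[of _ _ "{..<N}"] mult_ac)

lemma tri_app_fst: "tri F (app I P x) y z = tri (\<lambda>(i, j, k). \<Sum>i'\<in>I. F (i', j, k) * P i' i) x y z"
proof -
  have "tri F (app I P x) y z = (\<Sum>i'\<in>I. \<Sum>i\<in>I. (\<Sum>j\<in>J. \<Sum>k\<in>K. F (i', j, k) * (y j * z k)) * (P i' i * x i))"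
    unfolding tri_fst app_def by (simp add: sum_distrib_left)
  also have "\<dots> = (\<Sum>i\<in>I. \<Sum>i'\<in>I. (\<Sum>j\<in>J. \<Sum>k\<in>K. F (i', j, k) * (y j * z k)) * (P i' i * x i))" by (rule sum.swap)
  also have "\<dots> = (\<Sum>i\<in>I. (\<Sum>j\<in>J. \<Sum>k\<in>K. (\<Sum>i'\<in>I. F (i', j, k) * P i' i) * (y j * z k)) * x i)"
    by (simp only: sum_distrib_left sum_distrib_right sum.swap[of _ I J] sum.swap[of _ I K] mult_ac)
  finally show ?thesis unfolding tri_fst by simp
qed

lemma tri_app_snd: "tri F x (app J P y) z = tri (\<lambda>(i, j, k). \<Sum>j'\<in>J. F (i, j', k) * P j' j) x y z"
proof -
  have "tri F x (app J P y) z = (\<Sum>i'\<in>J. \<Sum>i\<in>J. (\<Sum>j\<in>I. \<Sum>k\<in>K. F (j, i', k) * (x j * z k)) * (P i' i * y i))"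
    unfolding tri_snd app_def by (simp add: sum_distrib_left)
  also have "\<dots> = (\<Sum>i\<in>J. \<Sum>i'\<in>J. (\<Sum>j\<in>I. \<Sum>k\<in>K. F (j, i', k) * (x j * z k)) * (P i' i * y i))" by (rule sum.swap)
  also have "\<dots> = (\<Sum>i\<in>J. (\<Sum>j\<in>I. \<Sum>k\<in>K. (\<Sum>i'\<in>J. F (j, i', k) * P i' i) * (x j * z k)) * y i)"
    by (simp only: sum_distrib_left sum_distrib_right sum.swap[of _ J I] sum.swap[of _ J K] mult_ac)
  finally show ?thesis unfolding tri_snd by simp
qed

lemma tri_app_trd: "tri F x y (app K P z) = tri (\<lambda>(i, j, k). \<Sum>k'\<in>K. F (i, j, k') * P k' k) x y z"
proof -
  have "tri F x y (app K P z) = (\<Sum>i'\<in>K. \<Sum>i\<in>K. (\<Sum>j\<in>I. \<Sum>k\<in>J. F (j, k, i') * (x j * y k)) * (P i' i * z i))"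
    unfolding tri_trd app_def by (simp add: sum_distrib_left)
  also have "\<dots> = (\<Sum>i\<in>K. \<Sum>i'\<in>K. (\<Sum>j\<in>I. \<Sum>k\<in>J. F (j, k, i') * (x j * y k)) * (P i' i * z i))" by (rule sum.swap)
  also have "\<dots> = (\<Sum>i\<in>K. (\<Sum>j\<in>I. \<Sum>k\<in>J. (\<Sum>i'\<in>K. F (j, k, i') * P i' i) * (x j * y k)) * z i)"
    by (simp only: sum_distrib_left sum_distrib_right sum.swap[of _ K I] sum.swap[of _ K J] mult_ac)
  finally show ?thesis unfolding tri_trd by simp
qed

lemma tri_inv:
  assumes F: "F \<in> Forms" and g: "g \<in> A.GG"
  shows "tri F (A.act g x) (B.act g y) (C.act g z) = tri F x y z"
proof -
  have "tri F (A.act g x) (B.act g y) (C.act g z)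
      = tri (\<lambda>(i, j, k). \<Sum>i'\<in>I. (\<Sum>j'\<in>J. (\<Sum>k'\<in>K. F (i', j', k') * \<tau> g k' k) * \<sigma> g j' j) * \<rho> g i' i) x y z"
    unfolding A.act_def B.act_def C.act_def tri_app_fst tri_app_snd tri_app_trd by (simp add: case_prod_beta)
  also have "\<dots> = tri F x y z"
    unfolding tri_def
  proof (intro sum.cong refl)
    fix i j k assume ijk: "i \<in> I" "j \<in> J" "k \<in> K"
    have "(\<Sum>i'\<in>I. (\<Sum>j'\<in>J. (\<Sum>k'\<in>K. F (i', j', k') * \<tau> g k' k) * \<sigma> g j' j) * \<rho> g i' i)
      = (\<Sum>i'\<in>I. \<Sum>j'\<in>J. \<Sum>k'\<in>K. F (i', j', k') * (\<rho> g i' i * \<sigma> g j' j * \<tau> g k' k))"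
      by (simp only: sum_distrib_left sum_distrib_right mult_ac)
    also have "\<dots> = F (i, j, k)" using F g ijk by (auto simp: inv_forms_def)
    finally show "(case (i, j, k) of (i, j, k) \<Rightarrow> \<Sum>i'\<in>I. (\<Sum>j'\<in>J. (\<Sum>k'\<in>K. F (i', j', k') * \<tau> g k' k) * \<sigma> g j' j) * \<rho> g i' i)
       * (x i * y j * z k) = F (i, j, k) * (x i * y j * z k)" by simp
  qed
  finally show ?thesis .
qed

lemma form_zeroI:
  assumes F: "F \<in> Forms" and "\<And>x y z. x \<in> A.VS \<Longrightarrow> y \<in> B.VS \<Longrightarrow> z \<in> C.VS \<Longrightarrow> tri F x y z = 0"
  shows "F s = 0"
proof (cases "s \<in> I \<times> J \<times> K")
  case True
  then obtain i j k where s: "s = (i, j, k)" and ijk: "i \<in> I" "j \<in> J" "k \<in> K" by auto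
  have "tri F (\<lambda>a. if a = i then 1 else 0) (\<lambda>a. if a = j then 1 else 0) (\<lambda>a. if a = k then 1 else 0) = F (i, j, k)"
  proof -
    have "F (a, b, c) * ((if a = i then 1 else 0) * (if b = j then 1 else 0) * (if c = k then 1 else 0))
       = (if c = k then if b = j then if a = i then F (a, b, c) else 0 else 0 else 0)" for a b c by auto
    then show ?thesis unfolding tri_def using ijk A.finite_I B.finite_I C.finite_I by (simp add: sum.delta' sum.delta)
  qed
  then show ?thesis using assms(2) ijk A.unit_in_VS B.unit_in_VS C.unit_in_VS s by metis
next
  case False
  then show ?thesis using F unfolding inv_forms_def by blast
qed

text \<open>Invariance moves a group element from the first argument to the other two, and the orbit
  of \<open>v\<close> spans the first space.\<close>

lemma form_zero_orbit1:
  assumes F: "F \<in> Forms" and v: "v \<in> A.VS" "v \<noteq> (\<lambda>_. 0)"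
    and z: "\<And>y z. y \<in> B.VS \<Longrightarrow> z \<in> C.VS \<Longrightarrow> tri F v y z = 0"
  shows "F s = 0"
proof (rule form_zeroI[OF F])
  fix x y z assume yz: "y \<in> B.VS" "z \<in> C.VS"
  have "(\<Sum>j\<in>J. \<Sum>k\<in>K. F (i, j, k) * (y j * z k)) = 0" if "i \<in> I" for i
  proof (rule A.functional_zero_on_orbit[OF v _ that])
    fix g assume g: "g \<in> A.GG"
    have "tri F (A.act g v) y z = tri F (A.act g v) (B.act g (B.act (A.ginv g) y)) (C.act g (C.act (A.ginv g) z))"
      using g yz by simp
    also have "\<dots> = tri F v (B.act (A.ginv g) y) (C.act (A.ginv g) z)" by (rule tri_inv[OF F g])
    also have "\<dots> = 0" using g by (intro z) auto
    finally show "(\<Sum>i\<in>I. (\<Sum>j\<in>J. \<Sum>k\<in>K. F (i, j, k) * (y j * z k)) * A.act g v i) = 0" unfolding tri_fst .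
  qed
  then show "tri F x y z = 0" unfolding tri_fst by simp
qed

lemma form_zero_orbit2:
  assumes F: "F \<in> Forms" and v: "v \<in> A.VS" "v \<noteq> (\<lambda>_. 0)" and w: "w \<in> B.VS" "w \<noteq> (\<lambda>_. 0)"
    and z: "\<And>h z. h \<in> A.GG \<Longrightarrow> z \<in> C.VS \<Longrightarrow> tri F v (B.act h w) z = 0"
  shows "F s = 0"
proof (rule form_zero_orbit1[OF F v])
  fix y z assume zV: "z \<in> C.VS"
  have "(\<Sum>i\<in>I. \<Sum>k\<in>K. F (i, j, k) * (v i * z k)) = 0" if "j \<in> J" for j
    by (rule B.functional_zero_on_orbit[OF w _ that]) (use z[OF _ zV] in \<open>simp add: tri_snd\<close>)
  then show "tri F v y z = 0" unfolding tri_snd by simp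
qed

lemma tri_eigen_zero:
  assumes F: "F \<in> Forms" and g: "g \<in> A.GG"
    and "A.act g x = (\<lambda>i. a * x i)" "B.act g y = (\<lambda>i. b * y i)" "C.act g z = (\<lambda>i. c * z i)" "a * b * c \<noteq> 1"
  shows "tri F x y z = 0"
proof -
  have "a * b * c * tri F x y z = tri F (A.act g x) (B.act g y) (C.act g z)"
    unfolding assms tri_scale by simp
  also have "\<dots> = tri F x y z" by (rule tri_inv[OF F g])
  finally show ?thesis using assms(6) by (metis mult_cancel_right2)
qed

lemma uu_move:
  assumes F: "F \<in> Forms" and v: "A.eigen v \<chi>" and y: "y \<in> B.VS" and z: "z \<in> C.VS"
  shows "tri F v (B.act (A.uu x) y) z = tri F v y (C.act (A.uu (- x)) z)"
proof -
  have "C.act (A.uu x) (C.act (A.uu (- x)) z) = z" using z by (simp add: C.act_uu_uu) (simp add: A.uu_def)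
  then have "tri F v (B.act (A.uu x) y) z = tri F (A.act (A.uu x) v) (B.act (A.uu x) y) (C.act (A.uu x) (C.act (A.uu (- x)) z))"
    using A.eigen_uu[OF v] by simp
  then show ?thesis using tri_inv[OF F, of "A.uu x"] by simp
qed

text \<open>In the open cell of \<open>w\<close> the translation \<open>uu x\<close> can be moved to
  the third argument because \<open>v\<close> is fixed by \<open>U\<close>; one representative
  \<open>ww w\<close> remains there.\<close>

lemma two_eigen_zero:
  assumes F: "F \<in> Forms" and v: "A.eigen v \<chi>" and w: "B.eigen w \<chi>'"
    and top: "\<And>z. z \<in> C.VS \<Longrightarrow> tri F v (B.act A.ww w) z = 0"
    and low: "\<And>\<zeta> z. p dvd \<zeta> \<Longrightarrow> z \<in> C.VS \<Longrightarrow> tri F v (B.act (A.ub \<zeta>) w) z = 0"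
  shows "F s = 0"
proof (rule form_zero_orbit2[OF F A.eigen_VS[OF v] B.eigen_VS[OF w]])
  fix h z assume h: "h \<in> A.GG" and z: "z \<in> C.VS"
  from B.eigen_orbit[OF w h] obtain k where "(\<exists>x. B.act h w = (\<lambda>i. k * B.act (A.uu x) (B.act A.ww w) i))
    \<or> (\<exists>z. p dvd z \<and> B.act h w = (\<lambda>i. k * B.act (A.ub z) w i))" by blast
  then show "tri F v (B.act h w) z = 0"
  proof
    assume "\<exists>x. B.act h w = (\<lambda>i. k * B.act (A.uu x) (B.act A.ww w) i)"
    then obtain x where "B.act h w = (\<lambda>i. k * B.act (A.uu x) (B.act A.ww w) i)" by blast
    then show ?thesis using uu_move[OF F v _ z] top by (simp add: tri_scale)
  next
    assume "\<exists>\<zeta>. p dvd \<zeta> \<and> B.act h w = (\<lambda>i. k * B.act (A.ub \<zeta>) w i)"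
    then show ?thesis using low[OF _ z] by (auto simp: tri_scale)
  qed
qed

text \<open>Primitive characters are nontrivial on the deepest unipotents, which fix both
  \<open>v\<close> and \<open>y\<close>; so only the part of \<open>z\<close> in \<open>N\<close> is
  seen.\<close>

lemma NN_only:
  assumes F: "F \<in> Forms" and v: "A.eigen v \<chi>" and y: "\<And>s. B.act (A.uu (A.f * s)) y = y"
    and N: "\<And>z. z \<in> C.NN \<Longrightarrow> tri F v y z = 0" and z: "z \<in> C.VS"
  shows "tri F v y z = 0"
  unfolding tri_trd
proof (rule C.functional_zero_if[OF z])
  fix b assume b: "\<not> p dvd b"
  obtain x where x: "\<psi> (p ^ (l - 1) * x) \<noteq> 1" using A.psi_nontriv by blast
  have "b * (A.f * (A.rinv b * x)) = b * A.rinv b * (p ^ (l - 1) * x)" unfolding A.f_def by (simp only: mult_ac)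
  then have bs: "\<psi> (b * (A.f * (A.rinv b * x))) \<noteq> 1" using b x by simp
  have "tri F v y (C.spec A.uu b z) = 0"
    by (rule tri_eigen_zero[OF F, of "A.uu (A.f * (A.rinv b * x))" _ 1 _ 1])
      (use bs y A.eigen_uu[OF v] in \<open>simp_all add: C.spec_eigen\<close>)
  then show "(\<Sum>k\<in>K. (\<Sum>i\<in>I. \<Sum>j\<in>J. F (i, j, k) * (v i * y j)) * C.spec A.uu b z k) = 0" unfolding tri_trd .
next
  fix w assume "w \<in> C.NN"
  then show "(\<Sum>k\<in>K. (\<Sum>i\<in>I. \<Sum>j\<in>J. F (i, j, k) * (v i * y j)) * w k) = 0" using N unfolding tri_trd by blast
qed

lemma ev_dim_le:
  assumes "finite S" "card S \<le> N"
    and "\<And>F s. F \<in> Forms \<Longrightarrow> (\<And>m. m \<in> S \<Longrightarrow> tri F (x m) (y m) (z m) = 0) \<Longrightarrow> F s = 0"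
  shows "dim_le Forms N"
proof (rule dim_le_functionals[where ev = "\<lambda>m F. tri F (x m) (y m) (z m)", OF assms(1,2)])
  show "(\<lambda>j. \<Sum>i<(k::nat). c i * f i j) \<in> Forms" if f: "\<And>i. i < k \<Longrightarrow> f i \<in> Forms" for k c f
  proof -
    have "(\<Sum>i'\<in>I. \<Sum>j'\<in>J. \<Sum>k'\<in>K. (\<Sum>m<k. c m * f m (i', j', k')) * (\<rho> g i' i * \<sigma> g j' j * \<tau> g k' n))
       = (\<Sum>m<k. c m * f m (i, j, n))" if "g \<in> A.GG" "i \<in> I" "j \<in> J" "n \<in> K" for g i j n
    proof -
      have "(\<Sum>i'\<in>I. \<Sum>j'\<in>J. \<Sum>k'\<in>K. (\<Sum>m<k. c m * f m (i', j', k')) * (\<rho> g i' i * \<sigma> g j' j * \<tau> g k' n))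
         = (\<Sum>m<k. c m * (\<Sum>i'\<in>I. \<Sum>j'\<in>J. \<Sum>k'\<in>K. f m (i', j', k') * (\<rho> g i' i * \<sigma> g j' j * \<tau> g k' n)))"
        by (simp only: sum_distrib_left sum_distrib_right sum.swap[of _ _ "{..<k}"] mult_ac)
      then show ?thesis using f that by (simp add: inv_forms_def)
    qed
    moreover have "(\<Sum>i<k. c i * f i s) = 0" if "s \<notin> I \<times> J \<times> K" for s
    proof (rule sum.neutral, rule ballI)
      fix m assume "m \<in> {..<k}"
      then have "f m s = 0" using f[of m] that unfolding inv_forms_def by blast
      then show "c m * f m s = 0" by simp
    qed
    ultimately show ?thesis unfolding inv_forms_def by blast
  qed
qed (simp_all add: tri_lincomb assms(3))

lemma torus_translate:
  assumes F: "F \<in> Forms" and v: "A.eigen v \<chi>" and w: "B.eigen w \<chi>'" and t: "A.dg c a b \<in> A.GG"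
    and z: "tri F v (B.act A.ww w) z = 0"
  shows "tri F v (B.act A.ww w) (C.act (A.dg c a b) z) = 0"
proof -
  have t': "A.dg c b a \<in> A.GG" using t A.dg_swap by blast
  have "\<chi> c a b * (\<chi>' c b a * tri F v (B.act A.ww w) (C.act (A.dg c a b) z))
     = tri F (A.act (A.dg c a b) v) (B.act (A.dg c a b) (B.act A.ww w)) (C.act (A.dg c a b) z)"
    unfolding A.eigen_dg[OF v t] B.eigen_ww[OF w t] tri_scale ..
  also have "\<dots> = 0" unfolding tri_inv[OF F t] using z .
  finally show ?thesis using A.chi_nz[OF v t] B.chi_nz[OF w t'] by simp
qed

text \<open>On the open cell the torus spreads the value at the Whittaker vector
  \<open>\<xi>\<close> over the primitive part and the value at \<open>\<eta>\<close> over
  \<open>N\<close>. Off the open cell only \<open>N\<close> is seen, where the element of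
  \<open>T'\<close> acts by scalars whose product is not 1.\<close>

lemma ss_ss_sns_aux:
  assumes v: "A.eigen v \<chi>" and w: "B.eigen w \<chi>'" and n: "card K = (if l = 1 then q else (q ^ 2 - 1) * q ^ (l - 2))"
    and t: "A.dg c a b \<in> A.GG" "A.f dvd a - b" and k: "\<And>z. z \<in> C.NN \<Longrightarrow> C.act (A.dg c a b) z = (\<lambda>i. k * z i)"
    and ne: "\<chi> c a b * \<chi>' c a b * k \<noteq> 1"
  shows "dim_le Forms 2"
proof -
  obtain \<xi> where \<xi>: "\<And>b v c a. A.dg c a 1 \<in> A.GG \<Longrightarrow> a * b = 1 \<Longrightarrow> \<exists>k. C.spec A.uu b v = (\<lambda>i. k * C.act (A.dg c a 1) \<xi> i)"
    using C.whittaker_vector[OF A.p_nonunit] by metis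
  obtain \<eta> where \<eta>: "\<And>h w. (\<And>c a b. A.dg c a b \<in> A.GG \<Longrightarrow> (\<Sum>i\<in>K. h i * C.act (A.dg c a b) \<eta> i) = 0) \<Longrightarrow>
     w \<in> C.NN \<Longrightarrow> (\<Sum>i\<in>K. h i * w i) = 0"
    using C.sns_generator[OF n] by metis
  show ?thesis
  proof (rule ev_dim_le[where S = "UNIV :: bool set" and x = "\<lambda>_. v" and y = "\<lambda>_. B.act A.ww w" and z = "\<lambda>m. if m then \<xi> else \<eta>"])
    fix F s assume F: "F \<in> Forms" and z: "\<And>m. m \<in> UNIV \<Longrightarrow> tri F v (B.act A.ww w) (if m then \<xi> else \<eta>) = 0"
    have z1: "tri F v (B.act A.ww w) \<xi> = 0" using z[of True] by simp
    have z2: "tri F v (B.act A.ww w) \<eta> = 0" using z[of False] by simp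
    show "F s = 0"
    proof (rule two_eigen_zero[OF F v w])
      fix z assume zV: "z \<in> C.VS"
      show "tri F v (B.act A.ww w) z = 0" unfolding tri_trd
      proof (rule C.functional_zero_if[OF zV])
        fix b assume b: "\<not> p dvd b"
        then obtain c where c: "A.dg c (A.rinv b) 1 \<in> A.GG" using A.dg_ex[of "A.rinv b" 1] A.p_nonunit by auto
        then obtain k where "C.spec A.uu b z = (\<lambda>i. k * C.act (A.dg c (A.rinv b) 1) \<xi> i)" using \<xi>[OF c] b by fastforce
        then have "tri F v (B.act A.ww w) (C.spec A.uu b z) = 0"
          using torus_translate[OF F v w c z1] by (simp add: tri_scale)
        then show "(\<Sum>k\<in>K. (\<Sum>i\<in>I. \<Sum>j\<in>J. F (i, j, k) * (v i * B.act A.ww w j)) * C.spec A.uu b z k) = 0" unfolding tri_trd .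
      next
        fix z' assume z': "z' \<in> C.NN"
        show "(\<Sum>k\<in>K. (\<Sum>i\<in>I. \<Sum>j\<in>J. F (i, j, k) * (v i * B.act A.ww w j)) * z' k) = 0"
          by (rule \<eta>[OF _ z']) (use torus_translate[OF F v w _ z2] in \<open>simp add: tri_trd\<close>)
      qed
    next
      fix \<zeta> z assume \<zeta>: "p dvd \<zeta>" and zV: "z \<in> C.VS"
      show "tri F v (B.act (A.ub \<zeta>) w) z = 0"
      proof (rule NN_only[OF F v _ _ zV])
        show "B.act (A.uu (A.f * s)) (B.act (A.ub \<zeta>) w) = B.act (A.ub \<zeta>) w" for s
          by (rule B.eigen_ub_uu_f[OF w \<zeta>])
        show "tri F v (B.act (A.ub \<zeta>) w) z' = 0" if "z' \<in> C.NN" for z'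
          by (rule tri_eigen_zero[OF F t(1) A.eigen_dg[OF v t(1)] B.eigen_ub[OF w t \<zeta>] k[OF that] ne])
      qed
    qed
  qed simp_all
qed

theorem ss_ss_sns:
  assumes nA: "card I = (q + 1) * q ^ (l - 1)" and nB: "card J = (q + 1) * q ^ (l - 1)"
    and nC: "card K = (if l = 1 then q else (q ^ 2 - 1) * q ^ (l - 2))"
  shows "dim_le Forms 2"
proof -
  obtain v \<chi> where v: "A.eigen v \<chi>" using A.principal_series[OF nA] by blast
  obtain w \<chi>' w' c a b where w: "B.eigen w \<chi>'" "B.eigen w' (\<lambda>c a b. \<chi>' c b a)"
    and t: "A.dg c a b \<in> A.GG" "A.f dvd a - b" and ne: "\<chi>' c a b \<noteq> \<chi>' c b a"
    using B.principal_series[OF nB] by blast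
  obtain k where k: "\<And>z. z \<in> C.NN \<Longrightarrow> C.act (A.dg c a b) z = (\<lambda>i. k * z i)" using C.sns_torus_scalar[OF nC t] by blast
  show ?thesis
  \<comment> \<open>If the relation holds for the chosen eigenvector \<open>w\<close>, it fails for
    the conjugate one \<open>w'\<close>, since the two characters differ at this torus
    element.\<close>
  proof (cases "\<chi> c a b * \<chi>' c a b * k = 1")
    case True
    then have "\<chi> c a b * \<chi>' c b a * k \<noteq> 1" using mult_middle_unique[OF True] ne by blast
    then show ?thesis using ss_ss_sns_aux[OF v w(2) nC t k] by simp
  next
    case False
    then show ?thesis using ss_ss_sns_aux[OF v w(1) nC t k] by simp
  qed
qed

text \<open>As \<open>v\<close> is fixed by \<open>U\<close>, the parameters in the second and third
  factor must be opposite, and the torus reduces them to 1 and -1: one value. On \<open>N\<close> in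
  both factors the scalars of \<open>T'\<close> are Weyl invariant while \<open>\<chi>\<close> is
  not, so one of two swapped elements forces zero.\<close>

theorem ss_sns_sns:
  assumes nA: "card I = (q + 1) * q ^ (l - 1)" and nB: "card J = (if l = 1 then q else (q ^ 2 - 1) * q ^ (l - 2))"
    and nC: "card K = (if l = 1 then q else (q ^ 2 - 1) * q ^ (l - 2))"
  shows "dim_le Forms 1"
proof -
  obtain v \<chi> c a b where v: "A.eigen v \<chi>" and t: "A.dg c a b \<in> A.GG" "A.f dvd a - b" and ne: "\<chi> c a b \<noteq> \<chi> c b a"
    using A.principal_series[OF nA] by blast
  have t': "A.dg c b a \<in> A.GG" using t A.dg_swap by blast
  obtain k2 where k2: "\<And>z. z \<in> B.NN \<Longrightarrow> B.act (A.dg c a b) z = (\<lambda>i. k2 * z i)" "\<And>z. z \<in> B.NN \<Longrightarrow> B.act (A.dg c b a) z = (\<lambda>i. k2 * z i)"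
    using B.sns_torus_scalar[OF nB t] by blast
  obtain k3 where k3: "\<And>z. z \<in> C.NN \<Longrightarrow> C.act (A.dg c a b) z = (\<lambda>i. k3 * z i)" "\<And>z. z \<in> C.NN \<Longrightarrow> C.act (A.dg c b a) z = (\<lambda>i. k3 * z i)"
    using C.sns_torus_scalar[OF nC t] by blast
  have m1: "\<not> p dvd - 1" using A.p_nonunit by simp
  obtain \<xi> where \<xi>: "\<And>b v c a. A.dg c a 1 \<in> A.GG \<Longrightarrow> a * b = 1 \<Longrightarrow> \<exists>k. B.spec A.uu b v = (\<lambda>i. k * B.act (A.dg c a 1) \<xi> i)"
    using B.whittaker_vector[OF A.p_nonunit] by metis
  obtain \<xi>' where \<xi>': "\<And>b v c a. A.dg c a 1 \<in> A.GG \<Longrightarrow> a * b = - 1 \<Longrightarrow> \<exists>k. C.spec A.uu b v = (\<lambda>i. k * C.act (A.dg c a 1) \<xi>' i)"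
    using C.whittaker_vector[OF m1] by metis
  show ?thesis
  proof (rule ev_dim_le[where S = "{()}" and x = "\<lambda>_. v" and y = "\<lambda>_. \<xi>" and z = "\<lambda>_. \<xi>'"])
    fix F s assume F: "F \<in> Forms" and "\<And>m. m \<in> {()} \<Longrightarrow> tri F v \<xi> \<xi>' = 0"
    then have z: "tri F v \<xi> \<xi>' = 0" by simp
    show "F s = 0"
    proof (rule form_zero_orbit1[OF F A.eigen_VS[OF v]])
      fix y z assume yV: "y \<in> B.VS" and zV: "z \<in> C.VS"
      show "tri F v y z = 0" unfolding tri_snd
      proof (rule B.functional_zero_if[OF yV])
        fix b assume b: "\<not> p dvd b"
        obtain c where c: "A.dg c (A.rinv b) 1 \<in> A.GG" using A.dg_ex[of "A.rinv b" 1] A.p_nonunit b by auto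
        obtain k where k: "B.spec A.uu b y = (\<lambda>i. k * B.act (A.dg c (A.rinv b) 1) \<xi> i)" using \<xi>[OF c] b by fastforce
        have "tri F v (B.spec A.uu b y) z = 0" unfolding tri_trd
        proof (rule C.functional_lincomb[where S = UNIV and w = "\<lambda>b'. C.spec A.uu b' z"])
          show "(\<lambda>i. \<Sum>b'\<in>UNIV. C.spec A.uu b' z i) = z" using C.spec_sum[OF C.onepar_uu zV] by auto
          fix b'
          have "tri F v (B.spec A.uu b y) (C.spec A.uu b' z) = 0"
          proof (cases "b' = - b")
            case True
            have "A.rinv b * b' = - 1" using b True by simp
            then obtain k' where k': "C.spec A.uu b' z = (\<lambda>i. k' * C.act (A.dg c (A.rinv b) 1) \<xi>' i)" using \<xi>'[OF c] by blast
            have "\<chi> c (A.rinv b) 1 * tri F v (B.act (A.dg c (A.rinv b) 1) \<xi>) (C.act (A.dg c (A.rinv b) 1) \<xi>')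
               = tri F (A.act (A.dg c (A.rinv b) 1) v) (B.act (A.dg c (A.rinv b) 1) \<xi>) (C.act (A.dg c (A.rinv b) 1) \<xi>')"
              unfolding A.eigen_dg[OF v c] tri_scale ..
            also have "\<dots> = 0" unfolding tri_inv[OF F c] using z .
            finally have "tri F v (B.act (A.dg c (A.rinv b) 1) \<xi>) (C.act (A.dg c (A.rinv b) 1) \<xi>') = 0"
              using A.chi_nz[OF v c] by simp
            then show ?thesis unfolding k k' tri_scale by simp
          next
            case False
            then have "b + b' \<noteq> 0" by (metis add.commute add_eq_0_iff)
            then obtain x where "\<psi> ((b + b') * x) \<noteq> 1" using A.psi_nondegenerate by blast
            then have "1 * \<psi> (b * x) * \<psi> (b' * x) \<noteq> 1" by (simp add: A.psi_add distrib_right)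
            then show ?thesis
              by (intro tri_eigen_zero[OF F, of "A.uu x" _ 1 _ "\<psi> (b * x)" _ "\<psi> (b' * x)"])
                (use A.eigen_uu[OF v] in \<open>simp_all add: B.spec_eigen C.spec_eigen\<close>)
          qed
          then show "(\<Sum>k\<in>K. (\<Sum>i\<in>I. \<Sum>j\<in>J. F (i, j, k) * (v i * B.spec A.uu b y j)) * C.spec A.uu b' z k) = 0" unfolding tri_trd .
        qed
        then show "(\<Sum>j\<in>J. (\<Sum>i\<in>I. \<Sum>k\<in>K. F (i, j, k) * (v i * z k)) * B.spec A.uu b y j) = 0" unfolding tri_snd .
      next
        fix y' assume y': "y' \<in> B.NN"
        have "tri F v y' z = 0"
        proof (rule NN_only[OF F v _ _ zV])
          show "B.act (A.uu (A.f * s)) y' = y'" for s using y' by (simp add: B.NN_def)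
          show "tri F v y' z' = 0" if z': "z' \<in> C.NN" for z'
          proof (cases "\<chi> c a b * k2 * k3 = 1")
            case True
            then have "\<chi> c b a * k2 * k3 \<noteq> 1"
              using mult_middle_unique[of 1 "\<chi> c a b" "k2 * k3" "\<chi> c b a"] ne by (auto simp: mult.assoc)
            then show ?thesis by (rule tri_eigen_zero[OF F t' A.eigen_dg[OF v t'] k2(2)[OF y'] k3(2)[OF z']])
          next
            case False
            then show ?thesis by (rule tri_eigen_zero[OF F t(1) A.eigen_dg[OF v t(1)] k2(1)[OF y'] k3(1)[OF z']])
          qed
        qed
        then show "(\<Sum>j\<in>J. (\<Sum>i\<in>I. \<Sum>k\<in>K. F (i, j, k) * (v i * z k)) * y' j) = 0" unfolding tri_snd .
      qed
    qed
  qed simp_all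
qed

text \<open>On the product of the open cells one parameter \<open>x\<close> in the ring remains, and
  the torus changes it by units; the powers \<open>p ^ m\<close> with \<open>m <= l\<close>
  represent all orbits, \<open>p ^ l = 0\<close> included. The three conditions remove, in order,
  the cells \<open>ub\<close> with \<open>ub\<close>, \<open>ub\<close> with \<open>ww\<close>, and
  \<open>ww\<close> with \<open>ub\<close>.\<close>

lemma ss_ss_ss_aux:
  assumes u: "A.eigen u \<alpha>" and v: "B.eigen v \<beta>" and w: "C.eigen w \<gamma>"
    and n1: "\<exists>c a b. A.dg c a b \<in> A.GG \<and> A.f dvd a - b \<and> \<alpha> c a b * \<beta> c a b * \<gamma> c a b \<noteq> 1"
    and n2: "\<exists>c a b. A.dg c a b \<in> A.GG \<and> A.f dvd a - b \<and> \<alpha> c a b * \<beta> c a b * \<gamma> c b a \<noteq> 1"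
    and n3: "\<exists>c a b. A.dg c a b \<in> A.GG \<and> A.f dvd a - b \<and> \<alpha> c a b * \<beta> c b a * \<gamma> c a b \<noteq> 1"
  shows "dim_le Forms (l + 1)"
proof (rule ev_dim_le[where S = "{..l}" and x = "\<lambda>_. u" and y = "\<lambda>_. B.act A.ww v" and z = "\<lambda>m. C.act (A.uu (p ^ m)) (C.act A.ww w)"])
  fix F s assume F: "F \<in> Forms" and z: "\<And>m. m \<in> {..l} \<Longrightarrow> tri F u (B.act A.ww v) (C.act (A.uu (p ^ m)) (C.act A.ww w)) = 0"
  have wV: "w \<in> C.VS" "w \<noteq> (\<lambda>_. 0)" using C.eigen_VS[OF w] .
  have orbit: "tri F u y z = 0" if zV: "z \<in> C.VS"
    and a: "\<And>x. tri F u y (C.act (A.uu x) (C.act A.ww w)) = 0" and b: "\<And>\<zeta>. p dvd \<zeta> \<Longrightarrow> tri F u y (C.act (A.ub \<zeta>) w) = 0" for y z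
  proof -
    have "(\<Sum>i\<in>I. \<Sum>j\<in>J. F (i, j, k) * (u i * y j)) = 0" if k: "k \<in> K" for k
    proof (rule C.functional_zero_on_orbit[OF wV _ k])
      fix g assume "g \<in> A.GG"
      from C.eigen_orbit[OF w this] obtain m where "(\<exists>x. C.act g w = (\<lambda>i. m * C.act (A.uu x) (C.act A.ww w) i))
        \<or> (\<exists>\<zeta>. p dvd \<zeta> \<and> C.act g w = (\<lambda>i. m * C.act (A.ub \<zeta>) w i))" by blast
      then have "tri F u y (C.act g w) = 0" using a b by (auto simp: tri_scale)
      then show "(\<Sum>k\<in>K. (\<Sum>i\<in>I. \<Sum>j\<in>J. F (i, j, k) * (u i * y j)) * C.act g w k) = 0" unfolding tri_trd .
    qed
    then show ?thesis unfolding tri_trd by simp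
  qed
  show "F s = 0"
  proof (rule two_eigen_zero[OF F u v])
    fix z assume zV: "z \<in> C.VS"
    show "tri F u (B.act A.ww v) z = 0"
    proof (rule orbit[OF zV])
      fix x
      show "tri F u (B.act A.ww v) (C.act (A.uu x) (C.act A.ww w)) = 0"
      proof (cases "x = 0")
        case True
        then show ?thesis using z[of l] A.p_pow_l by simp
      next
        case False
        then obtain m a where m: "m < l" "\<not> p dvd a" "x = p ^ m * a" by (rule A.valuation)
        obtain c where c: "A.dg c a 1 \<in> A.GG" using A.dg_ex[OF m(2), of 1] A.p_nonunit by auto
        have c': "A.dg c 1 a \<in> A.GG" using c A.dg_swap by blast
        have "tri F u (B.act A.ww v) (C.act (A.dg c a 1) (C.act (A.uu (p ^ m)) (C.act A.ww w))) = 0"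
          using torus_translate[OF F u v c] z[of m] m(1) by simp
        moreover have "C.act (A.dg c a 1) (C.act (A.uu (p ^ m)) (C.act A.ww w)) = (\<lambda>i. \<gamma> c 1 a * C.act (A.uu x) (C.act A.ww w) i)"
          unfolding C.act_dg_uu[OF c] C.eigen_ww[OF w c] C.act_scale using m(3) by (simp add: mult.commute)
        ultimately show ?thesis using C.chi_nz[OF w c'] by (simp add: tri_scale)
      qed
    next
      fix \<zeta> assume \<zeta>: "p dvd \<zeta>"
      obtain c a b where t: "A.dg c a b \<in> A.GG" "A.f dvd a - b" and ne: "\<alpha> c a b * \<beta> c b a * \<gamma> c a b \<noteq> 1" using n3 by blast
      show "tri F u (B.act A.ww v) (C.act (A.ub \<zeta>) w) = 0"
        by (rule tri_eigen_zero[OF F t(1) A.eigen_dg[OF u t(1)] B.eigen_ww[OF v t(1)] C.eigen_ub[OF w t \<zeta>] ne])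
    qed
  next
    fix \<zeta> z assume \<zeta>: "p dvd \<zeta>" and zV: "z \<in> C.VS"
    have ww0: "tri F u (B.act (A.ub \<zeta>') v) (C.act A.ww w) = 0" if \<zeta>': "p dvd \<zeta>'" for \<zeta>'
    proof -
      obtain c a b where t: "A.dg c a b \<in> A.GG" "A.f dvd a - b" and ne: "\<alpha> c a b * \<beta> c a b * \<gamma> c b a \<noteq> 1" using n2 by blast
      show ?thesis
        by (rule tri_eigen_zero[OF F t(1) A.eigen_dg[OF u t(1)] B.eigen_ub[OF v t \<zeta>'] C.eigen_ww[OF w t(1)] ne])
    qed
    show "tri F u (B.act (A.ub \<zeta>) v) z = 0"
    proof (rule orbit[OF zV])
      fix x
      obtain k \<zeta>' where \<zeta>': "p dvd \<zeta>'" "B.act (A.uu (- x)) (B.act (A.ub \<zeta>) v) = (\<lambda>i. k * B.act (A.ub \<zeta>') v i)"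
        using B.eigen_uu_ub[OF v \<zeta>] by blast
      have "tri F u (B.act (A.ub \<zeta>) v) (C.act (A.uu x) (C.act A.ww w)) = tri F u (B.act (A.uu (- x)) (B.act (A.ub \<zeta>) v)) (C.act A.ww w)"
        using uu_move[OF F u, of "B.act (A.ub \<zeta>) v" "C.act A.ww w" "- x"] by simp
      then show "tri F u (B.act (A.ub \<zeta>) v) (C.act (A.uu x) (C.act A.ww w)) = 0" using ww0[OF \<zeta>'(1)] \<zeta>'(2) by (simp add: tri_scale)
    next
      fix \<zeta>' assume \<zeta>': "p dvd \<zeta>'"
      obtain c a b where t: "A.dg c a b \<in> A.GG" "A.f dvd a - b" and ne: "\<alpha> c a b * \<beta> c a b * \<gamma> c a b \<noteq> 1" using n1 by blast
      show "tri F u (B.act (A.ub \<zeta>) v) (C.act (A.ub \<zeta>') w) = 0"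
        by (rule tri_eigen_zero[OF F t(1) A.eigen_dg[OF u t(1)] B.eigen_ub[OF v t \<zeta>] C.eigen_ub[OF w t \<zeta>'] ne])
    qed
  qed
qed simp_all

text \<open>Each of the three characters may be replaced by its Weyl conjugate. Of the four products
  that arise up to simultaneous conjugation, at most one is trivial on the torus elements
  that are scalar modulo the annihilator of the maximal ideal; the choice below makes it the
  one on which no condition is needed.\<close>

theorem ss_ss_ss:
  assumes nA: "card I = (q + 1) * q ^ (l - 1)" and nB: "card J = (q + 1) * q ^ (l - 1)" and nC: "card K = (q + 1) * q ^ (l - 1)"
  shows "dim_le Forms (l + 1)"
proof -
  define T where "T = {(c, a, b). A.dg c a b \<in> A.GG \<and> A.f dvd a - b}"
  have Tsw: "(c, b, a) \<in> T" if "(c, a, b) \<in> T" for c a b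
    using that A.dg_swap dvd_minus_iff[of A.f "a - b"] by (auto simp: T_def)
  obtain u \<alpha> ca aa ba where u: "A.eigen u \<alpha>" and ta: "(ca, aa, ba) \<in> T" and nea: "\<alpha> ca aa ba \<noteq> \<alpha> ca ba aa"
    using A.principal_series[OF nA] unfolding T_def by blast
  obtain v \<beta> v' cb ab bb where v: "B.eigen v \<beta>" "B.eigen v' (\<lambda>c a b. \<beta> c b a)"
    and tb: "(cb, ab, bb) \<in> T" and neb: "\<beta> cb ab bb \<noteq> \<beta> cb bb ab"
    using B.principal_series[OF nB] unfolding T_def by blast
  obtain w \<gamma> w' cc ac bc where w: "C.eigen w \<gamma>" "C.eigen w' (\<lambda>c a b. \<gamma> c b a)"
    and tc: "(cc, ac, bc) \<in> T" and nec: "\<gamma> cc ac bc \<noteq> \<gamma> cc bc ac"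
    using C.principal_series[OF nC] unfolding T_def by blast
  \<comment> \<open>The product of the characters is trivial on \<open>T'\<close>, where
    \<open>r\<close> and \<open>s\<close> tell whether the second and third are kept or replaced by
    their conjugates.\<close>
  define P where "P = (\<lambda>r s. \<forall>c a b. (c, a, b) \<in> T \<longrightarrow> \<alpha> c a b * (if r then \<beta> c a b else \<beta> c b a) * (if s then \<gamma> c a b else \<gamma> c b a) = 1)"
  have PD: "\<alpha> c a b * (if r then \<beta> c a b else \<beta> c b a) * (if s then \<gamma> c a b else \<gamma> c b a) = 1"
    if "P r s" "(c, a, b) \<in> T" for r s c a b using that unfolding P_def by blast
  have x1: False if h: "P r s" "P (\<not> r) s" for r s
    using mult_middle_unique[OF PD[OF h(1) tb] PD[OF h(2) tb]] neb by (cases r) auto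
  have x2: False if h: "P r s" "P r (\<not> s)" for r s
  proof -
    define m where "m = \<alpha> cc ac bc * (if r then \<beta> cc ac bc else \<beta> cc bc ac)"
    have "m * (if s then \<gamma> cc ac bc else \<gamma> cc bc ac) * 1 = 1" "m * (if \<not> s then \<gamma> cc ac bc else \<gamma> cc bc ac) * 1 = 1"
      using PD[OF h(1) tc] PD[OF h(2) tc] unfolding m_def by (simp_all only: mult_1_right)
    then have "(if s then \<gamma> cc ac bc else \<gamma> cc bc ac) = (if \<not> s then \<gamma> cc ac bc else \<gamma> cc bc ac)"
      by (rule mult_middle_unique)
    then show False using nec by (cases s) auto
  qed
  \<comment> \<open>Conjugating both \<open>\<beta>\<close> and \<open>\<gamma>\<close> amounts to
    conjugating \<open>\<alpha>\<close>, after swapping the two torus arguments.\<close>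
  have x3: False if h: "P r s" "P (\<not> r) (\<not> s)" for r s
  proof -
    have "1 * \<alpha> ca aa ba * ((if r then \<beta> ca aa ba else \<beta> ca ba aa) * (if s then \<gamma> ca aa ba else \<gamma> ca ba aa)) = 1"
      using PD[OF h(1) ta] by (simp only: mult_1 mult.assoc)
    moreover have "1 * \<alpha> ca ba aa * ((if r then \<beta> ca aa ba else \<beta> ca ba aa) * (if s then \<gamma> ca aa ba else \<gamma> ca ba aa)) = 1"
      using PD[OF h(2) Tsw[OF ta]] by (cases r; cases s) (simp_all add: mult.assoc)
    ultimately show False using mult_middle_unique nea by blast
  qed
  have V: "B.eigen (if r then v else v') (\<lambda>c a b. if r then \<beta> c a b else \<beta> c b a)" for r using v by (cases r) auto
  have W: "C.eigen (if s then w else w') (\<lambda>c a b. if s then \<gamma> c a b else \<gamma> c b a)" for s using w by (cases s) auto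
  have good: "dim_le Forms (l + 1)" if h: "\<not> P r s" "\<not> P r (\<not> s)" "\<not> P (\<not> r) s" for r s
  proof (rule ss_ss_ss_aux[OF u V[of r] W[of s]])
    have nP: "\<exists>c a b. A.dg c a b \<in> A.GG \<and> A.f dvd a - b \<and>
       \<alpha> c a b * (if r then \<beta> c a b else \<beta> c b a) * (if s then \<gamma> c a b else \<gamma> c b a) \<noteq> 1" if "\<not> P r s" for r s
      using that unfolding P_def T_def by blast
    have sw: "(if \<not> r then x else y) = (if r then y else x)" for r and x y :: complex by simp
    show "\<exists>c a b. A.dg c a b \<in> A.GG \<and> A.f dvd a - b \<and>
       \<alpha> c a b * (if r then \<beta> c a b else \<beta> c b a) * (if s then \<gamma> c a b else \<gamma> c b a) \<noteq> 1" by (rule nP[OF h(1)])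
    show "\<exists>c a b. A.dg c a b \<in> A.GG \<and> A.f dvd a - b \<and>
       \<alpha> c a b * (if r then \<beta> c a b else \<beta> c b a) * (if s then \<gamma> c b a else \<gamma> c a b) \<noteq> 1"
      using nP[OF h(2)] unfolding sw .
    show "\<exists>c a b. A.dg c a b \<in> A.GG \<and> A.f dvd a - b \<and>
       \<alpha> c a b * (if r then \<beta> c b a else \<beta> c a b) * (if s then \<gamma> c a b else \<gamma> c b a) \<noteq> 1"
      using nP[OF h(3)] unfolding sw .
  qed
  show ?thesis
  proof (cases "\<exists>r s. P r s")
    case True
    then obtain r s where "P r s" by blast
    then show ?thesis using good[of "\<not> r" "\<not> s"] x1[of r s] x2[of r s] x3[of r s] by auto
  next
    case False
    then show ?thesis using good by blast
  qed
qed

end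

section \<open>The cuspidal case\<close>

definition prod_mul :: "('g \<Rightarrow> 'g \<Rightarrow> 'g) \<Rightarrow> ('h \<Rightarrow> 'h \<Rightarrow> 'h) \<Rightarrow> 'g \<times> 'h \<Rightarrow> 'g \<times> 'h \<Rightarrow> 'g \<times> 'h" where
  "prod_mul m n x y = (m (fst x) (fst y), n (snd x) (snd y))"

definition prod_ker :: "('g \<Rightarrow> 'i \<Rightarrow> 'i \<Rightarrow> complex) \<Rightarrow> ('h \<Rightarrow> 'j \<Rightarrow> 'j \<Rightarrow> complex) \<Rightarrow> 'g \<times> 'h \<Rightarrow> 'i \<times> 'j \<Rightarrow> 'i \<times> 'j \<Rightarrow> complex" where
  "prod_ker \<rho> \<sigma> g i j = \<rho> (fst g) (fst i) (fst j) * \<sigma> (snd g) (snd i) (snd j)"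

lemma prod_mul_simp [simp]: "prod_mul m n (a, b) (c, d) = (m a c, n b d)" by (simp add: prod_mul_def)

lemma sum_prod_Times: "(\<Sum>x\<in>A \<times> B. f (fst x) * g (snd x)) = (\<Sum>a\<in>A. f a) * (\<Sum>b\<in>B. (g b :: complex))"
  unfolding sum_product by (simp add: sum.cartesian_product case_prod_beta)

lemma irr_rep_prod:
  assumes "irr_rep G m e I \<rho>" "irr_rep H n e' J \<sigma>"
  shows "irr_rep (G \<times> H) (prod_mul m n) (e, e') (I \<times> J) (prod_ker \<rho> \<sigma>)"
proof -
  interpret A: irr_rep G m e I \<rho> by fact
  interpret B: irr_rep H n e' J \<sigma> by fact
  show ?thesis
  proof
    show "finite (G \<times> H)" "finite (I \<times> J)" using A.finite_G B.finite_G A.finite_I B.finite_I by auto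
    show "\<exists>h\<in>G \<times> H. prod_mul m n g h = (e, e') \<and> prod_mul m n h g = (e, e')" if "g \<in> G \<times> H" for g
      using that by (intro bexI[of _ "(A.ginv (fst g), B.ginv (snd g))"]) (auto simp: prod_mul_def)
    show "prod_ker \<rho> \<sigma> (prod_mul m n g h) i j = (\<Sum>k\<in>I \<times> J. prod_ker \<rho> \<sigma> g i k * prod_ker \<rho> \<sigma> h k j)"
      if "g \<in> G \<times> H" "h \<in> G \<times> H" "i \<in> I \<times> J" "j \<in> I \<times> J" for g h i j
    proof -
      have "(\<Sum>k\<in>I \<times> J. prod_ker \<rho> \<sigma> g i k * prod_ker \<rho> \<sigma> h k j)
         = (\<Sum>k\<in>I \<times> J. (\<rho> (fst g) (fst i) (fst k) * \<rho> (fst h) (fst k) (fst j))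
             * (\<sigma> (snd g) (snd i) (snd k) * \<sigma> (snd h) (snd k) (snd j)))"
        by (simp add: prod_ker_def mult_ac)
      also have "\<dots> = \<rho> (m (fst g) (fst h)) (fst i) (fst j) * \<sigma> (n (snd g) (snd h)) (snd i) (snd j)"
        unfolding sum_prod_Times[where f = "\<lambda>k. \<rho> (fst g) (fst i) k * \<rho> (fst h) k (fst j)" and g = "\<lambda>k. \<sigma> (snd g) (snd i) k * \<sigma> (snd h) k (snd j)"]
        using that by (auto simp: A.rep_mul B.rep_mul)
      finally show ?thesis by (simp add: prod_ker_def prod_mul_def)
    qed
    show "prod_ker \<rho> \<sigma> (e, e') i j = (if i = j then 1 else 0)" if "i \<in> I \<times> J" "j \<in> I \<times> J" for i j
      using that by (auto simp: prod_ker_def A.rep_one B.rep_one split: if_splits)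
    show "prod_ker \<rho> \<sigma> g i j = 0" if "g \<in> G \<times> H" "i \<notin> I \<times> J \<or> j \<notin> I \<times> J" for g i j
      using that A.rep_supp[of "fst g" "fst i" "fst j"] B.rep_supp[of "snd g" "snd i" "snd j"]
      by (auto simp: prod_ker_def mem_Times_iff)
    show "\<exists>c. \<forall>a\<in>I \<times> J. \<forall>b\<in>I \<times> J. (\<Sum>g\<in>G \<times> H. c g * prod_ker \<rho> \<sigma> g a b) = (if a = i \<and> b = j then 1 else 0)"
      if "i \<in> I \<times> J" "j \<in> I \<times> J" for i j
    proof -
      have ij: "fst i \<in> I" "fst j \<in> I" "snd i \<in> J" "snd j \<in> J" using that by auto
      obtain c where c: "\<And>a b. a \<in> I \<Longrightarrow> b \<in> I \<Longrightarrow> (\<Sum>g\<in>G. c g * \<rho> g a b) = (if a = fst i \<and> b = fst j then 1 else 0)"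
        using A.full[OF ij(1,2)] by blast
      obtain d where d: "\<And>a b. a \<in> J \<Longrightarrow> b \<in> J \<Longrightarrow> (\<Sum>g\<in>H. d g * \<sigma> g a b) = (if a = snd i \<and> b = snd j then 1 else 0)"
        using B.full[OF ij(3,4)] by blast
      have "(\<Sum>g\<in>G \<times> H. (c (fst g) * d (snd g)) * prod_ker \<rho> \<sigma> g a b) = (if a = i \<and> b = j then 1 else 0)"
        if ab: "a \<in> I \<times> J" "b \<in> I \<times> J" for a b
      proof -
        have "(\<Sum>g\<in>G \<times> H. (c (fst g) * d (snd g)) * prod_ker \<rho> \<sigma> g a b)
          = (\<Sum>g\<in>G \<times> H. (c (fst g) * \<rho> (fst g) (fst a) (fst b)) * (d (snd g) * \<sigma> (snd g) (snd a) (snd b)))"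
          by (simp add: prod_ker_def mult_ac)
        also have "\<dots> = (\<Sum>g\<in>G. c g * \<rho> g (fst a) (fst b)) * (\<Sum>h\<in>H. d h * \<sigma> h (snd a) (snd b))"
          by (rule sum_prod_Times[where f = "\<lambda>g. c g * \<rho> g (fst a) (fst b)" and g = "\<lambda>h. d h * \<sigma> h (snd a) (snd b)"])
        also have "\<dots> = (if a = i \<and> b = j then 1 else 0)" using ab by (auto simp: c d prod_eq_iff)
        finally show ?thesis .
      qed
      then show ?thesis by (intro exI[of _ "\<lambda>g. c (fst g) * d (snd g)"]) blast
    qed
    show "I \<times> J \<noteq> {}" using A.I_nonempty B.I_nonempty by auto
  qed (auto simp: prod_mul_def A.assoc B.assoc)
qed

context top_rep
begin

lemma cuspidal_sum_zero:
  assumes n: "card I = (q - 1) * q ^ (l - 1)" and v: "v \<in> VS"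
  shows "(\<Sum>s\<in>UNIV. act (uu (p ^ (l - 1) * s)) v i) = 0"
proof -
  have "dimN = 0" using n dim_formula' by simp
  then have "spec hf 0 v = (\<lambda>_. 0)" using spec_hf_in[OF v] dimN_pos_iff by auto
  then have "(\<Sum>x\<in>UNIV. (1 / cardR) * act (uu (p ^ (l - 1) * x)) v i) = 0"
    using fun_cong[of "spec hf 0 v" _ i] unfolding spec_eq hf_def f_def by simp
  then show ?thesis unfolding sum_distrib_left[symmetric] by simp
qed

end

context tri_rep
begin

abbreviation "G3 \<equiv> A.GG \<times> (A.GG \<times> A.GG)"
abbreviation "\<rho>3 \<equiv> prod_ker \<rho> (prod_ker \<sigma> \<tau>)"

lemma irr3: "irr_rep G3 (prod_mul A.gm (prod_mul A.gm A.gm)) (ext_one c1, ext_one c1, ext_one c1) (I \<times> J \<times> K) \<rho>3"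
  by (intro irr_rep_prod) unfold_locales

sublocale T: irr_rep G3 "prod_mul A.gm (prod_mul A.gm A.gm)" "(ext_one c1, ext_one c1, ext_one c1)" "I \<times> J \<times> K" \<rho>3
  by (rule irr3)

definition diag :: "'c \<times> 'r m2 \<Rightarrow> ('c \<times> 'r m2) \<times> ('c \<times> 'r m2) \<times> ('c \<times> 'r m2)" where "diag g = (g, g, g)"

text \<open>The compressed operator at \<open>g\<close> applied to a diagonally invariant
  \<open>v\<close>, up to the factor \<open>card A.GG\<close>; on such \<open>v\<close> it depends
  only on the double coset of the diagonal.\<close>

definition EE :: "('i \<times> 'j \<times> 'k \<Rightarrow> complex) \<Rightarrow> ('c \<times> 'r m2) \<times> ('c \<times> 'r m2) \<times> ('c \<times> 'r m2) \<Rightarrow> 'i \<times> 'j \<times> 'k \<Rightarrow> complex" where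
  "EE v g = T.twisted_sum (diag ` A.GG) (\<lambda>_. 1) (T.act g v)"

lemma inj_diag: "inj_on diag A.GG" by (auto simp: inj_on_def diag_def)

lemma EE_eq: "EE v g s = (\<Sum>h\<in>A.GG. T.act (diag h) (T.act g v) s)"
  unfolding EE_def T.twisted_sum_def by (simp add: sum.reindex[OF inj_diag])

lemma EE_right:
  assumes "x \<in> A.GG" "y \<in> A.GG" "z \<in> A.GG" "h \<in> A.GG" "T.act (diag h) v = v"
  shows "EE v (A.gm x h, A.gm y h, A.gm z h) = EE v (x, y, z)"
proof -
  have "T.act (A.gm x h, A.gm y h, A.gm z h) v = T.act (prod_mul A.gm (prod_mul A.gm A.gm) (x, y, z) (diag h)) v"
    by (simp add: diag_def)
  also have "\<dots> = T.act (x, y, z) (T.act (diag h) v)" by (rule T.act_mul) (use assms in \<open>auto simp: diag_def\<close>)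
  finally show ?thesis unfolding EE_def assms(5) by simp
qed

lemma EE_left:
  assumes "x \<in> A.GG" "y \<in> A.GG" "z \<in> A.GG" "h \<in> A.GG"
  shows "EE v (A.gm h x, A.gm h y, A.gm h z) = EE v (x, y, z)"
proof
  fix s
  have "T.act (diag k) (T.act (A.gm h x, A.gm h y, A.gm h z) v) = T.act (diag (A.gm k h)) (T.act (x, y, z) v)" if "k \<in> A.GG" for k
    using assms that by (subst (1 2) T.act_mul[symmetric]) (auto simp: diag_def A.assoc)
  then have "EE v (A.gm h x, A.gm h y, A.gm h z) s = (\<Sum>k\<in>A.GG. T.act (diag (A.gm k h)) (T.act (x, y, z) v) s)"
    unfolding EE_eq by simp
  also have "\<dots> = (\<Sum>k\<in>A.GG. T.act (diag k) (T.act (x, y, z) v) s)"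
    by (rule sum.reindex_bij_witness[of _ "\<lambda>k. A.gm k (A.ginv h)" "\<lambda>k. A.gm k h"]) (use assms in \<open>auto simp: A.assoc\<close>)
  finally show "EE v (A.gm h x, A.gm h y, A.gm h z) s = EE v (x, y, z) s" unfolding EE_eq .
qed

lemma EE_sum_zero:
  assumes n: "card I = (q - 1) * q ^ (l - 1)" and G: "x \<in> A.GG" "y \<in> A.GG" "z \<in> A.GG" and v: "v \<in> T.VS"
  shows "(\<Sum>s\<in>UNIV. EE v (A.gm x (A.uu (p ^ (l - 1) * s)), y, z) t) = 0"
proof -
  let ?u = "\<lambda>s. (A.uu (p ^ (l - 1) * s), ext_one c1, ext_one c1)"
  have u: "?u s \<in> G3" for s by auto
  have z: "(\<lambda>t. \<Sum>s\<in>UNIV. T.act (?u s) v t) = (\<lambda>_. 0)"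
  proof
    fix t :: "'i \<times> 'j \<times> 'k"
    obtain i j k where t: "t = (i, j, k)" by (cases t)
    show "(\<Sum>s\<in>UNIV. T.act (?u s) v t) = 0"
    proof (cases "t \<in> I \<times> J \<times> K")
      case True
      then have jk: "j \<in> J" "k \<in> K" using t by auto
      have "T.act (?u s) v t = A.act (A.uu (p ^ (l - 1) * s)) (\<lambda>i'. v (i', j, k)) i" for s
      proof -
        have "T.act (?u s) v t = (\<Sum>i'\<in>I. \<Sum>j'\<in>J. \<Sum>k'\<in>K. \<rho>3 (?u s) t (i', j', k') * v (i', j', k'))"
          unfolding T.act_def app_def by (simp add: sum.cartesian_product)
        also have "\<dots> = (\<Sum>i'\<in>I. \<Sum>j'\<in>J. \<Sum>k'\<in>K. if k = k' then if j = j' then \<rho> (A.uu (p ^ (l - 1) * s)) i i' * v (i', j', k') else 0 else 0)"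
          unfolding t prod_ker_def using jk by (intro sum.cong refl) (simp add: B.rep_one C.rep_one)
        also have "\<dots> = (\<Sum>i'\<in>I. \<rho> (A.uu (p ^ (l - 1) * s)) i i' * v (i', j, k))"
          using jk B.finite_I C.finite_I by simp
        finally show ?thesis unfolding A.act_def app_def .
      qed
      moreover have "(\<lambda>i'. v (i', j, k)) \<in> A.VS" using v by (auto simp: A.VS_def T.VS_def)
      ultimately show ?thesis using A.cuspidal_sum_zero[OF n] by simp
    next
      case False
      then show ?thesis using T.VSD[OF T.act_in[OF u] False] by simp
    qed
  qed
  have "T.act (diag h) (T.act (A.gm x (A.uu (p ^ (l - 1) * s)), y, z) v) = T.act (diag h) (T.act (x, y, z) (T.act (?u s) v))" for h s
    using G by (subst (2) T.act_mul[symmetric]) auto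
  then have "(\<Sum>s\<in>UNIV. EE v (A.gm x (A.uu (p ^ (l - 1) * s)), y, z) t)
     = (\<Sum>h\<in>A.GG. \<Sum>s\<in>UNIV. T.act (diag h) (T.act (x, y, z) (T.act (?u s) v)) t)"
    unfolding EE_eq by (subst sum.swap) simp
  also have "\<dots> = (\<Sum>h\<in>A.GG. T.act (diag h) (T.act (x, y, z) (\<lambda>t. \<Sum>s\<in>UNIV. T.act (?u s) v t)) t)"
    unfolding T.act_sum ..
  finally show ?thesis unfolding z by simp
qed

definition iota :: "'c \<times> 'r m2 \<Rightarrow> 'c \<times> 'r m2" where "iota g = (fst g, madj (snd g))"

lemma iota_in [simp]: "g \<in> A.GG \<Longrightarrow> iota g \<in> A.GG" by (cases g) (simp add: iota_def A.GG_iff)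

lemma iota_iota [simp]: "iota (iota g) = g" by (simp add: iota_def)

lemma iota_mul: "iota (A.gm g h) = A.gm (iota h) (iota g)"
  by (simp add: iota_def ext_mul_def madj_mm A.cm_comm)

lemma iota_one [simp]: "iota (ext_one c1) = ext_one c1" by (simp add: iota_def ext_one_def mid_def)

text \<open>With third entry 1, double cosets of the diagonal are pairs up to simultaneous
  conjugation. The scalar parts \<open>\<kappa>\<close> and \<open>\<kappa>'\<close> are untouched,
  and in the matrix parts the value is a cuspidal pair function.\<close>

lemma EE_adj:
  assumes n: "card I = (q - 1) * q ^ (l - 1)" and v: "v \<in> T.VS" "\<And>h. h \<in> A.GG \<Longrightarrow> T.act (diag h) v = v"
    and x: "x \<in> A.GG" and y: "y \<in> A.GG"
  shows "EE v (x, y, ext_one c1) t = EE v (iota x, iota y, ext_one c1) t"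
proof -
  obtain \<kappa> X \<kappa>' Y where xy: "x = (\<kappa>, X)" "y = (\<kappa>', Y)" by (cases x; cases y)
  have ok: "ok \<kappa> (mdet X)" "ok \<kappa>' (mdet Y)" using x y xy by (simp_all add: A.GG_iff)
  define f where "f = (\<lambda>X Y. EE v ((\<kappa>, X), (\<kappa>', Y), ext_one c1) t)"
  have one: "A.gm g (ext_one c1) = A.gm (ext_one c1) g" if "g \<in> A.GG" for g using that by simp
  have "A.cuspidal_pair_function (mdet X) (mdet Y) f"
    unfolding A.cuspidal_pair_function_def
  proof (intro conjI allI impI)
    fix N X1 Y1 X2 Y2
    assume N: "\<not> p dvd mdet N" and d: "mdet X1 = mdet X" "mdet Y1 = mdet Y" and c: "mm N X1 = mm X2 N" "mm N Y1 = mm Y2 N"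
    obtain k where k: "ok k (mdet N)" using A.ok_ex[OF N] by blast
    have G: "(k, N) \<in> A.GG" "(\<kappa>, X1) \<in> A.GG" "(\<kappa>', Y1) \<in> A.GG" using k ok d by (simp_all add: A.GG_iff)
    have G': "(\<kappa>, X2) \<in> A.GG" "(\<kappa>', Y2) \<in> A.GG"
      using A.mdet_conj[OF N c(1)] A.mdet_conj[OF N c(2)] ok d by (simp_all add: A.GG_iff)
    have e: "A.gm (k, N) (\<kappa>, X1) = A.gm (\<kappa>, X2) (k, N)" "A.gm (k, N) (\<kappa>', Y1) = A.gm (\<kappa>', Y2) (k, N)"
      using c by (simp_all add: A.cm_comm)
    have "f X1 Y1 = EE v (A.gm (k, N) (\<kappa>, X1), A.gm (k, N) (\<kappa>', Y1), A.gm (k, N) (ext_one c1)) t"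
      unfolding f_def using G by (subst EE_left) auto
    also have "\<dots> = EE v (A.gm (\<kappa>, X2) (k, N), A.gm (\<kappa>', Y2) (k, N), A.gm (ext_one c1) (k, N)) t"
      unfolding e one[OF G(1)] ..
    also have "\<dots> = f X2 Y2" unfolding f_def using G G' v(2) by (subst EE_right) auto
    finally show "f X1 Y1 = f X2 Y2" .
  next
    fix N X1 Y1 Xs
    assume N: "\<not> p dvd mdet N" and d: "mdet X1 = mdet X" "mdet Y1 = mdet Y"
      and c: "\<forall>s. mm (Xs s) N = mm X1 (mm N (M2 1 (p ^ (l - 1) * s) 0 1))"
    obtain k where k: "ok k (mdet N)" using A.ok_ex[OF N] by blast
    have G: "(k, N) \<in> A.GG" "(\<kappa>, X1) \<in> A.GG" "(\<kappa>', Y1) \<in> A.GG" using k ok d by (simp_all add: A.GG_iff)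
    have Gs: "(\<kappa>, Xs s) \<in> A.GG" for s
    proof -
      have "mdet (Xs s) * mdet N = mdet X * mdet N"
        using arg_cong[OF c[rule_format, of s], of mdet] d by (simp add: mdet_mm)
      then have "mdet (Xs s) = mdet X" using A.unit_cancel[OF N] by (simp add: mult.commute)
      then show ?thesis using ok by (simp add: A.GG_iff)
    qed
    have "f (Xs s) Y1 = EE v (A.gm (A.gm (\<kappa>, X1) (k, N)) (A.uu (p ^ (l - 1) * s)), A.gm (\<kappa>', Y1) (k, N), (k, N)) t" for s
    proof -
      have "f (Xs s) Y1 = EE v (A.gm (\<kappa>, Xs s) (k, N), A.gm (\<kappa>', Y1) (k, N), A.gm (ext_one c1) (k, N)) t"
        unfolding f_def using G Gs v(2) by (subst EE_right) auto
      moreover have "A.gm (\<kappa>, Xs s) (k, N) = A.gm (A.gm (\<kappa>, X1) (k, N)) (A.uu (p ^ (l - 1) * s))"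
        using c by (simp add: A.uu_def mm_assoc)
      ultimately show ?thesis using G by simp
    qed
    then show "(\<Sum>s\<in>UNIV. f (Xs s) Y1) = 0"
      by (simp only:) (rule EE_sum_zero[OF n _ _ _ v(1)], (use G in \<open>blast intro: A.closed\<close>)+)
  qed
  from A.cuspidal_pair_function_adj[OF this A.ok_unit[OF ok(1)] refl refl]
  show ?thesis unfolding f_def xy iota_def by simp
qed

theorem cuspidal_vectors:
  assumes n: "card I = (q - 1) * q ^ (l - 1)"
    and v: "v \<in> T.VS" "\<And>h. h \<in> A.GG \<Longrightarrow> T.act (diag h) v = v"
    and w: "w \<in> T.VS" "\<And>h. h \<in> A.GG \<Longrightarrow> T.act (diag h) w = w"
  shows "v s * w t = v t * w s"
proof (rule T.gelfand_trick[where H = "diag ` A.GG" and \<chi> = "\<lambda>_. 1" and \<iota> = "\<lambda>g. (iota (fst g), iota (fst (snd g)), iota (snd (snd g)))"])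
  show "diag ` A.GG \<subseteq> G3" by (auto simp: diag_def)
  show "(ext_one c1, ext_one c1, ext_one c1) \<in> diag ` A.GG" using A.one_in by (auto simp: diag_def)
  show "prod_mul A.gm (prod_mul A.gm A.gm) h k \<in> diag ` A.GG" if "h \<in> diag ` A.GG" "k \<in> diag ` A.GG" for h k
  proof -
    from that(1) obtain x where x: "h = diag x" "x \<in> A.GG" by (rule imageE)
    from that(2) obtain y where y: "k = diag y" "y \<in> A.GG" by (rule imageE)
    have "prod_mul A.gm (prod_mul A.gm A.gm) h k = diag (A.gm x y)" unfolding x(1) y(1) by (simp add: diag_def)
    then show ?thesis using A.closed[OF x(2) y(2)] by (simp only: image_eqI)
  qed
  show "T.ginv h \<in> diag ` A.GG" if "h \<in> diag ` A.GG" for h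
  proof -
    from that obtain g where g: "h = diag g" "g \<in> A.GG" by (rule imageE)
    have "T.ginv h = diag (A.ginv g)" using g(2) unfolding g(1) by (intro T.ginv_eqI) (simp_all add: diag_def)
    then show ?thesis using A.ginv_in[OF g(2)] by (simp only: image_eqI)
  qed
  fix u g t
  assume u: "u \<in> T.VS" and uH: "\<And>h. h \<in> diag ` A.GG \<Longrightarrow> T.act h u = (\<lambda>i. 1 * u i)" and g: "g \<in> G3"
  have inv: "T.act (diag h) u = u" if "h \<in> A.GG" for h using uH[of "diag h"] that by simp
  obtain x y z where xyz: "g = (x, y, z)" by (cases g)
  then have G: "x \<in> A.GG" "y \<in> A.GG" "z \<in> A.GG" using g by auto
  \<comment> \<open>Right multiplication by the inverse of \<open>z\<close> normalises the third
    entry; after the adjugate, left multiplication by \<open>iota z\<close> restores it.\<close>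
  have "EE u g t = EE u (A.gm (A.gm x (A.ginv z)) z, A.gm (A.gm y (A.ginv z)) z, A.gm (ext_one c1) z) t"
    using G xyz by (simp add: A.assoc)
  also have "\<dots> = EE u (A.gm x (A.ginv z), A.gm y (A.ginv z), ext_one c1) t"
    using G inv by (subst EE_right) auto
  also have "\<dots> = EE u (iota (A.gm x (A.ginv z)), iota (A.gm y (A.ginv z)), ext_one c1) t"
    using G by (intro EE_adj[OF n u inv]) auto
  also have "\<dots> = EE u (A.gm (iota z) (iota (A.gm x (A.ginv z))), A.gm (iota z) (iota (A.gm y (A.ginv z))), A.gm (iota z) (ext_one c1)) t"
    using G by (subst EE_left) auto
  also have "\<dots> = EE u (iota x, iota y, iota z) t"
  proof -
    have "A.gm (iota z) (iota (A.gm x (A.ginv z))) = iota x" "A.gm (iota z) (iota (A.gm y (A.ginv z))) = iota y"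
      unfolding iota_mul[symmetric] using G by (simp_all add: A.assoc)
    then show ?thesis using G by simp
  qed
  finally show "T.twisted_sum (diag ` A.GG) (\<lambda>_. 1) (T.act g u) t
     = T.twisted_sum (diag ` A.GG) (\<lambda>_. 1) (T.act (iota (fst g), iota (fst (snd g)), iota (snd (snd g))) u) t"
    unfolding EE_def xyz by simp
next
  fix g h
  show "(iota (fst g), iota (fst (snd g)), iota (snd (snd g))) \<in> G3" if "g \<in> G3"
    using that iota_in by (auto simp del: split_paired_All)
  show "(iota (fst (prod_mul A.gm (prod_mul A.gm A.gm) g h)), iota (fst (snd (prod_mul A.gm (prod_mul A.gm A.gm) g h))),
      iota (snd (snd (prod_mul A.gm (prod_mul A.gm A.gm) g h))))
    = prod_mul A.gm (prod_mul A.gm A.gm) (iota (fst h), iota (fst (snd h)), iota (snd (snd h)))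
        (iota (fst g), iota (fst (snd g)), iota (snd (snd g)))"
    unfolding prod_mul_def fst_conv snd_conv iota_mul ..
next
  fix h assume "h \<in> diag ` A.GG"
  then obtain g where h: "h = diag g" and g: "g \<in> A.GG" by (rule imageE)
  then have "(iota (fst h), iota (fst (snd h)), iota (snd (snd h))) = diag (iota g)" by (simp add: diag_def)
  then show "(iota (fst h), iota (fst (snd h)), iota (snd (snd h))) \<in> diag ` A.GG" using iota_in[OF g] by (simp only: image_eqI)
  show "T.act h v = (\<lambda>i. 1 * v i)" "T.act h w = (\<lambda>i. 1 * w i)" unfolding h using v(2)[OF g] w(2)[OF g] by simp_all
qed (use v w in simp_all)

end

section \<open>Bounds by type\<close>

lemma dim_le_mono: "\<F> \<subseteq> \<F>' \<Longrightarrow> dim_le \<F>' N \<Longrightarrow> dim_le \<F> N"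
  by (erule dim_le_reindex[where \<pi> = "\<lambda>x. x"]) auto

text \<open>Transposing the kernels turns invariant forms into invariant vectors of the triple
  tensor product. Gelfand's trick is stated for vectors and the cell arguments for forms; passing to
  contragredients connects them.\<close>

definition inv_vecs :: "'g set \<Rightarrow> 'i set \<Rightarrow> ('g \<Rightarrow> 'i \<Rightarrow> 'i \<Rightarrow> complex) \<Rightarrow> 'j set \<Rightarrow> ('g \<Rightarrow> 'j \<Rightarrow> 'j \<Rightarrow> complex)
    \<Rightarrow> 'k set \<Rightarrow> ('g \<Rightarrow> 'k \<Rightarrow> 'k \<Rightarrow> complex) \<Rightarrow> ('i \<times> 'j \<times> 'k \<Rightarrow> complex) set" where
  "inv_vecs G I \<rho> J \<sigma> K \<tau> = inv_forms G I (\<lambda>g i j. \<rho> g j i) J (\<lambda>g i j. \<sigma> g j i) K (\<lambda>g i j. \<tau> g j i)"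

context tri_rep
begin

lemma cuspidal_first:
  assumes "card I = (q - 1) * q ^ (l - 1)"
  shows "dim_le (inv_vecs A.GG I \<rho> J \<sigma> K \<tau>) 1"
proof (rule dim_le_1I)
  have iv: "F \<in> T.VS \<and> (\<forall>h\<in>A.GG. T.act (diag h) F = F)" if F: "F \<in> inv_vecs A.GG I \<rho> J \<sigma> K \<tau>" for F
  proof -
    have s: "F t = 0" if "t \<notin> I \<times> J \<times> K" for t using F that unfolding inv_vecs_def inv_forms_def by blast
    then have FV: "F \<in> T.VS" unfolding T.VS_def by blast
    have "T.act (diag h) F t = F t" if h: "h \<in> A.GG" for h t
    proof (cases "t \<in> I \<times> J \<times> K")
      case True
      then obtain i j k where t: "t = (i, j, k)" "i \<in> I" "j \<in> J" "k \<in> K" by auto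
      have "T.act (diag h) F t = (\<Sum>i'\<in>I. \<Sum>j'\<in>J. \<Sum>k'\<in>K. F (i', j', k') * (\<rho> h i i' * \<sigma> h j j' * \<tau> h k k'))"
        unfolding T.act_def app_def t(1) by (simp add: sum.cartesian_product case_prod_beta prod_ker_def diag_def mult_ac)
      also have "\<dots> = F t" using F h t by (auto simp: inv_vecs_def inv_forms_def)
      finally show ?thesis .
    next
      case False
      have "diag h \<in> G3" using h by (simp add: diag_def)
      then show ?thesis using T.VSD[OF T.act_in False] s[OF False] by simp
    qed
    then show ?thesis using FV by blast
  qed
  fix F F' s t assume "F \<in> inv_vecs A.GG I \<rho> J \<sigma> K \<tau>" "F' \<in> inv_vecs A.GG I \<rho> J \<sigma> K \<tau>"
  then show "F s * F' t = F t * F' s" by (intro cuspidal_vectors[OF assms]) (use iv in blast)+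
qed

end

context chain_ring
begin

text \<open>Here the type dimensions meet \<open>level_card\<close>: in units of
  \<open>q ^ (l - 2)\<close> they are at least \<open>(q - 1) * q\<close>, already 6 against 4 when
  \<open>q = 3\<close>.\<close>

lemma type_large:
  assumes "has_type l q n t"
  shows "n > 1" "2 \<le> l \<Longrightarrow> n > (q + 1) * q ^ (l - 2)"
proof -
  have pos: "q ^ (l - 2) > 0" using q_ge_3 by simp
  show 2: "n > (q + 1) * q ^ (l - 2)" if l: "2 \<le> l"
  proof -
    have 1: "q ^ (l - 1) = q * q ^ (l - 2)" using l by (metis Suc_1 Suc_diff_Suc Suc_le_lessD power_Suc)
    have "q + 1 < (q - 1) * q"
    proof -
      have "2 * q \<le> (q - 1) * q" using q_ge_3 by (intro mult_le_mono1) simp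
      moreover have "q + 1 < 2 * q" using q_ge_3 by simp
      ultimately show ?thesis by (rule less_le_trans[rotated])
    qed
    moreover have "q + 1 < (q + 1) * q" using mult_less_mono2[of 1 q "q + 1"] q_ge_3 by simp
    moreover have "q + 1 < q ^ 2 - 1"
    proof -
      have "3 * q \<le> q ^ 2" unfolding power2_eq_square using q_ge_3 by (intro mult_le_mono1)
      then show ?thesis using q_ge_3 by simp
    qed
    moreover have "(q + 1) * q ^ (l - 2) < m * q ^ (l - 2)" if "q + 1 < m" for m using that pos by (rule mult_less_mono1)
    ultimately show ?thesis using assms l unfolding has_type_def 1 mult.assoc[symmetric]
      by (cases t) (simp_all del: mult_Suc mult_Suc_right add_mult_distrib)
  qed
  show "n > 1"
  proof (cases "2 \<le> l")
    case True
    have "0 < (q + 1) * q ^ (l - 2)" by (intro mult_pos_pos pos) simp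
    then show ?thesis using 2[OF True] by linarith
  next
    case False
    then have "l = 1" using l1 by simp
    then show ?thesis using assms q_ge_3 by (cases t) (auto simp: has_type_def)
  qed
qed

end

lemma ext_rep_top:
  assumes "ext_rep p l q \<psi> cm c1 ok I \<rho>" "has_type l q (card I) t"
  shows "top_rep p l q \<psi> cm c1 ok I \<rho>"
proof -
  interpret ext_rep p l q \<psi> cm c1 ok I \<rho> by fact
  show ?thesis by (rule top_rep_if_large[OF type_large[OF assms(2)]])
qed

lemma inv_vecs_dual:
  assumes "ext_rep p l q \<psi> cm c1 ok I \<rho>" "ext_rep p l q \<psi> cm c1 ok J \<sigma>" "ext_rep p l q \<psi> cm c1 ok K \<tau>"
  obtains \<rho>' \<sigma>' \<tau>' where "ext_rep p l q \<psi> cm c1 ok I \<rho>'" "ext_rep p l q \<psi> cm c1 ok J \<sigma>'" "ext_rep p l q \<psi> cm c1 ok K \<tau>'"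
    "inv_vecs (ext_carrier ok) I \<rho> J \<sigma> K \<tau> \<subseteq> inv_forms (ext_carrier ok) I \<rho>' J \<sigma>' K \<tau>'"
proof -
  interpret A: ext_rep p l q \<psi> cm c1 ok I \<rho> by fact
  interpret B: ext_rep p l q \<psi> cm c1 ok J \<sigma> by fact
  interpret C: ext_rep p l q \<psi> cm c1 ok K \<tau> by fact
  show thesis
  proof (rule that)
    show "ext_rep p l q \<psi> cm c1 ok I A.dual" "ext_rep p l q \<psi> cm c1 ok J B.dual" "ext_rep p l q \<psi> cm c1 ok K C.dual"
      using A.irr_rep_dual B.irr_rep_dual C.irr_rep_dual A.ext_group_axioms by (simp_all add: ext_rep_def)
    show "inv_vecs A.GG I \<rho> J \<sigma> K \<tau> \<subseteq> inv_forms A.GG I A.dual J B.dual K C.dual"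
      unfolding inv_vecs_def inv_forms_def A.dual_def B.dual_def C.dual_def
      using A.ginv_in by blast
  qed
qed

theorem dim_bounds:
  assumes R: "ext_rep p l q \<psi> cm c1 ok I \<rho>" "ext_rep p l q \<psi> cm c1 ok J \<sigma>" "ext_rep p l q \<psi> cm c1 ok K \<tau>"
    and t: "has_type l q (card I) t1" "has_type l q (card J) t2" "has_type l q (card K) t3"
  shows "Cus \<in> {t1, t2, t3} \<Longrightarrow> dim_le (inv_vecs (ext_carrier ok) I \<rho> J \<sigma> K \<tau>) 1"
    and "(t1, t2, t3) \<in> {(SS, SNS, SS), (SNS, SS, SS), (SS, SS, SNS)} \<Longrightarrow> dim_le (inv_vecs (ext_carrier ok) I \<rho> J \<sigma> K \<tau>) 2"
    and "(t1, t2, t3) \<in> {(SS, SNS, SNS), (SNS, SS, SNS), (SNS, SNS, SS)} \<Longrightarrow> dim_le (inv_vecs (ext_carrier ok) I \<rho> J \<sigma> K \<tau>) 1"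
    and "(t1, t2, t3) = (SS, SS, SS) \<Longrightarrow> dim_le (inv_vecs (ext_carrier ok) I \<rho> J \<sigma> K \<tau>) (l + 1)"
proof -
  have top: "top_rep p l q \<psi> cm c1 ok I \<rho>" "top_rep p l q \<psi> cm c1 ok J \<sigma>" "top_rep p l q \<psi> cm c1 ok K \<tau>"
    using ext_rep_top[OF R(1) t(1)] ext_rep_top[OF R(2) t(2)] ext_rep_top[OF R(3) t(3)] .
  show "dim_le (inv_vecs (ext_carrier ok) I \<rho> J \<sigma> K \<tau>) 1" if h: "Cus \<in> {t1, t2, t3}"
  proof -
    consider "t1 = Cus" | "t2 = Cus" | "t3 = Cus" using h by blast
    then show ?thesis
    proof cases
      case 1
      then show ?thesis using tri_rep.cuspidal_first[OF tri_rep.intro[OF top(1) top(2) top(3)]] t(1) by (simp add: has_type_def)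
    next
      case 2
      then have "dim_le (inv_vecs (ext_carrier ok) J \<sigma> I \<rho> K \<tau>) 1"
        using tri_rep.cuspidal_first[OF tri_rep.intro[OF top(2) top(1) top(3)]] t(2) by (simp add: has_type_def)
      then show ?thesis unfolding inv_vecs_def by (rule dim_le_swap12)
    next
      case 3
      then have "dim_le (inv_vecs (ext_carrier ok) K \<tau> I \<rho> J \<sigma>) 1"
        using tri_rep.cuspidal_first[OF tri_rep.intro[OF top(3) top(1) top(2)]] t(3) by (simp add: has_type_def)
      then show ?thesis unfolding inv_vecs_def by (rule dim_le_swap23[OF dim_le_swap12])
    qed
  qed
  obtain \<rho>' \<sigma>' \<tau>' where R': "ext_rep p l q \<psi> cm c1 ok I \<rho>'" "ext_rep p l q \<psi> cm c1 ok J \<sigma>'" "ext_rep p l q \<psi> cm c1 ok K \<tau>'"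
    and sub: "inv_vecs (ext_carrier ok) I \<rho> J \<sigma> K \<tau> \<subseteq> inv_forms (ext_carrier ok) I \<rho>' J \<sigma>' K \<tau>'"
    using inv_vecs_dual[OF R] by blast
  have top': "top_rep p l q \<psi> cm c1 ok I \<rho>'" "top_rep p l q \<psi> cm c1 ok J \<sigma>'" "top_rep p l q \<psi> cm c1 ok K \<tau>'"
    using ext_rep_top[OF R'(1) t(1)] ext_rep_top[OF R'(2) t(2)] ext_rep_top[OF R'(3) t(3)] .
  note tri = tri_rep.intro
  show "dim_le (inv_vecs (ext_carrier ok) I \<rho> J \<sigma> K \<tau>) 2"
    if h: "(t1, t2, t3) \<in> {(SS, SNS, SS), (SNS, SS, SS), (SS, SS, SNS)}"
  proof (rule dim_le_mono[OF sub])
    consider "t1 = SS" "t2 = SS" "t3 = SNS" | "t1 = SS" "t2 = SNS" "t3 = SS" | "t1 = SNS" "t2 = SS" "t3 = SS" using h by auto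
    then show "dim_le (inv_forms (ext_carrier ok) I \<rho>' J \<sigma>' K \<tau>') 2"
    proof cases
      case 1
      then show ?thesis using tri_rep.ss_ss_sns[OF tri[OF top'(1) top'(2) top'(3)]] t by (simp add: has_type_def)
    next
      case 2
      then show ?thesis using tri_rep.ss_ss_sns[OF tri[OF top'(1) top'(3) top'(2)]] t
        by - (rule dim_le_swap23, simp add: has_type_def)
    next
      case 3
      then show ?thesis using tri_rep.ss_ss_sns[OF tri[OF top'(2) top'(3) top'(1)]] t
        by - (rule dim_le_swap12[OF dim_le_swap23], simp add: has_type_def)
    qed
  qed
  show "dim_le (inv_vecs (ext_carrier ok) I \<rho> J \<sigma> K \<tau>) 1"
    if h: "(t1, t2, t3) \<in> {(SS, SNS, SNS), (SNS, SS, SNS), (SNS, SNS, SS)}"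
  proof (rule dim_le_mono[OF sub])
    consider "t1 = SS" "t2 = SNS" "t3 = SNS" | "t1 = SNS" "t2 = SS" "t3 = SNS" | "t1 = SNS" "t2 = SNS" "t3 = SS" using h by auto
    then show "dim_le (inv_forms (ext_carrier ok) I \<rho>' J \<sigma>' K \<tau>') 1"
    proof cases
      case 1
      then show ?thesis using tri_rep.ss_sns_sns[OF tri[OF top'(1) top'(2) top'(3)]] t by (simp add: has_type_def)
    next
      case 2
      then show ?thesis using tri_rep.ss_sns_sns[OF tri[OF top'(2) top'(1) top'(3)]] t
        by - (rule dim_le_swap12, simp add: has_type_def)
    next
      case 3
      then show ?thesis using tri_rep.ss_sns_sns[OF tri[OF top'(3) top'(1) top'(2)]] t
        by - (rule dim_le_swap23[OF dim_le_swap12], simp add: has_type_def)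
    qed
  qed
  show "dim_le (inv_vecs (ext_carrier ok) I \<rho> J \<sigma> K \<tau>) (l + 1)" if "(t1, t2, t3) = (SS, SS, SS)"
    by (rule dim_le_mono[OF sub], rule tri_rep.ss_ss_ss[OF tri[OF top'(1) top'(2) top'(3)]])
      (use t that in \<open>simp_all add: has_type_def\<close>)
qed

section \<open>Irreducible matrix representations and intertwiners\<close>

text \<open>Averaged products of matrix coefficients commute with the group, so Schur's lemma makes
  them scalar and the trace fixes the scalar. The resulting orthogonality relations exhibit the
  coefficients of each matrix unit.\<close>

lemma (in fin_rep) irr_rep_if_schur:
  assumes schur: "\<And>M. (\<And>g i j. g \<in> G \<Longrightarrow> i \<in> I \<Longrightarrow> j \<in> I \<Longrightarrow> (\<Sum>k\<in>I. \<rho> g i k * M k j) = (\<Sum>k\<in>I. M i k * \<rho> g k j)) \<Longrightarrow>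
      \<exists>c. \<forall>i\<in>I. \<forall>j\<in>I. M i j = (if i = j then c else (0::complex))"
    and ne: "I \<noteq> {}"
  shows "irr_rep G mul one I \<rho>"
proof
  fix i j assume ij: "i \<in> I" "j \<in> I"
  define N where "N = (of_nat (card G) / of_nat (card I) :: complex)"
  have N: "N \<noteq> 0" using finite_G finite_I one_in ne by (auto simp: N_def card_eq_0_iff)
  have ortho: "(\<Sum>g\<in>G. \<rho> (ginv g) a b * \<rho> g c e) = (if b = c \<and> a = e then N else 0)"
    if abce: "a \<in> I" "b \<in> I" "c \<in> I" "e \<in> I" for a b c e
  proof -
    define M where "M = (\<lambda>a e. \<Sum>g\<in>G. \<rho> (ginv g) a b * \<rho> g c e)"
    have "\<exists>m. \<forall>i\<in>I. \<forall>j\<in>I. M i j = (if i = j then m else 0)"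
    proof (rule schur)
      fix h i j assume h: "h \<in> G" and ij: "i \<in> I" "j \<in> I"
      have "(\<Sum>k\<in>I. \<rho> h i k * M k j) = (\<Sum>g\<in>G. (\<Sum>k\<in>I. \<rho> h i k * \<rho> (ginv g) k b) * \<rho> g c j)"
        unfolding M_def sum_distrib_left sum_distrib_right by (subst sum.swap) (simp add: mult.assoc)
      also have "\<dots> = (\<Sum>g\<in>G. \<rho> (h \<odot> ginv g) i b * \<rho> g c j)" using h ij abce by (simp add: rep_mul)
      also have "\<dots> = (\<Sum>g\<in>G. \<rho> (ginv g) i b * \<rho> (g \<odot> h) c j)"
        by (rule sum.reindex_bij_witness[of _ "\<lambda>g. g \<odot> h" "\<lambda>g. g \<odot> ginv h"]) (use h in \<open>auto simp: assoc ginv_mul\<close>)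
      also have "\<dots> = (\<Sum>g\<in>G. \<Sum>k\<in>I. \<rho> (ginv g) i b * \<rho> g c k * \<rho> h k j)"
        using h ij abce by (simp add: rep_mul sum_distrib_left mult.assoc)
      also have "\<dots> = (\<Sum>k\<in>I. M i k * \<rho> h k j)"
        unfolding M_def sum_distrib_right by (rule sum.swap)
      finally show "(\<Sum>k\<in>I. \<rho> h i k * M k j) = (\<Sum>k\<in>I. M i k * \<rho> h k j)" .
    qed
    then obtain m where m: "\<And>i j. i \<in> I \<Longrightarrow> j \<in> I \<Longrightarrow> M i j = (if i = j then m else 0)" by blast
    have "of_nat (card I) * m = (\<Sum>a\<in>I. M a a)" using m by simp
    also have "\<dots> = (\<Sum>g\<in>G. \<Sum>a\<in>I. \<rho> g c a * \<rho> (ginv g) a b)"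
      unfolding M_def by (subst sum.swap) (simp add: mult.commute)
    also have "\<dots> = (\<Sum>g\<in>G. \<rho> (g \<odot> ginv g) c b)" using abce by (intro sum.cong refl rep_mul[symmetric]) auto
    also have "\<dots> = of_nat (card G) * (if c = b then 1 else 0)" using abce by (simp add: rep_one)
    finally have "m = (if c = b then N else 0)"
      using finite_I ne by (auto simp: N_def field_simps split: if_splits)
    then show ?thesis using m[OF abce(1,4)] by (auto simp: M_def)
  qed
  have "(\<Sum>g\<in>G. \<rho> (ginv g) j i / N * \<rho> g a b) = (if a = i \<and> b = j then 1 else 0)" if "a \<in> I" "b \<in> I" for a b
  proof -
    have "(\<Sum>g\<in>G. \<rho> (ginv g) j i / N * \<rho> g a b) = (\<Sum>g\<in>G. \<rho> (ginv g) j i * \<rho> g a b) / N"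
      by (simp add: sum_divide_distrib)
    then show ?thesis using ortho[OF ij(2,1) that] N by auto
  qed
  then show "\<exists>c. \<forall>a\<in>I. \<forall>b\<in>I. (\<Sum>g\<in>G. c g * \<rho> g a b) = (if a = i \<and> b = j then 1 else 0)"
    by (intro exI[of _ "\<lambda>g. \<rho> (ginv g) j i / N"]) blast
qed (rule ne)

text \<open>An eigenspace of \<open>M\<close> is invariant and nonzero, hence everything; complex
  matrices of positive size have an eigenvalue.\<close>

lemma irred_rep_schur:
  assumes irr: "irred_rep G mul e n \<rho>" and M: "M \<in> carrier_mat n n" and comm: "\<And>g. g \<in> G \<Longrightarrow> \<rho> g * M = M * \<rho> g"
  shows "\<exists>c. M = c \<cdot>\<^sub>m 1\<^sub>m n"
proof -
  have rep: "is_rep G mul e n \<rho>" and n: "n > 0"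
    and sub: "\<And>W. invariant_subspace G n \<rho> W \<Longrightarrow> W = {0\<^sub>v n} \<or> W = carrier_vec n"
    using irr by (auto simp: irred_rep_def)
  have car: "\<rho> g \<in> carrier_mat n n" if "g \<in> G" for g using rep that by (auto simp: is_rep_def)
  obtain k where "k \<in> spectrum M" using spectrum_non_empty[OF M n] by blast
  then obtain v where v: "v \<in> carrier_vec n" "v \<noteq> 0\<^sub>v n" "M *\<^sub>v v = k \<cdot>\<^sub>v v"
    using M by (auto simp: spectrum_def eigenvalue_def eigenvector_def)
  define W where "W = {w \<in> carrier_vec n. M *\<^sub>v w = k \<cdot>\<^sub>v w}"
  have "invariant_subspace G n \<rho> W"
    unfolding invariant_subspace_def
  proof (intro conjI ballI allI)
    show "W \<subseteq> carrier_vec n" by (auto simp: W_def)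
    show "0\<^sub>v n \<in> W" using M by (auto simp: W_def)
    show "x + y \<in> W" if "x \<in> W" "y \<in> W" for x y
      using that M by (auto simp: W_def mult_add_distrib_mat_vec smult_add_distrib_vec)
    show "c \<cdot>\<^sub>v x \<in> W" if "x \<in> W" for c x
      using that M by (auto simp: W_def mult_mat_vec smult_smult_assoc mult.commute)
    show "\<rho> g *\<^sub>v x \<in> W" if g: "g \<in> G" and x: "x \<in> W" for g x
    proof -
      have xc: "x \<in> carrier_vec n" "M *\<^sub>v x = k \<cdot>\<^sub>v x" using x by (auto simp: W_def)
      have "M *\<^sub>v (\<rho> g *\<^sub>v x) = (M * \<rho> g) *\<^sub>v x" using M car[OF g] xc by simp
      also have "\<dots> = \<rho> g *\<^sub>v (M *\<^sub>v x)" unfolding comm[OF g, symmetric] using M car[OF g] xc by simp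
      also have "\<dots> = k \<cdot>\<^sub>v (\<rho> g *\<^sub>v x)" unfolding xc(2) using car[OF g] xc(1) by (simp add: mult_mat_vec)
      finally show ?thesis using car[OF g] xc by (simp add: W_def)
    qed
  qed
  then have "W = carrier_vec n" using sub[of W] v by (auto simp: W_def)
  then have all: "M *\<^sub>v w = k \<cdot>\<^sub>v w" if "w \<in> carrier_vec n" for w using that by (auto simp: W_def)
  have "M = k \<cdot>\<^sub>m 1\<^sub>m n"
  proof (rule eq_matI)
    fix i j assume "i < dim_row (k \<cdot>\<^sub>m 1\<^sub>m n)" "j < dim_col (k \<cdot>\<^sub>m 1\<^sub>m n)"
    then have ij: "i < n" "j < n" by auto
    have "M $$ (i, j) = (M *\<^sub>v unit_vec n j) $ i" using M ij by (simp add: scalar_prod_right_unit[where n = n])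
    also have "\<dots> = (k \<cdot>\<^sub>v unit_vec n j) $ i" using all[of "unit_vec n j"] by simp
    finally show "M $$ (i, j) = (k \<cdot>\<^sub>m 1\<^sub>m n) $$ (i, j)" using ij by (auto simp: unit_vec_def)
  qed (use M in auto)
  then show ?thesis by blast
qed

definition mat_ker :: "('h \<Rightarrow> 'g) \<Rightarrow> nat \<Rightarrow> ('g \<Rightarrow> complex mat) \<Rightarrow> 'h \<Rightarrow> nat \<Rightarrow> nat \<Rightarrow> complex" where
  "mat_ker \<phi> n \<rho> g i j = (if i < n \<and> j < n then \<rho> (\<phi> g) $$ (i, j) else 0)"

lemma mult_index:
  "A \<in> carrier_mat m n \<Longrightarrow> B \<in> carrier_mat n k \<Longrightarrow> i < m \<Longrightarrow> j < k \<Longrightarrow> (A * B) $$ (i, j) = (\<Sum>r<n. A $$ (i, r) * B $$ (r, j))"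
  by (simp add: scalar_prod_def lessThan_atLeast0)

text \<open>Pulling back along a surjective homomorphism leaves the set of operators, and hence the
  commutant, unchanged.\<close>

lemma irr_rep_mat_ker:
  assumes G: "fin_group H m e" and \<phi>: "\<And>g. g \<in> H \<Longrightarrow> \<phi> g \<in> G" "\<And>x. x \<in> G \<Longrightarrow> \<exists>g\<in>H. \<phi> g = x"
      "\<And>g h. g \<in> H \<Longrightarrow> h \<in> H \<Longrightarrow> \<phi> (m g h) = mul (\<phi> g) (\<phi> h)" "\<phi> e = e'"
    and irr: "irred_rep G mul e' n \<rho>"
  shows "irr_rep H m e {..<n} (mat_ker \<phi> n \<rho>)"
proof -
  interpret fin_group H m e by fact
  have rep: "is_rep G mul e' n \<rho>" and n: "n > 0" using irr by (auto simp: irred_rep_def)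
  have car: "\<rho> (\<phi> g) \<in> carrier_mat n n" if "g \<in> H" for g using rep \<phi>(1)[OF that] by (auto simp: is_rep_def)
  interpret fin_rep H m e "{..<n}" "mat_ker \<phi> n \<rho>"
  proof
    show "mat_ker \<phi> n \<rho> (m g h) i j = (\<Sum>k\<in>{..<n}. mat_ker \<phi> n \<rho> g i k * mat_ker \<phi> n \<rho> h k j)"
      if "g \<in> H" "h \<in> H" "i \<in> {..<n}" "j \<in> {..<n}" for g h i j
    proof -
      have "\<rho> (\<phi> (m g h)) = \<rho> (\<phi> g) * \<rho> (\<phi> h)" using rep that \<phi>(1,3) by (simp add: is_rep_def)
      then show ?thesis using that by (simp add: mat_ker_def mult_index[OF car car])
    qed
    show "mat_ker \<phi> n \<rho> e i j = (if i = j then 1 else 0)" if "i \<in> {..<n}" "j \<in> {..<n}" for i j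
      using that rep by (simp add: mat_ker_def \<phi>(4) is_rep_def)
  qed (auto simp: mat_ker_def)
  show ?thesis
  proof (rule irr_rep_if_schur)
    fix M :: "nat \<Rightarrow> nat \<Rightarrow> complex"
    assume c: "\<And>g i j. g \<in> H \<Longrightarrow> i \<in> {..<n} \<Longrightarrow> j \<in> {..<n} \<Longrightarrow>
      (\<Sum>k<n. mat_ker \<phi> n \<rho> g i k * M k j) = (\<Sum>k<n. M i k * mat_ker \<phi> n \<rho> g k j)"
    define A where "A = mat n n (\<lambda>(i, j). M i j)"
    have A: "A \<in> carrier_mat n n" by (simp add: A_def)
    have "\<rho> x * A = A * \<rho> x" if x: "x \<in> G" for x
    proof -
      obtain g where g: "g \<in> H" "\<phi> g = x" using \<phi>(2)[OF x] by blast
      have X: "\<rho> x \<in> carrier_mat n n" using car[OF g(1)] g by simp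
      show ?thesis
      proof (rule eq_matI)
        fix i j assume "i < dim_row (A * \<rho> x)" "j < dim_col (A * \<rho> x)"
        then have ij: "i < n" "j < n" using A X by auto
        have "(\<rho> x * A) $$ (i, j) = (\<Sum>k<n. mat_ker \<phi> n \<rho> g i k * M k j)"
          unfolding mult_index[OF X A ij] using ij g by (simp add: mat_ker_def A_def)
        also have "\<dots> = (\<Sum>k<n. M i k * mat_ker \<phi> n \<rho> g k j)" using c[OF g(1)] ij by simp
        also have "\<dots> = (A * \<rho> x) $$ (i, j)"
          unfolding mult_index[OF A X ij] using ij g by (simp add: mat_ker_def A_def)
        finally show "(\<rho> x * A) $$ (i, j) = (A * \<rho> x) $$ (i, j)" .
      qed (use A X in auto)
    qed
    from irred_rep_schur[OF irr A this] obtain k where k: "A = k \<cdot>\<^sub>m 1\<^sub>m n" by blast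
    have "M i j = (if i = j then k else 0)" if "i < n" "j < n" for i j
    proof -
      have "M i j = A $$ (i, j)" using that by (simp add: A_def)
      then show ?thesis using that by (simp add: k)
    qed
    then show "\<exists>c. \<forall>i\<in>{..<n}. \<forall>j\<in>{..<n}. M i j = (if i = j then c else 0)" by blast
  qed (use n in auto)
qed

lemma sum_div_mod: "(\<Sum>r<m * (n::nat). f (r div n) (r mod n)) = (\<Sum>i<m. \<Sum>j<n. (f i j :: complex))"
proof (cases "n = 0")
  case False
  have "(\<Sum>r<m * n. f (r div n) (r mod n)) = (\<Sum>s\<in>{..<m} \<times> {..<n}. f (fst s) (snd s))"
  proof (rule sum.reindex_bij_witness[of _ "\<lambda>s. fst s * n + snd s" "\<lambda>r. (r div n, r mod n)"])
    fix s assume "s \<in> {..<m} \<times> {..<n}"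
    then have s: "fst s < m" "snd s < n" by auto
    have "fst s * n + snd s < (fst s + 1) * n" using s by simp
    also have "\<dots> \<le> m * n" using s by (intro mult_le_mono1) simp
    finally show "fst s * n + snd s \<in> {..<m * n}" by simp
    show "((fst s * n + snd s) div n, (fst s * n + snd s) mod n) = s" using s False by (cases s) simp
  next
    fix r assume "r \<in> {..<m * n}"
    then have "r div n < m" using False by (simp add: less_mult_imp_div_less)
    then show "(r div n, r mod n) \<in> {..<m} \<times> {..<n}" using False by simp
  qed auto
  then show ?thesis by (simp add: sum.cartesian_product case_prod_beta)
qed simp

text \<open>The row index \<open>i * nm + j\<close> matches the pairing of indices in
  \<open>kron\<close>.\<close>

definition form_of :: "nat \<Rightarrow> nat \<Rightarrow> nat \<Rightarrow> complex mat \<Rightarrow> nat \<times> nat \<times> nat \<Rightarrow> complex" where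
  "form_of nl nm nn T = (\<lambda>(i, j, k). if i < nl \<and> j < nm \<and> k < nn then T $$ (i * nm + j, k) else 0)"

lemma index_lt: "i < m \<Longrightarrow> j < n \<Longrightarrow> i * n + j < m * (n::nat)"
proof -
  assume "i < m" "j < n"
  then have "i * n + j < (i + 1) * n" by simp
  also have "\<dots> \<le> m * n" using \<open>i < m\<close> by (intro mult_le_mono1) simp
  finally show ?thesis .
qed

text \<open>A homomorphism from the third representation into the tensor product of the first two is
  an invariant vector of the triple product with the contragredient in third place.\<close>

lemma form_of_inv:
  assumes G: "fin_group H m e" and \<phi>: "\<And>g. g \<in> H \<Longrightarrow> \<phi> g \<in> G"
    and rl: "\<And>g. g \<in> G \<Longrightarrow> rl g \<in> carrier_mat nl nl" and rm: "\<And>g. g \<in> G \<Longrightarrow> rm g \<in> carrier_mat nm nm"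
    and rn: "irr_rep H m e {..<nn} (mat_ker \<phi> nn rn)" "\<And>g. g \<in> G \<Longrightarrow> rn g \<in> carrier_mat nn nn"
    and T: "intertwiner G nl rl nm rm nn rn T"
  shows "form_of nl nm nn T \<in> inv_vecs H {..<nl} (mat_ker \<phi> nl rl) {..<nm} (mat_ker \<phi> nm rm)
    {..<nn} (fin_rep.dual H m e (mat_ker \<phi> nn rn))"
proof -
  interpret N: irr_rep H m e "{..<nn}" "mat_ker \<phi> nn rn" by fact
  have Tc: "T \<in> carrier_mat (nl * nm) nn" using T by (simp add: intertwiner_def)
  let ?F = "form_of nl nm nn T"
  have "(\<Sum>i'<nl. \<Sum>j'<nm. \<Sum>k'<nn. ?F (i', j', k') * (mat_ker \<phi> nl rl g i i' * mat_ker \<phi> nm rm g j j' * N.dual g k k')) = ?F (i, j, k)"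
    if g: "g \<in> H" and ijk: "i < nl" "j < nm" "k < nn" for g i j k
  proof -
    let ?x = "\<phi> g"
    have x: "?x \<in> G" by (rule \<phi>[OF g])
    have K: "kron (rl ?x) (rm ?x) \<in> carrier_mat (nl * nm) (nl * nm)" using rl[OF x] rm[OF x] by (auto simp: kron_def)
    have r: "i * nm + j < nl * nm" using ijk by (intro index_lt)
    have step: "(\<Sum>i'<nl. \<Sum>j'<nm. ?F (i', j', k') * (mat_ker \<phi> nl rl g i i' * mat_ker \<phi> nm rm g j j'))
       = (\<Sum>k''<nn. ?F (i, j, k'') * mat_ker \<phi> nn rn g k'' k')" if k': "k' < nn" for k'
    proof -
      have "(\<Sum>i'<nl. \<Sum>j'<nm. ?F (i', j', k') * (mat_ker \<phi> nl rl g i i' * mat_ker \<phi> nm rm g j j'))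
        = (\<Sum>i'<nl. \<Sum>j'<nm. T $$ (i' * nm + j', k') * (rl ?x $$ (i, i') * rm ?x $$ (j, j')))"
        using ijk k' by (intro sum.cong refl) (simp add: form_of_def mat_ker_def)
      also have "\<dots> = (\<Sum>r<nl * nm. T $$ ((r div nm) * nm + r mod nm, k') * (rl ?x $$ (i, r div nm) * rm ?x $$ (j, r mod nm)))"
        by (rule sum_div_mod[symmetric])
      also have "\<dots> = (\<Sum>r<nl * nm. kron (rl ?x) (rm ?x) $$ (i * nm + j, r) * T $$ (r, k'))"
      proof (rule sum.cong[OF refl])
        fix s assume "s \<in> {..<nl * nm}"
        then show "T $$ ((s div nm) * nm + s mod nm, k') * (rl ?x $$ (i, s div nm) * rm ?x $$ (j, s mod nm))
          = kron (rl ?x) (rm ?x) $$ (i * nm + j, s) * T $$ (s, k')"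
          using rl[OF x] rm[OF x] r ijk by (simp add: kron_def)
      qed
      also have "\<dots> = (kron (rl ?x) (rm ?x) * T) $$ (i * nm + j, k')" by (rule mult_index[OF K Tc r k', symmetric])
      also have "\<dots> = (T * rn ?x) $$ (i * nm + j, k')" using T x by (simp add: intertwiner_def)
      also have "\<dots> = (\<Sum>k''<nn. T $$ (i * nm + j, k'') * rn ?x $$ (k'', k'))" by (rule mult_index[OF Tc rn(2)[OF x] r k'])
      finally show ?thesis using ijk k' by (simp add: form_of_def mat_ker_def)
    qed
    have "(\<Sum>i'<nl. \<Sum>j'<nm. \<Sum>k'<nn. ?F (i', j', k') * (mat_ker \<phi> nl rl g i i' * mat_ker \<phi> nm rm g j j' * N.dual g k k'))
       = (\<Sum>k'<nn. (\<Sum>i'<nl. \<Sum>j'<nm. ?F (i', j', k') * (mat_ker \<phi> nl rl g i i' * mat_ker \<phi> nm rm g j j')) * N.dual g k k')"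
    proof -
      have "(\<Sum>i'<nl. \<Sum>j'<nm. \<Sum>k'<nn. E i' j' k' * D k') = (\<Sum>k'<nn. (\<Sum>i'<nl. \<Sum>j'<nm. E i' j' k') * D k')"
        for E :: "nat \<Rightarrow> nat \<Rightarrow> nat \<Rightarrow> complex" and D
      proof -
        have "(\<Sum>i'<nl. \<Sum>j'<nm. \<Sum>k'<nn. E i' j' k' * D k') = (\<Sum>i'<nl. \<Sum>k'<nn. \<Sum>j'<nm. E i' j' k' * D k')"
          by (rule sum.cong[OF refl]) (rule sum.swap)
        also have "\<dots> = (\<Sum>k'<nn. \<Sum>i'<nl. \<Sum>j'<nm. E i' j' k' * D k')" by (rule sum.swap)
        finally show ?thesis by (simp add: sum_distrib_right)
      qed
      from this[of "\<lambda>i' j' k'. ?F (i', j', k') * (mat_ker \<phi> nl rl g i i' * mat_ker \<phi> nm rm g j j')" "N.dual g k"]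
      show ?thesis by (simp only: mult.assoc)
    qed
    also have "\<dots> = (\<Sum>k'<nn. (\<Sum>k''<nn. ?F (i, j, k'') * mat_ker \<phi> nn rn g k'' k') * mat_ker \<phi> nn rn (N.ginv g) k' k)"
      unfolding N.dual_def by (rule sum.cong[OF refl]) (simp add: step)
    also have "\<dots> = (\<Sum>k''<nn. ?F (i, j, k'') * (\<Sum>k'<nn. mat_ker \<phi> nn rn g k'' k' * mat_ker \<phi> nn rn (N.ginv g) k' k))"
      unfolding sum_distrib_left sum_distrib_right by (subst sum.swap) (simp add: mult.assoc)
    also have "\<dots> = (\<Sum>k''<nn. ?F (i, j, k'') * (if k'' = k then 1 else 0))"
    proof (rule sum.cong[OF refl])
      fix k'' assume k'': "k'' \<in> {..<nn}"
      have "(\<Sum>k'<nn. mat_ker \<phi> nn rn g k'' k' * mat_ker \<phi> nn rn (N.ginv g) k' k) = mat_ker \<phi> nn rn (m g (N.ginv g)) k'' k"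
        by (rule N.rep_mul[symmetric]) (use g k'' ijk in auto)
      then show "?F (i, j, k'') * (\<Sum>k'<nn. mat_ker \<phi> nn rn g k'' k' * mat_ker \<phi> nn rn (N.ginv g) k' k)
        = ?F (i, j, k'') * (if k'' = k then 1 else 0)" using g k'' ijk by (simp add: N.rep_one)
    qed
    also have "\<dots> = ?F (i, j, k)" using ijk by (simp add: if_distrib[of "\<lambda>x. _ * x"] cong: if_cong)
    finally show ?thesis .
  qed
  moreover have "?F s = 0" if "s \<notin> {..<nl} \<times> {..<nm} \<times> {..<nn}" for s
    using that by (cases s) (auto simp: form_of_def)
  ultimately show ?thesis unfolding inv_vecs_def inv_forms_def by simp
qed

text \<open>The bound also guarantees that the \<open>GREATEST\<close> is attained, starting from
  the empty family.\<close>

lemma tensor_mult_le: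
  assumes dim: "dim_le \<F> N" and F: "\<And>T. intertwiner G nl rl nm rm nn rn T \<Longrightarrow> form_of nl nm nn T \<in> \<F>"
  shows "tensor_mult G nl rl nm rm nn rn \<le> N"
proof -
  define P where "P = (\<lambda>k. \<exists>Ts :: nat \<Rightarrow> complex mat.
        (\<forall>i<k. intertwiner G nl rl nm rm nn rn (Ts i)) \<and>
        (\<forall>c :: nat \<Rightarrow> complex.
           (\<forall>r<nl * nm. \<forall>s<nn. (\<Sum>i<k. c i * Ts i $$ (r, s)) = 0) \<longrightarrow> (\<forall>i<k. c i = 0)))"
  have bd: "k \<le> N" if "P k" for k
  proof -
    from that obtain Ts where T: "\<And>i. i < k \<Longrightarrow> intertwiner G nl rl nm rm nn rn (Ts i)"
      and ind: "\<And>c. \<forall>r<nl * nm. \<forall>s<nn. (\<Sum>i<k. c i * Ts i $$ (r, s)) = 0 \<Longrightarrow> \<forall>i<k. c i = 0"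
      unfolding P_def by blast
    have "\<forall>i<k. c i = 0" if z: "\<forall>j. (\<Sum>i<k. c i * form_of nl nm nn (Ts i) j) = 0" for c
    proof (rule ind, intro allI impI)
      fix r s assume r: "r < nl * nm" and s: "s < nn"
      have "nm > 0" using r by (cases nm) auto
      then have "r div nm < nl" "r mod nm < nm" using r by (auto simp: less_mult_imp_div_less)
      then show "(\<Sum>i<k. c i * Ts i $$ (r, s)) = 0"
        using z[rule_format, of "(r div nm, r mod nm, s)"] s by (simp add: form_of_def)
    qed
    then show ?thesis
      using dim[unfolded dim_le_def, rule_format, of k "\<lambda>i. form_of nl nm nn (Ts i)"] F T by blast
  qed
  have "P 0" by (simp add: P_def)
  then have "P (Greatest P)" using bd by (rule GreatestI_nat)
  then show ?thesis using bd unfolding tensor_mult_def P_def by blast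
qed

section \<open>The general linear and the unitary group\<close>

context chain_ring
begin

lemma one_mult_unit: "x * y = 1 \<Longrightarrow> \<not> p dvd x"
  using p_nonunit dvd_mult2 by metis

text \<open>Squaring is two-to-one on units, so the squares are half of them and a nonsquare
  multiple of the squares is the other half.\<close>

lemma unit_squares_index:
  assumes g: "\<not> p dvd g" "\<And>x. g \<noteq> x * x" and a: "\<not> p dvd a" "\<And>x. a \<noteq> x * x"
  shows "\<exists>x. \<not> p dvd x \<and> a = g * (x * x)"
proof (rule ccontr)
  assume neg: "\<not> ?thesis"
  define U where "U = {x. \<not> p dvd x}"
  define S where "S = (\<lambda>x. x * x) ` U"
  have fib: "{x \<in> U. x * x = y} = {z, - z}" if z: "z \<in> U" "y = z * z" for y z
  proof -
    have "x = z \<or> x = - z" if x: "x \<in> U" "x * x = z * z" for x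
    proof -
      have prod: "(x - z) * (x + z) = 0" using x(2) by (simp add: algebra_simps)
      show ?thesis
      proof (cases "p dvd x - z")
        case True
        have "x + z = 2 * z + (x - z)" by simp
        moreover have "\<not> p dvd 2 * z" using two_unit z(1) by (simp add: U_def unit_mult)
        ultimately have "\<not> p dvd x + z" using True by (metis unit_add)
        then have "x - z = 0" using prod unit_cancel[of "x + z" "x - z" 0] by (simp add: mult.commute)
        then show ?thesis by simp
      next
        case False
        then have "x + z = 0" using prod unit_cancel[of "x - z" "x + z" 0] by simp
        then show ?thesis by (simp add: eq_neg_iff_add_eq_0)
      qed
    qed
    then show ?thesis using z by (auto simp: U_def)
  qed
  have "card {x \<in> U. x * x = y} = 2" if "y \<in> S" for y
  proof -
    obtain z where z: "z \<in> U" "y = z * z" using \<open>y \<in> S\<close> by (auto simp: S_def)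
    have "z \<noteq> - z"
    proof
      assume "z = - z"
      then have "2 * z = 0" by (metis add.right_inverse mult_2)
      then have "z = 0" using unit_cancel[OF two_unit, of z 0] by simp
      then show False using z by (simp add: U_def)
    qed
    then show ?thesis unfolding fib[OF z] by simp
  qed
  then have "card U = 2 * card S"
    using sum.image_gen[of U "\<lambda>_. 1::nat" "\<lambda>x. x * x"] by (simp add: S_def)
  moreover have "card ((\<lambda>s. g * s) ` S) = card S"
    using unit_cancel[OF g(1)] by (intro card_image) (auto simp: inj_on_def)
  moreover have "S \<inter> (\<lambda>s. g * s) ` S = {}"
  proof -
    have False if "g * (x * x) = y * y" "\<not> p dvd x" for x y
    proof -
      have "(y * rinv x) * (y * rinv x) = y * y * (rinv x * rinv x)" by (simp only: mult_ac)
      also have "\<dots> = g * (x * rinv x) * (x * rinv x)" unfolding that(1)[symmetric] by (simp only: mult_ac)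
      finally show False using g(2)[of "y * rinv x"] that(2) by simp
    qed
    then show ?thesis by (fastforce simp: S_def U_def)
  qed
  ultimately have "card (S \<union> (\<lambda>s. g * s) ` S) = card U" by (subst card_Un_disjoint) auto
  moreover have "p dvd x * y \<longleftrightarrow> p dvd x \<or> p dvd y" for x y using unit_mult by blast
  then have "S \<union> (\<lambda>s. g * s) ` S \<subseteq> U" using g(1) by (auto simp: S_def U_def)
  ultimately have "S \<union> (\<lambda>s. g * s) ` S = U" by (intro card_subset_eq) auto
  then have "a \<in> S \<union> (\<lambda>s. g * s) ` S" using a(1) by (simp add: U_def)
  then show False using a(2) neg by (auto simp: S_def U_def)
qed

end

section \<open>The norm form of the unramified quadratic extension\<close>

locale quad_ext = chain_ring p l q for p :: "'r::comm_ring_1" and l q +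
  fixes d :: 'r
  assumes nonsq: "\<not> p dvd x * x - d"
begin

lemma d_unit: "\<not> p dvd d" using nonsq[of 0] by simp

text \<open>A nonunit norm with \<open>y\<close> a unit would make \<open>d\<close> a square modulo
  \<open>p\<close>.\<close>

lemma norm_anisotropic:
  assumes "p dvd x * x - d * (y * y)" shows "p dvd x" "p dvd y"
proof -
  show y: "p dvd y"
  proof (rule ccontr)
    assume y: "\<not> p dvd y"
    have "(x * rinv y) * (x * rinv y) - d * ((y * rinv y) * (y * rinv y)) = (x * x - d * (y * y)) * (rinv y * rinv y)"
      by (simp add: algebra_simps)
    then have "(x * rinv y) * (x * rinv y) - d = (x * x - d * (y * y)) * (rinv y * rinv y)" using y by simp
    then have "p dvd (x * rinv y) * (x * rinv y) - d" using assms by (metis dvd_mult2)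
    then show False using nonsq by blast
  qed
  then have "p dvd d * (y * y)" by simp
  then have "p dvd x * x" using assms by (metis diff_add_cancel dvd_add)
  then show "p dvd x" using unit_mult by blast
qed

text \<open>Squares are norms, so by index two it is enough to find one nonsquare unit that is a
  norm.\<close>

lemma norm_surj:
  assumes "\<not> p dvd a" shows "\<exists>x y. a = x * x - d * (y * y)"
proof (cases "\<exists>x. a = x * x")
  case True
  then obtain x where "a = x * x - d * (0 * 0)" by auto
  then show ?thesis by blast
next
  case nsq: False
  have "\<exists>x y. \<not> p dvd x * x - d * (y * y) \<and> (\<forall>z. x * x - d * (y * y) \<noteq> z * z)"
  proof (rule ccontr)
    assume "\<not> ?thesis"
    then have sq: "\<exists>z. x * x - d * (y * y) = z * z" if "\<not> p dvd y" for x y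
      using norm_anisotropic(2)[of x y] that by blast
    obtain e where e: "- d = e * e" using sq[of 1 0] p_nonunit by auto
    then have eu: "\<not> p dvd e" using d_unit by (metis dvd_minus_iff dvd_mult2)
    \<comment> \<open>If every norm with \<open>y\<close> a unit were a square, then
      \<open>- d = e * e\<close> and adding 1 to a square would give a norm, hence a square again.
      All positive integers would then be units, which a finite ring excludes.\<close>
    have "\<exists>z. (of_nat (Suc k) :: 'r) = z * z \<and> \<not> p dvd z * z" for k
    proof (induction k)
      case 0
      show ?case using p_nonunit by (intro exI[of _ 1]) simp
    next
      case (Suc k)
      then obtain z where z: "(of_nat (Suc k) :: 'r) = z * z" by blast
      have "z * z - d * (rinv e * rinv e) = z * z + (e * rinv e) * (e * rinv e)"
      proof -
        have "(e * rinv e) * (e * rinv e) = (e * e) * (rinv e * rinv e)" by (simp only: mult_ac)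
        then show ?thesis unfolding e[symmetric] by simp
      qed
      then have n: "of_nat (Suc (Suc k)) = z * z - d * (rinv e * rinv e)" using z eu by simp
      have "\<not> p dvd z * z - d * (rinv e * rinv e)" using norm_anisotropic(2)[of z "rinv e"] eu by auto
      moreover obtain w where "z * z - d * (rinv e * rinv e) = w * w" using sq[of "rinv e" z] eu by auto
      ultimately show ?case using n by (intro exI[of _ w]) simp
    qed
    then have u: "\<not> p dvd (of_nat (Suc k) :: 'r)" for k by metis
    have "\<not> inj (of_nat :: nat \<Rightarrow> 'r)" using fin finite_imageD[of of_nat "UNIV :: nat set"] finite_subset[OF subset_UNIV] infinite_UNIV_nat by blast
    then obtain m n :: nat where mn: "(of_nat m :: 'r) = of_nat n" "m < n" unfolding inj_def by (metis linorder_neqE_nat)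
    then have "(of_nat (n - m) :: 'r) = 0" by (simp add: of_nat_diff)
    moreover obtain k where "n - m = Suc k" using mn(2) by (metis Suc_diff_Suc)
    ultimately show False using u[of k] by simp
  qed
  then obtain x y where g: "\<not> p dvd x * x - d * (y * y)" "\<And>z. x * x - d * (y * y) \<noteq> z * z" by blast
  obtain z where "a = (x * x - d * (y * y)) * (z * z)" using unit_squares_index[OF g assms] nsq by blast
  then have "a = (x * z) * (x * z) - d * ((y * z) * (y * z))" by (simp add: algebra_simps)
  then show ?thesis by blast
qed

text \<open>The norm of the scalar part times the determinant must be 1; this product is the
  diagonal entry of \<open>A\<close>-star times \<open>A\<close> in
  \<open>unitary_map_star\<close>.\<close>

definition unitary_ok :: "'r qe \<Rightarrow> 'r \<Rightarrow> bool" where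
  "unitary_ok c a \<longleftrightarrow> (fst c * fst c - d * (snd c * snd c)) * a = 1"

lemma unitary_ext_group:
  assumes "chain_ring_char p l q \<psi>" shows "ext_group p l q \<psi> (qmul d) qone unitary_ok"
proof -
  interpret chain_ring_char p l q \<psi> by fact
  show ?thesis
  proof
    show "finite (UNIV :: 'r qe set)" by (rule finite_Prod_UNIV[OF fin fin])
    show "qmul d (qmul d c c') c'' = qmul d c (qmul d c' c'')" for c c' c'' by (simp add: qmul_def algebra_simps)
    show "qmul d c c' = qmul d c' c" for c c' by (simp add: qmul_def mult_ac add_ac)
    show "qmul d qone c = c" for c by (simp add: qmul_def qone_def)
    show "\<not> p dvd a" if "unitary_ok c a" for c a
      using that one_mult_unit by (metis mult.commute unitary_ok_def)
    show "unitary_ok qone 1" by (simp add: unitary_ok_def qone_def)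
    show "unitary_ok (qmul d c c') (a * a')" if "unitary_ok c a" "unitary_ok c' a'" for c c' a a'
    proof -
      have "fst (qmul d c c') * fst (qmul d c c') - d * (snd (qmul d c c') * snd (qmul d c c'))
        = (fst c * fst c - d * (snd c * snd c)) * (fst c' * fst c' - d * (snd c' * snd c'))"
        by (simp add: qmul_def algebra_simps)
      then have "(fst (qmul d c c') * fst (qmul d c c') - d * (snd (qmul d c c') * snd (qmul d c c'))) * (a * a')
        = ((fst c * fst c - d * (snd c * snd c)) * a) * ((fst c' * fst c' - d * (snd c' * snd c')) * a')"
        by (simp only: mult_ac)
      then show ?thesis using that by (simp add: unitary_ok_def)
    qed
    show "\<exists>c. unitary_ok c a" if "\<not> p dvd a" for a
    proof -
      obtain x y where "rinv a = x * x - d * (y * y)" using norm_surj rinv_unit[OF \<open>\<not> p dvd a\<close>] by blast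
      then have "unitary_ok (x, y) a" using that by (simp add: unitary_ok_def) (metis rinv(2))
      then show ?thesis by blast
    qed
    show "\<exists>c'. qmul d c c' = qone \<and> unitary_ok c' (rinv a)" if c: "unitary_ok c a" for c a
    proof (intro exI conjI)
      have n: "(fst c * fst c - d * (snd c * snd c)) * a = 1" using c by (simp add: unitary_ok_def)
      then have a: "\<not> p dvd a" using one_mult_unit by (metis mult.commute)
      show "qmul d c (a * fst c, - (a * snd c)) = qone"
        using n by (simp add: qmul_def qone_def algebra_simps)
      have "((a * fst c) * (a * fst c) - d * ((a * snd c) * (a * snd c))) * rinv a
         = ((fst c * fst c - d * (snd c * snd c)) * a) * (a * rinv a)" by (simp add: algebra_simps)
      then show "unitary_ok (a * fst c, - (a * snd c)) (rinv a)" using n a by (simp add: unitary_ok_def)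
    qed
  qed
qed

text \<open>The matrix is \<open>c\<close> times the conjugate of \<open>X\<close> by \<open>diag(\<theta>, 1)\<close>, up to the unit \<open>d = \<theta>\<^sup>2\<close>.
  For matrices of this form the involution is the adjugate, so that \<open>A\<^sup>\<star> A\<close> is the norm
  of \<open>c\<close> times the determinant of \<open>X\<close>.\<close>

definition unitary_map :: "'r qe \<times> 'r m2 \<Rightarrow> 'r qe m2" where
  "unitary_map g = M2 (qmul d (fst g) (m11 (snd g), 0)) (qmul d (fst g) (0, m12 (snd g)))
     (qmul d (fst g) (0, m21 (snd g) * rinv d)) (qmul d (fst g) (m22 (snd g), 0))"

text \<open>Writing the lower left entry as \<open>d * e\<close>, always possible for a unit
  \<open>d\<close>, keeps \<open>rinv d\<close> out of later computations.\<close>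

lemma unitary_map_simp:
  "unitary_map ((c, c'), M2 a b (d * e) f) = M2 (c * a, c' * a) (d * (c' * b), c * b) (d * (c' * e), c * e) (c * f, c' * f)"
proof -
  have "d * e * rinv d = e" using d_unit by (metis mult.assoc mult.commute rinv_cancel(2))
  then show ?thesis by (simp add: unitary_map_def qmul_def mult.assoc)
qed

lemma unitary_elem: obtains c c' a b e f where "g = ((c, c'), M2 a b (d * e) f)"
proof -
  obtain c c' a b e f where "g = ((c, c'), M2 a b e f)" by (metis m2.exhaust prod.exhaust)
  moreover have "e = d * (rinv d * e)" using d_unit by simp
  ultimately show thesis using that by metis
qed

lemma unitary_map_mul: "unitary_map (ext_mul (qmul d) g h) = m2mul d (unitary_map g) (unitary_map h)"
proof -
  obtain c c' a b e f where g: "g = ((c, c'), M2 a b (d * e) f)" by (rule unitary_elem)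
  obtain k k' x y z w where h: "h = ((k, k'), M2 x y (d * z) w)" by (rule unitary_elem)
  have E: "ext_mul (qmul d) g h
    = ((c * k + d * c' * k', c * k' + c' * k), M2 (a * x + b * (d * z)) (a * y + b * w) (d * (e * x + f * z)) (d * e * y + f * w))"
    by (simp add: g h qmul_def distrib_left mult_ac)
  show ?thesis unfolding E unitary_map_simp unfolding g h unitary_map_simp
    by (simp add: m2mul_def qmul_def qadd_def algebra_simps)
qed

lemma unitary_map_star:
  fixes g defines "D \<equiv> (fst (fst g) * fst (fst g) - d * (snd (fst g) * snd (fst g))) * mdet (snd g)"
  shows "m2mul d (m2star (unitary_map g)) (unitary_map g) = M2 (D, 0) (0, 0) (0, 0) (D, 0)"
proof -
  obtain c c' a b e f where g: "g = ((c, c'), M2 a b (d * e) f)" by (rule unitary_elem)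
  show ?thesis unfolding D_def g unitary_map_simp
    by (simp add: m2mul_def m2star_def qmul_def qadd_def qconj_def algebra_simps)
qed

lemma unitary_map_in: "g \<in> ext_carrier unitary_ok \<longleftrightarrow> unitary_map g \<in> Gset True d"
  using unitary_map_star[of g]
  by (cases g) (simp add: ext_carrier_def unitary_ok_def Gset_def m2one_def qone_def qzero_def)

text \<open>Take the upper left entry as scalar part; its norm is a unit. The unitary relations
  force the quotients of the other entries by it to be real on the diagonal and multiples of the
  square root of \<open>d\<close> off it.\<close>

lemma unitary_map_surj_unit:
  assumes A: "M2 (x, y) (u, v) (s, t) (m, k) \<in> Gset True d" and n: "\<not> p dvd x * x - d * (y * y)"
  shows "\<exists>g\<in>ext_carrier unitary_ok. unitary_map g = M2 (x, y) (u, v) (s, t) (m, k)"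
proof -
  define N where "N = x * x - d * (y * y)"
  have Nu: "\<not> p dvd N" using n by (simp add: N_def)
  have cancel: "z = 0" if "N * z = 0" for z using unit_cancel[OF Nu, of z 0] that by simp
  have eqs: "m2mul d (m2star (M2 (x, y) (u, v) (s, t) (m, k))) (M2 (x, y) (u, v) (s, t) (m, k)) = m2one"
    using A by (simp add: Gset_def)
  have half: "z = 0" if "z + z = 0" for z :: 'r
  proof -
    have "2 * z = 2 * 0" unfolding mult_2 that by simp
    then show ?thesis using unit_cancel[OF two_unit] by blast
  qed
  have e1: "(m * x - d * (k * y)) + (u * s - d * (v * t)) = 1"
    using arg_cong[OF eqs, of "\<lambda>X. fst (m11 X)"]
    by (simp add: m2mul_def m2star_def qmul_def qadd_def qconj_def m2one_def qone_def algebra_simps)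
  have e1': "(m * y - k * x) + (u * t - v * s) = 0"
    using arg_cong[OF eqs, of "\<lambda>X. snd (m11 X)"]
    by (simp add: m2mul_def m2star_def qmul_def qadd_def qconj_def m2one_def qone_def algebra_simps)
  have "(m * u - d * (k * v)) + (m * u - d * (k * v)) = 0"
    using arg_cong[OF eqs, of "\<lambda>X. fst (m12 X)"]
    by (simp add: m2mul_def m2star_def qmul_def qadd_def qconj_def m2one_def qzero_def algebra_simps)
  then have e2: "m * u - d * (k * v) = 0" by (rule half)
  have "(s * x - d * (t * y)) + (s * x - d * (t * y)) = 0"
    using arg_cong[OF eqs, of "\<lambda>X. fst (m21 X)"]
    by (simp add: m2mul_def m2star_def qmul_def qadd_def qconj_def m2one_def qzero_def algebra_simps)
  then have e3: "s * x - d * (t * y) = 0" by (rule half)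
  \<comment> \<open>\<open>T\<close> and \<open>V\<close> are the components of the upper right
    entry times the conjugate of the upper left one; \<open>P\<close> and \<open>- Q\<close> are
    those for the lower right entry. \<open>T = 0\<close> says that the upper right quotient is
    purely imaginary.\<close>
  define T V P Q where "T = u * x - d * (v * y)" "V = v * x - u * y" "P = m * x - d * (k * y)" "Q = m * y - k * x"
  have T0: "T = 0"
  proof -
    have "P * T + d * (Q * V) = N * (m * u - d * (k * v))" unfolding T_V_P_Q_def N_def by (simp add: algebra_simps)
    then have 1: "P * T + d * (Q * V) = 0" using e2 by simp
    have Pe: "P = 1 - (u * s - d * (v * t))" using e1 by (simp add: T_V_P_Q_def algebra_simps)
    have Qe: "Q = v * s - u * t" using e1' by (simp add: T_V_P_Q_def algebra_simps)
    have "T = (P * T + d * (Q * V)) + (u * u - d * (v * v)) * (s * x - d * (t * y))"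
      unfolding Pe Qe T_V_P_Q_def(1,2) by (simp add: algebra_simps)
    then show ?thesis using 1 e3 by simp
  qed
  then have i: "u * x = d * (v * y)" by (simp add: T_V_P_Q_def)
  have ii: "s * x = d * (t * y)" using e3 by simp
  have iii: "k * x = m * y"
  proof -
    have "N * (u * t - v * s) = (u * x - d * (v * y)) * (t * x - s * y) - (s * x - d * (t * y)) * (v * x - u * y)"
      unfolding N_def by (simp add: algebra_simps)
    then have "N * (u * t - v * s) = 0" using i ii by simp
    then have "u * t - v * s = 0" by (rule cancel)
    then show ?thesis using e1' by simp
  qed
  define r where "r = rinv N"
  have r: "N * z * r = z" for z
  proof -
    have "N * z * r = (N * r) * z" by (simp only: mult_ac)
    then show ?thesis using Nu by (simp add: r_def)
  qed
  define g where "g = ((x, y), M2 1 ((v * x - u * y) * r) (d * ((t * x - s * y) * r)) ((m * x - d * (k * y)) * r))"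
  have c1: "d * (y * ((v * x - u * y) * r)) = u"
  proof -
    have "d * (y * ((v * x - u * y) * r)) = (N * u - (u * x - d * (v * y)) * x) * r"
      unfolding N_def by (simp add: algebra_simps)
    then show ?thesis using i r[of u] by simp
  qed
  have c2: "x * ((v * x - u * y) * r) = v"
  proof -
    have "x * ((v * x - u * y) * r) = (N * v - (u * x - d * (v * y)) * y) * r"
      unfolding N_def by (simp add: algebra_simps)
    then show ?thesis using i r[of v] by simp
  qed
  have c3: "d * (y * ((t * x - s * y) * r)) = s"
  proof -
    have "d * (y * ((t * x - s * y) * r)) = (N * s - (s * x - d * (t * y)) * x) * r"
      unfolding N_def by (simp add: algebra_simps)
    then show ?thesis using ii r[of s] by simp
  qed
  have c4: "x * ((t * x - s * y) * r) = t"
  proof -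
    have "x * ((t * x - s * y) * r) = (N * t - (s * x - d * (t * y)) * y) * r"
      unfolding N_def by (simp add: algebra_simps)
    then show ?thesis using ii r[of t] by simp
  qed
  have c5: "x * ((m * x - d * (k * y)) * r) = m"
  proof -
    have "x * ((m * x - d * (k * y)) * r) = (N * m - d * (y * (k * x - m * y))) * r"
      unfolding N_def by (simp add: algebra_simps)
    then show ?thesis using iii r[of m] by simp
  qed
  have c6: "y * ((m * x - d * (k * y)) * r) = k"
  proof -
    have "y * ((m * x - d * (k * y)) * r) = (N * k - x * (k * x - m * y)) * r"
      unfolding N_def by (simp add: algebra_simps)
    then show ?thesis using iii r[of k] by simp
  qed
  have "unitary_map g = M2 (x, y) (u, v) (s, t) (m, k)"
    unfolding g_def unitary_map_simp c1 c2 c3 c4 c5 c6 by simp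
  then show ?thesis using A unitary_map_in by metis
qed

text \<open>If the upper left entry has nonunit norm, the first unitary relation makes the norm of
  the lower left one a unit. Swapping the rows, by a matrix that is itself in the image, reduces to
  the previous case.\<close>

lemma unitary_map_surj:
  assumes A: "A \<in> Gset True d"
  shows "\<exists>g\<in>ext_carrier unitary_ok. unitary_map g = A"
proof -
  obtain x y u v s t m k where A': "A = M2 (x, y) (u, v) (s, t) (m, k)" by (metis m2.exhaust prod.exhaust)
  show ?thesis
  proof (cases "p dvd x * x - d * (y * y)")
    case False
    then show ?thesis using unitary_map_surj_unit A unfolding A' by blast
  next
    case True
    note xy = norm_anisotropic[OF True]
    have eqs: "m2mul d (m2star (M2 (x, y) (u, v) (s, t) (m, k))) (M2 (x, y) (u, v) (s, t) (m, k)) = m2one"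
      using A by (simp add: Gset_def A')
    have e1: "(m * x - d * (k * y)) + (u * s - d * (v * t)) = 1"
      using arg_cong[OF eqs, of "\<lambda>X. fst (m11 X)"]
      by (simp add: m2mul_def m2star_def qmul_def qadd_def qconj_def m2one_def qone_def algebra_simps)
    have st: "\<not> p dvd s * s - d * (t * t)"
    proof
      assume "p dvd s * s - d * (t * t)"
      note st = norm_anisotropic[OF this]
      have "p dvd (m * x - d * (k * y)) + (u * s - d * (v * t))" using xy st by (intro dvd_add dvd_diff) auto
      then show False using e1 p_nonunit by simp
    qed
    have B: "M2 (s, t) (m, k) (x, y) (u, v) \<in> Gset True d"
      using eqs by (simp add: Gset_def m2mul_def m2star_def qmul_def qadd_def qconj_def m2one_def add_ac)
    then obtain g where g: "g \<in> ext_carrier unitary_ok" "unitary_map g = M2 (s, t) (m, k) (x, y) (u, v)"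
      using unitary_map_surj_unit[OF _ st] by blast
    define w :: "'r qe \<times> 'r m2" where "w = ((0, 1), M2 0 (rinv d) (d * rinv d) 0)"
    have w: "unitary_map w = M2 (0, 0) (1, 0) (1, 0) (0, 0)"
      unfolding w_def unitary_map_simp using d_unit by simp
    have "w \<in> ext_carrier unitary_ok"
      using d_unit by (simp add: w_def ext_carrier_def unitary_ok_def)
    then have "ext_mul (qmul d) w g \<in> ext_carrier unitary_ok"
      unfolding unitary_map_in unitary_map_mul w g(2)
      using A by (simp add: A' m2mul_def qmul_def qadd_def)
    moreover have "unitary_map (ext_mul (qmul d) w g) = A"
      unfolding unitary_map_mul w g(2) A' by (simp add: m2mul_def qmul_def qadd_def)
    ultimately show ?thesis by blast
  qed
qed

lemma unitary_map_one: "unitary_map (ext_one qone) = m2one"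
  by (simp add: unitary_map_def ext_one_def mid_def m2one_def qmul_def qone_def qzero_def)

end

section \<open>The general linear group as an extension with trivial scalar part\<close>

context chain_ring_char
begin

definition linear_map :: "unit \<times> 'r m2 \<Rightarrow> 'r qe m2" where
  "linear_map g = M2 (m11 (snd g), 0) (m12 (snd g), 0) (m21 (snd g), 0) (m22 (snd g), 0)"

lemma linear_ext_group: "ext_group p l q \<psi> (\<lambda>_ _. ()) () (\<lambda>_ a. \<not> p dvd a)"
  by unfold_locales (simp_all add: p_nonunit unit_mult)

lemma linear_map_mul: "linear_map (ext_mul (\<lambda>_ _. ()) g h) = m2mul d (linear_map g) (linear_map h)"
  by (cases g; cases h; cases "snd g"; cases "snd h") (simp add: linear_map_def m2mul_def qmul_def qadd_def)

lemma linear_map_in: "g \<in> ext_carrier (\<lambda>_ a. \<not> p dvd a) \<Longrightarrow> linear_map g \<in> Gset False d"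
  by (cases g; cases "snd g") (simp add: linear_map_def Gset_def ext_carrier_def m2real_def qreal_def unit_iff)

lemma linear_map_surj: assumes "A \<in> Gset False d" shows "\<exists>g\<in>ext_carrier (\<lambda>_ a. \<not> p dvd a). linear_map g = A"
proof -
  obtain x y u v s t m k where A: "A = M2 (x, y) (u, v) (s, t) (m, k)" by (metis m2.exhaust prod.exhaust)
  then have "linear_map ((), M2 x u s m) = A" "((), M2 x u s m) \<in> ext_carrier (\<lambda>_ a. \<not> p dvd a)"
    using assms by (simp_all add: linear_map_def Gset_def ext_carrier_def m2real_def qreal_def unit_iff)
  then show ?thesis by blast
qed

lemma linear_map_one: "linear_map (ext_one ()) = m2one"
  by (simp add: linear_map_def ext_one_def mid_def m2one_def qone_def qzero_def)

end

section \<open>Transfer of the bounds to the matrix representations\<close>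

lemma multiplicity_bounds:
  assumes G: "ext_group p l q \<psi> cm c1 ok"
    and \<phi>: "\<And>g. g \<in> ext_carrier ok \<Longrightarrow> \<phi> g \<in> G" "\<And>x. x \<in> G \<Longrightarrow> \<exists>g\<in>ext_carrier ok. \<phi> g = x"
      "\<And>g h. g \<in> ext_carrier ok \<Longrightarrow> h \<in> ext_carrier ok \<Longrightarrow> \<phi> (ext_mul cm g h) = mul (\<phi> g) (\<phi> h)" "\<phi> (ext_one c1) = e"
    and irr: "irred_rep G mul e nl rl" "irred_rep G mul e nm rm" "irred_rep G mul e nn rn"
    and ty: "has_type l q nl t1" "has_type l q nm t2" "has_type l q nn t3"
  shows "(Cus \<in> {t1, t2, t3} \<longrightarrow> tensor_mult G nl rl nm rm nn rn \<le> 1) \<and>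
         (card {t1, t2, t3} = 2 \<longrightarrow>
            tensor_mult G nl rl nm rm nn rn \<le> 2 \<and>
            (tensor_mult G nl rl nm rm nn rn = 2 \<longrightarrow>
               (t1, t2, t3) \<in> {(SS, SNS, SS), (SNS, SS, SS), (SS, SS, SNS)})) \<and>
         ({t1, t2, t3} = {SS} \<longrightarrow> tensor_mult G nl rl nm rm nn rn \<le> l + 1)"
proof -
  interpret ext_group p l q \<psi> cm c1 ok by fact
  note fg = ext_fin_group
  have ker: "irr_rep (ext_carrier ok) (ext_mul cm) (ext_one c1) {..<n} (mat_ker \<phi> n r)" if "irred_rep G mul e n r" for n r
    by (rule irr_rep_mat_ker[where G = G and mul = mul and e' = e, OF fg]) (use \<phi> that in blast)+
  note E = ext_rep.intro[OF G]
  interpret N: irr_rep "ext_carrier ok" "ext_mul cm" "ext_one c1" "{..<nn}" "mat_ker \<phi> nn rn" by (rule ker[OF irr(3)])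
  let ?F = "inv_vecs (ext_carrier ok) {..<nl} (mat_ker \<phi> nl rl) {..<nm} (mat_ker \<phi> nm rm) {..<nn} N.dual"
  have car: "r g \<in> carrier_mat n n" if "irred_rep G mul e n r" "g \<in> G" for r n g
    using that by (auto simp: irred_rep_def is_rep_def)
  have le: "tensor_mult G nl rl nm rm nn rn \<le> B" if "dim_le ?F B" for B
    by (rule tensor_mult_le[OF that], rule form_of_inv[where G = G, OF fg])
      (use \<phi>(1) car irr N.irr_rep_axioms in blast)+
  note bounds = dim_bounds[OF E[OF ker[OF irr(1)]] E[OF ker[OF irr(2)]] E[OF N.irr_rep_dual], unfolded card_lessThan, OF ty]
  have 1: "tensor_mult G nl rl nm rm nn rn \<le> 1" if "Cus \<in> {t1, t2, t3}" by (rule le[OF bounds(1)[OF that]])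
  have 2: "tensor_mult G nl rl nm rm nn rn \<le> 2" if "(t1, t2, t3) \<in> {(SS, SNS, SS), (SNS, SS, SS), (SS, SS, SNS)}"
    by (rule le[OF bounds(2)[OF that]])
  have 3: "tensor_mult G nl rl nm rm nn rn \<le> 1" if "(t1, t2, t3) \<in> {(SS, SNS, SNS), (SNS, SS, SNS), (SNS, SNS, SS)}"
    by (rule le[OF bounds(3)[OF that]])
  have 4: "tensor_mult G nl rl nm rm nn rn \<le> l + 1" if "(t1, t2, t3) = (SS, SS, SS)"
    by (rule le[OF bounds(4)[OF that]])
  define M where "M = tensor_mult G nl rl nm rm nn rn"
  have "M \<le> 2 \<and> (M = 2 \<longrightarrow> (t1, t2, t3) \<in> {(SS, SNS, SS), (SNS, SS, SS), (SS, SS, SNS)})" if h: "card {t1, t2, t3} = 2"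
  proof -
    consider "Cus \<in> {t1, t2, t3}" | "(t1, t2, t3) \<in> {(SS, SNS, SS), (SNS, SS, SS), (SS, SS, SNS)}"
      | "(t1, t2, t3) \<in> {(SS, SNS, SNS), (SNS, SS, SNS), (SNS, SNS, SS)}"
      using h by (cases t1; cases t2; cases t3) auto
    then show ?thesis using 1 2 3 unfolding M_def[symmetric] by cases auto
  qed
  moreover have "M \<le> l + 1" if "{t1, t2, t3} = {SS}" using 4 that unfolding M_def by auto
  ultimately show ?thesis using 1 unfolding M_def by blast
qed

theorem theorem1p1:
  fixes \<pi> d :: "'r::comm_ring_1"
    and l q :: nat
    and psi' :: "'r \<Rightarrow> complex"
    and unitary :: bool
    and rl rm rn :: "'r qe m2 \<Rightarrow> complex mat"
    and nl nm nn :: nat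
    and t1 t2 t3 :: rtype
  assumes fin: "finite (UNIV :: 'r set)"
    and l: "l \<ge> 1"
    and pi_pow: "\<pi> ^ l = 0" "\<pi> ^ (l - 1) \<noteq> 0"
    and local: "\<forall>x::'r. \<not> x dvd 1 \<longrightarrow> \<pi> dvd x"
    and q: "q = residue_card \<pi>"
    and odd: "odd q"
    and nonsq: "\<forall>x::'r. \<not> \<pi> dvd (x * x - d)"
    and psi_add: "\<forall>x y. psi' (x + y) = psi' x * psi' y"
    and psi_nontriv: "\<exists>x. psi' (\<pi> ^ (l - 1) * x) \<noteq> 1"
    and reg: "regular_rep unitary d \<pi> psi' l nl rl"
             "regular_rep unitary d \<pi> psi' l nm rm"
             "regular_rep unitary d \<pi> psi' l nn rn"
    and ty: "has_type l q nl t1" "has_type l q nm t2" "has_type l q nn t3"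
  shows "(Cus \<in> {t1, t2, t3} \<longrightarrow> tensor_mult (Gset unitary d) nl rl nm rm nn rn \<le> 1) \<and>
         (card {t1, t2, t3} = 2 \<longrightarrow>
            tensor_mult (Gset unitary d) nl rl nm rm nn rn \<le> 2 \<and>
            (tensor_mult (Gset unitary d) nl rl nm rm nn rn = 2 \<longrightarrow>
               (t1, t2, t3) \<in> {(SS, SNS, SS), (SNS, SS, SS), (SS, SS, SNS)})) \<and>
         ({t1, t2, t3} = {SS} \<longrightarrow> tensor_mult (Gset unitary d) nl rl nm rm nn rn \<le> l + 1)"
proof -
  interpret quad_ext \<pi> l q d
    by unfold_locales (fact fin l pi_pow q odd | use local nonsq in blast)+
  obtain \<psi> :: "'r \<Rightarrow> complex" where "\<forall>x y. \<psi> (x + y) = \<psi> x * \<psi> y" "\<psi> 0 = 1" "\<exists>x. \<psi> (\<pi> ^ (l - 1) * x) \<noteq> 1"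
    using additive_character_ex by blast
  then interpret chain_ring_char \<pi> l q \<psi> by unfold_locales auto
  have irr: "irred_rep (Gset unitary d) (m2mul d) m2one nl rl" "irred_rep (Gset unitary d) (m2mul d) m2one nm rm"
    "irred_rep (Gset unitary d) (m2mul d) m2one nn rn"
    using reg by (auto simp: regular_rep_def)
  show ?thesis
  proof (cases unitary)
    case True
    have U: "Gset unitary d = Gset True d" using True by simp
    show ?thesis unfolding U
      by (rule multiplicity_bounds[where \<phi> = unitary_map and mul = "m2mul d",
            OF unitary_ext_group[OF chain_ring_char_axioms] _ _ _ unitary_map_one irr[unfolded U] ty])
        (simp_all add: unitary_map_in unitary_map_surj unitary_map_mul)
  next
    case False
    have U: "Gset unitary d = Gset False d" using False by simp
    show ?thesis unfolding U
      by (rule multiplicity_bounds[where \<phi> = linear_map and mul = "m2mul d",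
            OF linear_ext_group _ _ _ linear_map_one irr[unfolded U] ty])
        (simp_all add: linear_map_in linear_map_surj linear_map_mul)
  qed
qed

end
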